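(* Let $r_*,\lambda_0,\tilde\kappa,p_i,q_i$ be as in the context, and let $\alpha_0$ satisfy $$\alpha_0\ge\max\Big\{\frac{2p_3(1-a)}{\tilde\kappa-p_3},\frac{4(1-a)}{\tilde\kappa-1},\frac a{1+\lambda_0-\tilde\kappa^2},\frac{2r_*}{\tilde\kappa(1-r_* )}\Big\},\qquad\alpha_0>\max\Big\{2,\frac a{\lambda_0},\frac{4-3a}{\lambda_0\tilde\kappa}\Big\}.$$ Let $\beta_1=\tilde\kappa\alpha_0$, $\omega_1=\omega/\hat\kappa$, $\omega_2=\mu_2\omega$, $\omega_3=\mu_3\omega$, $\omega_4=\omega_3+\tilde\nu/\beta_1$, $\omega_5=\omega_3+\omega_1(1-r_* )/r_*$, $\bar C_1=2^{\omega_1}\bar c_2^\omega\alpha_0^{\omega_3}(1+|U|)^{\omega_5}$, and $\mathcal M_2(t)=\mathcal M_{0,t}(q_1,q_2,q_3,q_4)$. Let $u\ge0$ be a sufficiently regular solution of the problem below, $\bar u=u-\Psi$, and let $\gamma,C_*,V_0,\mathcal E(\cdot)$ be as in the context with $\alpha=\beta_1$. Suppose $T>0$ and $B\in(0,1)$ satisfy $\gamma C_*V_0^\gamma\int_0^T\mathcal E(\tau)d\tau\le B$. For $t\in[0,T]$ and $\sigma\in(0,1)$ let $$\mathcal V(t)=V_0\Big(1-\gamma C_*V_0^\gamma\int_0^t\mathcal E(\tau)d\tau\Big)^{-1/\gamma},\qquad\mathscr B_\sigma(t)=1+\operatorname*{ess\,sup}_{\tau\in(\sigma t/2,t)}\|\Psi(\cdot,\tau)\|_{L^{\frac{2r_*}{1-r_*}}}.$$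 Then for all $t\in(0,T]$ and $\sigma\in(0,1)$, $$\|\bar u\|_{L^\infty(U\times(\sigma t,t))}\le\bar C_1\chi_*^{\omega_1}(1+\sigma^{-1}t^{-1})^{\omega_2}(1+t)^{\omega_4}\mathcal M_2(t)^{\omega_2}\mathscr B_\sigma(t)^{2\omega_1}\mathcal V(t)^{\frac{2\omega_1+\tilde\nu}{\beta_1}}.$$
   Context: Setting: $N\ge1$, $0=\bar\alpha_0<\dots<\bar\alpha_N$, $a_0,\dots,a_N>0$, $g(s)=\sum_ia_is^{\bar\alpha_i}$ ($0^0=1$), $a=\bar\alpha_N/(1+\bar\alpha_N)$, $\chi_0=\sum_ia_i$; $\vec k$ unit vector in $\mathbb R^3$, $\mathbf Jx=\vec k\times x$, $F_z(v)=g(|v|)v+z\mathbf Jv$ (a bijection of $\mathbb R^3$), fixed $R_*\ge0$, $X(z,y)=F_{R_*z}^{-1}(y)$; $\mathcal G>0$, $\Omega\ge0$, $e_0\in C^\infty(\mathbb R,\mathbb R^3)$ with $|e_0|=1$, $\mathcal Z(x,t)=-\mathcal Ge_0(t)+\Omega^2\mathbf J^2x$; $U\subset\mathbb R^3$ open bounded with $C^1$ boundary $\Gamma$, $r_U=\max_{\bar U}|x|$, $\chi_*=\max\{1,R_*^2,\chi_0^2,\mathcal G+\Omega^2r_U\}$. Problem: $u_t=\nabla\cdot X(u,\nabla u+u^2\mathcal Z)$ in $U\times(0,\infty)$, $u(\cdot,0)=u_0$, $u=\psi$ on $\Gamma\times(0,\infty)$; $\Psi$ an extension of $\psi$ to $\bar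 U\times[0,\infty)$; $\bar u_0=u_0-\Psi(\cdot,0)$. Parameters: $r_*$ with $\frac3{5-a}<r_*<1$, $r_*\ge\frac1{2-a}$; $\lambda_0=\frac{r_*(5-a)-3}{3r_*}$; $\tilde\kappa\in(1,\sqrt{1+\lambda_0})$; $\tilde\kappa>p_1,\dots,p_4>1$, $1/p_i+1/q_i=1$. $\mu_2=1+\frac a{1+\lambda_0}$, $\mu_3=2+\frac a{1+\lambda_0}$, $\hat\kappa=1+\lambda_0-\frac a2$. With $\beta_j=\tilde\kappa^j\alpha_0$, $\tilde s_j=(\beta_j+4(1-a))(1+\frac a{\beta_j-a})$: $\tilde\nu=\prod_{j\ge0}\tilde s_j/\beta_j$, $\omega=\frac{\tilde\nu\beta_0}{\tilde s_0}\cdot\frac{\tilde\kappa^2}{\alpha_0(\tilde\kappa-1)^2}$. Constants: $c_3=a_N^{a-1}$, $c_4=(\min\{1,a_0,a_N\}/2^{\bar\alpha_N})^{1+a}$, $c_5=2^{-a}c_4$, $c_9=c_5\chi_0^{-2}$, $c_{10}=c_4/4$, $c_{11}=4^{1-a}c_5+c_9+2c_3(32c_3/c_4)^{1-a}+c_{10}$, $c_{12}=2\cdot4^{1-a}c_3[1+(32c_3/c_4)^{1-a}]$, $c_{13}=5c_{12}+2c_{11}+1$, $c_{14}=4c_{12}+c_{11}$, $c_{15}=\max\{1,2c_{11},c_{14}\}$, $c_{16}=9(1+c_{11}+c_{12})$; $\bar c>0$ depends on $U$ and $q=r_*(2-a)$ with $\|f\|_{L^{3q/(3-q)}(U)}\le\bar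 c\|\nabla f\|_{L^q(U)}$ for $f\in W_0^{1,q}(U)$; $\bar c_1=\max\{1,\frac1{c_{10}}(\frac{\bar c}{2-a})^{2-a}\}$, $\bar A=2^{4+1/r_*}\bar c_1c_{16}^2$, $\bar c_2=(2\tilde\kappa)^{\mu_3}\bar A$. With $\tilde q=2\max\{2-a,3-2a\}$, $\mathcal M_{T',T}(q_1,q_2,q_3,q_4)=1+\chi_*^{1-a}\big(\int_{T'}^T\!\int_U(1+|\nabla\Psi|)^{(2-a)q_1}\big)^{1/q_1}+\chi_*^{1-a}\big(\int_{T'}^T\!\int_U(1+|\Psi|)^{2(1-a)q_2}(1+|\nabla\Psi|)^{(2-a)q_2}\big)^{1/q_2}+\chi_*^{3-a}\big(\int_{T'}^T\!\int_U(1+|\Psi|)^{\tilde qq_3}\big)^{1/q_3}+\big(\int_{T'}^T\!\int_U|\Psi_t|^{q_4}\big)^{1/q_4}$. For $\alpha=\beta_1$: $\theta=\frac{12(1-a)r_*}{\alpha((5-a)r_*-3)-3ar_*}$, $\mu=\frac{4(1-a)+a\theta}{1-\theta}$, $\gamma=\frac\mu\alpha+\frac{2\theta}{\alpha(1-\theta)}$, $\bar\mu=\frac{3-2a+\theta}{1-\theta}$; $C_1=[2^{\frac{1+r_*}{r_*}}(\frac{\bar c(\alpha-a)}{2-a})^{2-a}(1+|U|)^{\frac{\alpha(1-r_* )-2r_*}{\alpha r_*}}]^{\frac\theta{1-\theta}}$, $C_2=c_{13}C_1(4c_{13}/c_{10})^{\frac\theta{1-\theta}}$, $C_0=\max\{C_2,c_{15}\}\alpha(\alpha-1)$,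 $C_*=C_0(1+2^{\frac{2\theta}{1-\theta}}+2^{\alpha+4(1-a)-1}+2^{\frac{\alpha+4(1-a)}2-1})(1+|U|)^{\max\{1,\frac{(1-r_* )\theta}{r_*(1-\theta)}\}}$, $V_0=1+\int_U|\bar u_0|^\alpha dx$, $\mathcal E(t)=\chi_*^{\bar\mu}(1+\|\Psi(\cdot,t)\|_{L^{\frac{2r_*}{1-r_*}}}^{\frac{2\theta}{1-\theta}})+\chi_*^{3-2a}\int_U|\Psi|^{\alpha+4(1-a)}dx+\chi_*^{1-a}\int_U|\nabla\Psi|^{\frac{\alpha+4(1-a)}2}dx+\chi_*^{-\frac{(3-2a)(\alpha-1)}{5-4a}}\int_U|\Psi_t|^{\frac{\alpha+4(1-a)}{5-4a}}dx$ (evaluated at time $t$). *)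

theory Defs
  imports "HOL-Analysis.Analysis" "HOL-Probability.Essential_Supremum"
begin

definition epow :: "ennreal \<Rightarrow> real \<Rightarrow> ennreal" where
  "epow x r = (if x = top then top else ennreal (enn2real x powr r))"

text \<open>Real power with the convention 0^0 = 1.\<close>
definition pw :: "real \<Rightarrow> real \<Rightarrow> real" where
  "pw s e = (if e = 0 then 1 else s powr e)"

definition nnI :: "('b::euclidean_space) set \<Rightarrow> ('b \<Rightarrow> real) \<Rightarrow> ennreal" where
  "nnI S f = (\<integral>\<^sup>+ p. ennreal (f p) * indicator S p \<partial>lebesgue)"

definition C1_on :: "('b::euclidean_space) set \<Rightarrow> ('b \<Rightarrow> real) \<Rightarrow> bool" where
  "C1_on W h \<longleftrightarrow> (\<exists>h'. continuous_on W h' \<and> (\<forall>p\<in>W. (h has_derivative blinfun_apply (h' p)) (at p)))"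

definition smooth_curve :: "(real \<Rightarrow> real^3) \<Rightarrow> bool" where
  "smooth_curve e \<longleftrightarrow> (\<forall>i n t. (deriv ^^ n) (\<lambda>s. e s $ i) differentiable (at t))"

text \<open>Bounded open set with C^1 boundary: near each boundary point, after a rigid motion,
  U is the subgraph of a C^1 function of two variables.\<close>
definition C1_boundary :: "(real^3) set \<Rightarrow> bool" where
  "C1_boundary U \<longleftrightarrow> (\<forall>p\<in>frontier U. \<exists>r>0. \<exists>(Q::real^3 \<Rightarrow> real^3) (h::real^2 \<Rightarrow> real).
      orthogonal_transformation Q \<and> C1_on UNIV h \<and>
      (\<forall>x\<in>ball p r. x \<in> U \<longleftrightarrow>
          Q (x - p) $ 3 < h (vector [Q (x - p) $ 1, Q (x - p) $ 2])))"

definition xgrad :: "(real^3 \<Rightarrow> real \<Rightarrow> real) \<Rightarrow> real^3 \<Rightarrow> real \<Rightarrow> real^3" where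
  "xgrad f x t = (\<chi> i. frechet_derivative (\<lambda>y. f y t) (at x) (axis i 1))"

definition tder :: "(real^3 \<Rightarrow> real \<Rightarrow> real) \<Rightarrow> real^3 \<Rightarrow> real \<Rightarrow> real" where
  "tder f x t = deriv (\<lambda>s. f x s) t"

definition xdiv :: "(real^3 \<Rightarrow> real \<Rightarrow> real^3) \<Rightarrow> real^3 \<Rightarrow> real \<Rightarrow> real" where
  "xdiv W x t = (\<Sum>i\<in>UNIV. frechet_derivative (\<lambda>y. W y t $ i) (at x) (axis i 1))"

definition aexp :: "nat \<Rightarrow> (nat \<Rightarrow> real) \<Rightarrow> real" where
  "aexp N ab = ab N / (1 + ab N)"

definition chi0 :: "nat \<Rightarrow> (nat \<Rightarrow> real) \<Rightarrow> real" where
  "chi0 N ac = (\<Sum>i\<le>N. ac i)"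

definition gfun :: "nat \<Rightarrow> (nat \<Rightarrow> real) \<Rightarrow> (nat \<Rightarrow> real) \<Rightarrow> real \<Rightarrow> real" where
  "gfun N ab ac s = (\<Sum>i\<le>N. ac i * pw s (ab i))"

definition Ffun :: "nat \<Rightarrow> (nat \<Rightarrow> real) \<Rightarrow> (nat \<Rightarrow> real) \<Rightarrow> real^3 \<Rightarrow> real \<Rightarrow> real^3 \<Rightarrow> real^3" where
  "Ffun N ab ac kv z v = gfun N ab ac (norm v) *\<^sub>R v + z *\<^sub>R cross3 kv v"

definition Xfun :: "nat \<Rightarrow> (nat \<Rightarrow> real) \<Rightarrow> (nat \<Rightarrow> real) \<Rightarrow> real^3 \<Rightarrow> real \<Rightarrow> real \<Rightarrow> real^3 \<Rightarrow> real^3" where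
  "Xfun N ab ac kv Rs z y = inv (Ffun N ab ac kv (Rs * z)) y"

definition Zfun :: "real^3 \<Rightarrow> real \<Rightarrow> real \<Rightarrow> (real \<Rightarrow> real^3) \<Rightarrow> real^3 \<Rightarrow> real \<Rightarrow> real^3" where
  "Zfun kv G Om e0 x t = (- G) *\<^sub>R e0 t + Om\<^sup>2 *\<^sub>R cross3 kv (cross3 kv x)"

definition regular_fn :: "(real^3) set \<Rightarrow> (real^3 \<Rightarrow> real \<Rightarrow> real) \<Rightarrow> bool" where
  "regular_fn U f \<longleftrightarrow> continuous_on (closure U \<times> {0..}) (\<lambda>(x,t). f x t) \<and>
     (\<exists>W. open W \<and> closure U \<times> {0<..} \<subseteq> W \<and> C1_on W (\<lambda>(x,t). f x t))"

definition is_solution ::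
  "nat \<Rightarrow> (nat \<Rightarrow> real) \<Rightarrow> (nat \<Rightarrow> real) \<Rightarrow> real^3 \<Rightarrow> real \<Rightarrow> real \<Rightarrow> real \<Rightarrow> (real \<Rightarrow> real^3)
   \<Rightarrow> (real^3) set \<Rightarrow> (real^3 \<Rightarrow> real \<Rightarrow> real) \<Rightarrow> (real^3 \<Rightarrow> real \<Rightarrow> real) \<Rightarrow> bool" where
  "is_solution N ab ac kv Rs G Om e0 U Psi u \<longleftrightarrow>
     regular_fn U u \<and>
     (\<forall>x\<in>frontier U. \<forall>t>0. u x t = Psi x t) \<and>
     (let flux = (\<lambda>y s. Xfun N ab ac kv Rs (u y s)
                     (xgrad u y s + (u y s)\<^sup>2 *\<^sub>R Zfun kv G Om e0 y s)) in
      \<forall>x\<in>U. \<forall>t>0. (\<forall>i. (\<lambda>y. flux y t $ i) differentiable (at x)) \<and>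
                  tder u x t = xdiv flux x t)"

definition c3 where "c3 N ab ac = ac N powr (aexp N ab - 1)"
definition c4 where "c4 N ab ac = (min 1 (min (ac 0) (ac N)) / 2 powr ab N) powr (1 + aexp N ab)"
definition c5 where "c5 N ab ac = 2 powr (- aexp N ab) * c4 N ab ac"
definition c9 where "c9 N ab ac = c5 N ab ac * chi0 N ac powr (-2)"
definition c10 where "c10 N ab ac = c4 N ab ac / 4"
definition c11 where "c11 N ab ac = (let a = aexp N ab in
   4 powr (1 - a) * c5 N ab ac + c9 N ab ac
   + 2 * c3 N ab ac * (32 * c3 N ab ac / c4 N ab ac) powr (1 - a) + c10 N ab ac)"
definition c12 where "c12 N ab ac = (let a = aexp N ab in
   2 * 4 powr (1 - a) * c3 N ab ac * (1 + (32 * c3 N ab ac / c4 N ab ac) powr (1 - a)))"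
definition c13 where "c13 N ab ac = 5 * c12 N ab ac + 2 * c11 N ab ac + 1"
definition c14 where "c14 N ab ac = 4 * c12 N ab ac + c11 N ab ac"
definition c15 where "c15 N ab ac = max 1 (max (2 * c11 N ab ac) (c14 N ab ac))"
definition c16 where "c16 N ab ac = 9 * (1 + c11 N ab ac + c12 N ab ac)"

definition chistar where
  "chistar N ac Rs G Om (U::(real^3) set) =
     max 1 (max (Rs\<^sup>2) (max ((chi0 N ac)\<^sup>2) (G + Om\<^sup>2 * Sup (norm ` closure U))))"

definition lambda0 where "lambda0 a rs = (rs * (5 - a) - 3) / (3 * rs)"

definition betaj where "betaj kt a0 j = kt ^ j * a0"
definition stilde where "stilde a kt a0 j =
   (betaj kt a0 j + 4 * (1 - a)) * (1 + a / (betaj kt a0 j - a))"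
definition nutilde where "nutilde a kt a0 = prodinf (\<lambda>j. stilde a kt a0 j / betaj kt a0 j)"
definition omega where "omega a kt a0 =
   nutilde a kt a0 * betaj kt a0 0 / stilde a kt a0 0 * (kt\<^sup>2 / (a0 * (kt - 1)\<^sup>2))"

definition Mfun ::
  "real \<Rightarrow> real \<Rightarrow> (real^3) set \<Rightarrow> (real^3 \<Rightarrow> real \<Rightarrow> real) \<Rightarrow> (nat \<Rightarrow> real) \<Rightarrow> real \<Rightarrow> real \<Rightarrow> ennreal" where
  "Mfun a chis U Psi q T' T = (let S = U \<times> {T'<..<T}; qt = 2 * max (2 - a) (3 - 2 * a);
      gP = (\<lambda>p. norm (xgrad Psi (fst p) (snd p))); P = (\<lambda>p. \<bar>Psi (fst p) (snd p)\<bar>) in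
     1 + ennreal (chis powr (1 - a)) * epow (nnI S (\<lambda>p. (1 + gP p) powr ((2 - a) * q 1))) (1 / q 1)
       + ennreal (chis powr (1 - a)) * epow (nnI S (\<lambda>p. (1 + P p) powr (2 * (1 - a) * q 2)
                                              * (1 + gP p) powr ((2 - a) * q 2))) (1 / q 2)
       + ennreal (chis powr (3 - a)) * epow (nnI S (\<lambda>p. (1 + P p) powr (qt * q 3))) (1 / q 3)
       + epow (nnI S (\<lambda>p. \<bar>tder Psi (fst p) (snd p)\<bar> powr q 4)) (1 / q 4))"

definition thetaA where "thetaA a rs al = 12 * (1 - a) * rs / (al * ((5 - a) * rs - 3) - 3 * a * rs)"
definition muA where "muA a rs al = (4 * (1 - a) + a * thetaA a rs al) / (1 - thetaA a rs al)"
definition gammaA where "gammaA a rs al =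
   muA a rs al / al + 2 * thetaA a rs al / (al * (1 - thetaA a rs al))"
definition mubarA where "mubarA a rs al = (3 - 2 * a + thetaA a rs al) / (1 - thetaA a rs al)"

definition measU :: "(real^3) set \<Rightarrow> real" where "measU U = measure lebesgue U"

definition CC1 where "CC1 a rs al cbar U = (let th = thetaA a rs al in
   (2 powr ((1 + rs) / rs) * (cbar * (al - a) / (2 - a)) powr (2 - a)
     * (1 + measU U) powr ((al * (1 - rs) - 2 * rs) / (al * rs))) powr (th / (1 - th)))"
definition CC2 where "CC2 N ab ac rs al cbar U = (let th = thetaA (aexp N ab) rs al in
   c13 N ab ac * CC1 (aexp N ab) rs al cbar U * (4 * c13 N ab ac / c10 N ab ac) powr (th / (1 - th)))"
definition CC0 where "CC0 N ab ac rs al cbar U =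
   max (CC2 N ab ac rs al cbar U) (c15 N ab ac) * al * (al - 1)"
definition Cstar where "Cstar N ab ac rs al cbar U = (let a = aexp N ab; th = thetaA a rs al in
   CC0 N ab ac rs al cbar U
   * (1 + 2 powr (2 * th / (1 - th)) + 2 powr (al + 4 * (1 - a) - 1)
        + 2 powr ((al + 4 * (1 - a)) / 2 - 1))
   * (1 + measU U) powr (max 1 ((1 - rs) * th / (rs * (1 - th)))))"

definition V0fun :: "(real^3) set \<Rightarrow> (real^3 \<Rightarrow> real \<Rightarrow> real) \<Rightarrow> (real^3 \<Rightarrow> real \<Rightarrow> real) \<Rightarrow> real \<Rightarrow> ennreal" where
  "V0fun U u Psi al = 1 + nnI U (\<lambda>x. \<bar>u x 0 - Psi x 0\<bar> powr al)"

definition LpPsi :: "(real^3) set \<Rightarrow> (real^3 \<Rightarrow> real \<Rightarrow> real) \<Rightarrow> real \<Rightarrow> real \<Rightarrow> ennreal" where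
  "LpPsi U Psi p t = epow (nnI U (\<lambda>x. \<bar>Psi x t\<bar> powr p)) (1 / p)"

definition Efun :: "real \<Rightarrow> real \<Rightarrow> real \<Rightarrow> (real^3) set \<Rightarrow> (real^3 \<Rightarrow> real \<Rightarrow> real) \<Rightarrow> real \<Rightarrow> real \<Rightarrow> ennreal" where
  "Efun a rs chis U Psi al t = (let th = thetaA a rs al; m = al + 4 * (1 - a) in
     ennreal (chis powr mubarA a rs al) * (1 + epow (LpPsi U Psi (2 * rs / (1 - rs)) t) (2 * th / (1 - th)))
     + ennreal (chis powr (3 - 2 * a)) * nnI U (\<lambda>x. \<bar>Psi x t\<bar> powr m)
     + ennreal (chis powr (1 - a)) * nnI U (\<lambda>x. norm (xgrad Psi x t) powr (m / 2))
     + ennreal (chis powr (- ((3 - 2 * a) * (al - 1) / (5 - 4 * a))))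
         * nnI U (\<lambda>x. \<bar>tder Psi x t\<bar> powr (m / (5 - 4 * a))))"


definition kaphat where "kaphat a rs = 1 + lambda0 a rs - a / 2"
definition mu2 where "mu2 a rs = 1 + a / (1 + lambda0 a rs)"
definition mu3 where "mu3 a rs = 2 + a / (1 + lambda0 a rs)"
definition om1 where "om1 a rs kt a0 = omega a kt a0 / kaphat a rs"
definition om2 where "om2 a rs kt a0 = mu2 a rs * omega a kt a0"
definition om3 where "om3 a rs kt a0 = mu3 a rs * omega a kt a0"
definition om4 where "om4 a rs kt a0 = om3 a rs kt a0 + nutilde a kt a0 / (kt * a0)"
definition om5 where "om5 a rs kt a0 = om3 a rs kt a0 + om1 a rs kt a0 * (1 - rs) / rs"

definition cbar1 where "cbar1 N ab ac cbar =
   max 1 (1 / c10 N ab ac * (cbar / (2 - aexp N ab)) powr (2 - aexp N ab))"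
definition Abar where "Abar N ab ac rs cbar = 2 powr (4 + 1 / rs) * cbar1 N ab ac cbar * (c16 N ab ac)\<^sup>2"
definition cbar2 where "cbar2 N ab ac rs kt cbar =
   (2 * kt) powr (mu3 (aexp N ab) rs) * Abar N ab ac rs cbar"
definition Cbar1 where "Cbar1 N ab ac rs kt a0 cbar U = (let a = aexp N ab in
   2 powr om1 a rs kt a0 * cbar2 N ab ac rs kt cbar powr omega a kt a0 * a0 powr om3 a rs kt a0
   * (1 + measU U) powr om5 a rs kt a0)"

definition EInt where "EInt a rs chis U Psi al t =
   (\<integral>\<^sup>+ s. Efun a rs chis U Psi al s * indicator {0<..<t} s \<partial>lebesgue)"

end

theory Submission
  imports Defs
begin

text \<open>
  The difference \<open>v = u - \<Psi>\<close> vanishes on the boundary. Testing the equation with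
  \<open>\<bar>v\<bar>\<close> to the power \<open>\<beta> - 2\<close> times \<open>v\<close> and using the coercivity of \<open>X\<close>, which degenerates
  like \<open>(1 + \<bar>v\<bar> + \<bar>\<Psi>\<bar>)\<close> to the power \<open>-2\<close>, gives an energy inequality with a weighted gradient term.
  Hoelder's and Sobolev's inequalities turn this term into a norm of \<open>v\<close> with a higher
  exponent, at the cost of the factor \<open>\<parallel>1 + \<bar>v\<bar> + \<bar>\<Psi>\<bar>\<parallel>\<^sup>2\<close> in the exponent \<open>2r\<^sub>*/(1 - r\<^sub>*)\<close>.
  For \<open>\<beta> = \<beta>\<^sub>1\<close> the energy satisfies \<open>V' \<le> C\<^sub>* \<E> V\<close> to the power \<open>1 + \<gamma>\<close>, and integrating this
  differential inequality bounds that factor by \<open>\<V>\<close>.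
  On cylinders shrinking in time to \<open>U \<times> (\<sigma>t, t)\<close>, Moser's iteration with the exponents \<open>\<beta>\<^sub>j\<close>
  yields an affine recursion for the logarithms of the norms, whose solution gives the bound
  on the supremum.
\<close>

section \<open>Powers of real numbers\<close>

text \<open>Hoelder with exponents \<open>1 / rs\<close> and \<open>1 / (1 - rs)\<close> pays for
  the degenerate weight; the norm it produces has the fixed exponent \<open>pe\<close>, whatever
  power is tested. One bound on it, at \<open>al = kt * a0 >= pe\<close>, therefore serves every
  step of the iteration, and the same exponent gives the starting value. A step loses a factor
  \<open>kt\<close> of exponent to the data norms, since \<open>p i < kt\<close>, and advances by
  another \<open>kt\<close>; the parabolic gain is \<open>1 + lam\<close> up to a shift by
  \<open>a\<close>. Hence \<open>kt^2 < 1 + lam\<close> and the lower bounds on \<open>a0\<close>.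
  In the final constant \<open>nutilde\<close> is the product of all slopes of the recursion;
  \<open>omega\<close> is that product without its first factor, times a bound for the sum of
  \<open>(j + 1) / betaj kt a0 j\<close>. The obstacle is a factor \<open>1 / (kt - 1)\<close>
  arising in each step that \<open>Cbar1\<close> does not display: the bound for the sum of
  \<open>1 / betaj kt a0 j\<close> is smaller by a factor \<open>kt - 1\<close>, and this slack,
  with spare powers of 2 in \<open>Abar\<close>, absorbs it. Derivatives exist only at positive
  times, so energies are integrated from there and the initial value enters through a limit.\<close>

lemma powr_convex_nonneg:
  fixes x y :: real
  assumes "p \<ge> 1" "0 \<le> x" "0 \<le> y" "0 \<le> l" "l \<le> 1"
  shows "(l * x + (1 - l) * y) powr p \<le> l * x powr p + (1 - l) * y powr p"
proof -
  \<comment> \<open>With one point at 0 the convexity inequality reduces to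
    \<open>l powr p <= l\<close> for a weight \<open>l\<close> in the unit interval.\<close>
  have le: "s powr p \<le> s" if "0 \<le> s" "s \<le> 1" for s :: real
    using that assms(1) by (cases "s = 0") (auto intro: powr_le_one_le)
  consider "x = 0" | "y = 0" | "x > 0" "y > 0" using assms by linarith
  then show ?thesis
  proof cases
    case 1
    then show ?thesis using assms le[of "1 - l"] by (simp add: powr_mult mult_right_mono)
  next
    case 2
    then show ?thesis using assms le[of l] by (simp add: powr_mult mult_right_mono)
  next
    case 3
    then show ?thesis using convex_onD[OF powr_convex[OF assms(1)], of l y x] assms by (simp add: add.commute)
  qed
qed

lemma powr_add_le_two:
  fixes x y :: real
  assumes "p \<ge> 1" "0 \<le> x" "0 \<le> y"
  shows "(x + y) powr p \<le> 2 powr (p - 1) * (x powr p + y powr p)"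
proof -
  have "((x + y) / 2) powr p \<le> (x powr p + y powr p) / 2"
    using powr_convex_nonneg[of p x y "1/2"] assms by (simp add: field_simps)
  then show ?thesis using assms by (simp add: powr_divide powr_diff field_simps)
qed

text \<open>Weighted arithmetic-geometric mean inequality with zero arguments allowed; the Hoelder
  and Young estimates below are derived from it.\<close>

lemma young_theta:
  fixes x y :: real
  assumes "0 \<le> t" "t \<le> 1" "0 \<le> x" "0 \<le> y"
  shows "x powr t * y powr (1 - t) \<le> t * x + (1 - t) * y"
proof (cases "x = 0 \<or> y = 0")
  case True then show ?thesis using assms by auto
next
  case False
  then show ?thesis using Youngs_inequality_0[of t "1 - t" x y] assms by auto
qed

lemma powr_le_one_add: "0 \<le> x \<Longrightarrow> 0 \<le> p \<Longrightarrow> p \<le> q \<Longrightarrow> x powr p \<le> 1 + x powr q" for x :: real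
proof (cases "x \<le> 1")
  case True
  assume "0 \<le> x" "0 \<le> p"
  then have "x powr p \<le> 1" using True by (intro powr_le1) auto
  then show ?thesis by (smt (verit) powr_ge_zero)
next
  case False
  assume "p \<le> q"
  then have "x powr p \<le> x powr q" using False by (intro powr_mono) auto
  then show ?thesis by simp
qed

lemma powr_ge_one: "1 \<le> x \<Longrightarrow> 0 \<le> p \<Longrightarrow> 1 \<le> x powr p" for x :: real
  by (rule ge_one_powr_ge_zero)

lemma powr_cancel_mult: "x > 0 \<Longrightarrow> x powr p * x powr (- p) = 1" for x :: real
  by (simp flip: powr_add)

section \<open>The constitutive law\<close>

locale forchheimer =
  fixes N :: nat and ab ac :: "nat \<Rightarrow> real"
  assumes N1: "N \<ge> 1" and ab0: "ab 0 = 0"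
    and ab_mono: "\<And>i j. i < j \<Longrightarrow> j \<le> N \<Longrightarrow> ab i < ab j"
    and ac_pos: "\<And>i. i \<le> N \<Longrightarrow> ac i > 0"
begin

abbreviation "a \<equiv> aexp N ab"

lemma abN_pos: "ab N > 0"
  using ab_mono[of 0 N] N1 ab0 by simp

lemma ab_nonneg: "i \<le> N \<Longrightarrow> 0 \<le> ab i" and ab_le: "i \<le> N \<Longrightarrow> ab i \<le> ab N"
   apply (metis ab_mono ab0 less_eq_real_def not_gr_zero)
  by (metis ab_mono less_eq_real_def le_neq_implies_less order.refl)

lemma a_bounds: "0 < a" "a < 1"
  using abN_pos by (auto simp: aexp_def field_simps)

lemma a_abN: "a * (1 + ab N) = ab N" "1 - a = 1 / (1 + ab N)"
  using abN_pos by (auto simp: aexp_def field_simps)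

lemma chi0_ge: "chi0 N ac \<ge> ac 0 + ac N" 
proof -
  have "(\<Sum>i\<in>{0,N}. ac i) \<le> (\<Sum>i\<le>N. ac i)"
    by (intro sum_mono2) (auto intro: less_imp_le ac_pos)
  then show ?thesis using N1 by (auto simp: chi0_def)
qed

lemma chi0_pos: "chi0 N ac > 0" using chi0_ge ac_pos[of 0] ac_pos[of N] by simp

lemma gfun_upper: "s \<ge> 0 \<Longrightarrow> gfun N ab ac s \<le> chi0 N ac * (1 + s) powr ab N"
  unfolding gfun_def chi0_def sum_distrib_right
proof (intro sum_mono mult_left_mono)
  fix i assume s: "0 \<le> s" and i: "i \<in> {..N}"
  have "pw s (ab i) \<le> (1 + s) powr ab i"
    using s ab_nonneg[of i] i by (auto simp: pw_def intro: powr_mono2)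
  also have "\<dots> \<le> (1 + s) powr ab N" using s ab_le[of i] i by (intro powr_mono) auto
  finally show "pw s (ab i) \<le> (1 + s) powr ab N" .
qed (use ac_pos less_imp_le in auto)

lemma gfun_ge2: assumes "s \<ge> 0" shows "gfun N ab ac s \<ge> ac 0 + ac N * s powr ab N"
proof -
  have "(\<Sum>i\<in>{0,N}. ac i * pw s (ab i)) \<le> (\<Sum>i\<le>N. ac i * pw s (ab i))"
    using assms by (intro sum_mono2) (auto intro!: mult_nonneg_nonneg less_imp_le[OF ac_pos] simp: pw_def)
  then show ?thesis using N1 abN_pos by (auto simp: gfun_def pw_def ab0)
qed

lemma gfun_pos: "s \<ge> 0 \<Longrightarrow> gfun N ab ac s > 0"
proof -
  assume s: "s \<ge> 0"
  have "0 \<le> ac N * s powr ab N" using ac_pos[of N] by simp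
  then show ?thesis using gfun_ge2[OF s] ac_pos[of 0] by simp
qed

text \<open>The base of the power \<open>1 + a\<close> in \<open>c4\<close>. The division by
  \<open>2 powr ab N\<close> pays for splitting a power of \<open>1 + s\<close> into powers of 1 and
  \<open>s\<close>.\<close>

definition "mm = min 1 (min (ac 0) (ac N)) / 2 powr ab N"

lemma mm_pos: "0 < mm" "mm \<le> min 1 (min (ac 0) (ac N))"
proof -
  have 1: "0 < min 1 (min (ac 0) (ac N))" using ac_pos[of 0] ac_pos[of N] by simp
  then show "0 < mm" by (simp add: mm_def)
  have "1 \<le> 2 powr ab N" using abN_pos by (simp add: ge_one_powr_ge_zero)
  then show "mm \<le> min 1 (min (ac 0) (ac N))"
    using 1 unfolding mm_def by (simp only: divide_le_eq mult_le_cancel_left1) auto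
qed

lemma mm_bound: "min 1 (min (ac 0) (ac N)) = mm * 2 powr ab N"
  by (simp add: mm_def)

lemma gfun_lower: assumes s: "s \<ge> 0" shows "gfun N ab ac s \<ge> mm * (1 + s) powr ab N"
proof -
  define mu where "mu = min 1 (min (ac 0) (ac N))"
  have mu: "0 < mu" "mu \<le> ac 0" "mu \<le> ac N" using ac_pos[of 0] ac_pos[of N] by (auto simp: mu_def)
  have "(1 + s) powr ab N \<le> (2 * max 1 s) powr ab N" using s abN_pos by (intro powr_mono2) auto
  also have "\<dots> = 2 powr ab N * (max 1 s) powr ab N" using s by (simp add: powr_mult)
  also have "(max 1 s) powr ab N \<le> 1 + s powr ab N" by (auto simp: max_def)
  finally have 1: "(1 + s) powr ab N \<le> 2 powr ab N * (1 + s powr ab N)" by (simp add: mult_left_mono)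
  have "mm * (1 + s) powr ab N \<le> mm * (2 powr ab N * (1 + s powr ab N))" using 1 mm_pos by (intro mult_left_mono) auto
  also have "\<dots> = mu * (1 + s powr ab N)" using mm_bound by (simp add: mu_def)
  also have "\<dots> \<le> ac 0 + ac N * s powr ab N" using mu by (simp add: distrib_left mult_right_mono add_mono)
  finally show ?thesis using gfun_ge2[OF s] by simp
qed

text \<open>Convexity of the power \<open>1 + ab N\<close> at the midpoint of 1 and \<open>s\<close>
  costs exactly the factor \<open>2 powr ab N\<close> contained in \<open>mm\<close>. Raising this
  bound to the power \<open>a\<close> controls \<open>(1 + s) powr ab N\<close>, because
  \<open>a * (1 + ab N) = ab N\<close>.\<close>

lemma one_plus_powr_le: assumes s: "s \<ge> 0" shows "mm * (1 + s) powr (1 + ab N) \<le> 1 + gfun N ab ac s * s"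
proof -
  define mu where "mu = min 1 (min (ac 0) (ac N))"
  have mu: "0 < mu" "mu \<le> 1" "mu \<le> ac N" using ac_pos[of 0] ac_pos[of N] by (auto simp: mu_def)
  have "((1/2) * 1 + (1/2) * s) powr (1 + ab N) \<le> (1/2) * 1 powr (1 + ab N) + (1/2) * s powr (1 + ab N)"
    using powr_convex_nonneg[of "1 + ab N" 1 s "1/2"] abN_pos s by simp
  then have "((1 + s) / 2) powr (1 + ab N) \<le> (1 + s powr (1 + ab N)) / 2" by (simp add: field_simps)
  then have "(1 + s) powr (1 + ab N) \<le> 2 powr ab N * (1 + s powr (1 + ab N))"
    using s by (simp add: powr_divide powr_add field_simps)
  then have "mm * (1 + s) powr (1 + ab N) \<le> mm * (2 powr ab N * (1 + s powr (1 + ab N)))"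
    using mm_pos by (intro mult_left_mono) auto
  also have "\<dots> = mu + mu * s powr (1 + ab N)" using mm_bound by (simp add: mu_def algebra_simps)
  also have "\<dots> \<le> 1 + ac N * s powr (1 + ab N)" using mu by (intro add_mono mult_right_mono) auto
  also have "ac N * s powr (1 + ab N) = (ac N * s powr ab N) * s" using s by (simp add: powr_add)
  also have "(ac N * s powr ab N) * s \<le> gfun N ab ac s * s"
    using gfun_ge2[OF s] s ac_pos[of 0] by (intro mult_right_mono) auto
  finally show ?thesis by simp
qed

lemma gfun_cont: "continuous_on {0..} (gfun N ab ac)"
  unfolding gfun_def
proof (intro continuous_intros)
  fix i assume "i \<in> {..N}"
  then have *: "ab i = 0 \<or> ab i > 0" using ab_nonneg[of i] by auto
  then show "continuous_on {0..} (\<lambda>x. pw x (ab i))"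
    by (auto simp: pw_def intro!: continuous_intros continuous_on_powr')
qed

text \<open>The equation is nonlinear only through \<open>norm v\<close>. With \<open>gfun\<close>
  frozen at a number \<open>s\<close> it is linear and explicitly solvable; the intermediate value
  theorem then finds an \<open>s\<close> equal to the norm of the solution.\<close>

lemma Ffun_surj: assumes kv: "norm kv = 1" shows "\<exists>v. Ffun N ab ac kv z v = y"
proof -
  define g where "g = gfun N ab ac"
  define n2 where "n2 s = (g s)\<^sup>2 + z\<^sup>2" for s
  \<comment> \<open>The inverse of \<open>g s\<close> times the identity plus \<open>z\<close> times
    the rotation, found from
    \<open>cross3 kv (cross3 kv y) = (kv \<bullet> y) *\<^sub>R kv - y\<close>; the last summand
    corrects the component along \<open>kv\<close>, which the rotation annihilates.\<close>
  define v where "v s = (g s / n2 s) *\<^sub>R y - (z / n2 s) *\<^sub>R cross3 kv y + (z\<^sup>2 / (g s * n2 s) * (kv \<bullet> y)) *\<^sub>R kv" for s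
  have gp: "g s > 0" if "s \<ge> 0" for s using gfun_pos that by (simp add: g_def)
  have n2p: "n2 s > 0" if "s \<ge> 0" for s using gp[OF that] by (simp add: n2_def add_pos_nonneg)
  have kk: "kv \<bullet> kv = 1" using kv by (simp add: dot_square_norm)
  have sol: "g s *\<^sub>R v s + z *\<^sub>R cross3 kv (v s) = y" if s: "s \<ge> 0" for s
  proof -
    have "cross3 kv (v s) = (g s / n2 s) *\<^sub>R cross3 kv y - (z / n2 s) *\<^sub>R ((kv \<bullet> y) *\<^sub>R kv - y)"
      unfolding v_def by (simp only: cross_add_right Cross3.right_diff_distrib cross_mult_right Lagrange kk) simp
    then have "g s *\<^sub>R v s + z *\<^sub>R cross3 kv (v s) = 
       (g s * (g s / n2 s) + z * (z / n2 s)) *\<^sub>R y + (g s * (z\<^sup>2 / (g s * n2 s) * (kv \<bullet> y)) - z * (z / n2 s) * (kv \<bullet> y)) *\<^sub>R kv"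
      unfolding v_def by (simp add: scaleR_add_left scaleR_diff_left scaleR_add_right scaleR_diff_right mult_ac)
    moreover have "g s * (g s / n2 s) + z * (z / n2 s) = 1"
    proof -
      have "g s * (g s / n2 s) + z * (z / n2 s) = n2 s / n2 s" by (simp add: n2_def power2_eq_square flip: add_divide_distrib)
      then show ?thesis using n2p[OF s] by simp
    qed
    moreover have "g s * (z\<^sup>2 / (g s * n2 s) * (kv \<bullet> y)) - z * (z / n2 s) * (kv \<bullet> y) = 0"
      using gp[OF s] n2p[OF s] by (simp add: power2_eq_square)
    ultimately show ?thesis by simp
  qed
  have bd: "g s * norm (v s) \<le> norm y" if s: "s \<ge> 0" for s
  proof -
    have "g s * (v s \<bullet> v s) = v s \<bullet> (g s *\<^sub>R v s + z *\<^sub>R cross3 kv (v s))"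
      by (simp add: inner_add_right dot_cross_self)
    also have "\<dots> \<le> norm (v s) * norm y" unfolding sol[OF s] by (rule norm_cauchy_schwarz)
    finally have "g s * norm (v s) * norm (v s) \<le> norm y * norm (v s)"
      by (simp add: dot_square_norm power2_eq_square mult_ac)
    then show ?thesis by (metis mult_right_le_imp_le norm_ge_zero mult_zero_right order_less_le)
  qed
  have gc: "continuous_on {0..} g" using gfun_cont by (simp add: g_def)
  have nz: "n2 s \<noteq> 0" "g s * n2 s \<noteq> 0" if "s \<ge> 0" for s using gp[OF that] n2p[OF that] by auto
  have n2c: "continuous_on {0..} n2" unfolding n2_def by (intro continuous_intros gc)
  have cont: "continuous_on {0..} (\<lambda>s. norm (v s) - s)"
    unfolding v_def by (intro continuous_intros gc n2c) (use nz in auto)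
  define s1 where "s1 = norm y / ac 0"
  have a0: "ac 0 > 0" by (simp add: ac_pos)
  have s1: "s1 \<ge> 0" using a0 by (simp add: s1_def)
  have "0 \<le> ac N * s1 powr ab N" using ac_pos[of N] by simp
  then have "ac 0 * norm (v s1) \<le> g s1 * norm (v s1)"
    using gfun_ge2[OF s1] by (intro mult_right_mono) (auto simp: g_def)
  with bd[OF s1] have "norm (v s1) \<le> s1" using a0 by (simp add: s1_def field_simps)
  then have "\<exists>s\<ge>0. s \<le> s1 \<and> norm (v s) - s = 0"
    using s1 by (intro IVT2') (auto intro: continuous_on_subset[OF cont])
  then obtain s where s: "s \<ge> 0" "norm (v s) = s" by auto
  have "Ffun N ab ac kv z (v s) = y" using sol[OF s(1)] s(2) by (simp add: Ffun_def g_def)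
  then show ?thesis by blast
qed

lemma Xfun_eq: "norm kv = 1 \<Longrightarrow> Ffun N ab ac kv (Rs * z) (Xfun N ab ac kv Rs z y) = y"
proof -
  assume kv: "norm kv = 1"
  have "\<forall>y. \<exists>v. y = Ffun N ab ac kv (Rs * z) v" using Ffun_surj[OF kv, of "Rs * z"] by (auto intro: sym)
  then have "surj (Ffun N ab ac kv (Rs * z))" unfolding surj_def .
  then show ?thesis unfolding Xfun_def by (rule surj_f_inv_f)
qed

lemma c3_pos: "c3 N ab ac > 0" using ac_pos[of N] by (simp add: c3_def)
lemma c4_eq: "c4 N ab ac = mm powr (1 + a)" by (simp add: c4_def mm_def)
lemma c4_pos: "c4 N ab ac > 0" using mm_pos by (simp add: c4_eq)

lemma Ffun_inner: "v \<bullet> Ffun N ab ac kv z v = gfun N ab ac (norm v) * (norm v)\<^sup>2"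
  by (simp add: Ffun_def inner_add_right dot_cross_self dot_square_norm)

text \<open>The rotation is orthogonal to \<open>v\<close>, so pairing with \<open>v\<close> sees
  only the part with \<open>gfun\<close>.\<close>

lemma Ffun_norm_ge: "gfun N ab ac (norm v) * norm v \<le> norm (Ffun N ab ac kv z v)"
proof -
  have "gfun N ab ac (norm v) * norm v * norm v \<le> norm (Ffun N ab ac kv z v) * norm v"
    using Ffun_inner[of v kv z] norm_cauchy_schwarz[of v "Ffun N ab ac kv z v"] by (simp add: power2_eq_square mult_ac)
  then show ?thesis by (metis mult_right_le_imp_le norm_ge_zero mult_zero_right order_less_le)
qed

text \<open>The preimage satisfies \<open>ac N * norm v powr (1 + ab N) <= norm y\<close>, and
  \<open>1 - a\<close> is the reciprocal of \<open>1 + ab N\<close>.\<close>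

lemma X_growth: assumes "norm kv = 1" shows "norm (Xfun N ab ac kv Rs z y) \<le> c3 N ab ac * norm y powr (1 - a)"
proof -
  define v where "v = Xfun N ab ac kv Rs z y"
  have Fv: "Ffun N ab ac kv (Rs * z) v = y" using Xfun_eq assms by (simp add: v_def)
  have p: "0 < 1 + ab N" using abN_pos by simp
  have "ac N * norm v powr ab N * norm v \<le> gfun N ab ac (norm v) * norm v"
    using gfun_ge2[of "norm v"] ac_pos[of 0] by (intro mult_right_mono) auto
  also have "\<dots> \<le> norm y" using Ffun_norm_ge[of v kv "Rs * z"] Fv by simp
  finally have 1: "ac N * norm v powr (1 + ab N) \<le> norm y" by (simp add: powr_add mult_ac)
  then have "(ac N * norm v powr (1 + ab N)) powr (1 - a) \<le> norm y powr (1 - a)"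
    using a_bounds ac_pos[of N] by (intro powr_mono2) auto
  moreover have "(ac N * norm v powr (1 + ab N)) powr (1 - a) = ac N powr (1 - a) * norm v"
    using ac_pos[of N] p by (simp add: powr_mult powr_powr a_abN(2))
  ultimately have "ac N powr (1 - a) * norm v \<le> norm y powr (1 - a)" by simp
  moreover have "ac N powr (1 - a) * c3 N ab ac = 1" using ac_pos[of N] by (simp add: c3_def flip: powr_add)
  moreover have "c3 N ab ac * (ac N powr (1 - a) * norm v) \<le> c3 N ab ac * norm y powr (1 - a)"
    using calculation(1) c3_pos by (intro mult_left_mono) auto
  ultimately show ?thesis unfolding v_def[symmetric] by (simp add: mult_ac)
qed

text \<open>The pairing equals \<open>g * s^2\<close>, while \<open>Y <= h * A * s\<close> with
  \<open>A = (1 + s) powr ab N\<close>. The rotation enters only through \<open>h\<close>, whence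
  the inverse square in the bound.\<close>

lemma X_coercive:
  assumes kv: "norm kv = 1" 
  shows "Xfun N ab ac kv Rs z y \<bullet> y \<ge> c5 N ab ac / (chi0 N ac + \<bar>Rs * z\<bar>)\<^sup>2 * (norm y powr (2 - a) - 1)"
proof -
  define v where "v = Xfun N ab ac kv Rs z y"
  define s where "s = norm v"
  define g where "g = gfun N ab ac s"
  define Z where "Z = \<bar>Rs * z\<bar>"
  define Y where "Y = norm y"
  have s: "s \<ge> 0" and Y0: "Y \<ge> 0" and Z0: "Z \<ge> 0" by (auto simp: s_def Y_def Z_def)
  have Fv: "Ffun N ab ac kv (Rs * z) v = y" using Xfun_eq kv by (simp add: v_def)
  have vy: "v \<bullet> y = g * s\<^sup>2" using Ffun_inner[of v kv "Rs * z"] Fv by (simp add: g_def s_def)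
  have gp: "g > 0" using gfun_pos s by (simp add: g_def)
  have "(norm (cross3 kv v))\<^sup>2 + (kv \<bullet> v)\<^sup>2 = s\<^sup>2" using norm_cross_dot[of kv v] kv by (simp add: s_def)
  then have "(norm (cross3 kv v))\<^sup>2 \<le> s\<^sup>2" by (metis le_add_same_cancel1 zero_le_power2)
  then have cn: "norm (cross3 kv v) \<le> s" using s by (rule power2_le_imp_le)
  have "Y \<le> norm (g *\<^sub>R v) + norm ((Rs * z) *\<^sub>R cross3 kv v)" unfolding Y_def Fv[symmetric] Ffun_def g_def s_def by (rule norm_triangle_ineq)
  also have "\<dots> \<le> g * s + Z * s" using gp cn by (auto simp: s_def Z_def intro!: mult_left_mono)
  finally have Yle: "Y \<le> (g + Z) * s" by (simp add: algebra_simps)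
  define A where "A = (1 + s) powr ab N"
  have A1: "A \<ge> 1" using s abN_pos by (simp add: A_def ge_one_powr_ge_zero)
  have "g \<le> chi0 N ac * A" using gfun_upper[OF s] by (simp add: g_def A_def)
  moreover have "Z \<le> Z * A" using A1 Z0 by (simp add: mult_le_cancel_left1)
  ultimately have "g + Z \<le> (chi0 N ac + Z) * A" by (simp add: algebra_simps)
  then have Yle2: "Y \<le> (chi0 N ac + Z) * A * s" using Yle s by (meson mult_right_mono order_trans)
  define h where "h = chi0 N ac + Z"
  have h: "h > 0" using chi0_pos Z0 by (simp add: h_def)
  have "mm * (1 + s) powr (1 + ab N) \<le> 1 + g * s" using one_plus_powr_le[OF s] by (simp add: g_def)
  also have "g * s \<le> Y" using Ffun_norm_ge[of v kv "Rs * z"] Fv by (simp add: g_def s_def Y_def)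
  finally have "mm * (1 + s) powr (1 + ab N) \<le> 1 + Y" by simp
  then have "(mm * (1 + s) powr (1 + ab N)) powr a \<le> (1 + Y) powr a" using mm_pos a_bounds by (intro powr_mono2) auto
  moreover have "(mm * (1 + s) powr (1 + ab N)) powr a = mm powr a * A"
    using mm_pos s by (simp add: powr_mult powr_powr A_def a_abN mult.commute)
  ultimately have mA: "mm powr a * A \<le> (1 + Y) powr a" by simp
  have gm: "mm * A \<le> g" using gfun_lower[OF s] by (simp add: g_def A_def)
  \<comment> \<open>The two factors \<open>A\<close> of the square are spent differently: one is
    below \<open>g / mm\<close> and completes the pairing, the other is bounded by a power
    \<open>a\<close> of \<open>1 + Y\<close>. This is how the exponent 2 drops to
    \<open>2 - a\<close>.\<close>
  have "c4 N ab ac * Y\<^sup>2 \<le> c4 N ab ac * (h * A * s)\<^sup>2" using Yle2 Y0 c4_pos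
    by (intro mult_left_mono power_mono) (auto simp: h_def)
  also have "\<dots> = h\<^sup>2 * (mm * A) * s\<^sup>2 * (mm powr a * A)" using mm_pos by (simp add: c4_eq powr_add power2_eq_square mult_ac)
  also have "\<dots> \<le> h\<^sup>2 * g * s\<^sup>2 * (1 + Y) powr a"
    using gm mA h gp mm_pos A1 by (intro mult_mono) auto
  finally have core: "c4 N ab ac * Y\<^sup>2 \<le> h\<^sup>2 * (g * s\<^sup>2) * (1 + Y) powr a" by (simp add: mult_ac)
  have "c5 N ab ac * (Y powr (2 - a) - 1) \<le> h\<^sup>2 * (g * s\<^sup>2)"
  \<comment> \<open>Below 1 the left side is nonpositive, which is the purpose of the subtracted 1;
    above 1, \<open>1 + Y\<close> is at most \<open>2 * Y\<close>, which gives the factor between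
    \<open>c4\<close> and \<open>c5\<close>.\<close>
  proof (cases "Y \<ge> 1")
    case True
    have "(1 + Y) powr a \<le> (2 * Y) powr a" using True a_bounds by (intro powr_mono2) auto
    also have "\<dots> = 2 powr a * Y powr a" using True by (simp add: powr_mult)
    finally have "c4 N ab ac * Y\<^sup>2 \<le> h\<^sup>2 * (g * s\<^sup>2) * (2 powr a * Y powr a)"
      using core gp by (meson mult_left_mono order_trans mult_nonneg_nonneg zero_le_power2 less_imp_le)
    moreover have "Y\<^sup>2 = Y powr (2 - a) * Y powr a" using True by (simp flip: powr_add add: powr_numeral)
    ultimately have "c4 N ab ac * Y powr (2 - a) * Y powr a \<le> (h\<^sup>2 * (g * s\<^sup>2) * 2 powr a) * Y powr a" by (simp add: mult_ac)
    then have "c4 N ab ac * Y powr (2 - a) \<le> h\<^sup>2 * (g * s\<^sup>2) * 2 powr a"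
      using True by (metis mult_right_le_imp_le powr_gt_zero not_one_le_zero)
    then have "2 powr (-a) * (c4 N ab ac * Y powr (2 - a)) \<le> 2 powr (-a) * (h\<^sup>2 * (g * s\<^sup>2) * 2 powr a)" by simp
    also have "\<dots> = h\<^sup>2 * (g * s\<^sup>2) * (2 powr (-a) * 2 powr a)" by (simp only: mult_ac)
    also have "\<dots> = h\<^sup>2 * (g * s\<^sup>2)" by (simp flip: powr_add)
    finally have "c5 N ab ac * Y powr (2 - a) \<le> h\<^sup>2 * (g * s\<^sup>2)" by (simp add: c5_def mult_ac)
    moreover have "0 < c5 N ab ac" using c4_pos by (simp add: c5_def)
    ultimately show ?thesis unfolding right_diff_distrib by linarith
  next
    case False
    then have "Y powr (2 - a) \<le> 1" using Y0 a_bounds by (intro powr_le1) auto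
    then have "c5 N ab ac * (Y powr (2 - a) - 1) \<le> 0" using c4_pos by (simp add: c5_def mult_nonneg_nonpos)
    also have "0 \<le> h\<^sup>2 * (g * s\<^sup>2)" using gp by simp
    finally show ?thesis .
  qed
  then have "c5 N ab ac * (Y powr (2 - a) - 1) / h\<^sup>2 \<le> g * s\<^sup>2" using h by (simp add: divide_le_eq mult.commute)
  then show ?thesis using vy by (simp add: v_def[symmetric] Y_def h_def Z_def)
qed

text \<open>Compares coercivity with growth, so that \<open>flux_bound\<close> can estimate
  \<open>c5 / w\<close> by a multiple of \<open>w powr (1 - a)\<close>.\<close>

lemma c4_le_c3: "c4 N ab ac \<le> c3 N ab ac * (chi0 N ac)\<^sup>2"
proof -
  have X: "chi0 N ac \<ge> ac N" "mm \<le> chi0 N ac" "chi0 N ac > 0" using chi0_ge ac_pos[of 0] ac_pos[of N] mm_pos by auto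
  have "c4 N ab ac \<le> chi0 N ac powr (1 + a)" unfolding c4_eq using X mm_pos a_bounds by (intro powr_mono2) auto
  also have "\<dots> = 1 * chi0 N ac powr (1 + a)" by simp
  also have "1 * chi0 N ac powr (1 + a) = c3 N ab ac * ac N powr (1 - a) * chi0 N ac powr (1 + a)" using ac_pos[of N] by (simp add: c3_def flip: powr_add)
  also have "\<dots> \<le> c3 N ab ac * chi0 N ac powr (1 - a) * chi0 N ac powr (1 + a)"
    using X ac_pos[of N] c3_pos a_bounds by (intro mult_right_mono mult_left_mono powr_mono2) auto
  also have "\<dots> = c3 N ab ac * (chi0 N ac)\<^sup>2" using X by (simp flip: powr_add add: powr_numeral)
  finally show ?thesis .
qed

end

text \<open>Young's inequality for the conjugate exponents \<open>(2 - a) / (1 - a)\<close> and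
  \<open>2 - a\<close>. The term with \<open>e\<close> is meant to be absorbed by coercivity; the
  weights \<open>t\<close> and \<open>1 - t\<close> are bounded by 1.\<close>

lemma young_eps:
  fixes k e Y E a :: real
  assumes "k > 0" "e > 0" "Y \<ge> 0" "E \<ge> 0" "0 < a" "a < 1"
  shows "k * Y powr (1 - a) * E \<le> e * Y powr (2 - a) + k * (k / e) powr (1 - a) * E powr (2 - a)"
proof -
  define t where "t = (1 - a) / (2 - a)"
  have t: "0 \<le> t" "t \<le> 1" "1 - t = 1 / (2 - a)" "(2 - a) * t = 1 - a" "(2 - a) * (1 - t) = 1" "(1 - a) * (1 - t) = t"
    using assms by (auto simp: t_def field_simps)
  have "(e * Y powr (2 - a)) powr t = e powr t * Y powr (1 - a)"
    using assms t by (simp add: powr_mult powr_powr)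
  moreover have "(k * (k / e) powr (1 - a) * E powr (2 - a)) powr (1 - t) = k powr (1 - t) * (k / e) powr t * E"
    using assms by (simp add: powr_mult powr_powr t(5,6))
  moreover have "e powr t * (k powr (1 - t) * (k / e) powr t) = k"
    using assms by (simp add: powr_divide flip: powr_add)
  ultimately have "(e * Y powr (2 - a)) powr t * (k * (k / e) powr (1 - a) * E powr (2 - a)) powr (1 - t) = k * Y powr (1 - a) * E"
    by (metis (no_types, lifting) mult.assoc mult.commute)
  moreover have "\<dots> = k * Y powr (1 - a) * E" ..
  ultimately have "k * Y powr (1 - a) * E \<le> t * (e * Y powr (2 - a)) + (1 - t) * (k * (k / e) powr (1 - a) * E powr (2 - a))"
    using young_theta[of t "e * Y powr (2 - a)" "k * (k / e) powr (1 - a) * E powr (2 - a)"] assms t by simp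
  also have "\<dots> \<le> 1 * (e * Y powr (2 - a)) + 1 * (k * (k / e) powr (1 - a) * E powr (2 - a))"
    using assms t(1,2) by (intro add_mono mult_right_mono) auto
  finally show ?thesis by simp
qed

section \<open>The pointwise bound on the flux paired with the gradient of the difference\<close>

context forchheimer begin

lemma c5_pos: "c5 N ab ac > 0" using c4_pos by (simp add: c5_def)
lemma c9_pos: "c9 N ab ac > 0" using c5_pos chi0_pos by (simp add: c9_def)
lemma c10_pos: "c10 N ab ac > 0" using c4_pos by (simp add: c10_def)
lemma c11_ge: "c9 N ab ac \<le> c11 N ab ac"
  using c3_pos c4_pos c5_pos c10_pos by (simp add: c11_def Let_def)
lemma c11_pos: "c11 N ab ac > 0" using c11_ge c9_pos by simp

text \<open>The constant that \<open>young_eps\<close> produces from the growth constant and the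
  coercivity constant, stripped of powers of \<open>w\<close> and of numerical factors.\<close>

definition "HH = c3 N ab ac * (c3 N ab ac / c4 N ab ac) powr (1 - a)"
lemma HH_pos: "HH > 0" using c3_pos c4_pos by (simp add: HH_def)

lemma c12_ge: "2 * 128 powr (1 - a) * HH \<le> c12 N ab ac"
proof -
  have "32 * c3 N ab ac / c4 N ab ac = 32 * (c3 N ab ac / c4 N ab ac)" by simp
  then have "(32 * c3 N ab ac / c4 N ab ac) powr (1 - a) = 32 powr (1 - a) * (c3 N ab ac / c4 N ab ac) powr (1 - a)"
    using c3_pos c4_pos by (simp only: powr_mult less_imp_le divide_nonneg_pos)
  moreover have "(128::real) powr (1 - a) = 4 powr (1 - a) * 32 powr (1 - a)" by (simp flip: powr_mult)
  ultimately have "2 * 128 powr (1 - a) * HH = 2 * 4 powr (1 - a) * c3 N ab ac * (32 * c3 N ab ac / c4 N ab ac) powr (1 - a)"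
    by (simp add: HH_def)
  moreover have "0 \<le> 2 * 4 powr (1 - a) * c3 N ab ac" using c3_pos by simp
  ultimately show ?thesis unfolding c12_def Let_def distrib_left by linarith
qed
lemma c12_pos: "c12 N ab ac > 0"
proof -
  have "0 < 2 * 128 powr (1 - a) * HH" using HH_pos by simp
  then show ?thesis using c12_ge by linarith
qed

text \<open>With \<open>y = g + eta\<close> the pairing with \<open>g\<close> is the pairing with
  \<open>y\<close> minus that with \<open>eta\<close>. Half of the coercivity absorbs the second by
  Young's inequality, and \<open>norm g <= norm y + norm eta\<close> converts the other half into a
  power of \<open>norm g\<close>. The rest only sorts the powers of \<open>r\<close>,
  \<open>P\<close> and \<open>h\<close>.\<close>

lemma flux_bound:
  fixes g h Zv :: "real^3"
  assumes kv: "norm kv = 1" and chi: "chi \<ge> 1" "Rs\<^sup>2 \<le> chi" "(chi0 N ac)\<^sup>2 \<le> chi" and Rs: "Rs \<ge> 0"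
    and u: "0 \<le> u" "u \<le> r + P" and rP: "0 \<le> r" "0 \<le> P" and Zv: "norm Zv \<le> chi"
  defines "X \<equiv> Xfun N ab ac kv Rs u (g + h + u\<^sup>2 *\<^sub>R Zv)"
  shows "- (X \<bullet> g) \<le> - (c10 N ab ac / chi * ((1 + r + P) powr (-2) * norm g powr (2 - a))) + c11 N ab ac
     + 3/4 * c12 N ab ac * chi powr (1 - a) * ((r powr (2 - 2*a) + (1 + P) powr (2 - 2*a)) * norm h powr (2 - a))
     + 3/2 * c12 N ab ac * chi powr (3 - 2*a) * (r powr (6 - 4*a) + (1 + P) powr (6 - 4*a))"
proof -
  define y where "y = g + h + u\<^sup>2 *\<^sub>R Zv"
  define eta where "eta = h + u\<^sup>2 *\<^sub>R Zv"
  define Y E D where "Y = norm y" and "E = norm eta" and "D = norm g"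
  \<comment> \<open>The denominator of the coercivity bound. Its upper bound
    \<open>chi * S^2\<close> is the origin of the weight with exponent -2; its lower bound
    \<open>(chi0 N ac)^2\<close> turns the constant term into \<open>c9\<close>.\<close>
  define w where "w = (chi0 N ac + \<bar>Rs * u\<bar>)\<^sup>2"
  define S where "S = 1 + r + P"
  note ab = a_bounds
  have nn: "0 \<le> Y" "0 \<le> E" "0 \<le> D" by (auto simp: Y_def E_def D_def)
  have S1: "S \<ge> 1" "u \<le> S" using rP u by (auto simp: S_def)
  have wpos: "w > 0" using chi0_pos by (simp add: w_def add_pos_nonneg)
  have w_ge: "(chi0 N ac)\<^sup>2 \<le> w" using chi0_pos by (auto simp: w_def intro!: power_mono)
  have sq: "chi0 N ac \<le> sqrt chi" "Rs \<le> sqrt chi" using chi by (auto intro: real_le_rsqrt)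
  have "chi0 N ac + \<bar>Rs * u\<bar> \<le> sqrt chi + sqrt chi * u" using sq u Rs by (auto simp: abs_mult intro!: add_mono mult_right_mono)
  also have "\<dots> = sqrt chi * (1 + u)" by (simp add: algebra_simps)
  also have "\<dots> \<le> sqrt chi * S" using u rP chi by (auto simp: S_def intro!: mult_left_mono)
  finally have "w \<le> (sqrt chi * S)\<^sup>2" unfolding w_def using chi0_pos by (intro power_mono) auto
  then have w_le: "w \<le> chi * S\<^sup>2" using chi by (simp add: power_mult_distrib)
  have "- (X \<bullet> g) = - (X \<bullet> y) + X \<bullet> eta" by (simp add: y_def eta_def inner_add_right)
  also have "\<dots> \<le> - (c5 N ab ac / w * (Y powr (2 - a) - 1)) + c3 N ab ac * Y powr (1 - a) * E"
  proof (intro add_mono)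
    show "- (X \<bullet> y) \<le> - (c5 N ab ac / w * (Y powr (2 - a) - 1))"
      using X_coercive[OF kv, of Rs u y] by (simp add: X_def y_def Y_def w_def)
    have "X \<bullet> eta \<le> norm X * norm eta" by (rule norm_cauchy_schwarz)
    also have "\<dots> \<le> c3 N ab ac * Y powr (1 - a) * E"
      unfolding E_def using X_growth[OF kv, of Rs u y] by (intro mult_right_mono) (auto simp: X_def y_def Y_def)
    finally show "X \<bullet> eta \<le> c3 N ab ac * Y powr (1 - a) * E" .
  qed
  also have "c3 N ab ac * Y powr (1 - a) * E \<le> c5 N ab ac / w / 2 * Y powr (2 - a)
       + c3 N ab ac * (c3 N ab ac / (c5 N ab ac / w / 2)) powr (1 - a) * E powr (2 - a)"
    using nn ab c3_pos c5_pos wpos by (intro young_eps) auto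
  finally have 1: "- (X \<bullet> g) \<le> - (c5 N ab ac / w / 2 * Y powr (2 - a)) + c5 N ab ac / w
      + c3 N ab ac * (c3 N ab ac / (c5 N ab ac / w / 2)) powr (1 - a) * E powr (2 - a)"
    by (simp add: right_diff_distrib)
  have "D \<le> Y + E" using norm_triangle_ineq4[of y eta] by (simp add: D_def Y_def E_def y_def eta_def)
  then have "D powr (2 - a) \<le> (Y + E) powr (2 - a)" using nn ab by (intro powr_mono2) auto
  also have "\<dots> \<le> 2 powr (1 - a) * (Y powr (2 - a) + E powr (2 - a))"
    using powr_add_le_two[of "2 - a" Y E] ab nn by simp
  finally have "2 powr (a - 1) * D powr (2 - a) \<le> 2 powr (a - 1) * (2 powr (1 - a) * (Y powr (2 - a) + E powr (2 - a)))"
    by (rule mult_left_mono) simp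
  also have "\<dots> = (2 powr (a - 1) * 2 powr (1 - a)) * (Y powr (2 - a) + E powr (2 - a))" by (simp only: mult.assoc)
  also have "\<dots> = Y powr (2 - a) + E powr (2 - a)" by (simp flip: powr_add)
  finally have 2: "2 powr (a - 1) * D powr (2 - a) - E powr (2 - a) \<le> Y powr (2 - a)" by simp
  have c5h: "c5 N ab ac / 2 * 2 powr (a - 1) = c10 N ab ac"
    by (simp add: c5_def c10_def powr_diff powr_minus field_simps)
  have "c5 N ab ac / w / 2 * (2 powr (a - 1) * D powr (2 - a) - E powr (2 - a)) \<le> c5 N ab ac / w / 2 * Y powr (2 - a)"
    using 2 c5_pos wpos by (intro mult_left_mono) auto
  moreover have "c5 N ab ac / w / 2 * (2 powr (a - 1) * D powr (2 - a)) = c10 N ab ac / w * D powr (2 - a)"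
    unfolding c5h[symmetric] by simp
  ultimately have 3: "- (c5 N ab ac / w / 2 * Y powr (2 - a)) \<le> - (c10 N ab ac / w * D powr (2 - a)) + c5 N ab ac / w / 2 * E powr (2 - a)"
    by (simp only: right_diff_distrib)
  have 4: "c10 N ab ac / chi * (S powr (-2) * D powr (2 - a)) \<le> c10 N ab ac / w * D powr (2 - a)"
  proof -
    have "S powr (-2) = 1 / S\<^sup>2" using S1 by (simp add: powr_minus powr_numeral divide_inverse)
    then have "c10 N ab ac / chi * (S powr (-2) * D powr (2 - a)) = c10 N ab ac / (chi * S\<^sup>2) * D powr (2 - a)" by simp
    also have "\<dots> \<le> c10 N ab ac / w * D powr (2 - a)" using w_le wpos c10_pos by (intro mult_right_mono divide_left_mono) auto
    finally show ?thesis .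
  qed
  have c9: "c5 N ab ac / w \<le> c9 N ab ac"
  proof -
    have "c9 N ab ac = c5 N ab ac / (chi0 N ac)\<^sup>2" using chi0_pos by (simp add: c9_def powr_minus powr_numeral divide_inverse)
    moreover have "c5 N ab ac / w \<le> c5 N ab ac / (chi0 N ac)\<^sup>2" using w_ge wpos c5_pos chi0_pos by (intro divide_left_mono) auto
    ultimately show ?thesis by simp
  qed
  have c54: "c5 N ab ac \<le> c4 N ab ac" using ab c4_pos powr_le_one_le[of 2] by (simp add: c5_def mult_le_cancel_right1 powr_minus inverse_le_1_iff ge_one_powr_ge_zero)
  \<comment> \<open>Passing from \<open>Y\<close> to \<open>D\<close> leaves \<open>c5 / w\<close>
    times \<open>E powr (2 - a)\<close>; bringing this to the order \<open>w powr (1 - a)\<close> of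
    the Young term lets both be treated together.\<close>
  have 5: "c5 N ab ac / w \<le> HH * w powr (1 - a)"
  proof -
    have "c4 N ab ac \<le> c3 N ab ac * w" using c4_le_c3 w_ge c3_pos by (meson mult_left_mono order_trans less_imp_le)
    then have "c4 N ab ac powr (2 - a) \<le> (c3 N ab ac * w) powr (2 - a)" using c4_pos ab by (intro powr_mono2) auto
    then have "c4 N ab ac powr (2 - a) * c4 N ab ac powr (a - 1) \<le> (c3 N ab ac * w) powr (2 - a) * c4 N ab ac powr (a - 1)"
      by (rule mult_right_mono) simp
    also have "c4 N ab ac powr (2 - a) * c4 N ab ac powr (a - 1) = c4 N ab ac" using c4_pos by (simp flip: powr_add)
    also have "(c3 N ab ac * w) powr (2 - a) * c4 N ab ac powr (a - 1) = HH * w powr (1 - a) * w"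
    proof -
      have "x powr (2 - a) = x * x powr (1 - a)" if "x > 0" for x :: real using that powr_add[of x 1 "1 - a"] by simp
      moreover have "c4 N ab ac powr (a - 1) = 1 / c4 N ab ac powr (1 - a)" using powr_minus_divide[of "c4 N ab ac" "1 - a"] by simp
      ultimately show ?thesis using wpos c3_pos c4_pos by (simp add: HH_def powr_mult powr_divide)
    qed
    finally have "c4 N ab ac \<le> HH * w powr (1 - a) * w" .
    then have "c5 N ab ac \<le> HH * w powr (1 - a) * w" using c54 by simp
    then show ?thesis using wpos by (simp add: pos_divide_le_eq)
  qed
  have 6: "c3 N ab ac * (c3 N ab ac / (c5 N ab ac / w / 2)) powr (1 - a) \<le> 4 powr (1 - a) * HH * w powr (1 - a)"
  proof -
    have "c3 N ab ac / (c5 N ab ac / w / 2) = (2 * 2 powr a) * ((c3 N ab ac / c4 N ab ac) * w)"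
      by (simp add: c5_def powr_minus field_simps)
    also have "\<dots> \<le> 4 * ((c3 N ab ac / c4 N ab ac) * w)"
    proof (intro mult_right_mono)
      have "2 powr a \<le> 2 powr (1::real)" using ab by (intro powr_mono) auto
      then show "2 * 2 powr a \<le> (4::real)" by simp
    qed (use c3_pos c4_pos wpos in auto)
    finally have "(c3 N ab ac / (c5 N ab ac / w / 2)) powr (1 - a) \<le> (4 * ((c3 N ab ac / c4 N ab ac) * w)) powr (1 - a)"
      using ab c3_pos c5_pos wpos by (intro powr_mono2) auto
    also have "\<dots> = 4 powr (1 - a) * ((c3 N ab ac / c4 N ab ac) powr (1 - a) * w powr (1 - a))"
      using c3_pos c4_pos wpos by (simp only: powr_mult)
    finally have "c3 N ab ac * (c3 N ab ac / (c5 N ab ac / w / 2)) powr (1 - a) \<le> c3 N ab ac * (4 powr (1 - a) * ((c3 N ab ac / c4 N ab ac) powr (1 - a) * w powr (1 - a)))"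
      using c3_pos by (intro mult_left_mono) auto
    then show ?thesis by (simp add: HH_def mult_ac)
  qed
  have f1: "1 \<le> (4::real) powr (1 - a)" using ab by (intro ge_one_powr_ge_zero) auto
  have E0: "0 \<le> E powr (2 - a)" by simp
  have 7: "- (X \<bullet> g) \<le> - (c10 N ab ac / chi * (S powr (-2) * D powr (2 - a))) + c11 N ab ac
       + 3/2 * 4 powr (1 - a) * HH * w powr (1 - a) * E powr (2 - a)"
  proof -
    have "c5 N ab ac / w / 2 * E powr (2 - a) \<le> 1/2 * 4 powr (1 - a) * HH * w powr (1 - a) * E powr (2 - a)"
    proof (rule mult_right_mono[OF _ E0])
      have "HH * w powr (1 - a) \<le> 4 powr (1 - a) * (HH * w powr (1 - a))" using mult_right_mono[OF f1, of "HH * w powr (1 - a)"] HH_pos by simp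
      then show "c5 N ab ac / w / 2 \<le> 1/2 * 4 powr (1 - a) * HH * w powr (1 - a)" using 5 by (simp add: mult.assoc)
    qed
    moreover have "c3 N ab ac * (c3 N ab ac / (c5 N ab ac / w / 2)) powr (1 - a) * E powr (2 - a) \<le> 4 powr (1 - a) * HH * w powr (1 - a) * E powr (2 - a)"
      by (rule mult_right_mono[OF 6 E0])
    ultimately show ?thesis using 1 3 4 c9 c11_ge by (simp add: mult.assoc)
  qed
  have wS: "w powr (1 - a) \<le> chi powr (1 - a) * S powr (2 - 2*a)"
  proof -
    have "w powr (1 - a) \<le> (chi * S\<^sup>2) powr (1 - a)" using w_le wpos ab by (intro powr_mono2) auto
    also have "\<dots> = chi powr (1 - a) * (S powr 2) powr (1 - a)" using chi S1 by (simp add: powr_mult powr_numeral)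
    also have "\<dots> = chi powr (1 - a) * S powr (2 - 2*a)" by (simp add: powr_powr algebra_simps)
    finally show ?thesis .
  qed
  have ES: "E powr (2 - a) \<le> 2 powr (1 - a) * (norm h powr (2 - a) + chi powr (2 - a) * S powr (4 - 2*a))"
  proof -
    have "E \<le> norm h + norm (u\<^sup>2 *\<^sub>R Zv)" unfolding E_def eta_def by (rule norm_triangle_ineq)
    also have "norm (u\<^sup>2 *\<^sub>R Zv) \<le> S\<^sup>2 * chi" using Zv u S1 by (auto intro!: mult_mono power_mono)
    finally have "E powr (2 - a) \<le> (norm h + chi * S\<^sup>2) powr (2 - a)" using nn ab by (intro powr_mono2) (auto simp: mult.commute)
    also have "\<dots> \<le> 2 powr (2 - a - 1) * (norm h powr (2 - a) + (chi * S\<^sup>2) powr (2 - a))"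
      using ab chi by (intro powr_add_le_two) auto
    also have "(chi * S\<^sup>2) powr (2 - a) = chi powr (2 - a) * (S powr 2) powr (2 - a)" using chi S1 by (simp add: powr_mult powr_numeral)
    also have "\<dots> = chi powr (2 - a) * S powr (4 - 2*a)" by (simp add: powr_powr algebra_simps)
    finally show ?thesis by simp
  qed
  have S2: "S powr (2 - 2*a) \<le> 4 powr (1 - a) * (r powr (2 - 2*a) + (1 + P) powr (2 - 2*a))"
  proof -
    have "S powr (2 - 2*a) \<le> (2 * max r (1 + P)) powr (2 - 2*a)" using rP ab by (intro powr_mono2) (auto simp: S_def max_def)
    also have "\<dots> = 2 powr (2 - 2*a) * max r (1 + P) powr (2 - 2*a)" using rP by (simp add: powr_mult)
    also have "2 powr (2 - 2*a) = (2 powr 2) powr (1 - a)" by (simp only: powr_powr) (simp add: algebra_simps)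
    also have "max r (1 + P) powr (2 - 2*a) \<le> r powr (2 - 2*a) + (1 + P) powr (2 - 2*a)" by (auto simp: max_def)
    finally show ?thesis by (simp add: mult_left_mono)
  qed
  have S6: "S powr (6 - 4*a) \<le> 2 * 16 powr (1 - a) * (r powr (6 - 4*a) + (1 + P) powr (6 - 4*a))"
  proof -
    have "S powr (6 - 4*a) \<le> 2 powr (6 - 4*a - 1) * (r powr (6 - 4*a) + (1 + P) powr (6 - 4*a))"
      using powr_add_le_two[of "6 - 4*a" r "1 + P"] rP ab by (simp add: S_def add.assoc add.left_commute)
    also have "6 - 4*a - 1 = 1 + 4 * (1 - a)" by simp
    also have "2 powr (1 + 4 * (1 - a)) = 2 * (2 powr 4) powr (1 - a)" 
      by (simp only: powr_powr powr_add) simp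
    finally show ?thesis by simp
  qed
  define T1 where "T1 = r powr (2 - 2*a) + (1 + P) powr (2 - 2*a)"
  define T2 where "T2 = r powr (6 - 4*a) + (1 + P) powr (6 - 4*a)"
  have T: "0 \<le> T1" "0 \<le> T2" by (auto simp: T1_def T2_def)
  have "w powr (1 - a) * E powr (2 - a) \<le> (chi powr (1 - a) * S powr (2 - 2*a)) * (2 powr (1 - a) * (norm h powr (2 - a) + chi powr (2 - a) * S powr (4 - 2*a)))"
    using wS ES by (intro mult_mono) auto
  also have "\<dots> = 2 powr (1 - a) * (chi powr (1 - a) * S powr (2 - 2*a) * norm h powr (2 - a) + (chi powr (1 - a) * chi powr (2 - a)) * (S powr (2 - 2*a) * S powr (4 - 2*a)))"
    by (simp add: algebra_simps)
  also have "chi powr (1 - a) * chi powr (2 - a) = chi powr (3 - 2*a)" using chi by (simp flip: powr_add)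
  also have "S powr (2 - 2*a) * S powr (4 - 2*a) = S powr (6 - 4*a)" using S1 by (simp flip: powr_add)
  also have "2 powr (1 - a) * (chi powr (1 - a) * S powr (2 - 2*a) * norm h powr (2 - a) + chi powr (3 - 2*a) * S powr (6 - 4*a))
     \<le> 2 powr (1 - a) * (chi powr (1 - a) * (4 powr (1 - a) * T1) * norm h powr (2 - a) + chi powr (3 - 2*a) * (2 * 16 powr (1 - a) * T2))"
    using S2 S6 by (intro mult_left_mono add_mono mult_right_mono) (auto simp: T1_def T2_def)
  finally have 8: "w powr (1 - a) * E powr (2 - a) \<le> 2 powr (1 - a) * (chi powr (1 - a) * (4 powr (1 - a) * T1) * norm h powr (2 - a) + chi powr (3 - 2*a) * (2 * 16 powr (1 - a) * T2))" .
  \<comment> \<open>The numerical factors collapse to bases 32 and 128; \<open>c12\<close> is at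
    least \<open>2 * 128 powr (1 - a) * HH\<close>, which covers both.\<close>
  have p1: "(4::real) powr (1 - a) * (2 powr (1 - a) * 4 powr (1 - a)) = 32 powr (1 - a)" "(4::real) powr (1 - a) * (2 powr (1 - a) * 16 powr (1 - a)) = 128 powr (1 - a)"
    by (simp_all flip: powr_mult)
  have "3/2 * 4 powr (1 - a) * HH * w powr (1 - a) * E powr (2 - a) = 3/2 * 4 powr (1 - a) * HH * (w powr (1 - a) * E powr (2 - a))" by simp
  also have "\<dots> \<le> 3/2 * 4 powr (1 - a) * HH * (2 powr (1 - a) * (chi powr (1 - a) * (4 powr (1 - a) * T1) * norm h powr (2 - a) + chi powr (3 - 2*a) * (2 * 16 powr (1 - a) * T2)))"
    using 8 HH_pos by (intro mult_left_mono) auto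
  also have "\<dots> = (3/2 * HH * (4 powr (1 - a) * (2 powr (1 - a) * 4 powr (1 - a)))) * chi powr (1 - a) * (T1 * norm h powr (2 - a))
      + (3 * HH * (4 powr (1 - a) * (2 powr (1 - a) * 16 powr (1 - a)))) * chi powr (3 - 2*a) * T2"
    by (simp add: algebra_simps)
  also have "\<dots> = (3/2 * HH * 32 powr (1 - a)) * chi powr (1 - a) * (T1 * norm h powr (2 - a)) + (3 * HH * 128 powr (1 - a)) * chi powr (3 - 2*a) * T2"
    unfolding p1 ..
  also have "\<dots> \<le> (3/4 * c12 N ab ac) * chi powr (1 - a) * (T1 * norm h powr (2 - a)) + (3/2 * c12 N ab ac) * chi powr (3 - 2*a) * T2"
  proof (intro add_mono mult_right_mono)
    have "(32::real) powr (1 - a) \<le> 128 powr (1 - a)" using ab by (intro powr_mono2) auto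
    then have "HH * 32 powr (1 - a) \<le> HH * 128 powr (1 - a)" using HH_pos by simp
    then show "3/2 * HH * 32 powr (1 - a) \<le> 3/4 * c12 N ab ac" using c12_ge by (simp add: mult_ac)
    show "3 * HH * 128 powr (1 - a) \<le> 3/2 * c12 N ab ac" using c12_ge by (simp add: mult_ac)
  qed (use T in auto)
  finally show ?thesis using 7 unfolding S_def D_def T1_def T2_def by linarith
qed

end

section \<open>The divergence theorem for differentiable fields of compact support\<close>

lemma integrable_cont_compact_support:
  fixes f :: "'a::euclidean_space \<Rightarrow> real"
  assumes "continuous_on UNIV f" "compact K" "\<And>x. x \<notin> K \<Longrightarrow> f x = 0"
  shows "integrable lborel f"
proof -
  have "integrable lborel (\<lambda>x. indicator K x *\<^sub>R f x)"
    using assms by (intro borel_integrable_compact) (auto intro: continuous_on_subset)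
  also have "(\<lambda>x. indicator K x *\<^sub>R f x) = f" using assms(3) by (auto simp: fun_eq_iff indicator_def)
  finally show ?thesis .
qed

text \<open>Difference quotients in the direction \<open>e\<close> have integral 0 by translation
  invariance, and dominated convergence carries this to the derivative.\<close>

lemma integral_directional_derivative_eq_0:
  fixes f f' :: "'a::euclidean_space \<Rightarrow> real"
  assumes f: "continuous_on UNIV f" and f': "continuous_on UNIV f'"
    and K: "compact K" "\<And>x. x \<notin> K \<Longrightarrow> f x = 0" "\<And>x. x \<notin> K \<Longrightarrow> f' x = 0"
    and d: "\<And>x. ((\<lambda>h. f (x + h *\<^sub>R e)) has_real_derivative f' x) (at 0)"
  shows "(\<integral>x. f' x \<partial>lborel) = 0"
proof -
  obtain M where M: "\<And>x. \<bar>f' x\<bar> \<le> M" "M \<ge> 0"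
  proof -
    have "bounded (f' ` K)" using f' K(1) by (intro compact_imp_bounded compact_continuous_image) (auto intro: continuous_on_subset)
    then obtain B where "\<And>x. x \<in> K \<Longrightarrow> \<bar>f' x\<bar> \<le> B" by (auto simp: bounded_iff)
    then have "\<bar>f' x\<bar> \<le> max B 0" for x using K(3)[of x] by (cases "x \<in> K") (auto simp: le_max_iff_disj)
    then show ?thesis using that[of "max B 0"] by auto
  qed
  have d': "((\<lambda>h. f (x + h *\<^sub>R e)) has_real_derivative f' (x + t *\<^sub>R e)) (at t)" for x t
  proof -
    have "((\<lambda>h. f ((x + t *\<^sub>R e) + h *\<^sub>R e)) has_real_derivative f' (x + t *\<^sub>R e)) (at 0)" by (rule d)
    then have "((\<lambda>h. f (x + (h + t) *\<^sub>R e)) has_real_derivative f' (x + t *\<^sub>R e)) (at 0)" by (simp add: algebra_simps)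
    then show ?thesis using DERIV_shift[of "\<lambda>h. f (x + h *\<^sub>R e)" "f' (x + t *\<^sub>R e)" 0 t] by simp
  qed
  \<comment> \<open>Contains every point from which a step of length at most 1 along
    \<open>e\<close> meets \<open>K\<close>; off this set all the difference quotients vanish, so it
    carries the dominating function.\<close>
  define K' where "K' = (\<lambda>(x, t). x - t *\<^sub>R e) ` (K \<times> {0..1})"
  have K': "compact K'" unfolding K'_def using K(1)
    by (intro compact_continuous_image compact_Times) (auto intro!: continuous_intros simp: case_prod_unfold)
  define g where "g n x = (f (x + (1 / real (Suc n)) *\<^sub>R e) - f x) * real (Suc n)" for n x
  have shift: "(\<integral>x. f (x + c) \<partial>lborel) = (\<integral>x. f x \<partial>lborel)" "integrable lborel (\<lambda>x. f (x + c))" for c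
  proof -
    have m: "f \<in> borel_measurable borel" using f by (rule borel_measurable_continuous_onI)
    have "(\<integral>x. f x \<partial>lborel) = (\<integral>x. f x \<partial>(distr lborel borel ((+) c)))" by (simp add: lborel_distr_plus)
    also have "\<dots> = (\<integral>x. f (c + x) \<partial>lborel)" using m by (subst integral_distr) auto
    finally show "(\<integral>x. f (x + c) \<partial>lborel) = (\<integral>x. f x \<partial>lborel)" by (simp add: add.commute)
    have "integrable (distr lborel borel ((+) c)) f" unfolding lborel_distr_plus using integrable_cont_compact_support[OF f K(1,2)] by simp
    then show "integrable lborel (\<lambda>x. f (x + c))" using m by (subst (asm) integrable_distr_eq) (auto simp: add.commute)
  qed
  have int: "integrable lborel f" by (rule integrable_cont_compact_support[OF f K(1,2)])
  have g0: "(\<integral>x. g n x \<partial>lborel) = 0" for n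
    unfolding g_def using shift[of "(1 / real (Suc n)) *\<^sub>R e"] int by simp
  have gb: "\<bar>g n x\<bar> \<le> M * indicator K' x" for n x
  proof (cases "\<exists>t\<in>{0..1}. x + t *\<^sub>R e \<in> K")
    case True
    then have "x \<in> K'" by (force simp: K'_def image_iff)
    have "\<exists>t. 0 < t \<and> t < 1 / real (Suc n) \<and> f (x + (1 / real (Suc n)) *\<^sub>R e) - f (x + 0 *\<^sub>R e) = (1 / real (Suc n) - 0) * f' (x + t *\<^sub>R e)"
      by (rule MVT2[of 0 _ "\<lambda>h. f (x + h *\<^sub>R e)"]) (auto intro: d')
    then obtain t where "f (x + (1 / real (Suc n)) *\<^sub>R e) - f x = 1 / real (Suc n) * f' (x + t *\<^sub>R e)" by auto
    then have "g n x = f' (x + t *\<^sub>R e)" by (simp add: g_def)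
    then show ?thesis using M \<open>x \<in> K'\<close> by simp
  next
    case False
    have "f x = 0" using False[simplified, THEN bspec, of 0] K(2) by simp
    moreover have "x + (1 / real (Suc n)) *\<^sub>R e \<notin> K" using False by simp
    ultimately show ?thesis using K(2) M by (simp add: g_def)
  qed
  have "(\<lambda>n. \<integral>x. g n x \<partial>lborel) \<longlonglongrightarrow> (\<integral>x. f' x \<partial>lborel)"
  proof (rule integral_dominated_convergence[where w = "\<lambda>x. M * indicator K' x"])
    show "f' \<in> borel_measurable lborel" using f' by (simp add: borel_measurable_continuous_onI)
    show "g n \<in> borel_measurable lborel" for n
      unfolding g_def using f by (intro borel_measurable_times borel_measurable_diff) (auto intro!: borel_measurable_continuous_onI continuous_intros continuous_on_compose2[OF f])
    show "integrable lborel (\<lambda>x. M * indicator K' x)" using K' 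
      by (intro integrable_mult_right integrable_real_indicator) (use emeasure_bounded_finite[OF compact_imp_bounded[OF K']] in \<open>auto simp: borel_compact\<close>)
    show "AE x in lborel. (\<lambda>n. g n x) \<longlonglongrightarrow> f' x"
    proof (rule AE_I2)
      fix x
      have l1: "((\<lambda>h. (f (x + h *\<^sub>R e) - f x) / h) \<longlongrightarrow> f' x) (at 0)"
        using d[of x] by (simp add: has_field_derivative_iff)
      have "(\<lambda>n. 1 / (1 + real n)) \<longlonglongrightarrow> 0" using LIMSEQ_inverse_real_of_nat by (simp add: inverse_eq_divide)
      then have l2: "filterlim (\<lambda>n. 1 / real (Suc n)) (at 0) sequentially" by (simp add: filterlim_at)
      have "((\<lambda>n. (f (x + (1 / real (Suc n)) *\<^sub>R e) - f x) / (1 / real (Suc n))) \<longlonglongrightarrow> f' x)"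
        by (rule filterlim_compose[OF l1 l2])
      then show "(\<lambda>n. g n x) \<longlonglongrightarrow> f' x" by (simp add: g_def)
    qed
    show "AE x in lborel. norm (g n x) \<le> M * indicator K' x" for n using gb by simp
  qed
  then show ?thesis unfolding g0 by (simp add: LIMSEQ_const_iff)
qed

definition pos_part :: "real \<Rightarrow> real" where "pos_part x = max 0 x"

lemma continuous_pos_part: "continuous_on S pos_part" unfolding pos_part_def by (intro continuous_intros)

text \<open>The flux of a solution is merely differentiable with continuous divergence, so the library's
  integration results for \<open>C\<^sup>1\<close> fields do not apply. As in Goursat's proof, the defect
  \<open>\<integral> F \<bullet> \<nabla>\<phi> + \<phi> div F\<close> is localised: the quadratic B-spline below is a nonnegative combination of its
  dyadic rescalings, so a nonzero defect survives on a sequence of shrinking nested cubes with a loss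
  of at most \<open>2\<^sup>3\<close> per step, which contradicts differentiability at their common point.\<close>
definition bspline :: "real \<Rightarrow> real" where
  "bspline t = ((pos_part t)\<^sup>2 - 3 * (pos_part (t - 1))\<^sup>2 + 3 * (pos_part (t - 2))\<^sup>2 - (pos_part (t - 3))\<^sup>2) / 2"
definition bspline' :: "real \<Rightarrow> real" where
  "bspline' t = pos_part t - 3 * pos_part (t - 1) + 3 * pos_part (t - 2) - pos_part (t - 3)"

lemma pos_part_sq_deriv: "((\<lambda>t. (pos_part t)\<^sup>2) has_real_derivative 2 * pos_part t) (at t)"
proof -
  consider "t > 0" | "t < 0" | "t = 0" by linarith
  then show ?thesis
  proof cases
    case 1
    have "((\<lambda>t. t\<^sup>2) has_real_derivative 2 * t) (at t)" by (auto intro!: derivative_eq_intros)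
    then show ?thesis using 1
      by (rule_tac has_field_derivative_transform_within_open[where S = "{0<..}"]) (auto simp: pos_part_def)
  next
    case 2
    have "((\<lambda>t. 0) has_real_derivative 0) (at t)" by simp
    then show ?thesis using 2
      by (rule_tac has_field_derivative_transform_within_open[where S = "{..<0}"]) (auto simp: pos_part_def)
  next
    case 3
    have "((\<lambda>h. pos_part h) \<longlongrightarrow> pos_part 0) (at 0)" unfolding pos_part_def by (intro tendsto_intros)
    then have l: "((\<lambda>h. pos_part h) \<longlongrightarrow> 0) (at 0)" by (simp add: pos_part_def)
    have "((\<lambda>h. (pos_part h)\<^sup>2 / h) \<longlongrightarrow> 0) (at 0)"
      by (rule Lim_transform_eventually[OF l]) (auto simp: pos_part_def eventually_at_filter max_def power2_eq_square)
    then show ?thesis using 3 by (simp add: has_field_derivative_iff pos_part_def)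
  qed
qed

lemma bspline_deriv: "(bspline has_real_derivative bspline' t) (at t)"
proof -
  have "((\<lambda>t. (pos_part (t - c))\<^sup>2) has_real_derivative 2 * pos_part (t - c)) (at t)" for c
  proof -
    have "((\<lambda>t. t - c) has_real_derivative 1) (at t)" by (auto intro!: derivative_eq_intros)
    then show ?thesis
      using DERIV_chain2[where f = "\<lambda>t. (pos_part t)\<^sup>2" and g = "\<lambda>t. t - c" and x = t and Da = "2 * pos_part (t - c)" and Db = 1 and s = UNIV]
      pos_part_sq_deriv[of "t - c"] by simp
  qed
  note this[derivative_intros] pos_part_sq_deriv[derivative_intros]
  show ?thesis unfolding bspline_def bspline'_def by (auto intro!: derivative_eq_intros)
qed

lemma continuous_bspline: "continuous_on UNIV bspline"
  using bspline_deriv DERIV_isCont by (auto simp: continuous_on_eq_continuous_at)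
lemma continuous_bspline': "continuous_on UNIV bspline'"
  unfolding bspline'_def by (intro continuous_intros continuous_on_compose2[OF continuous_pos_part]) auto

lemma bspline_support: "t \<notin> {0..3} \<Longrightarrow> bspline t = 0" "t \<notin> {0..3} \<Longrightarrow> bspline' t = 0"
  by (auto simp: bspline_def bspline'_def pos_part_def max_def power2_eq_square algebra_simps)

text \<open>The two-scale coefficients of the quadratic spline: the binomial coefficients of order 3
  divided by 4.\<close>

definition refine_coeff :: "nat \<Rightarrow> real" where "refine_coeff k = (if k = 0 \<or> k = 3 then 1/4 else 3/4)"

lemma bspline_refine: 
  "bspline t = (\<Sum>k\<in>{..<4}. refine_coeff k * bspline (2 * t - real k))"
  "bspline' t = (\<Sum>k\<in>{..<4}. refine_coeff k * (2 * bspline' (2 * t - real k)))"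
proof -
  have sum4: "(\<Sum>k\<in>{..<4}. f k) = f 0 + f 1 + f 2 + f 3" for f :: "nat \<Rightarrow> real"
    by (simp add: numeral_eq_Suc lessThan_Suc)
  have tp2: "pos_part (2 * t) = 2 * pos_part t" "pos_part (2 * t - 2) = 2 * pos_part (t - 1)" "pos_part (2 * t - 4) = 2 * pos_part (t - 2)" "pos_part (2 * t - 6) = 2 * pos_part (t - 3)"
    by (auto simp: pos_part_def max_def)
  show "bspline t = (\<Sum>k\<in>{..<4}. refine_coeff k * bspline (2 * t - real k))"
    unfolding sum4 refine_coeff_def bspline_def by (simp add: tp2 diff_diff_eq power_mult_distrib add_divide_distrib diff_divide_distrib)
  show "bspline' t = (\<Sum>k\<in>{..<4}. refine_coeff k * (2 * bspline' (2 * t - real k)))"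
    unfolding sum4 refine_coeff_def bspline'_def by (simp add: tp2 diff_diff_eq add_divide_distrib diff_divide_distrib)
qed

lemma bspline_bounded: obtains M where "M \<ge> 1" "\<And>t. \<bar>bspline t\<bar> \<le> M" "\<And>t. \<bar>bspline' t\<bar> \<le> M"
proof -
  have "bounded (bspline ` {0..3})" "bounded (bspline' ` {0..3})"
    by (intro compact_imp_bounded compact_continuous_image; auto intro: continuous_on_subset continuous_bspline continuous_bspline')+
  then obtain B B' where "\<forall>t\<in>{0..3}. \<bar>bspline t\<bar> \<le> B" "\<forall>t\<in>{0..3}. \<bar>bspline' t\<bar> \<le> B'"
    unfolding bounded_iff by auto
  then have "\<bar>bspline t\<bar> \<le> max 1 (max B B')" "\<bar>bspline' t\<bar> \<le> max 1 (max B B')" for t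
    using bspline_support[of t] by (cases "t \<in> {0..3}"; auto simp: le_max_iff_disj simp del: atLeastAtMost_iff)+
  then show ?thesis using that[of "max 1 (max B B')"] by auto
qed

section \<open>The tensor product spline in three variables\<close>

definition bspline3 :: "real^3 \<Rightarrow> real" where "bspline3 y = (\<Prod>i\<in>UNIV. bspline (y $ i))"
definition bspline3' :: "3 \<Rightarrow> real^3 \<Rightarrow> real" where
  "bspline3' i y = (\<Prod>j\<in>UNIV. (if j = i then bspline' else bspline) (y $ j))"

lemma bspline3'_alt: "bspline3' i y = bspline' (y $ i) * (\<Prod>j\<in>UNIV - {i}. bspline (y $ j))"
  unfolding bspline3'_def by (subst prod.remove[of _ i]) (auto intro!: prod.cong)

lemma bspline3_deriv: "((\<lambda>h. bspline3 (y + h *\<^sub>R axis i 1)) has_real_derivative bspline3' i (y + t *\<^sub>R axis i 1)) (at t)"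
proof -
  have 1: "bspline3 (y + h *\<^sub>R axis i 1) = bspline (y $ i + h) * (\<Prod>j\<in>UNIV - {i}. bspline (y $ j))" for h
    unfolding bspline3_def by (subst prod.remove[of _ i]) (auto intro!: prod.cong simp: axis_def)
  have 2: "bspline3' i (y + t *\<^sub>R axis i 1) = bspline' (y $ i + t) * (\<Prod>j\<in>UNIV - {i}. bspline (y $ j))"
    unfolding bspline3'_alt by (auto intro!: prod.cong simp: axis_def)
  have "((\<lambda>h. bspline (y $ i + h)) has_real_derivative bspline' (y $ i + t)) (at t)"
    using DERIV_shift[of bspline "bspline' (y $ i + t)" t "y $ i"] bspline_deriv by (simp add: add.commute)
  then show ?thesis unfolding 1 2 by (rule DERIV_cmult_right)
qed

lemma continuous_bspline3: "continuous_on UNIV bspline3"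
  unfolding bspline3_def by (intro continuous_on_prod continuous_on_compose2[OF continuous_bspline] continuous_intros) auto

lemma continuous_bspline3': "continuous_on UNIV (bspline3' i)"
  unfolding bspline3'_def
proof (intro continuous_on_prod)
  fix j show "continuous_on UNIV (\<lambda>y :: real^3. (if j = i then bspline' else bspline) (y $ j))"
    by (cases "j = i") (auto intro!: continuous_intros continuous_on_compose2[OF continuous_bspline] continuous_on_compose2[OF continuous_bspline'])
qed

lemma bspline3_support: "y $ i \<notin> {0..3} \<Longrightarrow> bspline3 y = 0" "y $ i \<notin> {0..3} \<Longrightarrow> bspline3' k y = 0"
  unfolding bspline3_def bspline3'_def by (auto intro!: prod_zero simp: bspline_support del: atLeastAtMost_iff)
   (auto intro!: exI[of _ i] simp: bspline_support)

definition refine_index :: "(3 \<Rightarrow> nat) set" where "refine_index = UNIV \<rightarrow>\<^sub>E {..<4}"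
definition refine_coeff3 :: "(3 \<Rightarrow> nat) \<Rightarrow> real" where "refine_coeff3 v = (\<Prod>i\<in>UNIV. refine_coeff (v i))"
definition refine_shift :: "(3 \<Rightarrow> nat) \<Rightarrow> real^3" where "refine_shift v = (\<chi> i. real (v i))"

lemma finite_VV: "finite refine_index" unfolding refine_index_def by (intro finite_PiE) auto

lemma refine_coeff3_nonneg: "refine_coeff3 v \<ge> 0" unfolding refine_coeff3_def refine_coeff_def by (intro prod_nonneg) auto

text \<open>The loss per halving of the scale. It is exactly compensated by the volume of the
  supporting cube, which shrinks by the same factor 8; only the differentiability error remains to
  be small.\<close>

lemma sum_CC: "(\<Sum>v\<in>refine_index. refine_coeff3 v) = 8"
proof -
  have "(\<Sum>v\<in>refine_index. refine_coeff3 v) = (\<Prod>i\<in>(UNIV :: 3 set). \<Sum>k\<in>{..<4}. refine_coeff k)"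
    unfolding refine_index_def refine_coeff3_def by (rule prod_sum_PiE[symmetric]) auto
  also have "\<dots> = 8" by (simp add: numeral_eq_Suc lessThan_Suc refine_coeff_def)
  finally show ?thesis .
qed

lemma bspline3_refine: "bspline3 y = (\<Sum>v\<in>refine_index. refine_coeff3 v * bspline3 (2 *\<^sub>R y - refine_shift v))"
   "bspline3' i y = (\<Sum>v\<in>refine_index. refine_coeff3 v * (2 * bspline3' i (2 *\<^sub>R y - refine_shift v)))"
proof -
  have "bspline3 y = (\<Prod>j\<in>UNIV. \<Sum>k\<in>{..<4}. refine_coeff k * bspline (2 * y $ j - real k))"
    unfolding bspline3_def by (intro prod.cong refl bspline_refine(1))
  also have "\<dots> = (\<Sum>v\<in>refine_index. \<Prod>j\<in>UNIV. refine_coeff (v j) * bspline (2 * y $ j - real (v j)))"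
    unfolding refine_index_def by (rule prod_sum_PiE) auto
  finally show "bspline3 y = (\<Sum>v\<in>refine_index. refine_coeff3 v * bspline3 (2 *\<^sub>R y - refine_shift v))" by (simp add: prod.distrib refine_coeff3_def bspline3_def refine_shift_def)
  have "bspline3' i y = (\<Prod>j\<in>UNIV. \<Sum>k\<in>{..<4}. refine_coeff k * (if j = i then 2 * bspline' (2 * y $ j - real k) else bspline (2 * y $ j - real k)))"
    unfolding bspline3'_def
  proof (intro prod.cong refl)
    fix j show "(if j = i then bspline' else bspline) (y $ j) = (\<Sum>k\<in>{..<4}. refine_coeff k * (if j = i then 2 * bspline' (2 * y $ j - real k) else bspline (2 * y $ j - real k)))"
      using bspline_refine(1)[of "y $ j"] bspline_refine(2)[of "y $ j"] by (cases "j = i") (simp_all only: if_True if_False simp_thms)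
  qed
  also have "\<dots> = (\<Sum>v\<in>refine_index. \<Prod>j\<in>UNIV. refine_coeff (v j) * (if j = i then 2 * bspline' (2 * y $ j - real (v j)) else bspline (2 * y $ j - real (v j))))"
    unfolding refine_index_def by (rule prod_sum_PiE) auto
  also have "\<dots> = (\<Sum>v\<in>refine_index. refine_coeff3 v * (2 * bspline3' i (2 *\<^sub>R y - refine_shift v)))"
  proof (intro sum.cong refl)
    fix v
    have "(\<Prod>j\<in>UNIV. refine_coeff (v j) * (if j = i then 2 * bspline' (2 * y $ j - real (v j)) else bspline (2 * y $ j - real (v j))))
        = refine_coeff3 v * (\<Prod>j\<in>UNIV. (if j = i then 2 * bspline' (2 * y $ j - real (v j)) else bspline (2 * y $ j - real (v j))))"
      by (simp add: prod.distrib refine_coeff3_def)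
    also have "(\<Prod>j\<in>UNIV. (if j = i then 2 * bspline' (2 * y $ j - real (v j)) else bspline (2 * y $ j - real (v j)))) = 2 * bspline3' i (2 *\<^sub>R y - refine_shift v)"
      unfolding bspline3'_alt by (subst prod.remove[of _ i]) (auto intro!: prod.cong simp: refine_shift_def)
    finally show "(\<Prod>j\<in>UNIV. refine_coeff (v j) * (if j = i then 2 * bspline' (2 * y $ j - real (v j)) else bspline (2 * y $ j - real (v j))))
        = refine_coeff3 v * (2 * bspline3' i (2 *\<^sub>R y - refine_shift v))" .
  qed
  finally show "bspline3' i y = (\<Sum>v\<in>refine_index. refine_coeff3 v * (2 * bspline3' i (2 *\<^sub>R y - refine_shift v)))" .
qed

lemma bspline3_bounded: obtains M where "M \<ge> 1" "\<And>y. \<bar>bspline3 y\<bar> \<le> M" "\<And>y i. \<bar>bspline3' i y\<bar> \<le> M"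
proof -
  obtain M where M: "M \<ge> 1" "\<And>t. \<bar>bspline t\<bar> \<le> M" "\<And>t. \<bar>bspline' t\<bar> \<le> M" using bspline_bounded by blast
  have "\<bar>bspline3 y\<bar> \<le> M ^ 3" "\<bar>bspline3' i y\<bar> \<le> M ^ 3" for y i
  proof -
    have "(\<Prod>i\<in>(UNIV::3 set). \<bar>bspline (y $ i)\<bar>) \<le> (\<Prod>i\<in>(UNIV::3 set). M)" by (intro prod_mono) (auto simp: M)
    then show "\<bar>bspline3 y\<bar> \<le> M ^ 3" by (simp add: bspline3_def abs_prod)
    have "(\<Prod>j\<in>(UNIV::3 set). \<bar>(if j = i then bspline' else bspline) (y $ j)\<bar>) \<le> (\<Prod>i\<in>(UNIV::3 set). M)" by (intro prod_mono) (auto simp: M)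
    then show "\<bar>bspline3' i y\<bar> \<le> M ^ 3" by (simp add: bspline3'_def abs_prod)
  qed
  moreover have "M ^ 3 \<ge> 1" using M(1) by simp
  ultimately show ?thesis using that by blast
qed

lemma continuous_bspline3_scaled: "continuous_on UNIV (\<lambda>x. bspline3 (s *\<^sub>R x - w))" "continuous_on UNIV (\<lambda>x. bspline3' i (s *\<^sub>R x - w))"
  by (intro continuous_on_compose2[OF continuous_bspline3] continuous_on_compose2[OF continuous_bspline3'] continuous_intros; simp)+

definition ones3 :: "real^3" where "ones3 = (\<chi> i. 1)"

lemma ones3_simps [simp]: "ones3 $ k = 1" "b \<in> Basis \<Longrightarrow> ones3 \<bullet> b = 1"
  by (auto simp: ones3_def Basis_vec_def inner_axis)

lemma content_cube3: "s > 0 \<Longrightarrow> measure lborel (cbox l (l + s *\<^sub>R ones3)) = s ^ 3"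
  by (subst content_cbox) (auto simp: inner_simps)

context
  fixes F :: "real^3 \<Rightarrow> real^3" and F' :: "real^3 \<Rightarrow> real^3 \<Rightarrow> real^3" and d :: "real^3 \<Rightarrow> real" and K :: "(real^3) set"
  assumes dF: "\<And>x. (F has_derivative F' x) (at x)"
    and d_eq: "\<And>x. d x = (\<Sum>i\<in>UNIV. F' x (axis i 1) $ i)" and cd: "continuous_on UNIV d"
    and K: "compact K" and F0: "\<And>x. x \<notin> K \<Longrightarrow> F x = 0"
begin

text \<open>The weak form of the divergence tested with a spline supported in a cube of side
  \<open>3 / s\<close>; the divergence theorem amounts to its vanishing.\<close>

definition defect :: "real \<Rightarrow> real^3 \<Rightarrow> real" where
  "defect s w = (\<integral>x. ((\<Sum>i\<in>UNIV. F x $ i * (s * bspline3' i (s *\<^sub>R x - w))) + d x * bspline3 (s *\<^sub>R x - w)) \<partial>lborel)"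

lemma cF: "continuous_on UNIV F" using has_derivative_continuous[OF dF] by (auto simp: continuous_on_eq_continuous_within)

lemma d0: "x \<notin> K \<Longrightarrow> d x = 0"
proof -
  assume x: "x \<notin> K"
  have o: "open (- K)" using compact_imp_closed[OF K] by (simp add: open_Compl)
  have "((\<lambda>x. 0) has_derivative (\<lambda>h. 0 :: real^3)) (at x)" by simp
  then have "(F has_derivative (\<lambda>h. 0)) (at x)"
    by (rule has_derivative_transform_within_open[OF _ o]) (use x F0 in auto)
  then have "F' x = (\<lambda>h. 0)" by (rule has_derivative_unique[OF dF])
  then show ?thesis by (simp add: d_eq)
qed

lemma defect_integrable: "integrable lborel (\<lambda>x. (\<Sum>i\<in>UNIV. F x $ i * (s * bspline3' i (s *\<^sub>R x - w))) + d x * bspline3 (s *\<^sub>R x - w))"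
  by (rule integrable_cont_compact_support[OF _ K]) (use F0 d0 in \<open>auto intro!: continuous_intros cF cd continuous_bspline3_scaled\<close>)

lemma defect_refine: "defect s w = (\<Sum>v\<in>refine_index. refine_coeff3 v * defect (2 * s) (2 *\<^sub>R w + refine_shift v))"
proof -
  have e: "2 *\<^sub>R (s *\<^sub>R x - w) - refine_shift v = (2 * s) *\<^sub>R x - (2 *\<^sub>R w + refine_shift v)" for x v by (simp add: algebra_simps)
  have "(\<Sum>i\<in>UNIV. F x $ i * (s * bspline3' i (s *\<^sub>R x - w))) + d x * bspline3 (s *\<^sub>R x - w)
     = (\<Sum>v\<in>refine_index. refine_coeff3 v * ((\<Sum>i\<in>UNIV. F x $ i * ((2 * s) * bspline3' i ((2 * s) *\<^sub>R x - (2 *\<^sub>R w + refine_shift v)))) + d x * bspline3 ((2 * s) *\<^sub>R x - (2 *\<^sub>R w + refine_shift v))))" (is "?l = ?r") for x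
  proof -
    have "?l = (\<Sum>i\<in>UNIV. F x $ i * (s * (\<Sum>v\<in>refine_index. refine_coeff3 v * (2 * bspline3' i ((2 * s) *\<^sub>R x - (2 *\<^sub>R w + refine_shift v)))))) + d x * (\<Sum>v\<in>refine_index. refine_coeff3 v * bspline3 ((2 * s) *\<^sub>R x - (2 *\<^sub>R w + refine_shift v)))"
      using bspline3_refine(1)[of "s *\<^sub>R x - w"] bspline3_refine(2)[where y = "s *\<^sub>R x - w"] by (simp only: e)
    also have "\<dots> = (\<Sum>i\<in>UNIV. \<Sum>v\<in>refine_index. F x $ i * (s * (refine_coeff3 v * (2 * bspline3' i ((2 * s) *\<^sub>R x - (2 *\<^sub>R w + refine_shift v)))))) + (\<Sum>v\<in>refine_index. d x * (refine_coeff3 v * bspline3 ((2 * s) *\<^sub>R x - (2 *\<^sub>R w + refine_shift v))))"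
      by (simp only: sum_distrib_left)
    also have "\<dots> = (\<Sum>v\<in>refine_index. \<Sum>i\<in>UNIV. F x $ i * (s * (refine_coeff3 v * (2 * bspline3' i ((2 * s) *\<^sub>R x - (2 *\<^sub>R w + refine_shift v)))))) + (\<Sum>v\<in>refine_index. d x * (refine_coeff3 v * bspline3 ((2 * s) *\<^sub>R x - (2 *\<^sub>R w + refine_shift v))))"
      by (subst sum.swap) simp
    also have "\<dots> = ?r" unfolding sum.distrib[symmetric] distrib_left
      by (intro sum.cong refl arg_cong2[where f = "(+)"]) (auto simp: sum_distrib_left mult_ac)
    finally show ?thesis .
  qed
  then have "defect s w = (\<integral>x. (\<Sum>v\<in>refine_index. refine_coeff3 v * ((\<Sum>i\<in>UNIV. F x $ i * ((2 * s) * bspline3' i ((2 * s) *\<^sub>R x - (2 *\<^sub>R w + refine_shift v)))) + d x * bspline3 ((2 * s) *\<^sub>R x - (2 *\<^sub>R w + refine_shift v)))) \<partial>lborel)"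
    unfolding defect_def by simp
  also have "\<dots> = (\<Sum>v\<in>refine_index. refine_coeff3 v * defect (2 * s) (2 *\<^sub>R w + refine_shift v))"
    unfolding defect_def by (subst Bochner_Integration.integral_sum) (use defect_integrable in auto)
  finally show ?thesis .
qed

text \<open>The defect is a combination of defects at the doubled scale with nonnegative weights of
  sum 8, so one of them carries at least an eighth.\<close>

lemma defect_pick: "\<exists>v\<in>refine_index. \<bar>defect s w\<bar> \<le> 8 * \<bar>defect (2 * s) (2 *\<^sub>R w + refine_shift v)\<bar>"
proof (rule ccontr)
  assume "\<not> ?thesis"
  then have lt: "\<And>v. v \<in> refine_index \<Longrightarrow> \<bar>defect (2 * s) (2 *\<^sub>R w + refine_shift v)\<bar> < \<bar>defect s w\<bar> / 8" by force
  have le: "\<bar>defect s w\<bar> \<le> (\<Sum>v\<in>refine_index. refine_coeff3 v * \<bar>defect (2 * s) (2 *\<^sub>R w + refine_shift v)\<bar>)"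
    unfolding defect_refine[of s w] by (rule order_trans[OF sum_abs]) (simp add: abs_mult refine_coeff3_nonneg)
  have "\<exists>v\<in>refine_index. refine_coeff3 v > 0" 
  proof (rule ccontr)
    assume "\<not> ?thesis"
    then have "(\<Sum>v\<in>refine_index. refine_coeff3 v) \<le> 0" by (intro sum_nonpos) force
    then show False using sum_CC by simp
  qed
  then have pos: "\<exists>v\<in>refine_index. refine_coeff3 v > 0" .
  have "(\<Sum>v\<in>refine_index. refine_coeff3 v * \<bar>defect (2 * s) (2 *\<^sub>R w + refine_shift v)\<bar>) < (\<Sum>v\<in>refine_index. refine_coeff3 v * (\<bar>defect s w\<bar> / 8))"
  proof (intro sum_strict_mono_ex1 ballI)
    show "refine_coeff3 v * \<bar>defect (2 * s) (2 *\<^sub>R w + refine_shift v)\<bar> \<le> refine_coeff3 v * (\<bar>defect s w\<bar> / 8)" if "v \<in> refine_index" for v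
      using lt[OF that] refine_coeff3_nonneg by (intro mult_left_mono) auto
    show "\<exists>v\<in>refine_index. refine_coeff3 v * \<bar>defect (2 * s) (2 *\<^sub>R w + refine_shift v)\<bar> < refine_coeff3 v * (\<bar>defect s w\<bar> / 8)"
      using pos lt by (metis mult_strict_left_mono)
  qed (use finite_VV in auto)
  also have "\<dots> = \<bar>defect s w\<bar>" unfolding sum_distrib_right[symmetric] sum_CC by simp
  finally show False using le by simp
qed

lemma bspline3_scaled_support: "s > 0 \<Longrightarrow> x \<notin> cbox ((1/s) *\<^sub>R w) ((1/s) *\<^sub>R (w + 3 *\<^sub>R ones3)) \<Longrightarrow> bspline3 (s *\<^sub>R x - w) = 0"
  "s > 0 \<Longrightarrow> x \<notin> cbox ((1/s) *\<^sub>R w) ((1/s) *\<^sub>R (w + 3 *\<^sub>R ones3)) \<Longrightarrow> bspline3' i (s *\<^sub>R x - w) = 0"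
proof -
  have *: "\<exists>k. (s *\<^sub>R x - w) $ k \<notin> {0..3}" if "s > 0" "x \<notin> cbox ((1/s) *\<^sub>R w) ((1/s) *\<^sub>R (w + 3 *\<^sub>R ones3))"
  proof (rule ccontr)
    assume "\<nexists>k. (s *\<^sub>R x - w) $ k \<notin> {0..3}"
    then have "0 \<le> s * x $ k - w $ k \<and> s * x $ k - w $ k \<le> 3" for k by force
    then have "x \<in> cbox ((1/s) *\<^sub>R w) ((1/s) *\<^sub>R (w + 3 *\<^sub>R ones3))"
      using that(1) by (auto simp: mem_box_cart field_simps add.commute mult.commute)
    then show False using that by simp
  qed
  show "s > 0 \<Longrightarrow> x \<notin> cbox ((1/s) *\<^sub>R w) ((1/s) *\<^sub>R (w + 3 *\<^sub>R ones3)) \<Longrightarrow> bspline3 (s *\<^sub>R x - w) = 0"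
    using * bspline3_support(1) by blast
  show "s > 0 \<Longrightarrow> x \<notin> cbox ((1/s) *\<^sub>R w) ((1/s) *\<^sub>R (w + 3 *\<^sub>R ones3)) \<Longrightarrow> bspline3' i (s *\<^sub>R x - w) = 0"
    using * bspline3_support(2) by blast
qed

lemma bspline3_scaled_deriv: "((\<lambda>h. bspline3 (s *\<^sub>R (x + h *\<^sub>R axis i 1) - w)) has_real_derivative s * bspline3' i (s *\<^sub>R x - w)) (at 0)"
proof -
  have e: "s *\<^sub>R (x + h *\<^sub>R axis i 1) - w = (s *\<^sub>R x - w) + (s * h) *\<^sub>R axis i 1" for h by (simp add: algebra_simps)
  have 1: "((\<lambda>h. bspline3 ((s *\<^sub>R x - w) + h *\<^sub>R axis i 1)) has_real_derivative bspline3' i (s *\<^sub>R x - w)) (at (s * 0))"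
    using bspline3_deriv[of "s *\<^sub>R x - w" i 0] by simp
  have "((\<lambda>h. s * h) has_real_derivative s) (at 0)" by (auto intro!: derivative_eq_intros)
  from DERIV_chain2[where g = "\<lambda>h. s * h" and x = 0, OF 1 this] show ?thesis by (simp add: e mult.commute)
qed

text \<open>For an affine field, field times spline is continuously differentiable in each
  coordinate direction, so the one-directional result applies to each component.\<close>

lemma bspline3_affine:
  fixes A :: "real^3 \<Rightarrow> real^3"
  assumes A: "bounded_linear A" and s: "s > 0"
  shows "(\<integral>x. ((\<Sum>i\<in>UNIV. (c + A (x - z)) $ i * (s * bspline3' i (s *\<^sub>R x - w))) + (\<Sum>i\<in>UNIV. A (axis i 1) $ i) * bspline3 (s *\<^sub>R x - w)) \<partial>lborel) = 0"
    "integrable lborel (\<lambda>x. ((\<Sum>i\<in>UNIV. (c + A (x - z)) $ i * (s * bspline3' i (s *\<^sub>R x - w))) + (\<Sum>i\<in>UNIV. A (axis i 1) $ i) * bspline3 (s *\<^sub>R x - w)))"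
proof -
  define K where "K = cbox ((1/s) *\<^sub>R w) ((1/s) *\<^sub>R (w + 3 *\<^sub>R ones3))"
  note sup = bspline3_scaled_support[OF s, of _ w, folded K_def]
  note cA = bounded_linear.continuous_on[OF A]
  have i: "(\<integral>x. ((c + A (x - z)) $ i * (s * bspline3' i (s *\<^sub>R x - w)) + A (axis i 1) $ i * bspline3 (s *\<^sub>R x - w)) \<partial>lborel) = 0" for i
  proof (rule integral_directional_derivative_eq_0[where K = K and f = "\<lambda>x. (c + A (x - z)) $ i * bspline3 (s *\<^sub>R x - w)" and e = "axis i 1"])
    show "continuous_on UNIV (\<lambda>x. (c + A (x - z)) $ i * bspline3 (s *\<^sub>R x - w))" "continuous_on UNIV (\<lambda>x. (c + A (x - z)) $ i * (s * bspline3' i (s *\<^sub>R x - w)) + A (axis i 1) $ i * bspline3 (s *\<^sub>R x - w))"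
      by (intro continuous_intros continuous_bspline3_scaled cA)+
    show "compact K" by (simp add: K_def)
    fix x
    show "x \<notin> K \<Longrightarrow> (c + A (x - z)) $ i * bspline3 (s *\<^sub>R x - w) = 0" "x \<notin> K \<Longrightarrow> (c + A (x - z)) $ i * (s * bspline3' i (s *\<^sub>R x - w)) + A (axis i 1) $ i * bspline3 (s *\<^sub>R x - w) = 0"
      using sup by auto
    have e: "(c + A (x + h *\<^sub>R axis i 1 - z)) $ i = (c + A (x - z)) $ i + h * A (axis i 1) $ i" for h
    proof -
      have "x + h *\<^sub>R axis i 1 - z = (x - z) + h *\<^sub>R axis i 1" by simp
      then show ?thesis using A by (simp only: linear_add linear_scale bounded_linear.linear) (simp add: linear_add linear_scale bounded_linear.linear)
    qed
    show "((\<lambda>h. (c + A (x + h *\<^sub>R axis i 1 - z)) $ i * bspline3 (s *\<^sub>R (x + h *\<^sub>R axis i 1) - w)) has_real_derivative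
        (c + A (x - z)) $ i * (s * bspline3' i (s *\<^sub>R x - w)) + A (axis i 1) $ i * bspline3 (s *\<^sub>R x - w)) (at 0)"
      unfolding e using bspline3_scaled_deriv[of s x i w]
      by (auto intro!: derivative_eq_intros)
  qed
  have int: "integrable lborel (\<lambda>x. (c + A (x - z)) $ i * (s * bspline3' i (s *\<^sub>R x - w)) + A (axis i 1) $ i * bspline3 (s *\<^sub>R x - w))" for i
    by (rule integrable_cont_compact_support[where K = K]) (use sup in \<open>auto simp: K_def intro!: continuous_intros continuous_bspline3_scaled cA\<close>)
  have eq: "(\<Sum>i\<in>UNIV. (c + A (x - z)) $ i * (s * bspline3' i (s *\<^sub>R x - w))) + (\<Sum>i\<in>UNIV. A (axis i 1) $ i) * bspline3 (s *\<^sub>R x - w)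
     = (\<Sum>i\<in>UNIV. (c + A (x - z)) $ i * (s * bspline3' i (s *\<^sub>R x - w)) + A (axis i 1) $ i * bspline3 (s *\<^sub>R x - w))" for x
    by (simp add: sum.distrib sum_distrib_right)
  show "(\<integral>x. ((\<Sum>i\<in>UNIV. (c + A (x - z)) $ i * (s * bspline3' i (s *\<^sub>R x - w))) + (\<Sum>i\<in>UNIV. A (axis i 1) $ i) * bspline3 (s *\<^sub>R x - w)) \<partial>lborel) = 0"
    unfolding eq using int i by (subst Bochner_Integration.integral_sum) auto
  show "integrable lborel (\<lambda>x. ((\<Sum>i\<in>UNIV. (c + A (x - z)) $ i * (s * bspline3' i (s *\<^sub>R x - w))) + (\<Sum>i\<in>UNIV. A (axis i 1) $ i) * bspline3 (s *\<^sub>R x - w)))"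
    unfolding eq using int by auto
qed

lemma defect_eq_0: assumes s: "s > 0" shows "defect s w = 0"
proof (rule ccontr)
  assume nz: "defect s w \<noteq> 0"
  define e0 where "e0 = \<bar>defect s w\<bar>"
  have e0: "e0 > 0" using nz by (simp add: e0_def)
  define S where "S n = 2 ^ n * s" for n
  have Spos: "S n > 0" for n using s by (simp add: S_def)
  define pick where "pick n w = 2 *\<^sub>R w + refine_shift (SOME v. v \<in> refine_index \<and> \<bar>defect (S n) w\<bar> \<le> 8 * \<bar>defect (2 * S n) (2 *\<^sub>R w + refine_shift v)\<bar>)" for n w
  define W where "W = rec_nat w pick"
  have W0: "W 0 = w" by (simp add: W_def)
  have W: "\<exists>v\<in>refine_index. W (Suc n) = 2 *\<^sub>R W n + refine_shift v \<and> \<bar>defect (S n) (W n)\<bar> \<le> 8 * \<bar>defect (S (Suc n)) (W (Suc n))\<bar>" for n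
  proof -
    define P where "P v \<longleftrightarrow> v \<in> refine_index \<and> \<bar>defect (S n) (W n)\<bar> \<le> 8 * \<bar>defect (2 * S n) (2 *\<^sub>R W n + refine_shift v)\<bar>" for v
    have "\<exists>v. P v" using defect_pick[of "S n" "W n"] unfolding P_def by blast
    then have "P (SOME v. P v)" by (rule someI_ex)
    moreover have "W (Suc n) = 2 *\<^sub>R W n + refine_shift (SOME v. P v)" unfolding W_def by (simp only: nat.rec(2)) (simp only: pick_def P_def W_def)
    moreover have "S (Suc n) = 2 * S n" by (simp add: S_def)
    ultimately show ?thesis unfolding P_def by (intro bexI[of _ "SOME v. P v"]) (simp_all add: P_def)
  qed
  have grow: "e0 \<le> 8 ^ n * \<bar>defect (S n) (W n)\<bar>" for n
  proof (induction n)
    case 0 show ?case by (simp add: e0_def S_def W0)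
  next
    case (Suc n)
    have "8 ^ n * \<bar>defect (S n) (W n)\<bar> \<le> 8 ^ n * (8 * \<bar>defect (S (Suc n)) (W (Suc n))\<bar>)"
      using W[of n] by (intro mult_left_mono) auto
    then have "e0 \<le> 8 ^ n * (8 * \<bar>defect (S (Suc n)) (W (Suc n))\<bar>)" using Suc.IH by linarith
    also have "\<dots> = 8 ^ Suc n * \<bar>defect (S (Suc n)) (W (Suc n))\<bar>" by (simp only: power_Suc mult_ac)
    finally show ?case .
  qed
  define Q where "Q n = cbox ((1 / S n) *\<^sub>R W n) ((1 / S n) *\<^sub>R (W n + 3 *\<^sub>R ones3))" for n
  \<comment> \<open>A child index lies between 0 and 3, so in units of the parent scale a child cube
    starts at most 3/2 from the corner of the parent and has side 3/2.\<close>
  have Qsub: "Q (Suc n) \<subseteq> Q n" for n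
  proof -
    obtain v where v: "v \<in> refine_index" "W (Suc n) = 2 *\<^sub>R W n + refine_shift v" using W by blast
    have v3: "v i \<le> 3" for i proof -
      have "v i \<in> {..<4}" using v(1) unfolding refine_index_def by (rule PiE_mem) simp
      then show ?thesis by simp
    qed
    have v03: "0 \<le> refine_shift v $ i" "refine_shift v $ i \<le> 3" for i using v3[of i] by (auto simp: refine_shift_def)
    have S2: "S (Suc n) = 2 * S n" by (simp add: S_def)
    show ?thesis unfolding Q_def v(2) S2
    proof (rule subsetI)
      fix x assume x: "x \<in> cbox ((1 / (2 * S n)) *\<^sub>R (2 *\<^sub>R W n + refine_shift v)) ((1 / (2 * S n)) *\<^sub>R (2 *\<^sub>R W n + refine_shift v + 3 *\<^sub>R ones3))"
      have "(1 / S n) * W n $ i \<le> x $ i \<and> x $ i \<le> (1 / S n) * (W n $ i + 3)" for i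
      proof -
        have a: "(2 * W n $ i + refine_shift v $ i) / (2 * S n) \<le> x $ i" "x $ i \<le> (2 * W n $ i + refine_shift v $ i + 3) / (2 * S n)"
          using x by (auto simp: mem_box_cart)
        have "(2 * W n $ i) / (2 * S n) \<le> (2 * W n $ i + refine_shift v $ i) / (2 * S n)" using v03[of i] Spos[of n] by (intro divide_right_mono) auto
        moreover have "(2 * W n $ i + refine_shift v $ i + 3) / (2 * S n) \<le> (2 * W n $ i + 6) / (2 * S n)" using v03[of i] Spos[of n] by (intro divide_right_mono) auto
        moreover have "(2 * W n $ i + 6) / (2 * S n) = (1 / S n) * (W n $ i + 3)" using Spos[of n] by (simp add: field_simps)
        moreover have "(2 * W n $ i) / (2 * S n) = (1 / S n) * W n $ i" by simp
        ultimately show ?thesis using a by linarith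
      qed
      then show "x \<in> cbox ((1 / S n) *\<^sub>R W n) ((1 / S n) *\<^sub>R (W n + 3 *\<^sub>R ones3))" by (simp add: mem_box_cart)
    qed
  qed
  have "\<Inter>(range Q) \<noteq> {}"
  proof (rule compact_nest)
    show "Q n \<noteq> {}" for n unfolding Q_def box_ne_empty using Spos[of n] 
      by (auto simp: inner_simps intro!: divide_right_mono)
    show "compact (Q n)" for n by (simp add: Q_def)
    show "m \<le> n \<Longrightarrow> Q n \<subseteq> Q m" for m n by (rule lift_Suc_antimono_le) (use Qsub in auto)
  qed
  then obtain z where z: "\<And>n. z \<in> Q n" by auto
  have Qnear: "norm (x - z) \<le> 9 / S n" if "x \<in> Q n" for x n
  proof -
    have "\<bar>(x - z) $ i\<bar> \<le> 3 / S n" for i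
    proof -
      have "W n $ i / S n \<le> x $ i" "x $ i \<le> (W n $ i + 3) / S n" "W n $ i / S n \<le> z $ i" "z $ i \<le> (W n $ i + 3) / S n"
        using that z[of n] by (auto simp: Q_def mem_box_cart)
      then show ?thesis by (simp add: add_divide_distrib abs_le_iff)
    qed
    then have "(\<Sum>i\<in>UNIV. \<bar>(x - z) $ i\<bar>) \<le> (\<Sum>i\<in>(UNIV::3 set). 3 / S n)" by (intro sum_mono) auto
    then show ?thesis using norm_le_l1_cart[of "x - z"] by simp
  qed
  obtain M where M: "M \<ge> 1" "\<And>y. \<bar>bspline3 y\<bar> \<le> M" "\<And>y i. \<bar>bspline3' i y\<bar> \<le> M" using bspline3_bounded by blast
  have vol: "measure lborel (Q n) = 27 / (S n) ^ 3" for n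
  proof -
    have "Q n = cbox ((1 / S n) *\<^sub>R W n) ((1 / S n) *\<^sub>R W n + (3 / S n) *\<^sub>R ones3)" by (simp add: Q_def scaleR_add_right)
    then have "measure lborel (Q n) = (3 / S n) ^ 3" using content_cube3[of "3 / S n"] Spos[of n] by simp
    then show ?thesis by (simp add: power_divide)
  qed
  \<comment> \<open>Chosen so that the pointwise error \<open>28 * eps * M\<close> times the cube
    volume \<open>27 / (S n) ^ 3\<close> equals half of what \<open>grow\<close> forces. The 28 is
    27 from the three components, each with remainder \<open>9 * eps / S n\<close>, plus 1 from the
    divergence.\<close>
  define eps where "eps = e0 * s ^ 3 / (2 * 27 * 28 * M)"
  have eps: "eps > 0" using e0 s M by (simp add: eps_def)
  note A = has_derivative_bounded_linear[OF dF[of z]]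
  obtain d1 where d1: "d1 > 0" "\<And>x. norm (x - z) < d1 \<Longrightarrow> norm (F x - F z - F' z (x - z)) \<le> eps * norm (x - z)"
    using dF[of z] eps unfolding has_derivative_at_alt by blast
  obtain d2 where d2: "d2 > 0" "\<And>x. norm (x - z) < d2 \<Longrightarrow> \<bar>d x - d z\<bar> < eps"
    using cd eps by (force simp: continuous_on_iff dist_norm)
  obtain n where n: "9 / s < min d1 d2 * 2 ^ n"
  proof -
    define m where "m = min d1 d2"
    have m: "m > 0" using d1(1) d2(1) by (simp add: m_def)
    obtain n where "9 / s / m < 2 ^ n" using real_arch_pow[of 2] by auto
    then have "9 / s < 2 ^ n * m" using m by (simp only: pos_divide_less_eq)
    then show ?thesis using that[of n] by (simp add: m_def mult.commute)
  qed
  have near: "norm (x - z) < d1" "norm (x - z) < d2" if "x \<in> Q n" for x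
  proof -
    have "9 / s / 2 ^ n < min d1 d2" using n by (simp only: pos_divide_less_eq zero_less_power zero_less_numeral)
    then have "9 / S n < min d1 d2" by (simp add: S_def mult.commute)
    then show "norm (x - z) < d1" "norm (x - z) < d2" using Qnear[OF that] by auto
  qed
  \<comment> \<open>The integrand for the affine approximation of \<open>F\<close> at the common
    point \<open>z\<close>. Its integral is 0, so the defect is the integral of
    \<open>G - T\<close>.\<close>
  define T where "T x = ((\<Sum>i\<in>UNIV. (F z + F' z (x - z)) $ i * (S n * bspline3' i (S n *\<^sub>R x - W n))) + (\<Sum>i\<in>UNIV. F' z (axis i 1) $ i) * bspline3 (S n *\<^sub>R x - W n))" for x
  define G where "G x = ((\<Sum>i\<in>UNIV. F x $ i * (S n * bspline3' i (S n *\<^sub>R x - W n))) + d x * bspline3 (S n *\<^sub>R x - W n))" for x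
  have TG: "integrable lborel T" "integral\<^sup>L lborel T = 0" "integrable lborel G"
    unfolding T_def[abs_def] G_def[abs_def] by (rule bspline3_affine[OF A Spos] defect_integrable)+
  have "defect (S n) (W n) = integral\<^sup>L lborel G" by (simp add: defect_def G_def[abs_def])
  also have "\<dots> = integral\<^sup>L lborel (\<lambda>x. G x - T x)"
    using TG by (subst Bochner_Integration.integral_diff) auto
  finally have LLe: "\<bar>defect (S n) (W n)\<bar> \<le> integral\<^sup>L lborel (\<lambda>x. \<bar>G x - T x\<bar>)" by (simp add: integral_abs_bound)
  have GT: "\<bar>G x - T x\<bar> \<le> 28 * eps * M * indicator (Q n) x" for x
  proof (cases "x \<in> Q n")
    case False
    then show ?thesis using bspline3_scaled_support[OF Spos[of n], of x "W n"] by (simp add: G_def T_def Q_def)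
  next
    case True
    have r: "norm (F x - F z - F' z (x - z)) \<le> eps * (9 / S n)"
      using d1(2)[OF near(1)[OF True]] Qnear[OF True] eps by (meson mult_left_mono order_trans less_imp_le)
    have "G x - T x = (\<Sum>i\<in>UNIV. (F x - F z - F' z (x - z)) $ i * (S n * bspline3' i (S n *\<^sub>R x - W n))) + (d x - d z) * bspline3 (S n *\<^sub>R x - W n)"
      by (simp add: G_def T_def d_eq[of z] algebra_simps sum_subtractf sum.distrib)
    also have "\<bar>\<dots>\<bar> \<le> (\<Sum>i\<in>UNIV. \<bar>(F x - F z - F' z (x - z)) $ i * (S n * bspline3' i (S n *\<^sub>R x - W n))\<bar>) + \<bar>(d x - d z) * bspline3 (S n *\<^sub>R x - W n)\<bar>"
      by (rule order_trans[OF abs_triangle_ineq add_right_mono[OF sum_abs]])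
    also have "\<dots> \<le> (\<Sum>i\<in>(UNIV :: 3 set). eps * (9 / S n) * (S n * M)) + eps * M"
    proof (intro add_mono sum_mono)
      fix i
      show "\<bar>(F x - F z - F' z (x - z)) $ i * (S n * bspline3' i (S n *\<^sub>R x - W n))\<bar> \<le> eps * (9 / S n) * (S n * M)"
        unfolding abs_mult using order_trans[OF component_le_norm_cart r] M Spos[of n] eps by (intro mult_mono) auto
      show "\<bar>(d x - d z) * bspline3 (S n *\<^sub>R x - W n)\<bar> \<le> eps * M"
        unfolding abs_mult using d2(2)[OF near(2)[OF True]] M eps by (intro mult_mono) auto
    qed
    also have "\<dots> = 28 * eps * M" using Spos[of n] by (simp add: field_simps)
    finally show ?thesis using True by simp
  qed
  have "integral\<^sup>L lborel (\<lambda>x. \<bar>G x - T x\<bar>) \<le> integral\<^sup>L lborel (\<lambda>x. 28 * eps * M * indicator (Q n) x)"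
  proof (intro integral_mono)
    show "integrable lborel (\<lambda>x. \<bar>G x - T x\<bar>)"
      using TG by auto
    show "integrable lborel (\<lambda>x. 28 * eps * M * indicator (Q n) x)"
      unfolding Q_def by (intro integrable_mult_right integrable_real_indicator) (use emeasure_bounded_finite[OF bounded_cbox] in auto)
  qed (use GT in auto)
  also have "\<dots> = 28 * eps * M * (27 / (S n) ^ 3)" using vol[of n] by simp
  also have "\<dots> = e0 / 2 / 8 ^ n"
  proof -
    have "(2 ^ n) ^ 3 = ((2 :: real) ^ 3) ^ n" by (simp only: power_mult[symmetric] mult.commute)
    then have "(2 ^ n) ^ 3 = (8 :: real) ^ n" by simp
    then have "(S n) ^ 3 = 8 ^ n * s ^ 3" by (simp add: S_def power_mult_distrib)
    then show ?thesis using s M by (simp add: eps_def)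
  qed
  finally have "\<bar>defect (S n) (W n)\<bar> \<le> e0 / 2 / 8 ^ n" using LLe by simp
  then have "8 ^ n * \<bar>defect (S n) (W n)\<bar> \<le> e0 / 2" by (simp add: field_simps)
  then show False using grow[of n] e0 by simp
qed

text \<open>As the scale tends to 0, the spline flattens to a constant on \<open>K\<close> while the
  gradient term carries the factor \<open>r n\<close>; the vanishing defects then yield the integral
  of \<open>d\<close>.\<close>

theorem integral_divergence_eq_0: "(\<integral>x. d x \<partial>lborel) = 0"
proof -
  obtain M where M: "M \<ge> 1" "\<And>y. \<bar>bspline3 y\<bar> \<le> M" "\<And>y i. \<bar>bspline3' i y\<bar> \<le> M" using bspline3_bounded by blast
  \<comment> \<open>The centre of the support of the spline, where it does not vanish.\<close>
  define c :: "real^3" where "c = (\<chi> i. 3/2)"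
  have tbc: "bspline3 c \<noteq> 0" by (simp add: bspline3_def c_def bspline_def pos_part_def power2_eq_square)
  define r where "r n = 1 / real (Suc n)" for n
  have r0: "r \<longlonglongrightarrow> 0" unfolding r_def using LIMSEQ_inverse_real_of_nat by (simp add: inverse_eq_divide)
  have rb: "0 < r n" "r n \<le> 1" for n by (auto simp: r_def)
  define G where "G n x = (\<Sum>i\<in>UNIV. F x $ i * (r n * bspline3' i (r n *\<^sub>R x - - c))) + d x * bspline3 (r n *\<^sub>R x - - c)" for n x
  have di: "integrable lborel d" by (rule integrable_cont_compact_support[OF cd K d0])
  have "(\<lambda>n. integral\<^sup>L lborel (G n)) \<longlonglongrightarrow> integral\<^sup>L lborel (\<lambda>x. d x * bspline3 c)"
  proof (rule integral_dominated_convergence[where w = "\<lambda>x. M * ((\<Sum>i\<in>UNIV. \<bar>F x $ i\<bar>) + \<bar>d x\<bar>)"])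
    show "(\<lambda>x. d x * bspline3 c) \<in> borel_measurable lborel" using di by (auto dest: borel_measurable_integrable)
    show "G n \<in> borel_measurable lborel" for n using defect_integrable[of "r n" "- c"] unfolding G_def by (rule borel_measurable_integrable)
    show "integrable lborel (\<lambda>x. M * ((\<Sum>i\<in>UNIV. \<bar>F x $ i\<bar>) + \<bar>d x\<bar>))"
      by (rule integrable_cont_compact_support[OF _ K]) (use F0 d0 in \<open>auto intro!: continuous_intros cF cd\<close>)
    show "AE x in lborel. norm (G n x) \<le> M * ((\<Sum>i\<in>UNIV. \<bar>F x $ i\<bar>) + \<bar>d x\<bar>)" for n
    proof (rule AE_I2)
      fix x
      have "\<bar>G n x\<bar> \<le> (\<Sum>i\<in>UNIV. \<bar>F x $ i * (r n * bspline3' i (r n *\<^sub>R x - - c))\<bar>) + \<bar>d x * bspline3 (r n *\<^sub>R x - - c)\<bar>"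
        unfolding G_def by (rule order_trans[OF abs_triangle_ineq add_right_mono[OF sum_abs]])
      also have "\<dots> \<le> (\<Sum>i\<in>UNIV. \<bar>F x $ i\<bar> * (1 * M)) + \<bar>d x\<bar> * M"
        unfolding abs_mult using M rb[of n] by (intro add_mono sum_mono mult_left_mono mult_mono) auto
      also have "\<dots> = M * ((\<Sum>i\<in>UNIV. \<bar>F x $ i\<bar>) + \<bar>d x\<bar>)" by (simp add: sum_distrib_right distrib_left sum_distrib_left mult.commute)
      finally show "norm (G n x) \<le> M * ((\<Sum>i\<in>UNIV. \<bar>F x $ i\<bar>) + \<bar>d x\<bar>)" by simp
    qed
    show "AE x in lborel. (\<lambda>n. G n x) \<longlonglongrightarrow> d x * bspline3 c"
    proof (rule AE_I2)
      fix x
      have y: "(\<lambda>n. r n *\<^sub>R x - - c) \<longlonglongrightarrow> 0 *\<^sub>R x - - c" by (intro tendsto_intros r0)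
      have "(\<lambda>n. bspline3 (r n *\<^sub>R x - - c)) \<longlonglongrightarrow> bspline3 (0 *\<^sub>R x - - c)"
        by (rule continuous_on_tendsto_compose[OF continuous_bspline3 y]) auto
      moreover have "(\<lambda>n. bspline3' i (r n *\<^sub>R x - - c)) \<longlonglongrightarrow> bspline3' i (0 *\<^sub>R x - - c)" for i
        by (rule continuous_on_tendsto_compose[OF continuous_bspline3' y]) auto
      ultimately have "(\<lambda>n. G n x) \<longlonglongrightarrow> (\<Sum>i\<in>UNIV. F x $ i * (0 * bspline3' i (0 *\<^sub>R x - - c))) + d x * bspline3 (0 *\<^sub>R x - - c)"
        unfolding G_def by (intro tendsto_intros r0)
      then show "(\<lambda>n. G n x) \<longlonglongrightarrow> d x * bspline3 c" by simp
    qed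
  qed
  moreover have "integral\<^sup>L lborel (G n) = 0" for n
    using defect_eq_0[OF rb(1), of n "- c"] by (simp add: defect_def G_def[abs_def])
  ultimately have "integral\<^sup>L lborel (\<lambda>x. d x * bspline3 c) = 0" by (simp add: LIMSEQ_const_iff)
  then show ?thesis using tbc by simp
qed

end

section \<open>Integration on bounded domains and cylinders\<close>

text \<open>Hoelder's inequality in the exponents \<open>1 / t\<close> and
  \<open>1 / (1 - t)\<close>, stated with \<open>t\<close> so that the endpoints are included.
  Normalising by the integrals reduces it to \<open>young_theta\<close>.\<close>

lemma holder_theta:
  fixes f g :: "'a \<Rightarrow> real"
  assumes t: "0 \<le> t" "t \<le> 1" and f: "integrable M f" "\<And>x. x \<in> space M \<Longrightarrow> 0 \<le> f x" and g: "integrable M g" "\<And>x. x \<in> space M \<Longrightarrow> 0 \<le> g x"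
  shows "integrable M (\<lambda>x. f x powr t * g x powr (1 - t))"
    and "(\<integral>x. f x powr t * g x powr (1 - t) \<partial>M) \<le> (\<integral>x. f x \<partial>M) powr t * (\<integral>x. g x \<partial>M) powr (1 - t)"
proof -
  have m: "f \<in> borel_measurable M" "g \<in> borel_measurable M" using f g by auto
  show int: "integrable M (\<lambda>x. f x powr t * g x powr (1 - t))"
  proof (rule Bochner_Integration.integrable_bound[of M "\<lambda>x. t * f x + (1 - t) * g x"])
    show "AE x in M. norm (f x powr t * g x powr (1 - t)) \<le> norm (t * f x + (1 - t) * g x)"
      using young_theta[OF t] f(2) g(2) t by (intro AE_I2) auto
  qed (use f g m in auto)
  define A B where "A = (\<integral>x. f x \<partial>M)" and "B = (\<integral>x. g x \<partial>M)"
  have AB: "0 \<le> A" "0 \<le> B" using f g by (auto simp: A_def B_def intro!: Bochner_Integration.integral_nonneg)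
  show "(\<integral>x. f x powr t * g x powr (1 - t) \<partial>M) \<le> (\<integral>x. f x \<partial>M) powr t * (\<integral>x. g x \<partial>M) powr (1 - t)"
  proof (cases "A = 0 \<or> B = 0")
    case True
    \<comment> \<open>Since \<open>0 powr t = 0\<close> also for \<open>t = 0\<close>, the product
      vanishes almost everywhere even if one exponent is 0.\<close>
    then have "AE x in M. f x powr t * g x powr (1 - t) = 0"
    proof
      assume "A = 0"
      then have "AE x in M. f x = 0" using integral_nonneg_eq_0_iff_AE[OF f(1)] f(2) by (auto simp: A_def)
      then show ?thesis by (rule AE_mp) (auto intro!: AE_I2)
    next
      assume "B = 0"
      then have "AE x in M. g x = 0" using integral_nonneg_eq_0_iff_AE[OF g(1)] g(2) by (auto simp: B_def)
      then show ?thesis by (rule AE_mp) (auto intro!: AE_I2)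
    qed
    then have "(\<integral>x. f x powr t * g x powr (1 - t) \<partial>M) = (\<integral>x. 0 \<partial>M)"
      using m by (intro integral_cong_AE) auto
    then show ?thesis using AB by simp
  next
    case False
    then have AB': "A > 0" "B > 0" using AB by auto
    have "(\<integral>x. f x powr t * g x powr (1 - t) \<partial>M) \<le> (\<integral>x. A powr t * B powr (1 - t) * (t * (f x / A) + (1 - t) * (g x / B)) \<partial>M)"
    proof (rule integral_mono[OF int])
      show "integrable M (\<lambda>x. A powr t * B powr (1 - t) * (t * (f x / A) + (1 - t) * (g x / B)))"
        using f g by auto
      fix x assume x: "x \<in> space M"
      have "(f x / A) powr t * (g x / B) powr (1 - t) \<le> t * (f x / A) + (1 - t) * (g x / B)"
        by (rule young_theta[OF t]) (use f(2)[OF x] g(2)[OF x] AB in auto)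
      then have "A powr t * B powr (1 - t) * ((f x / A) powr t * (g x / B) powr (1 - t)) \<le> A powr t * B powr (1 - t) * (t * (f x / A) + (1 - t) * (g x / B))"
        by (rule mult_left_mono) simp
      then show "f x powr t * g x powr (1 - t) \<le> A powr t * B powr (1 - t) * (t * (f x / A) + (1 - t) * (g x / B))"
        using AB' f(2)[OF x] g(2)[OF x] by (simp add: powr_divide)
    qed
    also have "\<dots> = A powr t * B powr (1 - t) * (t * (A / A) + (1 - t) * (B / B))"
      using f(1) g(1) by (simp add: A_def B_def)
    finally show ?thesis using AB' by (simp add: A_def B_def)
  qed
qed

lemma holder_measure:
  fixes f :: "'a \<Rightarrow> real"
  assumes "finite_measure M" and s: "0 \<le> s" "s \<le> r" "r > 0" and f: "integrable M (\<lambda>x. f x powr r)" "\<And>x. x \<in> space M \<Longrightarrow> 0 \<le> f x" "f \<in> borel_measurable M"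
    and s0: "s > 0"
  shows "integrable M (\<lambda>x. f x powr s)"
    "(\<integral>x. f x powr s \<partial>M) \<le> (\<integral>x. f x powr r \<partial>M) powr (s / r) * measure M (space M) powr (1 - s / r)"
proof -
  interpret finite_measure M by fact
  have e: "(f x powr r) powr (s / r) * 1 powr (1 - s / r) = f x powr s" for x using s by (simp add: powr_powr)
  have t: "0 \<le> s / r" "s / r \<le> 1" using s by auto
  have "integrable M (\<lambda>x. 1::real)" by simp
  from holder_theta[OF t f(1) _ this] show "integrable M (\<lambda>x. f x powr s)"
    "(\<integral>x. f x powr s \<partial>M) \<le> (\<integral>x. f x powr r \<partial>M) powr (s / r) * measure M (space M) powr (1 - s / r)"
    unfolding e by auto
qed

text \<open>With \<open>a\<close> and \<open>b\<close> slightly above the two norms,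
  \<open>(f + g) / (a + b)\<close> is a convex combination of \<open>f / a\<close> and
  \<open>g / b\<close>; convexity of the power gives the bound with \<open>a + b\<close>. The
  increment \<open>e\<close> avoids division by a vanishing norm and then tends to 0.\<close>

lemma minkowski_powr:
  fixes f g :: "'a \<Rightarrow> real"
  assumes p: "p \<ge> 1" and f: "integrable M (\<lambda>x. f x powr p)" "\<And>x. x \<in> space M \<Longrightarrow> 0 \<le> f x" "f \<in> borel_measurable M"
    and g: "integrable M (\<lambda>x. g x powr p)" "\<And>x. x \<in> space M \<Longrightarrow> 0 \<le> g x" "g \<in> borel_measurable M"
  shows "(\<integral>x. (f x + g x) powr p \<partial>M) powr (1/p) \<le> (\<integral>x. f x powr p \<partial>M) powr (1/p) + (\<integral>x. g x powr p \<partial>M) powr (1/p)"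
proof -
  define A B where "A = (\<integral>x. f x powr p \<partial>M) powr (1/p)" and "B = (\<integral>x. g x powr p \<partial>M) powr (1/p)"
  have Ap: "(\<integral>x. f x powr p \<partial>M) = A powr p" "(\<integral>x. g x powr p \<partial>M) = B powr p"
    using p by (auto simp: A_def B_def powr_powr intro!: integral_nonneg_AE)
  have AB: "0 \<le> A" "0 \<le> B" by (auto simp: A_def B_def)
  have bd: "(\<integral>x. (f x + g x) powr p \<partial>M) \<le> (A + e + (B + e)) powr p" if e: "e > 0" for e
  proof -
    define a b where "a = A + e" and "b = B + e"
    have ab: "a > 0" "b > 0" using AB e by (auto simp: a_def b_def)
    define l where "l = a / (a + b)"
    have l: "0 \<le> l" "l \<le> 1" "1 - l = b / (a + b)" using ab by (auto simp: l_def field_simps)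
    have pw: "(f x + g x) powr p \<le> (a + b) powr p * (l * (f x powr p / a powr p) + (1 - l) * (g x powr p / b powr p))" if x: "x \<in> space M" for x
    proof -
      have "(l * (f x / a) + (1 - l) * (g x / b)) powr p \<le> l * (f x / a) powr p + (1 - l) * (g x / b) powr p"
        using powr_convex_nonneg[OF p, of "f x / a" "g x / b" l] f(2)[OF x] g(2)[OF x] ab l by auto
      also have "l * (f x / a) + (1 - l) * (g x / b) = (f x + g x) / (a + b)"
        unfolding l(3) using ab by (simp add: l_def add_divide_distrib)
      finally have "(a + b) powr p * ((f x + g x) / (a + b)) powr p \<le> (a + b) powr p * (l * (f x / a) powr p + (1 - l) * (g x / b) powr p)"
        by (intro mult_left_mono) auto
      then show ?thesis using ab f(2)[OF x] g(2)[OF x] by (simp add: powr_divide)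
    qed
    have int: "integrable M (\<lambda>x. (a + b) powr p * (l * (f x powr p / a powr p) + (1 - l) * (g x powr p / b powr p)))"
      using f g by auto
    have "integrable M (\<lambda>x. (f x + g x) powr p)"
    proof (rule Bochner_Integration.integrable_bound[OF int])
      show "AE x in M. norm ((f x + g x) powr p) \<le> norm ((a + b) powr p * (l * (f x powr p / a powr p) + (1 - l) * (g x powr p / b powr p)))"
        using pw by (intro AE_I2) (auto intro: order_trans[OF _ abs_ge_self])
    qed (use f g in auto)
    from integral_mono[OF this int pw]
    have "(\<integral>x. (f x + g x) powr p \<partial>M) \<le> (\<integral>x. (a + b) powr p * (l * (f x powr p / a powr p) + (1 - l) * (g x powr p / b powr p)) \<partial>M)" .
    also have "\<dots> = (a + b) powr p * (l * (A powr p / a powr p) + (1 - l) * (B powr p / b powr p))"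
      using f(1) g(1) by (simp add: Ap)
    also have "\<dots> \<le> (a + b) powr p * (l * 1 + (1 - l) * 1)"
      using l AB e ab p by (intro mult_left_mono add_mono) (auto simp: a_def b_def intro!: powr_mono2)
    finally show ?thesis by (simp add: a_def b_def)
  qed
  have "((\<lambda>e. (A + e + (B + e)) powr p) \<longlongrightarrow> (A + 0 + (B + 0)) powr p) (at_right 0)"
    using p AB by (intro tendsto_intros tendsto_powr') (auto simp: eventually_at_filter)
  then have "(\<integral>x. (f x + g x) powr p \<partial>M) \<le> (A + 0 + (B + 0)) powr p"
    by (rule tendsto_lowerbound) (use bd in \<open>auto simp: eventually_at_filter intro!: always_eventually\<close>)
  then have "(\<integral>x. (f x + g x) powr p \<partial>M) powr (1/p) \<le> ((A + B) powr p) powr (1/p)"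
    using p by (intro powr_mono2) (auto intro!: integral_nonneg_AE)
  also have "\<dots> = A + B" using p AB by (simp add: powr_powr)
  finally show ?thesis by (simp add: A_def B_def)
qed

lemma integrable_continuous_bounded_set:
  fixes f :: "'a::euclidean_space \<Rightarrow> real"
  assumes U: "U \<in> lmeasurable" "compact C" "U \<subseteq> C" and f: "continuous_on C f"
  shows "integrable (lebesgue_on U) f"
proof -
  interpret finite_measure "lebesgue_on U" by (rule finite_measure_lebesgue_on[OF U(1)])
  have "bounded (f ` C)" by (intro compact_imp_bounded compact_continuous_image f U)
  then obtain B where B: "\<forall>x\<in>C. \<bar>f x\<bar> \<le> B" by (auto simp: bounded_iff)
  show ?thesis
  proof (rule integrable_const_bound[of _ B])
    show "AE x in lebesgue_on U. norm (f x) \<le> B" using B U(3) by (intro AE_I2) auto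
    show "f \<in> borel_measurable (lebesgue_on U)"
      using U f by (intro continuous_imp_measurable_on_sets_lebesgue) (auto intro: continuous_on_subset)
  qed
qed

lemma integral_lebesgue_on_eq_lborel:
  fixes f :: "'a::euclidean_space \<Rightarrow> real"
  assumes S: "S \<in> sets borel" and f: "continuous_on S f"
  shows "integral\<^sup>L (lebesgue_on S) f = (\<integral>x. indicator S x *\<^sub>R f x \<partial>lborel)"
    "integrable (lebesgue_on S) f \<longleftrightarrow> integrable lborel (\<lambda>x. indicator S x *\<^sub>R f x)"
proof -
  have m: "(\<lambda>x. indicator S x *\<^sub>R f x) \<in> borel_measurable lborel" using borel_measurable_continuous_on_indicator[OF S f] by simp
  have SL: "S \<inter> space lebesgue \<in> sets lebesgue" using S by simp
  show "integral\<^sup>L (lebesgue_on S) f = (\<integral>x. indicator S x *\<^sub>R f x \<partial>lborel)"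
    using integral_restrict_space[OF SL, of f] integral_completion[OF m] by simp
  show "integrable (lebesgue_on S) f \<longleftrightarrow> integrable lborel (\<lambda>x. indicator S x *\<^sub>R f x)"
    using integrable_restrict_space[OF SL, of f] integrable_completion[OF m] by simp
qed

text \<open>The set where the bound fails inside \<open>S\<close> is open and null, hence empty;
  continuity extends the bound to the closure.\<close>

lemma AE_le_on_closure:
  fixes f :: "'a::euclidean_space \<Rightarrow> real"
  assumes S: "open S" and f: "continuous_on (closure S) f" and ae: "AE x in lebesgue_on S. f x \<le> e" and x: "x \<in> closure S"
  shows "f x \<le> e"
proof (rule continuous_le_on_closure[OF f x])
  define S' where "S' = {x\<in>S. e < f x}"
  have "open S'"
  proof -
    have "continuous_on S f" using f closure_subset by (rule continuous_on_subset)
    then have "open (f -` {e<..} \<inter> S)" using S by (simp add: continuous_on_open_vimage)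
    moreover have "f -` {e<..} \<inter> S = S'" by (auto simp: S'_def)
    ultimately show ?thesis by simp
  qed
  have "AE x in lebesgue. x \<in> S \<longrightarrow> f x \<le> e" using ae S by (subst (asm) AE_restrict_space_iff) auto
  moreover have "{x \<in> space lebesgue. \<not> (x \<in> S \<longrightarrow> f x \<le> e)} = S'" by (auto simp: S'_def)
  ultimately have "S' \<in> null_sets lebesgue" using \<open>open S'\<close> by (subst (asm) AE_iff_null) auto
  then have "negligible S'" by (simp add: negligible_iff_null_sets)
  then have "S' = {}" using open_not_negligible[OF \<open>open S'\<close>] by blast
  then show "f y \<le> e" if "y \<in> S" for y using that by (auto simp: S'_def not_less)
qed

locale bounded_domain =
  fixes U :: "(real^3) set"
  assumes U_open: "open U" and U_bounded: "bounded U"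
begin

abbreviation "LU \<equiv> lebesgue_on U"
abbreviation "CU \<equiv> closure U"
abbreviation "LQ (a::real) (b::real) \<equiv> lebesgue_on (U \<times> {a..b})"

lemma CU: "compact CU" "U \<subseteq> CU" using U_bounded closure_subset by (auto simp: compact_closure)
lemma U_lm: "U \<in> lmeasurable" using U_open U_bounded by (intro bounded_set_imp_lmeasurable) auto
lemma U_borel: "U \<in> sets borel" using U_open by auto
lemma Q_borel: "U \<times> {a..b::real} \<in> sets borel" using U_borel by (auto simp: borel_prod[symmetric])
lemma Q_bounded: "bounded (U \<times> {a..b::real})" using U_bounded by (intro bounded_Times) auto
lemma Q_lm: "U \<times> {a..b::real} \<in> lmeasurable" using Q_borel Q_bounded by (intro bounded_set_imp_lmeasurable) auto
lemma CQ: "compact (CU \<times> {a..b::real})" "U \<times> {a..b::real} \<subseteq> CU \<times> {a..b}" using CU by (auto intro!: compact_Times)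

lemma fin_LU: "finite_measure LU" by (rule finite_measure_lebesgue_on[OF U_lm])
lemma fin_LQ: "finite_measure (LQ a b)" by (rule finite_measure_lebesgue_on[OF Q_lm])

lemma intU: "continuous_on CU f \<Longrightarrow> integrable LU (f :: _ \<Rightarrow> real)"
  by (rule integrable_continuous_bounded_set[OF U_lm CU])
lemma intQ: "continuous_on (CU \<times> {a..b::real}) f \<Longrightarrow> integrable (LQ a b) (f :: _ \<Rightarrow> real)"
  by (rule integrable_continuous_bounded_set[OF Q_lm CQ])
lemma measU: "continuous_on CU f \<Longrightarrow> (f :: _ \<Rightarrow> real) \<in> borel_measurable LU"
  using intU by (rule borel_measurable_integrable)

lemma slice_cont: "continuous_on (CU \<times> S) (\<lambda>z. f (fst z) (snd z)) \<Longrightarrow> s \<in> S \<Longrightarrow> continuous_on CU (\<lambda>x. f x s)"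
proof -
  assume f: "continuous_on (CU \<times> S) (\<lambda>z. f (fst z) (snd z))" and s: "s \<in> S"
  have "continuous_on CU (\<lambda>x. (x, s))" "(\<lambda>x. (x, s)) ` CU \<subseteq> CU \<times> S" using s by (auto intro!: continuous_intros)
  from continuous_on_compose2[OF f this] show ?thesis by simp
qed

lemma cont_int:
  fixes f :: "real^3 \<Rightarrow> real \<Rightarrow> real"
  assumes f: "continuous_on (CU \<times> {a..b}) (\<lambda>z. f (fst z) (snd z))"
  shows "continuous_on {a..b} (\<lambda>s. \<integral>x. f x s \<partial>LU)"
  unfolding continuous_on_sequentially o_def
proof (intro allI ballI impI, elim conjE)
  interpret finite_measure LU by (rule fin_LU)
  fix S s assume s: "s \<in> {a..b}" "\<forall>n. S n \<in> {a..b}" "S \<longlonglongrightarrow> s"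
  have "bounded ((\<lambda>z. f (fst z) (snd z)) ` (CU \<times> {a..b}))" by (intro compact_imp_bounded compact_continuous_image f CQ)
  then obtain B where B: "\<forall>z\<in>CU \<times> {a..b}. \<bar>f (fst z) (snd z)\<bar> \<le> B" unfolding bounded_iff by auto
  show "(\<lambda>n. \<integral>x. f x (S n) \<partial>LU) \<longlonglongrightarrow> (\<integral>x. f x s \<partial>LU)"
  proof (rule integral_dominated_convergence[where w = "\<lambda>_. B"])
    show "(\<lambda>x. f x s) \<in> borel_measurable LU" "(\<lambda>x. f x (S n)) \<in> borel_measurable LU" for n
      using s by (auto intro!: measU slice_cont[OF f])
    show "integrable LU (\<lambda>_. B)" by simp
    show "AE x in LU. (\<lambda>n. f x (S n)) \<longlonglongrightarrow> f x s"
    proof (rule AE_I2)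
      fix x assume "x \<in> space LU"
      then have x: "x \<in> CU" using CU by auto
      have "(\<lambda>n. (x, S n)) \<longlonglongrightarrow> (x, s)" using s by (intro tendsto_intros)
      from continuous_on_tendsto_compose[OF f this] x s show "(\<lambda>n. f x (S n)) \<longlonglongrightarrow> f x s" by auto
    qed
    show "AE x in LU. norm (f x (S n)) \<le> B" for n
    proof (rule AE_I2)
      fix x assume "x \<in> space LU"
      then have x: "x \<in> CU" using CU by auto
      show "norm (f x (S n)) \<le> B" using B[rule_format, of "(x, S n)"] x s by simp
    qed
  qed
qed

lemma cylinder_fubini:
  fixes f :: "real^3 \<Rightarrow> real \<Rightarrow> real"
  assumes f: "continuous_on (CU \<times> {a..b}) (\<lambda>z. f (fst z) (snd z))"
  shows "(\<integral>z. f (fst z) (snd z) \<partial>LQ a b) = integral {a..b} (\<lambda>s. \<integral>x. f x s \<partial>LU)"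
proof -
  have fQ: "continuous_on (U \<times> {a..b}) (\<lambda>z. f (fst z) (snd z))" using CQ(2) by (rule continuous_on_subset[OF f])
  define g where "g z = indicator (U \<times> {a..b}) z *\<^sub>R f (fst z) (snd z)" for z
  have "(\<integral>z. f (fst z) (snd z) \<partial>LQ a b) = integral\<^sup>L lborel g" unfolding g_def by (rule integral_lebesgue_on_eq_lborel[OF Q_borel fQ])
  moreover have ig: "integrable lborel g" unfolding g_def using integral_lebesgue_on_eq_lborel(2)[OF Q_borel fQ] intQ[OF f] by blast
  then have ig': "integrable (lborel \<Otimes>\<^sub>M lborel) (\<lambda>(x, y). g (x, y))" by (simp add: lborel_prod)
  have "integral\<^sup>L lborel g = (\<integral>s. \<integral>x. g (x, s) \<partial>lborel \<partial>lborel)"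
    using lborel_pair.integral_snd[OF ig'] by (simp add: lborel_prod)
  moreover have "(\<integral>x. g (x, s) \<partial>lborel) = indicator {a..b} s *\<^sub>R (\<integral>x. f x s \<partial>LU)" for s
  proof (cases "s \<in> {a..b}")
    case True
    have "continuous_on U (\<lambda>x. f x s)" using slice_cont[OF f True] CU by (auto intro: continuous_on_subset)
    from integral_lebesgue_on_eq_lborel(1)[OF U_borel this] True show ?thesis
      by (auto simp: g_def indicator_def intro!: Bochner_Integration.integral_cong)
  next
    case False then show ?thesis by (auto simp: g_def)
  qed
  moreover have "(\<integral>s. indicator {a..b} s *\<^sub>R (\<integral>x. f x s \<partial>LU) \<partial>lborel) = integral {a..b} (\<lambda>s. \<integral>x. f x s \<partial>LU)"
  proof -
    have "set_integrable lborel {a..b} (\<lambda>s. \<integral>x. f x s \<partial>LU)"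
      unfolding set_integrable_def by (intro borel_integrable_compact cont_int f) auto
    from set_borel_integral_eq_integral(2)[OF this] show ?thesis by (simp add: set_lebesgue_integral_def)
  qed
  ultimately show ?thesis by simp
qed

text \<open>By Fubini and the fundamental theorem at each point, the increment of the integral is
  the time integral of a continuous function, which can be differentiated directly.\<close>

lemma deriv_int:
  fixes f ft :: "real^3 \<Rightarrow> real \<Rightarrow> real"
  assumes f: "continuous_on (CU \<times> {a..b}) (\<lambda>z. f (fst z) (snd z))" and ft: "continuous_on (CU \<times> {a..b}) (\<lambda>z. ft (fst z) (snd z))"
    and d: "\<And>x s. x \<in> U \<Longrightarrow> s \<in> {a..b} \<Longrightarrow> ((\<lambda>s. f x s) has_real_derivative ft x s) (at s within {a..b})"
    and s: "s \<in> {a..b}"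
  shows "((\<lambda>s. \<integral>x. f x s \<partial>LU) has_real_derivative (\<integral>x. ft x s \<partial>LU)) (at s within {a..b})"
proof -
  have eq: "(\<integral>x. f x r \<partial>LU) = (\<integral>x. f x a \<partial>LU) + integral {a..r} (\<lambda>s. \<integral>x. ft x s \<partial>LU)" if r: "r \<in> {a..b}" for r
  proof -
    have sub: "{a..r} \<subseteq> {a..b}" using r by auto
    have ft': "continuous_on (CU \<times> {a..r}) (\<lambda>z. ft (fst z) (snd z))" using ft sub by (auto intro: continuous_on_subset)
    have "integral {a..r} (\<lambda>s. \<integral>x. ft x s \<partial>LU) = (\<integral>z. ft (fst z) (snd z) \<partial>LQ a r)" using cylinder_fubini[OF ft'] by simp
    also have "\<dots> = (\<integral>x. f x r - f x a \<partial>LU)"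
    proof -
      have fQ: "continuous_on (U \<times> {a..r}) (\<lambda>z. ft (fst z) (snd z))" using CQ(2) by (rule continuous_on_subset[OF ft'])
      define g where "g z = indicator (U \<times> {a..r}) z *\<^sub>R ft (fst z) (snd z)" for z
      have "(\<integral>z. ft (fst z) (snd z) \<partial>LQ a r) = integral\<^sup>L lborel g" unfolding g_def by (rule integral_lebesgue_on_eq_lborel[OF Q_borel fQ])
      moreover have ig: "integrable lborel g" unfolding g_def using integral_lebesgue_on_eq_lborel(2)[OF Q_borel fQ] intQ[OF ft'] by blast
      then have ig': "integrable (lborel \<Otimes>\<^sub>M lborel) g" by (simp add: lborel_prod)
      have "integral\<^sup>L lborel g = (\<integral>x. \<integral>s. g (x, s) \<partial>lborel \<partial>lborel)"
        using lborel_pair.integral_fst'[OF ig'] by (simp add: lborel_prod)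
      moreover have "(\<integral>s. g (x, s) \<partial>lborel) = indicator U x *\<^sub>R (f x r - f x a)" for x
      proof (cases "x \<in> U")
        case True
        have c: "continuous_on {a..r} (ft x)"
        proof -
          have "continuous_on {a..r} (\<lambda>s. (x, s))" "(\<lambda>s. (x, s)) ` {a..r} \<subseteq> CU \<times> {a..r}" using True CU by (auto intro!: continuous_intros)
          from continuous_on_compose2[OF ft' this] show ?thesis by simp
        qed
        have "(\<integral>s. g (x, s) \<partial>lborel) = (\<integral>s. indicator {a..r} s *\<^sub>R ft x s \<partial>lborel)"
          using True by (auto simp: g_def indicator_def intro!: Bochner_Integration.integral_cong)
        also have "\<dots> = integral {a..r} (ft x)"
        proof -
          have "set_integrable lborel {a..r} (ft x)" unfolding set_integrable_def by (intro borel_integrable_compact c) auto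
          from set_borel_integral_eq_integral(2)[OF this] show ?thesis by (simp add: set_lebesgue_integral_def)
        qed
        also have "\<dots> = f x r - f x a"
        proof (rule integral_unique[OF fundamental_theorem_of_calculus])
          show "a \<le> r" using r by simp
          show "(f x has_vector_derivative ft x t) (at t within {a..r})" if "t \<in> {a..r}" for t
            using d[OF True, of t] that r sub by (auto intro: DERIV_subset simp: has_real_derivative_iff_has_vector_derivative[symmetric])
        qed
        finally show ?thesis using True by simp
      next
        case False then show ?thesis by (simp add: g_def)
      qed
      moreover have "(\<integral>x. indicator U x *\<^sub>R (f x r - f x a) \<partial>lborel) = (\<integral>x. f x r - f x a \<partial>LU)"
        using r CU by (intro integral_lebesgue_on_eq_lborel(1)[OF U_borel, symmetric] continuous_intros)
         (auto intro!: continuous_on_subset[OF slice_cont[OF f]])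
      ultimately show ?thesis by simp
    qed
    also have "\<dots> = (\<integral>x. f x r \<partial>LU) - (\<integral>x. f x a \<partial>LU)"
      using r by (intro Bochner_Integration.integral_diff intU slice_cont[OF f]) auto
    finally show ?thesis by simp
  qed
  have "((\<lambda>r. integral {a..r} (\<lambda>s. \<integral>x. ft x s \<partial>LU)) has_real_derivative (\<integral>x. ft x s \<partial>LU)) (at s within {a..b})"
    by (rule integral_has_real_derivative[OF cont_int[OF ft] s])
  from DERIV_add[OF DERIV_const[of "\<integral>x. f x a \<partial>LU"] this]
  have "((\<lambda>r. (\<integral>x. f x a \<partial>LU) + integral {a..r} (\<lambda>s. \<integral>x. ft x s \<partial>LU)) has_real_derivative (\<integral>x. ft x s \<partial>LU)) (at s within {a..b})"
    by simp
  then show ?thesis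
  proof (rule has_field_derivative_transform_within[where d = 1])
    show "r \<in> {a..b} \<Longrightarrow> (\<integral>x. f x a \<partial>LU) + integral {a..r} (\<lambda>s. \<integral>x. ft x s \<partial>LU) = (\<integral>x. f x r \<partial>LU)" for r
      by (rule eq[symmetric])
  qed (use s in auto)
qed

end

section \<open>Signed and truncated powers as test functions\<close>

definition signed_powr :: "real \<Rightarrow> real \<Rightarrow> real" where "signed_powr p s = pos_part s powr p - pos_part (- s) powr p"

lemma pos_part_nonneg [simp]: "0 \<le> pos_part x" by (simp add: pos_part_def)

lemma pos_part_powr_cont: "p > 0 \<Longrightarrow> continuous_on S (\<lambda>x. pos_part x powr p)"
  by (intro continuous_on_powr' continuous_pos_part continuous_intros) auto

lemma pos_part_powr_deriv: assumes p: "p > 1" shows "((\<lambda>x. pos_part x powr p) has_real_derivative p * pos_part x powr (p - 1)) (at x)"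
proof -
  consider "x > 0" | "x < 0" | "x = 0" by linarith
  then show ?thesis
  proof cases
    case 1
    have "((\<lambda>x. x powr p) has_real_derivative p * x powr (p - 1)) (at x)" using 1 by (rule has_real_derivative_powr)
    then show ?thesis using 1 by (rule_tac has_field_derivative_transform_within_open[where S = "{0<..}"]) (auto simp: pos_part_def)
  next
    case 2
    have "((\<lambda>x. 0) has_real_derivative 0) (at x)" by simp
    then show ?thesis using 2 by (rule_tac has_field_derivative_transform_within_open[where S = "{..<0}"]) (auto simp: pos_part_def)
  next
    case 3
    have "((\<lambda>h. pos_part h powr (p - 1)) \<longlongrightarrow> pos_part 0 powr (p - 1)) (at 0)"
      using pos_part_powr_cont[of "p - 1" UNIV] p by (auto simp: continuous_on_def)
    then have l: "((\<lambda>h. pos_part h powr (p - 1)) \<longlongrightarrow> 0) (at 0)" by (simp add: pos_part_def)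
    have "((\<lambda>h. pos_part h powr p / h) \<longlongrightarrow> 0) (at 0)"
      by (rule Lim_transform_eventually[OF l]) (auto simp: pos_part_def eventually_at_filter max_def powr_diff)
    then show ?thesis using 3 by (simp add: has_field_derivative_iff pos_part_def)
  qed
qed

lemma abs_powr_eq: "p \<noteq> 0 \<Longrightarrow> \<bar>s\<bar> powr p = pos_part s powr p + pos_part (- s) powr p"
  by (auto simp: pos_part_def max_def)

lemma abs_signed_powr: "\<bar>signed_powr p s\<bar> = \<bar>s\<bar> powr p"
  by (auto simp: signed_powr_def pos_part_def max_def)

lemma signed_powr_cont: "p > 0 \<Longrightarrow> continuous_on S (signed_powr p)"
  unfolding signed_powr_def by (intro continuous_intros continuous_on_compose2[OF pos_part_powr_cont[of p UNIV]]) auto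

lemma abs_powr_deriv: assumes p: "p > 1" shows "((\<lambda>s. \<bar>s\<bar> powr p) has_real_derivative p * signed_powr (p - 1) s) (at s)"
proof -
  have "((\<lambda>s. pos_part (- s) powr p) has_real_derivative (p * pos_part (- s) powr (p - 1)) * - 1) (at s)"
    by (rule DERIV_chain2[OF pos_part_powr_deriv[OF p]]) (auto intro!: derivative_eq_intros)
  from DERIV_add[OF pos_part_powr_deriv[OF p, of s] this] show ?thesis
    using p by (simp add: abs_powr_eq signed_powr_def algebra_simps)
qed

text \<open>Truncation at level e makes the test functions vanish near the boundary, where \<open>u\<close> equals \<open>\<Psi>\<close>.\<close>
definition trunc_powr :: "real \<Rightarrow> real \<Rightarrow> real \<Rightarrow> real" where "trunc_powr e p s = pos_part (\<bar>s\<bar> - e) powr p"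
definition signed_trunc_powr :: "real \<Rightarrow> real \<Rightarrow> real \<Rightarrow> real" where "signed_trunc_powr e p s = pos_part (s - e) powr p - pos_part (- s - e) powr p"

lemma trunc_powr_eq: assumes "e > 0" "p \<noteq> 0" shows "trunc_powr e p s = pos_part (s - e) powr p + pos_part (- s - e) powr p"
  using assms by (auto simp: trunc_powr_def pos_part_def max_def abs_if)

lemma abs_signed_trunc_powr: assumes "e > 0" shows "\<bar>signed_trunc_powr e p s\<bar> = trunc_powr e p s"
  using assms by (auto simp: trunc_powr_def signed_trunc_powr_def pos_part_def max_def abs_if)

lemma shifted_deriv: assumes p: "p > 1" 
  shows "((\<lambda>s. pos_part (s - e) powr p) has_real_derivative p * pos_part (s - e) powr (p - 1)) (at s)"
    "((\<lambda>s. pos_part (- s - e) powr p) has_real_derivative - (p * pos_part (- s - e) powr (p - 1))) (at s)"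
proof -
  have "((\<lambda>s. pos_part (s - e) powr p) has_real_derivative (p * pos_part (s - e) powr (p - 1)) * 1) (at s)"
    by (rule DERIV_chain2[OF pos_part_powr_deriv[OF p]]) (auto intro!: derivative_eq_intros)
  then show "((\<lambda>s. pos_part (s - e) powr p) has_real_derivative p * pos_part (s - e) powr (p - 1)) (at s)" by simp
  have "((\<lambda>s. pos_part (- s - e) powr p) has_real_derivative (p * pos_part (- s - e) powr (p - 1)) * - 1) (at s)"
    by (rule DERIV_chain2[OF pos_part_powr_deriv[OF p]]) (auto intro!: derivative_eq_intros)
  then show "((\<lambda>s. pos_part (- s - e) powr p) has_real_derivative - (p * pos_part (- s - e) powr (p - 1))) (at s)" by simp
qed

lemma signed_trunc_powr_deriv: assumes "p > 1" "e > 0" shows "(signed_trunc_powr e p has_real_derivative p * trunc_powr e (p - 1) s) (at s)"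
  unfolding signed_trunc_powr_def[abs_def] using DERIV_diff[OF shifted_deriv[OF assms(1), of e s]] assms
  by (simp add: trunc_powr_eq algebra_simps)

lemma trunc_powr_deriv: assumes "p > 1" "e > 0" shows "(trunc_powr e p has_real_derivative p * signed_trunc_powr e (p - 1) s) (at s)"
proof -
  have "trunc_powr e p = (\<lambda>s. pos_part (s - e) powr p + pos_part (- s - e) powr p)" using assms by (auto simp: trunc_powr_eq)
  then show ?thesis using DERIV_add[OF shifted_deriv[OF assms(1), of e s]] by (simp add: signed_trunc_powr_def algebra_simps)
qed

lemma trunc_powr_cont: "p > 0 \<Longrightarrow> continuous_on S (trunc_powr e p)"
  unfolding trunc_powr_def by (intro continuous_on_compose2[OF pos_part_powr_cont[of p UNIV]] continuous_intros) auto
lemma signed_trunc_powr_cont: "p > 0 \<Longrightarrow> continuous_on S (signed_trunc_powr e p)"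
  unfolding signed_trunc_powr_def by (intro continuous_intros continuous_on_compose2[OF pos_part_powr_cont[of p UNIV]]) auto

lemma trunc_powr_zero: "\<bar>s\<bar> \<le> e \<Longrightarrow> trunc_powr e p s = 0" "\<bar>s\<bar> \<le> e \<Longrightarrow> signed_trunc_powr e p s = 0"
  by (auto simp: trunc_powr_def signed_trunc_powr_def pos_part_def max_def abs_le_iff)

lemma trunc_powr_nonneg: "0 \<le> trunc_powr e p s" by (simp add: trunc_powr_def)
lemma trunc_powr_le: "e \<ge> 0 \<Longrightarrow> p > 0 \<Longrightarrow> trunc_powr e p s \<le> \<bar>s\<bar> powr p"
  unfolding trunc_powr_def by (intro powr_mono2) (auto simp: pos_part_def)

text \<open>Truncation levels tending to 0, along which the full powers are recovered.\<close>

definition ee :: "nat \<Rightarrow> real" where "ee n = 1 / real (Suc n)"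
lemma ee: "ee n > 0" "ee \<longlonglongrightarrow> 0"
  unfolding ee_def using LIMSEQ_inverse_real_of_nat by (auto simp: inverse_eq_divide)

lemma trunc_powr_lim: assumes "p > 0" shows "(\<lambda>n. trunc_powr (ee n) p s) \<longlonglongrightarrow> \<bar>s\<bar> powr p"
proof -
  have "(\<lambda>n. \<bar>s\<bar> - ee n) \<longlonglongrightarrow> \<bar>s\<bar> - 0" by (intro tendsto_intros ee)
  from continuous_on_tendsto_compose[OF pos_part_powr_cont[OF assms, of UNIV] this] show ?thesis
    by (simp add: trunc_powr_def pos_part_def)
qed
lemma signed_trunc_powr_lim: assumes "p > 0" shows "(\<lambda>n. signed_trunc_powr (ee n) p s) \<longlonglongrightarrow> signed_powr p s"
proof -
  have 1: "(\<lambda>n. s - ee n) \<longlonglongrightarrow> s - 0" "(\<lambda>n. - s - ee n) \<longlonglongrightarrow> - s - 0" by (intro tendsto_intros ee)+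
  show ?thesis using tendsto_diff[OF continuous_on_tendsto_compose[OF pos_part_powr_cont[OF assms, of UNIV] 1(1)] continuous_on_tendsto_compose[OF pos_part_powr_cont[OF assms, of UNIV] 1(2)]]
    by (simp add: signed_trunc_powr_def signed_powr_def)
qed

text \<open>\<open>xgrad\<close> and \<open>tder\<close> are defined through derivatives of slices;
  here they become values of the joint derivative, so that \<open>C1_on\<close> yields their
  continuity.\<close>

lemma xgrad_deriv:
  assumes d: "((\<lambda>(x, t). f x t) has_derivative D) (at (x, t))"
  shows "((\<lambda>y. f y t) has_derivative (\<lambda>h. xgrad f x t \<bullet> h)) (at x)" "((\<lambda>s. f x s) has_real_derivative tder f x t) (at t)"
    "xgrad f x t = (\<chi> i. D (axis i 1, 0))" "tder f x t = D (0, 1)"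
proof -
  note lin = has_derivative_linear[OF d]
  have 1: "((\<lambda>y. (y, t)) has_derivative (\<lambda>h. (h, 0))) (at x)" by (auto intro!: derivative_eq_intros)
  have dx: "((\<lambda>y. f y t) has_derivative (\<lambda>h. D (h, 0))) (at x)"
    using has_derivative_compose[OF 1, of "\<lambda>(x, t). f x t" D] d by simp
  have 2: "((\<lambda>s. (x, s)) has_derivative (\<lambda>h. (0, h))) (at t)" by (auto intro!: derivative_eq_intros)
  have dt: "((\<lambda>s. f x s) has_derivative (\<lambda>h. D (0, h))) (at t)"
    using has_derivative_compose[OF 2, of "\<lambda>(x, t). f x t" D] d by simp
  have D1: "D (0, h) = h * D (0, 1)" for h using linear_scale[OF lin, of h "(0, 1)"] by simp
  have "(\<lambda>h. D (0, h)) = (*) (D (0, 1))" by (rule ext) (rule trans[OF D1 mult.commute])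
  then have dt': "((\<lambda>s. f x s) has_real_derivative D (0, 1)) (at t)"
    using dt by (simp only: has_field_derivative_def)
  then show t: "tder f x t = D (0, 1)" unfolding tder_def by (rule DERIV_imp_deriv)
  show "((\<lambda>s. f x s) has_real_derivative tder f x t) (at t)" using dt' t by simp
  have fr: "frechet_derivative (\<lambda>y. f y t) (at x) = (\<lambda>h. D (h, 0))" using frechet_derivative_at[OF dx] by simp
  show x: "xgrad f x t = (\<chi> i. D (axis i 1, 0))" by (simp add: xgrad_def fr)
  have lin1: "linear (\<lambda>h. D (h, 0))" using has_derivative_linear[OF dx] .
  have "D (h, 0) = xgrad f x t \<bullet> h" for h
  proof -
    have "D (h, 0) = D ((\<Sum>i\<in>UNIV. h $ i *s axis i 1), 0)" by (simp only: basis_expansion)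
    also have "\<dots> = (\<Sum>i\<in>UNIV. h $ i * D (axis i 1, 0))"
      using linear_sum[OF lin1, of "\<lambda>i. h $ i *s axis i 1" UNIV] linear_scale[OF lin1] by (simp add: scalar_mult_eq_scaleR)
    finally show ?thesis by (simp add: x inner_vec_def mult.commute)
  qed
  then show "((\<lambda>y. f y t) has_derivative (\<lambda>h. xgrad f x t \<bullet> h)) (at x)" using dx by simp
qed

context bounded_domain begin

text \<open>Time 0 is left out because \<open>regular_fn\<close> provides derivatives only for
  positive times. Closure under the usual operations makes all integrands below integrable at each
  positive time.\<close>

definition "SC f \<longleftrightarrow> continuous_on (CU \<times> {0::real<..}) (\<lambda>z. f (fst z) (snd z))" 

lemma regular_fnD:
  assumes "regular_fn U f"
  shows "\<exists>W. open W \<and> CU \<times> {0<..} \<subseteq> W \<and> continuous_on W (\<lambda>z. f (fst z) (snd z)) \<and> 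
     (\<forall>x t. (x, t) \<in> W \<longrightarrow> ((\<lambda>y. f y t) has_derivative (\<lambda>h. xgrad f x t \<bullet> h)) (at x) \<and> ((\<lambda>s. f x s) has_real_derivative tder f x t) (at t)) \<and>
     continuous_on W (\<lambda>z. xgrad f (fst z) (snd z)) \<and> continuous_on W (\<lambda>z. tder f (fst z) (snd z))"
proof -
  obtain W where W: "open W" "CU \<times> {0<..} \<subseteq> W" "C1_on W (\<lambda>(x,t). f x t)" using assms by (auto simp: regular_fn_def)
  then obtain h' where h': "continuous_on W h'" "\<And>p. p \<in> W \<Longrightarrow> ((\<lambda>(x,t). f x t) has_derivative blinfun_apply (h' p)) (at p)"
    by (auto simp: C1_on_def)
  have e: "xgrad f x t = (\<chi> i. h' (x, t) (axis i 1, 0))" "tder f x t = h' (x, t) (0, 1)" if "(x, t) \<in> W" for x t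
    using xgrad_deriv(3,4)[OF h'(2)[OF that]] by auto
  have c1: "continuous_on W (\<lambda>z. xgrad f (fst z) (snd z))"
  proof -
    have "continuous_on W (\<lambda>z. \<chi> i. h' z (axis i 1, 0))" by (intro continuous_intros h'(1))
    then show ?thesis by (rule continuous_on_cong[OF refl, THEN iffD2, rotated]) (use e in auto)
  qed
  have c2: "continuous_on W (\<lambda>z. tder f (fst z) (snd z))"
  proof -
    have "continuous_on W (\<lambda>z. h' z (0, 1))" by (intro continuous_intros h'(1))
    then show ?thesis by (rule continuous_on_cong[OF refl, THEN iffD2, rotated]) (use e in auto)
  qed
  have c0: "continuous_on W (\<lambda>(x,t). f x t)"
    using h'(2) W(1) by (auto simp: continuous_on_eq_continuous_at intro!: has_derivative_continuous)
  then have c0': "continuous_on W (\<lambda>z. f (fst z) (snd z))" by (simp add: case_prod_unfold)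
  show ?thesis
    using W(1,2) c0' c1 c2 xgrad_deriv(1,2)[OF h'(2)] by (intro exI[of _ W] conjI allI impI) auto
qed

end

section \<open>The energy inequality\<close>

context bounded_domain begin

lemma SC_intros:
  "SC (\<lambda>x t. c)"
  "SC f \<Longrightarrow> SC g \<Longrightarrow> SC (\<lambda>x t. f x t + g x t)"
  "SC f \<Longrightarrow> SC g \<Longrightarrow> SC (\<lambda>x t. f x t - g x t)"
  "SC f' \<Longrightarrow> SC g' \<Longrightarrow> SC (\<lambda>x t. f' x t * g' x t)"
  "SC f \<Longrightarrow> SC (\<lambda>x t. - f x t)"
  "SC f \<Longrightarrow> SC (\<lambda>x t. norm (f x t))"
  "SC f' \<Longrightarrow> SC (\<lambda>x t. \<bar>f' x t\<bar>)"
  for f g :: "real^3 \<Rightarrow> real \<Rightarrow> 'a::real_normed_vector" and f' g' :: "real^3 \<Rightarrow> real \<Rightarrow> real"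
  unfolding SC_def by (auto intro!: continuous_intros)

lemma SC_powr: "SC f \<Longrightarrow> (\<And>x t. 0 \<le> f x t) \<Longrightarrow> p > 0 \<Longrightarrow> SC (\<lambda>x t. (f x t :: real) powr p)"
  unfolding SC_def by (intro continuous_on_powr' continuous_on_const) auto
lemma SC_powr_pos: "SC f \<Longrightarrow> (\<And>x t. 0 < f x t) \<Longrightarrow> SC (\<lambda>x t. (f x t :: real) powr p)"
  unfolding SC_def by (intro continuous_on_powr continuous_on_const) (auto simp: less_imp_neq[symmetric])
lemma SC_comp: "SC f \<Longrightarrow> continuous_on UNIV g \<Longrightarrow> SC (\<lambda>x t. g (f x t))"
  unfolding SC_def by (rule continuous_on_compose2[of UNIV g]) auto

lemma SC_time: "SC f \<Longrightarrow> t > 0 \<Longrightarrow> continuous_on CU (\<lambda>x. f x t)"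
  unfolding SC_def by (rule slice_cont) auto
lemma SC_int: "SC f \<Longrightarrow> t > 0 \<Longrightarrow> integrable LU (\<lambda>x. f x t :: real)"
  by (intro intU SC_time)
lemma SC_cyl: "SC f \<Longrightarrow> a > 0 \<Longrightarrow> continuous_on (CU \<times> {a..b}) (\<lambda>z. f (fst z) (snd z))"
  unfolding SC_def by (erule continuous_on_subset) auto

lemma SC_int_mono: "SC f \<Longrightarrow> SC g \<Longrightarrow> t > 0 \<Longrightarrow> (\<And>x. x \<in> U \<Longrightarrow> f x t \<le> (g x t :: real)) \<Longrightarrow> (\<integral>x. f x t \<partial>LU) \<le> (\<integral>x. g x t \<partial>LU)"
  by (intro integral_mono SC_int) auto

lemma SC_cont_int: "SC f \<Longrightarrow> a > 0 \<Longrightarrow> continuous_on {a..b} (\<lambda>s. \<integral>x. f x s \<partial>LU)"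
  for f :: "real^3 \<Rightarrow> real \<Rightarrow> real"
  by (intro cont_int SC_cyl)

end

section \<open>The solution, its difference to the data, and the tested equation\<close>

locale flow = forchheimer N ab ac + bounded_domain U
  for N ab ac U +
  fixes kv :: "real^3" and Rs G Om :: real and e0 :: "real \<Rightarrow> real^3" and Psi u :: "real^3 \<Rightarrow> real \<Rightarrow> real"
  assumes kv1: "norm kv = 1" and Rs0: "Rs \<ge> 0" and G0: "G > 0" and e01: "\<And>t. norm (e0 t) = 1"
    and Psi_reg: "regular_fn U Psi" and sol: "is_solution N ab ac kv Rs G Om e0 U Psi u"
    and u0: "\<And>x t. x \<in> closure U \<Longrightarrow> t \<ge> 0 \<Longrightarrow> u x t \<ge> 0"
begin

definition "chi = chistar N ac Rs G Om U"

lemma chi_ge: "chi \<ge> 1" "Rs\<^sup>2 \<le> chi" "(chi0 N ac)\<^sup>2 \<le> chi" by (auto simp: chi_def chistar_def)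

lemma Z_le: assumes "x \<in> CU" shows "norm (Zfun kv G Om e0 x t) \<le> chi"
proof -
  have c: "norm (cross3 kv y) \<le> norm y" for y
  proof -
    have "(norm (cross3 kv y))\<^sup>2 + (kv \<bullet> y)\<^sup>2 = (norm y)\<^sup>2" using norm_cross_dot[of kv y] kv1 by simp
    then have "(norm (cross3 kv y))\<^sup>2 \<le> (norm y)\<^sup>2" by (metis le_add_same_cancel1 zero_le_power2)
    then show ?thesis by (rule power2_le_imp_le) simp
  qed
  have "bounded (norm ` CU)" using CU by (intro compact_imp_bounded compact_continuous_image continuous_intros) auto
  then have "norm x \<le> Sup (norm ` CU)" using assms by (intro cSup_upper bounded_imp_bdd_above) auto
  then have n: "norm (cross3 kv (cross3 kv x)) \<le> Sup (norm ` CU)" using c[of x] c[of "cross3 kv x"] by linarith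
  have "norm (Zfun kv G Om e0 x t) \<le> norm ((- G) *\<^sub>R e0 t) + norm (Om\<^sup>2 *\<^sub>R cross3 kv (cross3 kv x))"
    unfolding Zfun_def by (rule norm_triangle_ineq)
  also have "\<dots> \<le> G + Om\<^sup>2 * Sup (norm ` CU)" using G0 e01 n by (auto intro!: mult_left_mono)
  also have "\<dots> \<le> chi" by (simp add: chi_def chistar_def)
  finally show ?thesis .
qed

definition "v x t = u x t - Psi x t"
definition "gv x t = xgrad u x t - xgrad Psi x t"
definition "gP x t = xgrad Psi x t"
definition "vt x t = tder u x t - tder Psi x t"
definition "rho x t = \<bar>v x t\<bar>"
definition "Pa x t = \<bar>Psi x t\<bar>"
definition "flux x t = Xfun N ab ac kv Rs (u x t) (xgrad u x t + (u x t)\<^sup>2 *\<^sub>R Zfun kv G Om e0 x t)"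

lemma u_reg: "regular_fn U u" using sol by (simp add: is_solution_def)

lemma rho_nn [simp]: "0 \<le> rho x t" and Pa_nn [simp]: "0 \<le> Pa x t" by (auto simp: rho_def Pa_def)

lemma reg_SC: assumes "regular_fn U f" shows "SC f" "SC (xgrad f)" "SC (tder f)" "continuous_on (CU \<times> {0..}) (\<lambda>z. f (fst z) (snd z))"
proof -
  obtain W where "CU \<times> {0<..} \<subseteq> W" "continuous_on W (\<lambda>z. f (fst z) (snd z))" "continuous_on W (\<lambda>z. xgrad f (fst z) (snd z))" "continuous_on W (\<lambda>z. tder f (fst z) (snd z))"
    using regular_fnD[OF assms] by auto
  then show "SC f" "SC (xgrad f)" "SC (tder f)" unfolding SC_def by (auto intro: continuous_on_subset)
  show "continuous_on (CU \<times> {0..}) (\<lambda>z. f (fst z) (snd z))" using assms by (simp add: regular_fn_def case_prod_unfold)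
qed

lemma SC_base: "SC u" "SC Psi" "SC v" "SC gv" "SC gP" "SC vt" "SC rho" "SC Pa" "SC (tder Psi)" "SC (tder u)"
proof -
  note r = reg_SC[OF u_reg] reg_SC[OF Psi_reg]
  have e: "v = (\<lambda>x t. u x t - Psi x t)" "gv = (\<lambda>x t. xgrad u x t - xgrad Psi x t)" "gP = xgrad Psi" "vt = (\<lambda>x t. tder u x t - tder Psi x t)"
     "Pa = (\<lambda>x t. \<bar>Psi x t\<bar>)"
    by (auto simp: v_def gv_def gP_def vt_def Pa_def fun_eq_iff)
  show "SC u" "SC Psi" "SC v" "SC gv" "SC gP" "SC vt" "SC Pa" "SC (tder Psi)" "SC (tder u)"
    unfolding e using r by (auto intro!: SC_intros)
  have e2: "rho = (\<lambda>x t. \<bar>v x t\<bar>)" by (auto simp: rho_def fun_eq_iff)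
  show "SC rho" unfolding e2 using \<open>SC v\<close> by (rule SC_intros)
qed

lemma v_cont0: "continuous_on (CU \<times> {0..}) (\<lambda>z. v (fst z) (snd z))"
  unfolding v_def using reg_SC(4)[OF u_reg] reg_SC(4)[OF Psi_reg] by (intro continuous_intros)

lemma v_deriv: assumes "x \<in> CU" "t > 0"
  shows "((\<lambda>y. v y t) has_derivative (\<lambda>h. gv x t \<bullet> h)) (at x)" "((\<lambda>s. v x s) has_real_derivative vt x t) (at t)"
proof -
  have m: "(x, t) \<in> CU \<times> {0<..}" using assms by simp
  have 1: "((\<lambda>y. f y t) has_derivative (\<lambda>h. xgrad f x t \<bullet> h)) (at x)" "((\<lambda>s. f x s) has_real_derivative tder f x t) (at t)"
    if r: "regular_fn U f" for f
    using regular_fnD[OF r] m by blast+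
  show "((\<lambda>y. v y t) has_derivative (\<lambda>h. gv x t \<bullet> h)) (at x)"
    using has_derivative_diff[OF 1(1)[OF u_reg] 1(1)[OF Psi_reg]] by (simp add: v_def[abs_def] gv_def inner_diff_left)
  show "((\<lambda>s. v x s) has_real_derivative vt x t) (at t)"
    using DERIV_diff[OF 1(2)[OF u_reg] 1(2)[OF Psi_reg]] by (simp add: v_def[abs_def] vt_def)
qed

lemma v_frontier: "x \<in> CU \<Longrightarrow> x \<notin> U \<Longrightarrow> t > 0 \<Longrightarrow> v x t = 0"
  using sol U_open by (simp add: is_solution_def v_def frontier_def interior_open)

lemma flux_diff: "x \<in> U \<Longrightarrow> t > 0 \<Longrightarrow> (\<lambda>y. flux y t $ i) differentiable (at x)"
  and flux_div: "x \<in> U \<Longrightarrow> t > 0 \<Longrightarrow> tder u x t = xdiv flux x t"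
  using sol unfolding is_solution_def Let_def flux_def[abs_def] by auto

text \<open>The difference \<open>v\<close> vanishes on the frontier, so a positive level is kept
  away from it.\<close>

lemma level_compact:
  assumes t: "t > 0" and e: "e > 0"
  shows "compact {x \<in> CU. e \<le> \<bar>v x t\<bar>}" "{x \<in> CU. e \<le> \<bar>v x t\<bar>} \<subseteq> U"
proof -
  have "continuous_on CU (\<lambda>x. \<bar>v x t\<bar>)" using SC_time[OF SC_base(3) t] by (intro continuous_intros)
  then have "closed (CU \<inter> (\<lambda>x. \<bar>v x t\<bar>) -` {e..})" by (rule continuous_closed_preimage) auto
  then have "compact (CU \<inter> (CU \<inter> (\<lambda>x. \<bar>v x t\<bar>) -` {e..}))" using CU by (intro compact_Int_closed)
  moreover have "CU \<inter> (CU \<inter> (\<lambda>x. \<bar>v x t\<bar>) -` {e..}) = {x \<in> CU. e \<le> \<bar>v x t\<bar>}" by auto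
  ultimately show "compact {x \<in> CU. e \<le> \<bar>v x t\<bar>}" by simp
  show "{x \<in> CU. e \<le> \<bar>v x t\<bar>} \<subseteq> U" using v_frontier[OF _ _ t] e by force
qed

text \<open>The divergence theorem for the truncated signed power of \<open>v\<close> times the
  flux, extended by 0. Truncation gives compact support inside \<open>U\<close>, the only place
  where the flux is known to be differentiable.\<close>

lemma div_identity:
  assumes t: "t > 0" and e: "e > 0" and p: "p > 1"
  shows "(\<integral>x. signed_trunc_powr e p (v x t) * tder u x t + p * trunc_powr e (p - 1) (v x t) * (gv x t \<bullet> flux x t) \<partial>LU) = 0"
    "integrable LU (\<lambda>x. signed_trunc_powr e p (v x t) * tder u x t + p * trunc_powr e (p - 1) (v x t) * (gv x t \<bullet> flux x t))"
proof -
  define K where "K = {x \<in> CU. e \<le> \<bar>v x t\<bar>}"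
  have K: "compact K" "K \<subseteq> U" using level_compact[OF t e] by (auto simp: K_def)
  have oK: "open (- K)" using compact_imp_closed[OF K(1)] by (simp add: open_Compl)
  have z: "signed_trunc_powr e p (v x t) = 0" "trunc_powr e (p - 1) (v x t) = 0" if "x \<in> U" "x \<notin> K" for x
    using that CU trunc_powr_zero[of "v x t" e] by (auto simp: K_def)
  define Di where "Di x i = frechet_derivative (\<lambda>y. flux y t $ i) (at x)" for x i
  define F where "F x = (if x \<in> U then signed_trunc_powr e p (v x t) *\<^sub>R flux x t else 0)" for x
  define F' where "F' x h = (if x \<in> U then signed_trunc_powr e p (v x t) *\<^sub>R (\<chi> i. Di x i h) + (p * trunc_powr e (p - 1) (v x t) * (gv x t \<bullet> h)) *\<^sub>R flux x t else 0)" for x h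
  define d where "d x = (if x \<in> U then signed_trunc_powr e p (v x t) * tder u x t + p * trunc_powr e (p - 1) (v x t) * (gv x t \<bullet> flux x t) else 0)" for x
  \<comment> \<open>\<open>U\<close> and the complement of \<open>K\<close> are open and cover the
    space: on the first the product rule applies, on the second the field is 0.\<close>
  have dF: "(F has_derivative F' x) (at x)" for x
  proof (cases "x \<in> U")
    case True
    then have xC: "x \<in> CU" using CU by auto
    have 1: "((\<lambda>y. flux y t $ i) has_derivative Di x i) (at x)" for i
      unfolding Di_def using flux_diff[OF True t] by (simp add: frechet_derivative_works)
    have 2: "((\<lambda>y. flux y t) has_derivative (\<lambda>h. \<chi> i. Di x i h)) (at x)"
      proof (rule has_derivative_componentwise_within[THEN iffD2], rule ballI)
      fix b :: "real^3" assume "b \<in> Basis"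
      then obtain i where b: "b = axis i 1" by (auto simp: Basis_vec_def)
      show "((\<lambda>y. flux y t \<bullet> b) has_derivative (\<lambda>h. (\<chi> i. Di x i h) \<bullet> b)) (at x)"
        using 1[of i] by (simp add: b inner_axis)
    qed
    have 3: "((\<lambda>y. signed_trunc_powr e p (v y t)) has_derivative (\<lambda>h. (gv x t \<bullet> h) * (p * trunc_powr e (p - 1) (v x t)))) (at x)"
      by (rule DERIV_compose_FDERIV[OF signed_trunc_powr_deriv[OF p e] v_deriv(1)[OF xC t]])
    have "((\<lambda>y. signed_trunc_powr e p (v y t) *\<^sub>R flux y t) has_derivative F' x) (at x)"
      by (rule has_derivative_eq_rhs[OF has_derivative_scaleR[OF 3 2]]) (use True in \<open>simp add: F'_def fun_eq_iff mult_ac\<close>)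
    then show ?thesis
      by (rule has_derivative_transform_within_open[OF _ U_open True]) (simp add: F_def)
  next
    case False
    then have x: "x \<in> - K" using K by auto
    have "((\<lambda>y. 0) has_derivative F' x) (at x)" using False by (simp add: F'_def[abs_def])
    then show ?thesis
      by (rule has_derivative_transform_within_open[OF _ oK x]) (use z in \<open>auto simp: F_def\<close>)
  qed
  \<comment> \<open>The equation replaces the divergence of the flux by \<open>tder u\<close>; this
    makes the total divergence continuous although the derivatives of the flux need not be.\<close>
  have d_eq: "d x = (\<Sum>i\<in>UNIV. F' x (axis i 1) $ i)" for x
  proof (cases "x \<in> U")
    case True
    have "tder u x t = (\<Sum>i\<in>UNIV. Di x i (axis i 1))" using flux_div[OF True t] by (simp add: xdiv_def Di_def)
    moreover have "gv x t \<bullet> flux x t = (\<Sum>i\<in>UNIV. gv x t $ i * flux x t $ i)" by (simp add: inner_vec_def)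
    ultimately show ?thesis using True 
      by (simp add: d_def F'_def sum.distrib sum_distrib_left inner_axis mult_ac)
  qed (simp add: d_def F'_def)
  have cU: "continuous_on U (\<lambda>x. signed_trunc_powr e p (v x t) * tder u x t + p * trunc_powr e (p - 1) (v x t) * (gv x t \<bullet> flux x t))"
  proof -
    have fc: "continuous_on U (\<lambda>x. flux x t $ i)" for i
      using flux_diff[OF _ t] U_open by (auto simp: continuous_on_eq_continuous_at intro!: differentiable_imp_continuous_within)
    have vc: "continuous_on U (\<lambda>x. v x t)" and uc: "continuous_on U (\<lambda>x. tder u x t)" and gc: "continuous_on U (\<lambda>x. gv x t)"
      using SC_time[OF SC_base(3) t] SC_time[OF SC_base(10) t] SC_time[OF SC_base(4) t] CU(2) by (auto intro: continuous_on_subset)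
    have "continuous_on U (\<lambda>x. signed_trunc_powr e p (v x t) * tder u x t + p * trunc_powr e (p - 1) (v x t) * (\<Sum>i\<in>UNIV. gv x t $ i * flux x t $ i))"
      by (intro continuous_intros continuous_on_compose2[OF signed_trunc_powr_cont[of p UNIV] vc] continuous_on_compose2[OF trunc_powr_cont[of "p - 1" UNIV] vc] uc gc fc) (use p in auto)
    then show ?thesis by (simp add: inner_vec_def)
  qed
  have cd: "continuous_on UNIV d"
  proof -
    have "continuous_on U d" by (rule continuous_on_cong[OF refl, THEN iffD1, OF _ cU]) (simp add: d_def)
    moreover have "continuous_on (- K) d"
    proof -
      have "continuous_on (- K) (\<lambda>x. 0 :: real)" by simp
      then show ?thesis by (rule continuous_on_cong[OF refl, THEN iffD1, rotated]) (use z in \<open>auto simp: d_def\<close>)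
    qed
    ultimately have "continuous_on (U \<union> - K) d" using U_open oK by (intro continuous_on_open_Un)
    moreover have "U \<union> - K = UNIV" using K by auto
    ultimately show ?thesis by simp
  qed
  have F0: "F x = 0" if "x \<notin> K" for x using z that by (auto simp: F_def)
  have d0: "d x = 0" if "x \<notin> K" for x using z that by (auto simp: d_def)
  have "(\<integral>x. d x \<partial>lborel) = 0" by (rule integral_divergence_eq_0[OF dF d_eq cd K(1) F0])
  moreover have "d = (\<lambda>x. indicator U x *\<^sub>R (signed_trunc_powr e p (v x t) * tder u x t + p * trunc_powr e (p - 1) (v x t) * (gv x t \<bullet> flux x t)))"
    by (auto simp: d_def fun_eq_iff)
  moreover have "integrable lborel d" by (rule integrable_cont_compact_support[OF cd K(1) d0])
  ultimately show "(\<integral>x. signed_trunc_powr e p (v x t) * tder u x t + p * trunc_powr e (p - 1) (v x t) * (gv x t \<bullet> flux x t) \<partial>LU) = 0"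
    "integrable LU (\<lambda>x. signed_trunc_powr e p (v x t) * tder u x t + p * trunc_powr e (p - 1) (v x t) * (gv x t \<bullet> flux x t))"
    using integral_lebesgue_on_eq_lborel[OF U_borel cU] by auto
qed

text \<open>The dissipation density, a power of the gradient with the degenerate weight;
  \<open>Hr\<close> is the corresponding remainder in \<open>flux_bound\<close>.\<close>

definition "Iw x t = (1 + rho x t + Pa x t) powr (-2) * norm (gv x t) powr (2 - a)"
definition "Hr x t = c11 N ab ac
     + 3/4 * c12 N ab ac * chi powr (1 - a) * ((rho x t powr (2 - 2*a) + (1 + Pa x t) powr (2 - 2*a)) * norm (gP x t) powr (2 - a))
     + 3/2 * c12 N ab ac * chi powr (3 - 2*a) * (rho x t powr (6 - 4*a) + (1 + Pa x t) powr (6 - 4*a))"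

lemma one_Pa_pos: "0 < 1 + Pa x t" "0 < 1 + rho x t + Pa x t" using rho_nn[of x t] Pa_nn[of x t] by linarith+

lemma SC_IwHr: "SC Iw" "SC Hr"
proof -
  have 1: "SC (\<lambda>x t. (1 + rho x t + Pa x t) powr q)" for q
    by (rule SC_powr_pos) (intro SC_intros SC_base one_Pa_pos)+
  have 2: "SC (\<lambda>x t. (1 + Pa x t) powr q)" for q
    by (rule SC_powr_pos) (intro SC_intros SC_base one_Pa_pos)+
  show "SC Iw" "SC Hr"
    unfolding Iw_def[abs_def] Hr_def[abs_def]
    by (intro SC_intros 1 2 SC_powr SC_base rho_nn norm_ge_zero; use a_bounds in simp)+
qed

lemma flux_le: assumes x: "x \<in> U" and t: "t > 0"
  shows "- (flux x t \<bullet> gv x t) \<le> - (c10 N ab ac / chi * Iw x t) + Hr x t"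
proof -
  have xC: "x \<in> CU" using x CU by auto
  have e: "xgrad u x t = gv x t + gP x t" by (simp add: gv_def gP_def)
  have u: "u x t \<ge> 0" using u0[OF xC] t by simp
  have "u x t \<le> rho x t + Pa x t" by (simp add: rho_def Pa_def v_def)
  from flux_bound[OF kv1 chi_ge Rs0 u this rho_nn Pa_nn Z_le[OF xC, of t], of "gv x t" "gP x t"]
  show ?thesis by (simp add: flux_def e Iw_def Hr_def add.assoc)
qed

lemma dct_U:
  fixes f :: "nat \<Rightarrow> real^3 \<Rightarrow> real"
  assumes "\<And>n. continuous_on CU (f n)" "continuous_on CU g" "continuous_on CU w"
    and "\<And>n x. x \<in> U \<Longrightarrow> \<bar>f n x\<bar> \<le> w x" "\<And>x. x \<in> U \<Longrightarrow> (\<lambda>n. f n x) \<longlonglongrightarrow> g x"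
  shows "(\<lambda>n. \<integral>x. f n x \<partial>LU) \<longlonglongrightarrow> (\<integral>x. g x \<partial>LU)"
  using assms by (intro integral_dominated_convergence[where w = w] measU intU AE_I2) auto

text \<open>The flux is estimated before the truncation level tends to 0: after the estimate all
  integrands are continuous up to the boundary, so dominated convergence applies.\<close>

lemma energy_time:
  assumes t: "t > 0" and p: "p > 1"
  shows "(\<integral>x. signed_powr p (v x t) * tder u x t \<partial>LU) \<le> p * (\<integral>x. rho x t powr (p - 1) * (- (c10 N ab ac / chi * Iw x t) + Hr x t) \<partial>LU)"
proof -
  define H where "H x t = - (c10 N ab ac / chi * Iw x t) + Hr x t" for x t
  have SH: "SC H" unfolding H_def[abs_def] by (intro SC_intros SC_IwHr)
  have p0: "p > 0" "p - 1 > 0" using p by auto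
  note vC = SC_time[OF SC_base(3) t] and utC = SC_time[OF SC_base(10) t] and HC = SC_time[OF SH t]
  have c1: "continuous_on CU (\<lambda>x. signed_trunc_powr e p (v x t) * tder u x t)" for e
    by (intro continuous_intros continuous_on_compose2[OF signed_trunc_powr_cont[OF p0(1), of UNIV] vC] utC) auto
  have c2: "continuous_on CU (\<lambda>x. trunc_powr e (p - 1) (v x t) * H x t)" for e
    by (intro continuous_intros continuous_on_compose2[OF trunc_powr_cont[OF p0(2), of UNIV] vC] HC) auto
  have le: "(\<integral>x. signed_trunc_powr e p (v x t) * tder u x t \<partial>LU) \<le> p * (\<integral>x. trunc_powr e (p - 1) (v x t) * H x t \<partial>LU)" if e: "e > 0" for e
  proof -
    note di = div_identity[OF t e p]
    have i1: "integrable LU (\<lambda>x. signed_trunc_powr e p (v x t) * tder u x t)" by (rule intU[OF c1])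
    have i2: "integrable LU (\<lambda>x. p * trunc_powr e (p - 1) (v x t) * (gv x t \<bullet> flux x t))"
      using Bochner_Integration.integrable_diff[OF di(2) i1] by simp
    have "(\<integral>x. signed_trunc_powr e p (v x t) * tder u x t \<partial>LU) = - (\<integral>x. p * trunc_powr e (p - 1) (v x t) * (gv x t \<bullet> flux x t) \<partial>LU)"
      using di(1) i1 i2 by simp
    also have "\<dots> = (\<integral>x. - (p * trunc_powr e (p - 1) (v x t) * (gv x t \<bullet> flux x t)) \<partial>LU)" by simp
    also have "\<dots> \<le> (\<integral>x. p * (trunc_powr e (p - 1) (v x t) * H x t) \<partial>LU)"
    proof (rule integral_mono)
      show "integrable LU (\<lambda>x. - (p * trunc_powr e (p - 1) (v x t) * (gv x t \<bullet> flux x t)))" using i2 by simp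
      show "integrable LU (\<lambda>x. p * (trunc_powr e (p - 1) (v x t) * H x t))" using intU[OF c2] by simp
      fix x assume "x \<in> space LU"
      then have x: "x \<in> U" by simp
      have "p * trunc_powr e (p - 1) (v x t) * (- (flux x t \<bullet> gv x t)) \<le> p * trunc_powr e (p - 1) (v x t) * H x t"
        unfolding H_def using flux_le[OF x t] p by (intro mult_left_mono mult_nonneg_nonneg trunc_powr_nonneg) auto
      then show "- (p * trunc_powr e (p - 1) (v x t) * (gv x t \<bullet> flux x t)) \<le> p * (trunc_powr e (p - 1) (v x t) * H x t)"
        by (simp add: inner_commute mult.assoc)
    qed
    finally show ?thesis by simp
  qed
  have l1: "(\<lambda>n. \<integral>x. signed_trunc_powr (ee n) p (v x t) * tder u x t \<partial>LU) \<longlonglongrightarrow> (\<integral>x. signed_powr p (v x t) * tder u x t \<partial>LU)"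
  proof (rule dct_U[OF c1, where w = "\<lambda>x. rho x t powr p * \<bar>tder u x t\<bar>"])
    show "continuous_on CU (\<lambda>x. signed_powr p (v x t) * tder u x t)"
      by (intro continuous_intros continuous_on_compose2[OF signed_powr_cont[OF p0(1), of UNIV] vC] utC) auto
    show "continuous_on CU (\<lambda>x. rho x t powr p * \<bar>tder u x t\<bar>)"
      using p0 by (intro SC_time[OF _ t] SC_intros SC_powr SC_base) auto
    show "\<bar>signed_trunc_powr (ee n) p (v x t) * tder u x t\<bar> \<le> rho x t powr p * \<bar>tder u x t\<bar>" for n x
      unfolding abs_mult abs_signed_trunc_powr[OF ee(1)] rho_def using trunc_powr_le[of "ee n" p "v x t"] ee(1)[of n] p by (intro mult_right_mono) auto
    show "(\<lambda>n. signed_trunc_powr (ee n) p (v x t) * tder u x t) \<longlonglongrightarrow> signed_powr p (v x t) * tder u x t" for x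
      by (intro tendsto_intros signed_trunc_powr_lim p0)
  qed
  have l2: "(\<lambda>n. \<integral>x. trunc_powr (ee n) (p - 1) (v x t) * H x t \<partial>LU) \<longlonglongrightarrow> (\<integral>x. rho x t powr (p - 1) * H x t \<partial>LU)"
  proof (rule dct_U[OF c2, where w = "\<lambda>x. rho x t powr (p - 1) * \<bar>H x t\<bar>"])
    show "continuous_on CU (\<lambda>x. rho x t powr (p - 1) * H x t)" "continuous_on CU (\<lambda>x. rho x t powr (p - 1) * \<bar>H x t\<bar>)"
      using p0 by (auto intro!: SC_time[OF _ t] SC_intros SC_powr SC_base SH)
    show "\<bar>trunc_powr (ee n) (p - 1) (v x t) * H x t\<bar> \<le> rho x t powr (p - 1) * \<bar>H x t\<bar>" for n x
      unfolding abs_mult rho_def using trunc_powr_le[of "ee n" "p - 1" "v x t"] ee(1)[of n] p trunc_powr_nonneg[of "ee n" "p - 1" "v x t"] by (intro mult_right_mono) auto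
    show "(\<lambda>n. trunc_powr (ee n) (p - 1) (v x t) * H x t) \<longlonglongrightarrow> rho x t powr (p - 1) * H x t" for x
      unfolding rho_def by (intro tendsto_intros trunc_powr_lim p0)
  qed
  show ?thesis unfolding H_def[symmetric]
    by (rule tendsto_le[OF sequentially_bot tendsto_mult_left[OF l2] l1]) (use le[OF ee(1)] in \<open>auto intro: always_eventually\<close>)
qed

definition "Phi al t = (\<integral>x. rho x t powr al \<partial>LU)"

lemma Phi_nn: "0 \<le> Phi al t" unfolding Phi_def by simp

lemma Phi_cont: "al > 0 \<Longrightarrow> continuous_on {0..b} (Phi al)"
  unfolding Phi_def[abs_def]
proof (rule cont_int)
  assume "al > 0"
  have "continuous_on (CU \<times> {0..b}) (\<lambda>z. v (fst z) (snd z))" by (rule continuous_on_subset[OF v_cont0]) auto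
  then show "continuous_on (CU \<times> {0..b}) (\<lambda>z. rho (fst z) (snd z) powr al)"
    unfolding rho_def using \<open>al > 0\<close> by (intro continuous_on_powr' continuous_intros) auto
qed

definition "Phi' al t = al * (\<integral>x. signed_powr (al - 1) (v x t) * vt x t \<partial>LU)"

lemma Phi_deriv:
  assumes al: "al > 2" and a: "0 < c" and t: "t \<in> {c..b}"
  shows "(Phi al has_real_derivative Phi' al t) (at t within {c..b})"
proof -
  have S1: "SC (\<lambda>x t. rho x t powr al)" and S2: "SC (\<lambda>x t. al * (signed_powr (al - 1) (v x t) * vt x t))"
    using al by (auto intro!: SC_intros SC_powr SC_base SC_comp[OF SC_base(3) signed_powr_cont])
  have "((\<lambda>s. \<integral>x. rho x s powr al \<partial>LU) has_real_derivative (\<integral>x. al * (signed_powr (al - 1) (v x t) * vt x t) \<partial>LU)) (at t within {c..b})"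
  proof (rule deriv_int[OF SC_cyl[OF S1 a] SC_cyl[OF S2 a] _ t])
    fix x s assume x: "x \<in> U" and s: "s \<in> {c..b}"
    then have "x \<in> CU" "s > 0" using CU a by auto
    from DERIV_chain2[OF abs_powr_deriv v_deriv(2)[OF this], of al]
    have "((\<lambda>s. \<bar>v x s\<bar> powr al) has_real_derivative al * signed_powr (al - 1) (v x s) * vt x s) (at s)" using al by simp
    then show "((\<lambda>s. rho x s powr al) has_real_derivative al * (signed_powr (al - 1) (v x s) * vt x s)) (at s within {c..b})"
      by (auto simp: rho_def mult.assoc intro: has_field_derivative_at_within)
  qed
  then show ?thesis by (simp add: Phi_def[abs_def] Phi'_def)
qed

text \<open>The case \<open>p = al - 1\<close> of \<open>energy_time\<close>. The term with
  \<open>tder Psi\<close> appears because the equation governs \<open>u\<close> while the energy is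
  that of \<open>v\<close>.\<close>

lemma Phi'_le:
  assumes al: "al > 2" and t: "t > 0"
  shows "Phi' al t \<le> - (al * (al - 1) * (c10 N ab ac / chi) * (\<integral>x. rho x t powr (al - 2) * Iw x t \<partial>LU))
      + al * (al - 1) * (\<integral>x. rho x t powr (al - 2) * Hr x t \<partial>LU) + al * (\<integral>x. rho x t powr (al - 1) * \<bar>tder Psi x t\<bar> \<partial>LU)"
proof -
  have S: "SC (\<lambda>x t. signed_powr (al - 1) (v x t) * tder u x t)" "SC (\<lambda>x t. signed_powr (al - 1) (v x t) * tder Psi x t)"
     "SC (\<lambda>x t. - (signed_powr (al - 1) (v x t) * tder Psi x t))"
     "SC (\<lambda>x t. rho x t powr (al - 1) * \<bar>tder Psi x t\<bar>)" "SC (\<lambda>x t. rho x t powr (al - 2) * Iw x t)" "SC (\<lambda>x t. rho x t powr (al - 2) * Hr x t)"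
    using al by (auto intro!: SC_intros SC_powr SC_base SC_IwHr SC_comp[OF SC_base(3) signed_powr_cont])
  have "(\<integral>x. signed_powr (al - 1) (v x t) * vt x t \<partial>LU) = (\<integral>x. signed_powr (al - 1) (v x t) * tder u x t - signed_powr (al - 1) (v x t) * tder Psi x t \<partial>LU)"
    by (simp add: vt_def right_diff_distrib)
  also have "\<dots> = (\<integral>x. signed_powr (al - 1) (v x t) * tder u x t \<partial>LU) + (\<integral>x. - (signed_powr (al - 1) (v x t) * tder Psi x t) \<partial>LU)"
    using SC_int[OF S(1) t] SC_int[OF S(2) t] by simp
  also have "(\<integral>x. - (signed_powr (al - 1) (v x t) * tder Psi x t) \<partial>LU) \<le> (\<integral>x. rho x t powr (al - 1) * \<bar>tder Psi x t\<bar> \<partial>LU)"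
  proof (rule SC_int_mono[OF S(3,4) t])
    fix x
    have "- (signed_powr (al - 1) (v x t) * tder Psi x t) \<le> \<bar>signed_powr (al - 1) (v x t) * tder Psi x t\<bar>" by linarith
    then show "- (signed_powr (al - 1) (v x t) * tder Psi x t) \<le> rho x t powr (al - 1) * \<bar>tder Psi x t\<bar>"
      by (simp add: abs_mult abs_signed_powr rho_def)
  qed
  also have "(\<integral>x. signed_powr (al - 1) (v x t) * tder u x t \<partial>LU) \<le> (al - 1) * (\<integral>x. rho x t powr (al - 2) * (- (c10 N ab ac / chi * Iw x t) + Hr x t) \<partial>LU)"
    using energy_time[OF t, of "al - 1"] al by (simp add: diff_diff_eq)
  also have "(\<integral>x. rho x t powr (al - 2) * (- (c10 N ab ac / chi * Iw x t) + Hr x t) \<partial>LU)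
     = (\<integral>x. rho x t powr (al - 2) * Hr x t - c10 N ab ac / chi * (rho x t powr (al - 2) * Iw x t) \<partial>LU)"
    by (simp add: algebra_simps)
  also have "\<dots> = (\<integral>x. rho x t powr (al - 2) * Hr x t \<partial>LU) - c10 N ab ac / chi * (\<integral>x. rho x t powr (al - 2) * Iw x t \<partial>LU)"
    using SC_int[OF S(5) t] SC_int[OF S(6) t] by simp
  finally have "(\<integral>x. signed_powr (al - 1) (v x t) * vt x t \<partial>LU) \<le> (al - 1) * ((\<integral>x. rho x t powr (al - 2) * Hr x t \<partial>LU) - c10 N ab ac / chi * (\<integral>x. rho x t powr (al - 2) * Iw x t \<partial>LU))
      + (\<integral>x. rho x t powr (al - 1) * \<bar>tder Psi x t\<bar> \<partial>LU)" by simp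
  then have "Phi' al t \<le> al * ((al - 1) * ((\<integral>x. rho x t powr (al - 2) * Hr x t \<partial>LU) - c10 N ab ac / chi * (\<integral>x. rho x t powr (al - 2) * Iw x t \<partial>LU))
      + (\<integral>x. rho x t powr (al - 1) * \<bar>tder Psi x t\<bar> \<partial>LU))" unfolding Phi'_def using al by (intro mult_left_mono) auto
  then show ?thesis by (simp add: algebra_simps)
qed

end

section \<open>The weighted Sobolev inequality\<close>

lemma epow_ennreal: "0 \<le> r \<Longrightarrow> epow (ennreal r) e = ennreal (r powr e)"
  by (simp add: epow_def)

lemma epow_mono: assumes "x \<le> y" "0 \<le> e" shows "epow x e \<le> epow y e"
proof (cases "y = top")
  case True then show ?thesis by (simp add: epow_def)
next
  case False
  then have "y < top" by (simp add: less_top)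
  then have "x \<noteq> top" "enn2real x \<le> enn2real y" using assms(1) by (auto intro: enn2real_mono)
  then show ?thesis using False assms(2) by (auto simp: epow_def intro!: ennreal_leI powr_mono2)
qed

context bounded_domain begin

lemma nnI_U: assumes "continuous_on CU g" "\<And>x. x \<in> U \<Longrightarrow> 0 \<le> g x"
  shows "nnI U g = ennreal (\<integral>x. g x \<partial>LU)"
proof -
  have "nnI U g = (\<integral>\<^sup>+ x. ennreal (g x) \<partial>LU)"
    unfolding nnI_def using U_open by (subst nn_integral_restrict_space) auto
  also have "\<dots> = ennreal (\<integral>x. g x \<partial>LU)"
    using assms by (intro nn_integral_eq_integral intU AE_I2) auto
  finally show ?thesis .
qed

lemma nnI_UNIV_if: assumes "\<And>x. x \<notin> U \<Longrightarrow> f x = 0" shows "nnI UNIV f = nnI U f"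
  unfolding nnI_def by (intro nn_integral_cong) (use assms in \<open>auto simp: indicator_def\<close>)

lemma nnI_cong: assumes "\<And>x. x \<in> S \<Longrightarrow> f x = g x" shows "nnI S f = nnI S g"
  unfolding nnI_def by (intro nn_integral_cong) (use assms in \<open>auto simp: indicator_def\<close>)

lemma measure_LU: "measure LU (space LU) = measU U"
  using U_open by (simp add: measU_def measure_restrict_space)

lemma measU_nn [simp]: "0 \<le> measU U" by (simp add: measU_def)

end

locale flow_sob = flow +
  fixes rs cbar :: real
  assumes rs: "3 / (5 - a) < rs" "rs < 1" "rs \<ge> 1 / (2 - a)"
    and cbar0: "cbar > 0"
    and sobolev: "\<And>f :: real^3 \<Rightarrow> real. C1_on UNIV f \<Longrightarrow>
         (\<exists>K. compact K \<and> K \<subseteq> U \<and> (\<forall>x. x \<notin> K \<longrightarrow> f x = 0)) \<Longrightarrow>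
         (let qs = rs * (2 - a) in
          epow (nnI UNIV (\<lambda>x. \<bar>f x\<bar> powr (3 * qs / (3 - qs)))) ((3 - qs) / (3 * qs))
            \<le> ennreal cbar * epow (nnI UNIV (\<lambda>x. norm (xgrad (\<lambda>y s. f y) x 0) powr qs)) (1 / qs))"
begin

definition "q = rs * (2 - a)"
definition "ps = 3 * q / (3 - q)"

lemma q_bounds: "1 \<le> q" "q < 2" "q < 3" "0 < q" and rs_pos: "0 < rs" "1/2 < rs"
proof -
  have "3 / 5 \<le> 3 / (5 - a)" using a_bounds by (intro divide_left_mono) auto
  then show "0 < rs" "1/2 < rs" using rs by auto
  have "1 / (2 - a) * (2 - a) \<le> rs * (2 - a)" using rs a_bounds by (intro mult_right_mono) auto
  then show 1: "1 \<le> q" using a_bounds by (simp add: q_def)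
  then show "0 < q" by simp
  have "rs * (2 - a) < 1 * (2 - a)" using rs a_bounds by (intro mult_strict_right_mono) auto
  then have "q < 2 - a" by (simp add: q_def)
  then show "q < 2" "q < 3" using a_bounds by linarith+
qed

lemma ps_pos: "ps > 0" using q_bounds by (simp add: ps_def)

definition "lam = lambda0 a rs"
lemma lam_bounds: "0 < lam" "lam < 1" "lam < (2 - a) / 3"
proof -
  have "3 < rs * (5 - a)" using rs(1) a_bounds by (simp add: pos_divide_less_eq)
  then show "0 < lam" using rs_pos by (simp add: lam_def lambda0_def)
  have "lam = (5 - a) / 3 - 1 / rs" using rs_pos by (simp add: lam_def lambda0_def diff_divide_distrib)
  moreover have "1 / rs > 1" using rs rs_pos by simp
  ultimately show "lam < (2 - a) / 3" by (simp add: field_simps)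
  then show "lam < 1" using a_bounds by simp
qed

text \<open>Links the gain \<open>lam\<close> with the Sobolev exponent: raising the Sobolev
  inequality to the power \<open>2 - a\<close> turns the exponent \<open>1 / ps\<close> of the
  integral into \<open>1 - lam\<close>.\<close>

lemma one_minus_lam: "1 - lam = (2 - a) / ps"
  using rs_pos q_bounds a_bounds by (simp add: lam_def lambda0_def ps_def q_def field_simps)

text \<open>The hypothesis only covers compactly supported functions, which the truncated powers of \<open>v\<close> are.\<close>
lemma sobolev_trunc:
  assumes t: "t > 0" and k: "k > 1" and e: "e > 0"
  shows "(\<integral>x. trunc_powr e k (v x t) powr ps \<partial>LU) powr (1 / ps) \<le> cbar * (\<integral>x. (k * rho x t powr (k - 1) * norm (gv x t)) powr q \<partial>LU) powr (1 / q)"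
proof -
  define K where "K = {x \<in> CU. e \<le> \<bar>v x t\<bar>}"
  have K: "compact K" "K \<subseteq> U" using level_compact[OF t e] by (auto simp: K_def)
  have oK: "open (- K)" using compact_imp_closed[OF K(1)] by (simp add: open_Compl)
  have z: "trunc_powr e k (v x t) = 0" "signed_trunc_powr e (k - 1) (v x t) = 0" if "x \<in> U" "x \<notin> K" for x
    using that CU trunc_powr_zero[of "v x t" e] by (auto simp: K_def)
  define f where "f x = (if x \<in> U then trunc_powr e k (v x t) else 0)" for x
  define w where "w x = (if x \<in> U then (k * signed_trunc_powr e (k - 1) (v x t)) *\<^sub>R gv x t else 0)" for x
  have vC: "continuous_on CU (\<lambda>x. v x t)" and gC: "continuous_on CU (\<lambda>x. gv x t)" using SC_time[OF _ t] SC_base by auto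
  have df: "(f has_derivative (\<lambda>h. w x \<bullet> h)) (at x)" for x
  proof (cases "x \<in> U")
    case True
    then have xC: "x \<in> CU" using CU by auto
    have "((\<lambda>y. trunc_powr e k (v y t)) has_derivative (\<lambda>h. (gv x t \<bullet> h) * (k * signed_trunc_powr e (k - 1) (v x t)))) (at x)"
      by (rule DERIV_compose_FDERIV[OF trunc_powr_deriv[OF k e] v_deriv(1)[OF xC t]])
    then have "((\<lambda>y. trunc_powr e k (v y t)) has_derivative (\<lambda>h. w x \<bullet> h)) (at x)"
      by (rule has_derivative_eq_rhs) (use True in \<open>simp add: w_def fun_eq_iff mult_ac\<close>)
    then show ?thesis by (rule has_derivative_transform_within_open[OF _ U_open True]) (simp add: f_def)
  next
    case False
    then have x: "x \<in> - K" using K by auto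
    have "((\<lambda>y. 0) has_derivative (\<lambda>h. w x \<bullet> h)) (at x)" using False by (simp add: w_def)
    then show ?thesis by (rule has_derivative_transform_within_open[OF _ oK x]) (use z in \<open>auto simp: f_def\<close>)
  qed
  have cw: "continuous_on UNIV w"
  proof -
    have "continuous_on U (\<lambda>x. (k * signed_trunc_powr e (k - 1) (v x t)) *\<^sub>R gv x t)"
      using k by (intro continuous_intros continuous_on_compose2[OF signed_trunc_powr_cont[of "k - 1" UNIV] continuous_on_subset[OF vC CU(2)]] continuous_on_subset[OF gC CU(2)]) auto
    then have "continuous_on U w" by (rule continuous_on_cong[OF refl, THEN iffD1, rotated]) (simp add: w_def)
    moreover have "continuous_on (- K) w"
    proof -
      have "continuous_on (- K) (\<lambda>x. 0 :: real^3)" by simp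
      then show ?thesis by (rule continuous_on_cong[OF refl, THEN iffD1, rotated]) (use z in \<open>auto simp: w_def\<close>)
    qed
    ultimately have "continuous_on (U \<union> - K) w" using U_open oK by (intro continuous_on_open_Un)
    moreover have "U \<union> - K = UNIV" using K by auto
    ultimately show ?thesis by simp
  qed
  have C1: "C1_on UNIV f" unfolding C1_on_def
  proof (intro exI conjI ballI)
    show "continuous_on UNIV (\<lambda>x. blinfun_inner_right (w x))" by (intro continuous_intros cw)
    show "(f has_derivative blinfun_apply (blinfun_inner_right (w x))) (at x)" for x using df[of x] by simp
  qed
  have "\<exists>K. compact K \<and> K \<subseteq> U \<and> (\<forall>x. x \<notin> K \<longrightarrow> f x = 0)" using K z by (intro exI[of _ K]) (auto simp: f_def)
  from sobolev[OF C1 this, unfolded Let_def, folded q_def]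
  have sob: "epow (nnI UNIV (\<lambda>x. \<bar>f x\<bar> powr ps)) (1 / ps) \<le> ennreal cbar * epow (nnI UNIV (\<lambda>x. norm (xgrad (\<lambda>y s. f y) x 0) powr q)) (1 / q)"
    by (simp add: ps_def)
  have xg: "xgrad (\<lambda>y s. f y) x 0 = w x" for x
    using frechet_derivative_at[OF df[of x]] by (simp add: xgrad_def vec_eq_iff inner_axis flip: fun_eq_iff) (metis cart_eq_inner_axis)
  have "nnI UNIV (\<lambda>x. \<bar>f x\<bar> powr ps) = nnI U (\<lambda>x. \<bar>f x\<bar> powr ps)" by (rule nnI_UNIV_if) (auto simp: f_def)
  also have "\<dots> = nnI U (\<lambda>x. trunc_powr e k (v x t) powr ps)" by (rule nnI_cong) (auto simp: f_def trunc_powr_nonneg)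
  also have "\<dots> = ennreal (\<integral>x. trunc_powr e k (v x t) powr ps \<partial>LU)"
    using k ps_pos by (intro nnI_U continuous_on_powr' continuous_intros continuous_on_compose2[OF trunc_powr_cont[of k UNIV] vC]) (auto simp: trunc_powr_nonneg)
  finally have 1: "nnI UNIV (\<lambda>x. \<bar>f x\<bar> powr ps) = ennreal (\<integral>x. trunc_powr e k (v x t) powr ps \<partial>LU)" .
  have cR: "continuous_on CU (\<lambda>x. (k * rho x t powr (k - 1) * norm (gv x t)) powr q)"
    using k q_bounds by (intro SC_time[OF _ t] SC_powr SC_intros SC_base mult_nonneg_nonneg) auto
  have "nnI UNIV (\<lambda>x. norm (xgrad (\<lambda>y s. f y) x 0) powr q) = nnI U (\<lambda>x. norm (w x) powr q)"
    unfolding xg by (rule nnI_UNIV_if) (auto simp: w_def)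
  also have "\<dots> \<le> nnI U (\<lambda>x. (k * rho x t powr (k - 1) * norm (gv x t)) powr q)"
    unfolding nnI_def
  proof (intro nn_integral_mono)
    fix x
    have "\<bar>signed_trunc_powr e (k - 1) (v x t)\<bar> \<le> rho x t powr (k - 1)" unfolding abs_signed_trunc_powr[OF e] rho_def using trunc_powr_le[of e "k - 1" "v x t"] e k by simp
    then have "norm (w x) powr q \<le> (k * rho x t powr (k - 1) * norm (gv x t)) powr q" if "x \<in> U"
      using k that q_bounds by (intro powr_mono2) (auto simp: w_def abs_mult intro!: mult_right_mono mult_left_mono)
    then show "ennreal (norm (w x) powr q) * indicator U x \<le> ennreal ((k * rho x t powr (k - 1) * norm (gv x t)) powr q) * indicator U x"
      by (auto simp: indicator_def intro!: ennreal_leI)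
  qed
  also have "\<dots> = ennreal (\<integral>x. (k * rho x t powr (k - 1) * norm (gv x t)) powr q \<partial>LU)"
    by (rule nnI_U[OF cR]) simp
  finally have 2: "nnI UNIV (\<lambda>x. norm (xgrad (\<lambda>y s. f y) x 0) powr q) \<le> ennreal (\<integral>x. (k * rho x t powr (k - 1) * norm (gv x t)) powr q \<partial>LU)" .
  have "epow (nnI UNIV (\<lambda>x. norm (xgrad (\<lambda>y s. f y) x 0) powr q)) (1 / q) \<le> epow (ennreal (\<integral>x. (k * rho x t powr (k - 1) * norm (gv x t)) powr q \<partial>LU)) (1 / q)"
    by (rule epow_mono[OF 2]) (use q_bounds in simp)
  then have "ennreal cbar * epow (nnI UNIV (\<lambda>x. norm (xgrad (\<lambda>y s. f y) x 0) powr q)) (1 / q)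
     \<le> ennreal cbar * ennreal ((\<integral>x. (k * rho x t powr (k - 1) * norm (gv x t)) powr q \<partial>LU) powr (1 / q))"
    by (subst (asm) epow_ennreal) (auto intro!: mult_left_mono Bochner_Integration.integral_nonneg)
  note le2 = order_trans[OF sob this]
  have "ennreal ((\<integral>x. trunc_powr e k (v x t) powr ps \<partial>LU) powr (1 / ps)) \<le> ennreal cbar * ennreal ((\<integral>x. (k * rho x t powr (k - 1) * norm (gv x t)) powr q \<partial>LU) powr (1 / q))"
    using le2 unfolding 1 by (subst (asm) epow_ennreal) (auto intro!: Bochner_Integration.integral_nonneg)
  then show ?thesis using cbar0 by (simp flip: ennreal_mult)
qed

lemma sobolev_rho:
  assumes t: "t > 0" and k: "k > 1"
  shows "(\<integral>x. rho x t powr (k * ps) \<partial>LU) powr (1 / ps) \<le> cbar * (\<integral>x. (k * rho x t powr (k - 1) * norm (gv x t)) powr q \<partial>LU) powr (1 / q)"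
proof -
  have vC: "continuous_on CU (\<lambda>x. v x t)" using SC_time[OF _ t] SC_base by auto
  have "(\<lambda>n. \<integral>x. trunc_powr (ee n) k (v x t) powr ps \<partial>LU) \<longlonglongrightarrow> (\<integral>x. rho x t powr (k * ps) \<partial>LU)"
  proof (rule dct_U[where w = "\<lambda>x. rho x t powr (k * ps)"])
    show "continuous_on CU (\<lambda>x. trunc_powr (ee n) k (v x t) powr ps)" for n
      using k ps_pos by (intro continuous_on_powr' continuous_intros continuous_on_compose2[OF trunc_powr_cont[of k UNIV] vC]) (auto simp: trunc_powr_nonneg)
    show "continuous_on CU (\<lambda>x. rho x t powr (k * ps))" "continuous_on CU (\<lambda>x. rho x t powr (k * ps))"
      using k ps_pos by (intro SC_time[OF _ t] SC_powr SC_base; simp)+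
    fix x
    show "\<bar>trunc_powr (ee n) k (v x t) powr ps\<bar> \<le> rho x t powr (k * ps)" for n
      using powr_mono2[OF less_imp_le[OF ps_pos] trunc_powr_nonneg trunc_powr_le[of "ee n" k "v x t"]] ee(1)[of n] k by (simp add: rho_def powr_powr)
    have "(\<lambda>n. trunc_powr (ee n) k (v x t) powr ps) \<longlonglongrightarrow> (\<bar>v x t\<bar> powr k) powr ps"
      using k ps_pos by (intro tendsto_powr' trunc_powr_lim tendsto_const) (auto simp: trunc_powr_nonneg)
    then show "(\<lambda>n. trunc_powr (ee n) k (v x t) powr ps) \<longlonglongrightarrow> rho x t powr (k * ps)" by (simp add: rho_def powr_powr)
  qed
  then have "(\<lambda>n. (\<integral>x. trunc_powr (ee n) k (v x t) powr ps \<partial>LU) powr (1 / ps)) \<longlonglongrightarrow> (\<integral>x. rho x t powr (k * ps) \<partial>LU) powr (1 / ps)"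
    using ps_pos by (intro tendsto_powr' tendsto_const) auto
  then show ?thesis by (rule tendsto_upperbound) (use sobolev_trunc[OF t k ee(1)] in \<open>auto intro: always_eventually\<close>)
qed

definition "Ia al t = (\<integral>x. rho x t powr (al - 2) * Iw x t \<partial>LU)"
text \<open>Determined by \<open>pe * (1 - rs) = 2 * rs\<close>, so that Hoelder turns the inverse
  of the degenerate weight into the power \<open>pe\<close>.\<close>

definition "pe = 2 * rs / (1 - rs)"
definition "JJ t = (\<integral>x. (1 + rho x t + Pa x t) powr pe \<partial>LU) powr (1 / pe)"
definition "NP t = (\<integral>x. Pa x t powr pe \<partial>LU) powr (1 / pe)"
definition "Csob al = (cbar * (al - a) / (2 - a)) powr (2 - a)"

lemma pe_pos: "pe > 2" "pe \<ge> 1" "pe > 0"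
proof -
  show "pe > 2" using rs rs_pos by (simp add: pe_def field_simps)
  then show "pe \<ge> 1" "pe > 0" by auto
qed

lemma S_SC: "SC (\<lambda>x t. (1 + rho x t + Pa x t) powr r)"
  by (rule SC_powr_pos) (intro SC_intros SC_base one_Pa_pos)+

lemma Ia_nn: "0 \<le> Ia al t" unfolding Ia_def Iw_def by (intro Bochner_Integration.integral_nonneg) auto

text \<open>Sobolev's inequality for the power \<open>k\<close> of \<open>rho\<close>, where
  \<open>(k - 1) * (2 - a) = al - 2\<close> makes the gradient term match the dissipation. Inserting
  the weight and its inverse, Hoelder with exponents \<open>1 / rs\<close> and
  \<open>1 / (1 - rs)\<close> splits off the norm \<open>JJ\<close>.\<close>

lemma sobolev_weighted:
  assumes t: "t > 0" and al: "al > 2"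
  shows "(\<integral>x. rho x t powr ((al - a) / (2 - a) * ps) \<partial>LU) powr (1 - lam) \<le> Csob al * Ia al t * (JJ t)\<^sup>2"
proof -
  define k where "k = (al - a) / (2 - a)"
  have k: "k > 1" using al a_bounds by (simp add: k_def)
  have k2: "(k - 1) * (2 - a) = al - 2" using a_bounds by (simp add: k_def field_simps)
  define I where "I = (\<integral>x. rho x t powr (al - 2) * Iw x t \<partial>LU)"
  define J where "J = (\<integral>x. (1 + rho x t + Pa x t) powr pe \<partial>LU)"
  have I0: "I \<ge> 0" "J \<ge> 0" by (auto simp: I_def J_def Iw_def intro!: Bochner_Integration.integral_nonneg)
  have S1: "SC (\<lambda>x t. rho x t powr (al - 2) * Iw x t)" using al by (intro SC_intros SC_powr SC_base SC_IwHr) auto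
  have eq: "(k * rho x t powr (k - 1) * norm (gv x t)) powr q = k powr q * ((rho x t powr (al - 2) * Iw x t) powr rs * ((1 + rho x t + Pa x t) powr pe) powr (1 - rs))" for x
  proof -
    have "(rho x t powr (al - 2) * Iw x t) powr rs = rho x t powr ((al - 2) * rs) * ((1 + rho x t + Pa x t) powr (-2 * rs) * norm (gv x t) powr q)"
      by (simp add: Iw_def powr_mult powr_powr q_def mult.commute)
    moreover have "((1 + rho x t + Pa x t) powr pe) powr (1 - rs) = (1 + rho x t + Pa x t) powr (2 * rs)"
      using rs by (simp add: powr_powr pe_def)
    moreover have "(1 + rho x t + Pa x t) powr (-2 * rs) * (1 + rho x t + Pa x t) powr (2 * rs) = 1"
      using powr_add[of "1 + rho x t + Pa x t" "-2 * rs" "2 * rs"] one_Pa_pos(2)[of x t] by simp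
    moreover have "(k - 1) * q = (al - 2) * rs" using k2 by (simp add: q_def mult.commute mult.assoc[symmetric])
    then have "(k * rho x t powr (k - 1) * norm (gv x t)) powr q = k powr q * rho x t powr ((al - 2) * rs) * norm (gv x t) powr q"
      using k by (simp add: powr_mult powr_powr)
    moreover have "k powr q * (rho x t powr ((al - 2) * rs) * ((1 + rho x t + Pa x t) powr (-2 * rs) * norm (gv x t) powr q) * (1 + rho x t + Pa x t) powr (2 * rs))
       = k powr q * rho x t powr ((al - 2) * rs) * norm (gv x t) powr q * ((1 + rho x t + Pa x t) powr (-2 * rs) * (1 + rho x t + Pa x t) powr (2 * rs))"
      by (simp only: mult_ac)
    ultimately show ?thesis by (simp only: mult_1_right)
  qed
  have h: "(\<integral>x. (rho x t powr (al - 2) * Iw x t) powr rs * ((1 + rho x t + Pa x t) powr pe) powr (1 - rs) \<partial>LU) \<le> I powr rs * J powr (1 - rs)"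
    unfolding I_def J_def using rs rs_pos by (intro holder_theta SC_int[OF S1 t] SC_int[OF S_SC t]) (auto simp: Iw_def)
  have "(\<integral>x. rho x t powr (k * ps) \<partial>LU) powr (1 / ps) \<le> cbar * (\<integral>x. (k * rho x t powr (k - 1) * norm (gv x t)) powr q \<partial>LU) powr (1 / q)"
    by (rule sobolev_rho[OF t k])
  also have "\<dots> \<le> cbar * (k powr q * (I powr rs * J powr (1 - rs))) powr (1 / q)"
    unfolding eq using h cbar0 q_bounds by (intro mult_left_mono powr_mono2) (auto intro!: mult_left_mono Bochner_Integration.integral_nonneg mult_nonneg_nonneg)
  also have "\<dots> = cbar * k * (I powr (rs / q) * J powr ((1 - rs) / q))"
    using k q_bounds I0 by (simp add: powr_mult powr_powr)
  finally have "((\<integral>x. rho x t powr (k * ps) \<partial>LU) powr (1 / ps)) powr (2 - a) \<le> (cbar * k * (I powr (rs / q) * J powr ((1 - rs) / q))) powr (2 - a)"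
    using a_bounds by (intro powr_mono2) auto
  also have "\<dots> = (cbar * k) powr (2 - a) * (I powr (rs / q * (2 - a)) * J powr ((1 - rs) / q * (2 - a)))"
    using k cbar0 I0 by (simp add: powr_mult powr_powr)
  also have "rs / q * (2 - a) = 1" using rs_pos a_bounds by (simp add: q_def)
  also have "(1 - rs) / q * (2 - a) = 1 / pe * 2"
  proof -
    have "(1 - rs) / q * (2 - a) = (1 - rs) / rs" using a_bounds by (simp add: q_def)
    also have "\<dots> = 1 / pe * 2" using rs_pos rs by (simp add: pe_def divide_simps)
    finally show ?thesis .
  qed
  also have "J powr (1 / pe * 2) = (JJ t)\<^sup>2" by (simp only: powr_powr[symmetric]) (simp add: JJ_def J_def powr_numeral)
  finally show ?thesis using I0 unfolding Csob_def Ia_def I_def[symmetric] one_minus_lam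
    by (simp add: powr_powr k_def[symmetric] mult.assoc) (simp add: k_def)
qed

text \<open>Hoelder between the exponent \<open>al\<close> and the Sobolev exponent
  \<open>s\<close>, for which \<open>(1 - lam) * s = al - a\<close>. The case \<open>th = 1\<close>
  is the parabolic gain; a smaller \<open>th\<close> keeps a sublinear power of the dissipation that
  can be absorbed.\<close>

lemma interp_main:
  assumes t: "t > 0" and al: "al > 2" and th: "0 \<le> th" "th \<le> 1"
  shows "(\<integral>x. rho x t powr (al + th * (al * lam - a)) \<partial>LU) \<le> Phi al t powr (1 - th * (1 - lam)) * (Csob al * Ia al t * (JJ t)\<^sup>2) powr th"
proof -
  define s where "s = (al - a) / (2 - a) * ps"
  have s: "s > 0" "(1 - lam) * s = al - a" using al a_bounds ps_pos by (auto simp: s_def one_minus_lam)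
  define y where "y = th * (1 - lam)"
  have "th * (1 - lam) \<le> 1 * 1" using th lam_bounds by (intro mult_mono) auto
  then have y: "0 \<le> y" "y \<le> 1" using th lam_bounds by (auto simp: y_def)
  have "th * ((1 - lam) * s) = th * (al - a)" by (simp only: s)
  then have ys: "y * s = th * (al - a)" by (simp add: y_def)
  have e: "al + th * (al * lam - a) = al * (1 - y) + s * y" using ys by (simp add: y_def algebra_simps)
  have eq: "rho x t powr (al + th * (al * lam - a)) = (rho x t powr al) powr (1 - y) * (rho x t powr s) powr (1 - (1 - y))" for x
    unfolding e by (simp add: powr_add powr_powr)
  have "(\<integral>x. rho x t powr (al + th * (al * lam - a)) \<partial>LU) \<le> (\<integral>x. rho x t powr al \<partial>LU) powr (1 - y) * (\<integral>x. rho x t powr s \<partial>LU) powr (1 - (1 - y))"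
    unfolding eq using y al s by (intro holder_theta SC_int[OF _ t] SC_powr SC_base) auto
  also have "(\<integral>x. rho x t powr s \<partial>LU) powr (1 - (1 - y)) = ((\<integral>x. rho x t powr s \<partial>LU) powr (1 - lam)) powr th"
    by (simp add: powr_powr y_def mult.commute)
  also have "(\<integral>x. rho x t powr al \<partial>LU) powr (1 - y) * \<dots> \<le> (\<integral>x. rho x t powr al \<partial>LU) powr (1 - y) * (Csob al * Ia al t * (JJ t)\<^sup>2) powr th"
    using sobolev_weighted[OF t al] th unfolding s_def[symmetric] by (intro mult_left_mono powr_mono2) auto
  finally show ?thesis unfolding Phi_def y_def by simp
qed

text \<open>Minkowski separates the solution from the data. Since \<open>U\<close> has finite
  measure, \<open>be >= pe\<close> allows the norm of \<open>rho\<close> to be raised to the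
  exponent \<open>be\<close>.\<close>

lemma JJ_le:
  assumes t: "t > 0" and be: "be \<ge> pe"
  shows "JJ t \<le> Phi be t powr (1 / be) * measU U powr (1 / pe - 1 / be) + measU U powr (1 / pe) + NP t"
proof -
  have be0: "be > 0" using be pe_pos by simp
  have S: "SC (\<lambda>x t. rho x t powr pe)" "SC (\<lambda>x t. (1 + Pa x t) powr pe)" "SC (\<lambda>x t. Pa x t powr pe)" "SC (\<lambda>x t. 1 :: real)" "SC (\<lambda>x t. 1 + Pa x t)" "SC (\<lambda>x t. rho x t powr be)"
  proof -
    show o: "SC (\<lambda>x t. 1 + Pa x t)" by (intro SC_intros SC_base)
    show "SC (\<lambda>x t. (1 + Pa x t) powr pe)" by (rule SC_powr_pos[OF o one_Pa_pos(1)])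
    show "SC (\<lambda>x t. 1 :: real)" by (rule SC_intros)
  qed (use pe_pos be0 in \<open>auto intro!: SC_powr SC_base SC_intros(1)\<close>)
  note m = borel_measurable_integrable[OF SC_int[OF _ t]]
  have hm: "(\<integral>x. rho x t powr pe \<partial>LU) \<le> Phi be t powr (pe / be) * measU U powr (1 - pe / be)"
    unfolding Phi_def measure_LU[symmetric]
  proof (rule holder_measure(2)[OF fin_LU])
    show "integrable LU (\<lambda>x. rho x t powr be)" by (rule SC_int[OF S(6) t])
    show "(\<lambda>x. rho x t) \<in> borel_measurable LU" by (rule m[OF SC_base(7)])
  qed (use pe_pos be be0 in auto)
  have "JJ t = (\<integral>x. (rho x t + (1 + Pa x t)) powr pe \<partial>LU) powr (1 / pe)" by (simp add: JJ_def add_ac)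
  also have "\<dots> \<le> (\<integral>x. rho x t powr pe \<partial>LU) powr (1 / pe) + (\<integral>x. (1 + Pa x t) powr pe \<partial>LU) powr (1 / pe)"
    using pe_pos one_Pa_pos less_imp_le by (intro minkowski_powr SC_int[OF _ t] S m SC_base) auto
  also have "(\<integral>x. (1 + Pa x t) powr pe \<partial>LU) powr (1 / pe) \<le> (\<integral>x. 1 powr pe \<partial>LU) powr (1 / pe) + (\<integral>x. Pa x t powr pe \<partial>LU) powr (1 / pe)"
    using pe_pos by (intro minkowski_powr SC_int[OF _ t] m S SC_base) (auto intro: SC_intros(1))
  also have "(\<integral>x. 1 powr pe \<partial>LU) = measU U" using measure_LU by simp
  also have "(\<integral>x. rho x t powr pe \<partial>LU) powr (1 / pe) \<le> (Phi be t powr (pe / be) * measU U powr (1 - pe / be)) powr (1 / pe)"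
    using hm pe_pos by (intro powr_mono2) auto
  also have "\<dots> = Phi be t powr (1 / be) * measU U powr (1 / pe - 1 / be)"
  proof -
    have "(1 - pe / be) * (1 / pe) = 1 / pe - 1 / be" using pe_pos be0 by (simp add: divide_simps)
    moreover have "pe / be * (1 / pe) = 1 / be" using pe_pos by simp
    ultimately show ?thesis by (simp only: powr_mult powr_powr Phi_nn powr_ge_zero)
  qed
  finally show ?thesis by (simp add: NP_def)
qed

end

section \<open>Growth of the energy\<close>

lemma young_exp:
  fixes X Y :: real
  assumes "0 \<le> X" "0 \<le> Y" "0 < m" "0 < n" "0 \<le> p" "0 \<le> r" "p / m + r / n = 1"
  shows "X powr p * Y powr r \<le> X powr m + Y powr n"
proof -
  have "0 \<le> r / n" "0 \<le> p / m" using assms by auto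
  then have t: "0 \<le> p / m" "p / m \<le> 1" using assms(7) by linarith+
  have e: "m * (p / m) = p" "n * (1 - p / m) = r"
  proof -
    have "1 - p / m = r / n" using assms(7) by simp
    then show "n * (1 - p / m) = r" using assms(4) by simp
  qed (use assms in simp)
  have "(X powr m) powr (p / m) * (Y powr n) powr (1 - p / m) \<le> p / m * X powr m + (1 - p / m) * Y powr n"
    by (rule young_theta[OF t]) auto
  also have "\<dots> \<le> 1 * X powr m + 1 * Y powr n" using t by (intro add_mono mult_right_mono) auto
  finally show ?thesis by (simp only: powr_powr e mult_1)
qed

lemma young_absorb:
  fixes K I eps :: real
  assumes "0 \<le> K" "0 \<le> I" "0 < eps" "0 < th" "th < 1"
  shows "K * I powr th \<le> eps * I + K powr (1 / (1 - th)) * eps powr (- (th / (1 - th)))"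
proof -
  \<comment> \<open>The value for which the geometric mean of \<open>eps * I\<close> and
    \<open>y\<close> with weights \<open>th\<close> and \<open>1 - th\<close> is
    \<open>K * I powr th\<close>.\<close>
  define y where "y = K powr (1 / (1 - th)) * eps powr (- (th / (1 - th)))"
  have y0: "0 \<le> y" by (simp add: y_def)
  have "(eps * I) powr th * y powr (1 - th) \<le> th * (eps * I) + (1 - th) * y"
    using assms y0 by (intro young_theta) auto
  also have "\<dots> \<le> 1 * (eps * I) + 1 * y" using assms y0 by (intro add_mono mult_right_mono) auto
  also have "(eps * I) powr th * y powr (1 - th) = K * I powr th"
  proof -
    have "y powr (1 - th) = K * eps powr (- th)"
      using assms by (simp add: y_def powr_mult powr_powr)
    then show ?thesis using assms by (simp add: powr_mult powr_cancel_mult mult_ac)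
  qed
  finally show ?thesis by (simp add: y_def)
qed

lemma powr_add_le_pow: fixes x y :: real assumes "0 \<le> x" "0 \<le> y" "0 \<le> r" shows "(x + y) powr r \<le> 2 powr r * (x powr r + y powr r)"
proof -
  have "(x + y) powr r \<le> (2 * max x y) powr r" using assms by (intro powr_mono2) (auto simp: max_def)
  also have "\<dots> = 2 powr r * max x y powr r" using assms by (simp add: powr_mult)
  also have "\<dots> \<le> 2 powr r * (x powr r + y powr r)" by (intro mult_left_mono) (auto simp: max_def)
  finally show ?thesis .
qed

context forchheimer begin
lemma c13_pos: "c13 N ab ac > 0" using c11_pos c12_pos by (simp add: c13_def)
end

locale flow_al = flow_sob +
  fixes al :: real
  assumes al2: "al > 2" and al_pe: "al \<ge> pe" and al_lam: "al * lam > 4 - 3 * a"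
begin

definition "th = thetaA a rs al"
definition "ex = th / (1 - th)"
definition "m = al + 4 * (1 - a)"
definition "gam = gammaA a rs al"
definition "mub = mubarA a rs al"
definition "Cst = Cstar N ab ac rs al cbar U"

text \<open>\<open>th\<close> is the interpolation parameter that reaches
  \<open>al + 4 * (1 - a)\<close>, the highest power of \<open>rho\<close> in the energy inequality.
  The condition \<open>al * lam > 4 - 3 * a\<close> says \<open>th < 1\<close>.\<close>

lemma th_eq: "th = 4 * (1 - a) / (al * lam - a)"
proof -
  have "al * lam - a = (al * ((5 - a) * rs - 3) - 3 * a * rs) / (3 * rs)"
    using rs_pos by (simp add: lam_def lambda0_def field_simps)
  then show ?thesis using rs_pos by (simp add: th_def thetaA_def)
qed

lemma th_bounds: "0 < th" "th < 1"
  using al_lam a_bounds by (auto simp: th_eq pos_divide_less_eq)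

lemma th_mult: "th * (al * lam - a) = 4 * (1 - a)"
  using al_lam a_bounds by (simp add: th_eq)

lemma ex_pos: "0 < ex" and ex1: "1 / (1 - th) = 1 + ex"
  using th_bounds by (auto simp: ex_def field_simps)

text \<open>The surplus over linear growth in \<open>Phi'_Er\<close>: \<open>ex * lam\<close> comes
  from the energy factor of the interpolation, \<open>2 * ex / al\<close> from the energy inside
  \<open>JJ\<close>.\<close>

lemma gam_eq: "gam = ex * lam + 2 * ex / al"
proof -
  have "muA a rs al / al = ex * lam"
  proof -
    have "4 * (1 - a) + a * th = th * al * lam" using th_mult by (simp add: algebra_simps)
    then show ?thesis using al2 by (simp add: muA_def ex_def th_def[symmetric])
  qed
  moreover have "2 * th / (al * (1 - th)) = 2 * ex / al" by (simp add: ex_def mult.commute)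
  ultimately show ?thesis by (simp add: gam_def gammaA_def th_def[symmetric])
qed

lemma gam_pos: "gam > 0" using gam_eq ex_pos lam_bounds al2 by (simp add: add_pos_pos)

text \<open>Used in \<open>small_time\<close>, where the factor \<open>1 - a\<close> must
  survive.\<close>

lemma gam_ge: "gam \<ge> 4 * (1 - a) / al"
proof -
  have "ex \<ge> th" using th_bounds by (simp add: ex_def pos_le_divide_eq mult_le_cancel_left1)
  then have "ex * lam \<ge> th * lam" using lam_bounds by simp
  moreover have "al * (th * lam) \<ge> 4 * (1 - a)" using th_mult th_bounds a_bounds by (simp add: algebra_simps)
  then have "th * lam \<ge> 4 * (1 - a) / al" using al2 by (simp add: pos_divide_le_eq mult.commute)
  moreover have "0 \<le> 2 * ex / al" using ex_pos al2 by simp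
  ultimately show ?thesis unfolding gam_eq by linarith
qed

lemma mub_eq: "mub = (3 - 2 * a + th) / (1 - th)" by (simp add: mub_def mubarA_def th_def)
lemma mub_ge: "mub \<ge> 3 - 2 * a"
proof -
  have "(3 - 2 * a) * (1 - th) \<le> 3 - 2 * a + th" using th_bounds a_bounds by (simp add: algebra_simps mult_nonneg_nonneg)
  then show ?thesis using th_bounds by (simp add: mub_eq pos_le_divide_eq)
qed

lemma m_pos: "m > 2" using al2 a_bounds by (simp add: m_def)

text \<open>\<open>Efun\<close> as a real number, legitimate at positive times where all data
  integrals are finite.\<close>

definition "Er t = chi powr mub * (1 + NP t powr (2 * ex)) + chi powr (3 - 2 * a) * (\<integral>x. Pa x t powr m \<partial>LU)
   + chi powr (1 - a) * (\<integral>x. norm (gP x t) powr (m / 2) \<partial>LU)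
   + chi powr (- ((3 - 2 * a) * (al - 1) / (5 - 4 * a))) * (\<integral>x. \<bar>tder Psi x t\<bar> powr (m / (5 - 4 * a)) \<partial>LU)"

definition "Rt x t = c13 N ab ac * chi powr (3 - 2*a) * rho x t powr m + c14 N ab ac * chi powr (3 - 2*a) * (1 + Pa x t) powr m
   + c14 N ab ac * chi powr (1 - a) * norm (gP x t) powr (m / 2) + c11 N ab ac
   + chi powr (- ((3 - 2 * a) * (al - 1) / (5 - 4 * a))) * \<bar>tder Psi x t\<bar> powr (m / (5 - 4 * a))"

lemma chi_pos: "chi > 0" using chi_ge(1) by simp

text \<open>Young's inequality separates every product. The exponents are forced by homogeneity: if
  \<open>rho\<close> and \<open>Pa\<close> have degree 1, then \<open>m\<close> is the top degree, a
  power \<open>2 - a\<close> of the gradient counts twice, and \<open>tder Psi\<close> has degree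
  \<open>5 - 4 * a\<close>.\<close>

lemma pointwise:
  "rho x t powr (al - 2) * Hr x t + 1 / (al - 1) * (rho x t powr (al - 1) * \<bar>tder Psi x t\<bar>) \<le> Rt x t"
proof -
  define r P G where "r = rho x t" and "P = 1 + Pa x t" and "G = norm (gP x t)"
  have nn: "0 \<le> r" "1 \<le> P" "0 \<le> G" using Pa_nn[of x t] by (auto simp: r_def P_def G_def)
  note ab = a_bounds
  have mm: "0 < m" "0 < m / 2" "al - 2 + (2 - 2*a) = al - 2 * a" "al - 2 + (6 - 4*a) = m" using m_pos by (auto simp: m_def)
  have t0: "r powr (al - 2) \<le> 1 + r powr m" using nn al2 ab by (intro powr_le_one_add) (auto simp: m_def)
  have e1: "(al - 2 * a) / m + (2 - a) / (m / 2) = 1" using mm by (simp add: m_def flip: add_divide_distrib)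
  have t1: "r powr (al - 2 * a) * G powr (2 - a) \<le> r powr m + G powr (m / 2)"
    using nn mm al2 ab e1 by (intro young_exp) auto
  have t2': "P powr (al - 2 * a) * G powr (2 - a) \<le> P powr m + G powr (m / 2)"
    using nn mm al2 ab e1 by (intro young_exp) auto
  have t2: "r powr (al - 2) * P powr (2 - 2*a) \<le> r powr (al - 2*a) + P powr (al - 2*a)"
  proof (rule young_exp)
    show "(al - 2) / (al - 2 * a) + (2 - 2 * a) / (al - 2 * a) = 1" using al2 ab by (simp flip: add_divide_distrib)
  qed (use nn al2 ab in auto)
  have t4: "r powr (al - 2) * P powr (6 - 4*a) \<le> r powr m + P powr m"
  proof (rule young_exp)
    show "(al - 2) / m + (6 - 4 * a) / m = 1" using mm by (simp add: m_def flip: add_divide_distrib)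
  qed (use nn al2 ab mm in auto)
  have s1: "r powr (al - 2) * r powr (2 - 2*a) = r powr (al - 2*a)" "r powr (al - 2) * r powr (6 - 4*a) = r powr m"
    unfolding powr_add[symmetric] mm by auto
  have t5: "r powr (al - 1) * \<bar>tder Psi x t\<bar> \<le> chi powr (3 - 2*a) * r powr m + chi powr (- ((3 - 2 * a) * (al - 1) / (5 - 4 * a))) * \<bar>tder Psi x t\<bar> powr (m / (5 - 4 * a))"
  proof -
    \<comment> \<open>The powers of \<open>chi\<close> cancel in the product; they are chosen so
      that the term in \<open>rho\<close> gets the coefficient \<open>chi powr (3 - 2 * a)\<close>
      it has elsewhere, at the price of a negative power on \<open>tder Psi\<close>.\<close>
    define X Y where "X = chi powr ((3 - 2*a) / m) * r" and "Y = chi powr (- ((3 - 2*a) * (al - 1) / m)) * \<bar>tder Psi x t\<bar>"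
    have "X powr (al - 1) * Y powr 1 \<le> X powr m + Y powr (m / (5 - 4*a))"
    proof (rule young_exp)
      show "(al - 1) / m + 1 / (m / (5 - 4 * a)) = 1" using mm by (simp add: m_def flip: add_divide_distrib)
    qed (use nn al2 ab mm chi_pos in \<open>auto simp: X_def Y_def\<close>)
    moreover have "X powr (al - 1) * Y powr 1 = r powr (al - 1) * \<bar>tder Psi x t\<bar>"
    proof -
      have "X powr (al - 1) * Y powr 1 = (chi powr ((3 - 2*a) * (al - 1) / m) * chi powr (- ((3 - 2*a) * (al - 1) / m))) * (r powr (al - 1) * \<bar>tder Psi x t\<bar>)"
        using nn chi_pos by (simp add: X_def Y_def powr_mult powr_powr)
      then show ?thesis using chi_pos by (simp add: powr_cancel_mult)
    qed
    moreover have "X powr m = chi powr (3 - 2*a) * r powr m" using nn mm by (simp add: X_def powr_mult powr_powr)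
    moreover have "Y powr (m / (5 - 4*a)) = chi powr (- ((3 - 2 * a) * (al - 1) / (5 - 4 * a))) * \<bar>tder Psi x t\<bar> powr (m / (5 - 4 * a))"
      using mm by (simp add: Y_def powr_mult powr_powr)
    ultimately show ?thesis by simp
  qed
  define C1 C2 where "C1 = chi powr (1 - a)" and "C2 = chi powr (3 - 2*a)"
  have C: "1 \<le> C1" "C1 \<le> C2" "1 \<le> C2" using chi_ge(1) ab by (auto simp: C1_def C2_def intro!: powr_mono powr_ge_one)
  define R Q G2 where "R = r powr m" and "Q = P powr m" and "G2 = G powr (m / 2)"
  have RQ: "0 \<le> R" "0 \<le> Q" "0 \<le> G2" by (auto simp: R_def Q_def G2_def)
  define k11 k12 where "k11 = c11 N ab ac" and "k12 = c12 N ab ac"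
  have k: "0 < k11" "0 < k12" using c11_pos c12_pos by (auto simp: k11_def k12_def)
  have "r powr (al - 2) * Hr x t = k11 * r powr (al - 2) + 3/4 * k12 * C1 * (r powr (al - 2) * r powr (2 - 2*a) * G powr (2 - a) + (r powr (al - 2) * P powr (2 - 2*a)) * G powr (2 - a))
     + 3/2 * k12 * C2 * (r powr (al - 2) * r powr (6 - 4*a) + r powr (al - 2) * P powr (6 - 4*a))"
    by (simp add: Hr_def r_def P_def G_def C1_def C2_def k11_def k12_def algebra_simps)
  also have "\<dots> \<le> k11 * (1 + R) + 3/4 * k12 * C1 * ((R + G2) + ((R + G2) + (Q + G2))) + 3/2 * k12 * C2 * (R + (R + Q))"
  proof (intro add_mono mult_left_mono)
    have "(r powr (al - 2) * P powr (2 - 2*a)) * G powr (2 - a) \<le> (r powr (al - 2*a) + P powr (al - 2*a)) * G powr (2 - a)"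
      by (rule mult_right_mono[OF t2]) simp
    then show "(r powr (al - 2) * P powr (2 - 2*a)) * G powr (2 - a) \<le> (R + G2) + (Q + G2)"
      using t1 t2' by (simp add: R_def Q_def G2_def distrib_right)
  qed (use t0 t1 t4 s1 k C in \<open>auto simp: R_def Q_def G2_def\<close>)
  also have "\<dots> = k11 + k11 * R + 3/2 * k12 * (C1 * R) + 9/4 * k12 * (C1 * G2) + 3/4 * k12 * (C1 * Q) + 3 * k12 * (C2 * R) + 3/2 * k12 * (C2 * Q)"
    by (simp add: algebra_simps add_divide_distrib)
  also have "\<dots> \<le> k11 + k11 * (C2 * R) + 3/2 * k12 * (C2 * R) + 9/4 * k12 * (C1 * G2) + 3/4 * k12 * (C2 * Q) + 3 * k12 * (C2 * R) + 3/2 * k12 * (C2 * Q)"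
    using C RQ k by (intro add_mono mult_left_mono order_refl mult_right_mono) (auto simp: mult_le_cancel_right1)
  finally have 1: "r powr (al - 2) * Hr x t \<le> k11 + (k11 + 9/2 * k12) * (C2 * R) + 9/4 * k12 * (C1 * G2) + 9/4 * k12 * (C2 * Q)"
    by (simp add: algebra_simps)
  define W where "W = chi powr (- ((3 - 2 * a) * (al - 1) / (5 - 4 * a))) * \<bar>tder Psi x t\<bar> powr (m / (5 - 4 * a))"
  have W0: "0 \<le> W" by (simp add: W_def)
  have "1 / (al - 1) * (r powr (al - 1) * \<bar>tder Psi x t\<bar>) \<le> 1 * (r powr (al - 1) * \<bar>tder Psi x t\<bar>)"
    using al2 by (intro mult_right_mono) auto
  then have 2: "1 / (al - 1) * (r powr (al - 1) * \<bar>tder Psi x t\<bar>) \<le> C2 * R + W"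
    using t5 by (simp add: C2_def R_def W_def)
  have 3: "Rt x t = (5 * k12 + 2 * k11 + 1) * (C2 * R) + (4 * k12 + k11) * (C2 * Q) + (4 * k12 + k11) * (C1 * G2) + k11 + W"
    by (simp add: Rt_def c13_def c14_def k11_def k12_def C1_def C2_def R_def Q_def G2_def r_def P_def G_def W_def mult.assoc)
  have "(k11 + 9/2 * k12) * (C2 * R) + C2 * R \<le> (5 * k12 + 2 * k11 + 1) * (C2 * R)"
  proof -
    have "(k11 + 9/2 * k12 + 1) * (C2 * R) \<le> (5 * k12 + 2 * k11 + 1) * (C2 * R)" using k C RQ by (intro mult_right_mono) auto
    then show ?thesis by (simp add: algebra_simps)
  qed
  moreover have "9/4 * k12 * (C1 * G2) \<le> (4 * k12 + k11) * (C1 * G2)" "9/4 * k12 * (C2 * Q) \<le> (4 * k12 + k11) * (C2 * Q)"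
  proof -
    have k3: "9/4 * k12 \<le> 4 * k12 + k11" using k by simp
    have nn: "0 \<le> C1 * G2" "0 \<le> C2 * Q" using C RQ by auto
    show "9/4 * k12 * (C1 * G2) \<le> (4 * k12 + k11) * (C1 * G2)" "9/4 * k12 * (C2 * Q) \<le> (4 * k12 + k11) * (C2 * Q)"
      by (rule mult_right_mono[OF k3 nn(1)], rule mult_right_mono[OF k3 nn(2)])
  qed
  ultimately show ?thesis using 1 2 3 unfolding r_def by linarith
qed

text \<open>The top power \<open>IR\<close> is interpolated and its part in the dissipation
  absorbed; what remains is a power of the energy times \<open>JJ\<close>, and \<open>JJ\<close> is
  bounded by the energy and the data. The remainder of the proof fits the constants into
  \<open>Cstar\<close>.\<close>

lemma Phi'_Er:
  assumes t: "t > 0"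
  shows "Phi' al t \<le> Cst * Er t * (1 + Phi al t) powr (1 + gam)"
proof -
  note ab = a_bounds
  define A where "A = al * (al - 1)"
  have A0: "A > 0" using al2 by (simp add: A_def)
  define V w where "V = 1 + Phi al t" and "w = 1 + measU U"
  have V1: "V \<ge> 1" and w1: "w \<ge> 1" "measU U \<le> w" using Phi_nn[of al t] by (auto simp: V_def w_def)
  define c where "c = chi powr (3 - 2*a)"
  define IP IG IT where "IP = (\<integral>x. Pa x t powr m \<partial>LU)" and "IG = (\<integral>x. norm (gP x t) powr (m / 2) \<partial>LU)"
    and "IT = chi powr (- ((3 - 2 * a) * (al - 1) / (5 - 4 * a))) * (\<integral>x. \<bar>tder Psi x t\<bar> powr (m / (5 - 4 * a)) \<partial>LU)"
  define IR where "IR = (\<integral>x. rho x t powr m \<partial>LU)"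
  have nn: "0 \<le> IP" "0 \<le> IG" "0 \<le> IT" "0 \<le> IR" by (auto simp: IP_def IG_def IT_def IR_def)
  have S: "SC (\<lambda>x t. rho x t powr (al - 2) * Hr x t)" "SC (\<lambda>x t. rho x t powr (al - 1) * \<bar>tder Psi x t\<bar>)"
    "SC (\<lambda>x t. rho x t powr m)" "SC (\<lambda>x t. Pa x t powr m)" "SC (\<lambda>x t. norm (gP x t) powr (m / 2))" "SC (\<lambda>x t. \<bar>tder Psi x t\<bar> powr (m / (5 - 4 * a)))"
    using al2 m_pos ab by (auto intro!: SC_intros SC_powr SC_base SC_IwHr)
  have SP: "SC (\<lambda>x t. (1 + Pa x t) powr m)" by (rule SC_powr_pos) (intro SC_intros SC_base one_Pa_pos)+
  have cint: "integrable LU (\<lambda>x. c :: real)" for c by (intro intU continuous_intros)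
  note i = SC_int[OF _ t]
  have "Phi' al t \<le> - (A * (c10 N ab ac / chi) * Ia al t) + A * (\<integral>x. rho x t powr (al - 2) * Hr x t \<partial>LU) + al * (\<integral>x. rho x t powr (al - 1) * \<bar>tder Psi x t\<bar> \<partial>LU)"
    using Phi'_le[OF al2 t] by (simp add: A_def Ia_def)
  also have "\<dots> = - (A * (c10 N ab ac / chi) * Ia al t) + A * (\<integral>x. rho x t powr (al - 2) * Hr x t + 1 / (al - 1) * (rho x t powr (al - 1) * \<bar>tder Psi x t\<bar>) \<partial>LU)"
    using i[OF S(1)] i[OF S(2)] al2 by (simp add: A_def distrib_left)
  also have "(\<integral>x. rho x t powr (al - 2) * Hr x t + 1 / (al - 1) * (rho x t powr (al - 1) * \<bar>tder Psi x t\<bar>) \<partial>LU) \<le> (\<integral>x. Rt x t \<partial>LU)"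
  proof (rule integral_mono)
    show "integrable LU (\<lambda>x. Rt x t)" unfolding Rt_def
      by (intro Bochner_Integration.integrable_add integrable_mult_right i S SP cint)
  qed (use i[OF S(1)] i[OF S(2)] pointwise in auto)
  also have "(\<integral>x. Rt x t \<partial>LU) = c13 N ab ac * c * IR + c14 N ab ac * c * (\<integral>x. (1 + Pa x t) powr m \<partial>LU) + c14 N ab ac * chi powr (1 - a) * IG + c11 N ab ac * measU U + IT"
    unfolding Rt_def using i[OF S(3)] i[OF S(5)] i[OF S(6)] i[OF SP] cint measure_LU
    by (simp add: IR_def IG_def IT_def c_def)
  finally have 1: "Phi' al t \<le> - (A * (c10 N ab ac / chi) * Ia al t) + A * (c13 N ab ac * c * IR + c14 N ab ac * c * (\<integral>x. (1 + Pa x t) powr m \<partial>LU) + c14 N ab ac * chi powr (1 - a) * IG + c11 N ab ac * measU U + IT)"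
    using A0 by simp
  have P2: "(\<integral>x. (1 + Pa x t) powr m \<partial>LU) \<le> 2 powr (m - 1) * (measU U + IP)"
  proof -
    have "(\<integral>x. (1 + Pa x t) powr m \<partial>LU) \<le> (\<integral>x. 2 powr (m - 1) * (1 + Pa x t powr m) \<partial>LU)"
    proof (rule integral_mono[OF i[OF SP]])
      show "integrable LU (\<lambda>x. 2 powr (m - 1) * (1 + Pa x t powr m))" using cint i[OF S(4)] by auto
      show "(1 + Pa x t) powr m \<le> 2 powr (m - 1) * (1 + Pa x t powr m)" for x using powr_add_le_two[of m 1 "Pa x t"] m_pos by simp
    qed
    also have "\<dots> = 2 powr (m - 1) * (measU U + IP)" using cint i[OF S(4)] measure_LU by (simp add: IP_def)
    finally show ?thesis .
  qed
  \<comment> \<open>The whole coefficient of the dissipation, so that the absorption cancels it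
    completely.\<close>
  define eps where "eps = c10 N ab ac / chi"
  have eps: "eps > 0" using c10_pos chi_pos by (simp add: eps_def)
  define R where "R = Phi al t powr (1 - th * (1 - lam)) * (Csob al * (JJ t)\<^sup>2) powr th"
  have R0: "R \<ge> 0" by (simp add: R_def)
  have Cs0: "Csob al \<ge> 0" by (simp add: Csob_def)
  have J0: "JJ t \<ge> 0" by (simp add: JJ_def)
  have "m = al + th * (al * lam - a)" using th_mult by (simp add: m_def)
  then have "IR \<le> Phi al t powr (1 - th * (1 - lam)) * (Csob al * Ia al t * (JJ t)\<^sup>2) powr th"
    using interp_main[OF t al2, of th] th_bounds by (simp add: IR_def)
  also have "\<dots> = R * Ia al t powr th" using Cs0 Ia_nn[of al t] by (simp add: R_def powr_mult mult_ac)
  finally have IR: "c13 N ab ac * c * IR \<le> (c13 N ab ac * c * R) * Ia al t powr th"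
    using c13_pos by (simp add: c_def mult.assoc mult_left_mono)
  define Q where "Q = (c13 N ab ac * c * R) powr (1 + ex) * eps powr (- ex)"
  have 2: "c13 N ab ac * c * IR \<le> eps * Ia al t + Q"
  proof -
    have "(c13 N ab ac * c * R) * Ia al t powr th \<le> eps * Ia al t + Q"
      using young_absorb[of "c13 N ab ac * c * R" "Ia al t" eps th] c13_pos R0 Ia_nn eps th_bounds
      by (simp add: Q_def ex1 ex_def[symmetric] c_def)
    then show ?thesis using IR by linarith
  qed
  define kk where "kk = c13 N ab ac"
  define kt where "kt = c10 N ab ac"
  have kk: "kk > 0" "kt > 0" using c13_pos c10_pos by (auto simp: kk_def kt_def)
  \<comment> \<open>The part \<open>(3 - 2 * a) * (1 + ex)\<close> comes from the coefficient
    \<open>c\<close>, the further \<open>ex\<close> from \<open>eps powr (- ex)\<close>, because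
    \<open>eps\<close> contains \<open>1 / chi\<close>.\<close>
  have mub: "(3 - 2*a) * (1 + ex) + ex = mub"
  proof -
    have "(3 - 2*a) * (1 + ex) + ex = (3 - 2*a) * (1 / (1 - th)) + th / (1 - th)" by (simp only: ex1 ex_def[symmetric])
    then show ?thesis by (simp add: mub_eq add_divide_distrib)
  qed
  have Rp: "R powr (1 + ex) = Phi al t powr (1 + ex * lam) * (Csob al powr ex * JJ t powr (2 * ex))"
  proof -
    have e1: "(1 - th * (1 - lam)) * (1 + ex) = 1 + ex * lam" "th * (1 + ex) = ex"
      using th_bounds by (simp_all add: ex1[symmetric] ex_def field_simps)
    have "((JJ t)\<^sup>2) powr ex = JJ t powr (2 * ex)" using J0 by (simp add: powr_powr flip: powr_numeral)
    then show ?thesis using Cs0 by (simp add: R_def powr_mult powr_powr e1)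
  qed
  have Q: "Q = kk * (kk / kt) powr ex * chi powr mub * (Phi al t powr (1 + ex * lam) * (Csob al powr ex * JJ t powr (2 * ex)))"
  proof -
    have n1: "eps powr (- ex) = kt powr (- ex) * chi powr ex"
      using chi_pos kk by (simp add: eps_def kt_def[symmetric] powr_divide powr_minus_divide)
    have n2: "c powr (1 + ex) * chi powr ex = chi powr mub" using chi_pos mub by (simp add: c_def powr_powr flip: powr_add)
    have n3: "kk powr (1 + ex) * kt powr (- ex) = kk * (kk / kt) powr ex" using kk by (simp add: powr_add powr_divide powr_minus_divide)
    have n4: "Q = kk powr (1 + ex) * c powr (1 + ex) * R powr (1 + ex) * eps powr (- ex)"
      using kk R0 by (simp add: Q_def kk_def[symmetric] powr_mult c_def)
    have "Q = (kk powr (1 + ex) * kt powr (- ex)) * (c powr (1 + ex) * chi powr ex) * R powr (1 + ex)"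
      unfolding n4 n1 by (simp only: mult_ac)
    then show ?thesis using Rp \<open>c powr (1 + ex) * chi powr ex = chi powr mub\<close> \<open>kk powr (1 + ex) * kt powr (- ex) = kk * (kk / kt) powr ex\<close> by simp
  qed
  define b g where "b = w powr (1 / pe - 1 / al)" and "g = w powr (1 / pe)"
  have "1 / al \<le> 1 / pe" using al_pe pe_pos by (simp add: divide_left_mono)
  then have bg: "1 \<le> b" "1 \<le> g" using w1 pe_pos by (auto simp: b_def g_def intro!: powr_ge_one)
  have NP0: "0 \<le> NP t" by (simp add: NP_def)
  have Va: "1 \<le> V powr (1 / al)" using V1 al2 by (intro powr_ge_one) auto
  have JJ: "JJ t \<le> 2 * (b * g * V powr (1 / al) * (1 + NP t))"
  proof -
    have "JJ t \<le> Phi al t powr (1 / al) * measU U powr (1 / pe - 1 / al) + measU U powr (1 / pe) + NP t" by (rule JJ_le[OF t al_pe])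
    also have "\<dots> \<le> V powr (1 / al) * b + g + NP t"
      using \<open>1 / al \<le> 1 / pe\<close> pe_pos al2 Phi_nn[of al t] w1
      by (intro add_mono mult_mono powr_mono2 order_refl) (auto simp: b_def g_def V_def intro!: powr_mono2)
    also have "\<dots> \<le> b * g * V powr (1 / al) + b * g * V powr (1 / al) + b * g * V powr (1 / al) * NP t"
    proof (intro add_mono)
      have "V powr (1 / al) * b * 1 \<le> V powr (1 / al) * b * g" using bg Va by (intro mult_left_mono) auto
      then show "V powr (1 / al) * b \<le> b * g * V powr (1 / al)" by (simp add: mult_ac)
      have bv: "1 * 1 \<le> b * V powr (1 / al)" using bg Va by (intro mult_mono) auto
      then have "g * 1 \<le> g * (b * V powr (1 / al))" using bg by (intro mult_left_mono) auto
      then show "g \<le> b * g * V powr (1 / al)" by (simp add: mult_ac)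
      have "1 * 1 \<le> g * (b * V powr (1 / al))" using bg bv by (intro mult_mono) auto
      then have "1 * NP t \<le> (g * (b * V powr (1 / al))) * NP t" using NP0 by (intro mult_right_mono) auto
      then show "NP t \<le> b * g * V powr (1 / al) * NP t" by (simp add: mult_ac)
    qed
    also have "\<dots> \<le> 2 * (b * g * V powr (1 / al) * (1 + NP t))" using bg NP0 by (simp add: algebra_simps)
    finally show ?thesis .
  qed
  have "JJ t powr (2 * ex) \<le> (2 * (b * g * V powr (1 / al) * (1 + NP t))) powr (2 * ex)"
    using JJ J0 ex_pos by (intro powr_mono2) auto
  also have "\<dots> = 2 powr (2 * ex) * (b powr (2 * ex) * g powr (2 * ex) * V powr (2 * ex / al) * (1 + NP t) powr (2 * ex))"
    using bg NP0 by (simp add: powr_mult powr_powr)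
  also have "\<dots> \<le> 2 powr (2 * ex) * (b powr (2 * ex) * g powr (2 * ex) * V powr (2 * ex / al) * (2 powr (2 * ex) * (1 + NP t powr (2 * ex))))"
    using powr_add_le_pow[of 1 "NP t" "2 * ex"] NP0 ex_pos by (intro mult_left_mono) auto
  finally have JJ2: "JJ t powr (2 * ex) \<le> 2 powr (2 * ex) * (b powr (2 * ex) * g powr (2 * ex) * V powr (2 * ex / al) * (2 powr (2 * ex) * (1 + NP t powr (2 * ex))))" .
  have CC1: "CC1 a rs al cbar U = 2 powr ((1 + 1 / rs) * ex) * Csob al powr ex * b powr (2 * ex)"
  proof -
    have e: "(al * (1 - rs) - 2 * rs) / (al * rs) = 2 * (1 / pe - 1 / al)" "(1 + rs) / rs = 1 + 1 / rs"
      using al2 rs_pos rs by (auto simp: pe_def field_simps)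
    have "(w powr (2 * (1 / pe - 1 / al))) powr ex = b powr (2 * ex)" by (simp only: b_def powr_powr mult_ac)
    then show ?thesis unfolding CC1_def Let_def th_def[symmetric] ex_def[symmetric] e w_def[symmetric] Csob_def[symmetric]
      by (simp add: powr_mult powr_powr Csob_def)
  qed
  define K2 where "K2 = CC2 N ab ac rs al cbar U"
  have K2: "K2 = kk * (2 powr ((1 + 1 / rs) * ex) * Csob al powr ex * b powr (2 * ex)) * (4 powr ex * (kk / kt) powr ex)"
  proof -
    have "(4 * kk / kt) powr ex = 4 powr ex * (kk / kt) powr ex" using kk powr_mult[of 4 "kk / kt" ex] by simp
    then show ?thesis unfolding K2_def CC2_def Let_def th_def[symmetric] ex_def[symmetric] CC1 kk_def[symmetric] kt_def[symmetric] by simp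
  qed
  define Wm where "Wm = w powr max 1 ((1 - rs) * th / (rs * (1 - th)))"
  have Wm1: "w \<le> Wm" using w1 powr_mono[of 1 "max 1 ((1 - rs) * th / (rs * (1 - th)))" w] by (simp add: Wm_def)
  have Wm2: "g powr (2 * ex) \<le> Wm"
  proof -
    have "g powr (2 * ex) = w powr ((1 - rs) * th / (rs * (1 - th)))" using rs rs_pos by (simp add: g_def powr_powr pe_def ex_def)
    also have "\<dots> \<le> Wm" unfolding Wm_def using w1 by (intro powr_mono) auto
    finally show ?thesis .
  qed
  define E1 where "E1 = chi powr mub * (1 + NP t powr (2 * ex))"
  have E1: "chi powr mub \<le> E1" "0 \<le> E1" by (auto simp: E1_def mult_le_cancel_left1)
  have cm: "c \<le> chi powr mub" "1 \<le> chi powr mub" using mub_ge chi_ge(1) ab by (auto simp: c_def intro!: powr_mono powr_ge_one)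
  define Vg where "Vg = V powr (1 + gam)"
  have Vg1: "1 \<le> Vg" using V1 gam_pos by (auto simp: Vg_def intro!: powr_ge_one)
  \<comment> \<open>One factor \<open>2 powr (2 * ex)\<close> stems from the bound on
    \<open>JJ\<close>, the other from splitting \<open>1 + NP t\<close>. The first is absorbed by
    \<open>4 powr ex\<close> in \<open>CC2\<close>, the second is a summand of
    \<open>Cstar\<close>.\<close>
  have Qle: "Q \<le> K2 * 2 powr (2 * ex) * Wm * E1 * Vg"
  proof -
    have "Q = (kk * (kk / kt) powr ex * chi powr mub * Csob al powr ex) * (Phi al t powr (1 + ex * lam) * JJ t powr (2 * ex))"
      unfolding Q by (simp add: mult_ac)
    also have "\<dots> \<le> (kk * (kk / kt) powr ex * chi powr mub * Csob al powr ex) * (V powr (1 + ex * lam) * (2 powr (2 * ex) * (b powr (2 * ex) * Wm * V powr (2 * ex / al) * (2 powr (2 * ex) * (1 + NP t powr (2 * ex))))))"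
    proof (intro mult_left_mono mult_mono)
      show "Phi al t powr (1 + ex * lam) \<le> V powr (1 + ex * lam)" using Phi_nn[of al t] ex_pos lam_bounds by (intro powr_mono2) (auto simp: V_def)
      show "JJ t powr (2 * ex) \<le> 2 powr (2 * ex) * (b powr (2 * ex) * Wm * V powr (2 * ex / al) * (2 powr (2 * ex) * (1 + NP t powr (2 * ex))))"
        by (rule order_trans[OF JJ2]) (intro mult_left_mono mult_right_mono Wm2; simp)
    qed (use kk Wm1 w1 in auto)
    also have "\<dots> = (kk * (kk / kt) powr ex * Csob al powr ex * b powr (2 * ex)) * (2 powr (2 * ex) * 2 powr (2 * ex)) * Wm * E1 * (V powr (1 + ex * lam) * V powr (2 * ex / al))"
      by (simp add: E1_def mult_ac)
    also have "V powr (1 + ex * lam) * V powr (2 * ex / al) = Vg" unfolding Vg_def gam_eq by (simp add: add.assoc flip: powr_add)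
    also have "(kk * (kk / kt) powr ex * Csob al powr ex * b powr (2 * ex)) * (2 powr (2 * ex) * 2 powr (2 * ex)) * Wm * E1 * Vg
      \<le> (kk * (kk / kt) powr ex * Csob al powr ex * b powr (2 * ex)) * ((2 powr ((1 + 1 / rs) * ex) * 4 powr ex) * 2 powr (2 * ex)) * Wm * E1 * Vg"
    proof (intro mult_right_mono mult_left_mono)
      have "(2::real) powr (2 * ex) = 1 * 4 powr ex" by (simp add: powr_powr[symmetric])
      also have "\<dots> \<le> 2 powr ((1 + 1 / rs) * ex) * 4 powr ex" using ex_pos rs_pos by (intro mult_right_mono powr_ge_one) auto
      finally show "(2::real) powr (2 * ex) \<le> 2 powr ((1 + 1 / rs) * ex) * 4 powr ex" .
    qed (use kk Wm1 w1 E1 Vg1 in auto)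
    also have "\<dots> = K2 * 2 powr (2 * ex) * Wm * E1 * Vg" unfolding K2 by (simp add: mult_ac)
    finally show ?thesis .
  qed
  define C0 where "C0 = max K2 (c15 N ab ac)"
  have k15: "c11 N ab ac \<le> c15 N ab ac" "c14 N ab ac \<le> c15 N ab ac" "1 \<le> c15 N ab ac"
    using c11_pos by (auto simp: c15_def le_max_iff_disj)
  then have kC: "c11 N ab ac \<le> C0" "c14 N ab ac \<le> C0" "1 \<le> C0" "K2 \<le> C0" by (auto simp: C0_def)
  have c14p: "0 < c14 N ab ac" using c11_pos c12_pos by (simp add: c14_def)
  define E2 E3 where "E2 = c * IP" and "E3 = chi powr (1 - a) * IG"
  have E23: "0 \<le> E2" "0 \<le> E3" using nn by (auto simp: E2_def E3_def c_def)
  have Er: "Er t = E1 + E2 + E3 + IT" by (simp add: Er_def E1_def E2_def E3_def IT_def IP_def IG_def c_def)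
  define M where "M = (2::real) powr (m - 1)"
  have M0: "0 \<le> M" by (simp add: M_def)
  have Wm0: "1 \<le> Wm" using Wm1 w1 by simp
  have rest: "c14 N ab ac * c * (\<integral>x. (1 + Pa x t) powr m \<partial>LU) + c14 N ab ac * chi powr (1 - a) * IG + c11 N ab ac * measU U + IT
     \<le> C0 * (M + 1) * Wm * Er t"
  proof -
    have "c14 N ab ac * c * (\<integral>x. (1 + Pa x t) powr m \<partial>LU) \<le> C0 * c * (M * (measU U + IP))"
      unfolding M_def using kC P2 c14p by (intro mult_mono mult_right_mono) (auto simp: c_def)
    also have "\<dots> = C0 * M * (c * measU U + E2)" by (simp add: E2_def algebra_simps)
    also have "\<dots> \<le> C0 * M * (Wm * E1 + Wm * E2)"
    proof (intro mult_left_mono add_mono)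
      have "c * measU U \<le> E1 * Wm" using cm E1 w1 Wm1 by (intro mult_mono) (auto simp: c_def)
      then show "c * measU U \<le> Wm * E1" by (simp add: mult.commute)
      show "E2 \<le> Wm * E2" using Wm0 E23 by (simp add: mult_le_cancel_right1)
    qed (use kC M0 in auto)
    finally have a1: "c14 N ab ac * c * (\<integral>x. (1 + Pa x t) powr m \<partial>LU) \<le> C0 * M * (Wm * E1 + Wm * E2)" .
    have a2: "c14 N ab ac * chi powr (1 - a) * IG \<le> C0 * (Wm * E3)"
    proof -
      have "c14 N ab ac * E3 \<le> C0 * (Wm * E3)" using kC c14p E23 Wm0 by (intro mult_mono) (auto simp: mult_le_cancel_right1)
      then show ?thesis by (simp add: E3_def mult.assoc)
    qed
    have a3: "c11 N ab ac * measU U \<le> C0 * (Wm * E1)"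
    proof -
      have "measU U * 1 \<le> Wm * E1" using w1 Wm1 cm E1 by (intro mult_mono) auto
      then show ?thesis using kC c11_pos by (intro mult_mono) auto
    qed
    have a4: "IT \<le> C0 * (Wm * IT)"
    proof -
      have "1 * 1 \<le> C0 * Wm" using kC Wm0 by (intro mult_mono) auto
      from mult_right_mono[OF this nn(3)] show ?thesis by (simp add: mult_ac)
    qed
    have z: "0 \<le> C0 * M * (Wm * E3)" "0 \<le> C0 * M * (Wm * IT)" "0 \<le> C0 * (Wm * E2)" using kC M0 Wm0 E23 nn by auto
    have "C0 * (M + 1) * Wm * Er t = C0 * M * (Wm * E1 + Wm * E2) + C0 * M * (Wm * E3) + C0 * M * (Wm * IT) + C0 * (Wm * E1) + C0 * (Wm * E2) + C0 * (Wm * E3) + C0 * (Wm * IT)"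
      unfolding Er by (simp add: algebra_simps)
    then show ?thesis using a1 a2 a3 a4 z by linarith
  qed
  have Er0: "0 \<le> Er t" "E1 \<le> Er t" using E1 E23 nn unfolding Er by linarith+
  have K20: "0 \<le> K2" using kk unfolding K2 by simp
  have tot: "Q + C0 * (M + 1) * Wm * Er t \<le> C0 * (1 + 2 powr (2 * ex) + M + 2 powr (m / 2 - 1)) * Wm * Er t * Vg"
  proof -
    have "Q \<le> C0 * 2 powr (2 * ex) * Wm * Er t * Vg"
      by (rule order_trans[OF Qle]) (use kC K20 Wm0 E1 Er0 Vg1 in \<open>intro mult_mono order_refl; simp\<close>)
    moreover have "C0 * (M + 1) * Wm * Er t * 1 \<le> C0 * (M + 1) * Wm * Er t * Vg"
      using kC M0 Wm0 Er0 Vg1 by (intro mult_left_mono) auto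
    moreover have "0 \<le> C0 * 2 powr (m / 2 - 1) * Wm * Er t * Vg" using kC Wm0 Er0 Vg1 by simp
    moreover have "C0 * (1 + 2 powr (2 * ex) + M + 2 powr (m / 2 - 1)) * Wm * Er t * Vg = C0 * 2 powr (2 * ex) * Wm * Er t * Vg + C0 * (M + 1) * Wm * Er t * Vg + C0 * 2 powr (m / 2 - 1) * Wm * Er t * Vg"
      by (simp add: algebra_simps)
    ultimately show ?thesis by linarith
  qed
  have Cst: "Cst = A * (C0 * (1 + 2 powr (2 * ex) + M + 2 powr (m / 2 - 1)) * Wm)"
    unfolding Cst_def Cstar_def Let_def th_def[symmetric] CC0_def K2_def[symmetric] C0_def[symmetric] w_def[symmetric] Wm_def[symmetric]
    by (simp add: A_def M_def m_def ex_def mult_ac)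
  have "Phi' al t \<le> A * (Q + C0 * (M + 1) * Wm * Er t)"
  proof -
    have "- (A * (c10 N ab ac / chi) * Ia al t) + A * (c13 N ab ac * c * IR + c14 N ab ac * c * (\<integral>x. (1 + Pa x t) powr m \<partial>LU) + c14 N ab ac * chi powr (1 - a) * IG + c11 N ab ac * measU U + IT)
       = A * (c13 N ab ac * c * IR - eps * Ia al t + (c14 N ab ac * c * (\<integral>x. (1 + Pa x t) powr m \<partial>LU) + c14 N ab ac * chi powr (1 - a) * IG + c11 N ab ac * measU U + IT))"
      by (simp add: eps_def algebra_simps)
    also have "\<dots> \<le> A * (Q + C0 * (M + 1) * Wm * Er t)"
      using 2 rest A0 by (intro mult_left_mono add_mono) auto
    finally show ?thesis using 1 by linarith
  qed
  also have "\<dots> \<le> A * (C0 * (1 + 2 powr (2 * ex) + M + 2 powr (m / 2 - 1)) * Wm * Er t * Vg)"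
    using tot A0 by (intro mult_left_mono) auto
  also have "\<dots> = Cst * Er t * (1 + Phi al t) powr (1 + gam)" unfolding Cst Vg_def V_def by (simp add: mult_ac)
  finally show ?thesis .
qed

end

text \<open>The substitution \<open>V powr (- g)\<close> linearises the inequality: this quantity
  decreases at most at the rate \<open>g * C * E\<close>. The smallness assumption keeps its lower
  bound positive, so it can be inverted.\<close>

lemma bernoulli_ode_bound:
  fixes V V' E :: "real \<Rightarrow> real"
  assumes t: "t > 0" and V: "continuous_on {0..t} V" "\<And>s. 0 \<le> s \<Longrightarrow> s \<le> t \<Longrightarrow> V s > 0"
    and d: "\<And>s. 0 < s \<Longrightarrow> s < t \<Longrightarrow> (V has_real_derivative V' s) (at s)"
    and le: "\<And>s. 0 < s \<Longrightarrow> s < t \<Longrightarrow> V' s \<le> C * E s * V s powr (1 + g)"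
    and E: "\<And>s. 0 < s \<Longrightarrow> continuous_on {s..t} E" and g: "g > 0" and C: "C \<ge> 0"
    and eta: "\<And>s. 0 < s \<Longrightarrow> s < t \<Longrightarrow> integral {s..t} E \<le> eta" and small: "g * C * V 0 powr g * eta < 1"
  shows "V t \<le> V 0 * (1 - g * C * V 0 powr g * eta) powr (- 1 / g)"
proof -
  have step: "V s powr (- g) - g * C * eta \<le> V t powr (- g)" if s: "0 < s" "s < t" for s
  proof -
    define f where "f r = V r powr (- g) + g * C * integral {s..r} E" for r
    have "f s \<le> f t"
    proof (rule DERIV_nonneg_imp_increasing_open[OF less_imp_le[OF s(2)]])
      fix r assume r: "s < r" "r < t"
      have Ed: "((\<lambda>r. integral {s..r} E) has_real_derivative E r) (at r)"
        using integral_has_real_derivative[OF E[OF s(1)], of r] r at_within_Icc_at[of s r t] by simp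
      have "((\<lambda>r. V r powr (- g)) has_real_derivative (- g) * V r powr (- g - 1) * V' r) (at r)"
        using DERIV_fun_powr[OF d[of r], of "- g"] V(2)[of r] s r by simp
      from DERIV_add[OF this DERIV_cmult[OF Ed, of "g * C"]]
      have D: "(f has_real_derivative (- g) * V r powr (- g - 1) * V' r + g * C * E r) (at r)" unfolding f_def .
      have "V r powr (- g - 1) * V' r \<le> V r powr (- g - 1) * (C * E r * V r powr (1 + g))"
        using le[of r] s r by (intro mult_left_mono) auto
      also have "\<dots> = C * E r * (V r powr (- g - 1) * V r powr (1 + g))" by simp
      also have "V r powr (- g - 1) * V r powr (1 + g) = 1" using V(2)[of r] s r by (simp flip: powr_add)
      finally have "g * (V r powr (- g - 1) * V' r) \<le> g * (C * E r)" using g by (intro mult_left_mono) auto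
      then have "0 \<le> (- g) * V r powr (- g - 1) * V' r + g * C * E r" by (simp add: mult.assoc)
      then show "\<exists>y. (f has_real_derivative y) (at r) \<and> 0 \<le> y" using D by blast
    next
      have Vc: "continuous_on {s..t} V" by (rule continuous_on_subset[OF V(1)]) (use s in auto)
      have nz: "\<forall>r\<in>{s..t}. V r \<noteq> 0" using V(2) s by (metis atLeastAtMost_iff less_irrefl less_le_trans less_imp_le)
      show "continuous_on {s..t} f" unfolding f_def
        by (intro continuous_intros Vc indefinite_integral_continuous_1 integrable_continuous_interval E s nz)
    qed
    then have "V s powr (- g) \<le> V t powr (- g) + g * C * integral {s..t} E" by (simp add: f_def)
    also have "g * C * integral {s..t} E \<le> g * C * eta" using eta[OF s] g C by (intro mult_left_mono) auto
    finally show ?thesis by simp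
  qed
  have V0: "V 0 > 0" "V t > 0" using V(2) t by auto
  \<comment> \<open>\<open>E\<close> is known to be continuous only away from 0, so the comparison
    starts at \<open>s > 0\<close>; continuity of \<open>V\<close> at 0 suffices for the
    limit.\<close>
  have lim: "((\<lambda>s. V s powr (- g) - g * C * eta) \<longlongrightarrow> V 0 powr (- g) - g * C * eta) (at_right 0)"
  proof -
    have "(V \<longlongrightarrow> V 0) (at 0 within {0..t})" using V(1) t by (auto simp: continuous_on_def)
    then have "(V \<longlongrightarrow> V 0) (at_right 0)" using at_within_Icc_at_right[OF t] by simp
    then show ?thesis using V0 by (intro tendsto_intros) auto
  qed
  have "eventually (\<lambda>s. V s powr (- g) - g * C * eta \<le> V t powr (- g)) (at_right 0)"
    using step t by (auto simp: eventually_at_right_field)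
  from tendsto_upperbound[OF lim this] have "V 0 powr (- g) - g * C * eta \<le> V t powr (- g)" by simp
  moreover have "V 0 powr (- g) - g * C * eta = V 0 powr (- g) * (1 - g * C * V 0 powr g * eta)"
    using V0 by (simp add: right_diff_distrib powr_minus field_simps)
  ultimately have le2: "V 0 powr (- g) * (1 - g * C * V 0 powr g * eta) \<le> V t powr (- g)" by simp
  have pos: "0 < V 0 powr (- g) * (1 - g * C * V 0 powr g * eta)" using V0 small by simp
  have "V t = (V t powr (- g)) powr (- 1 / g)" using V0 g by (simp add: powr_powr)
  also have "\<dots> \<le> (V 0 powr (- g) * (1 - g * C * V 0 powr g * eta)) powr (- 1 / g)"
    using le2 pos g by (intro powr_mono2') auto
  also have "\<dots> = V 0 * (1 - g * C * V 0 powr g * eta) powr (- 1 / g)"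
    using V0 small g by (simp add: powr_mult powr_powr)
  finally show ?thesis .
qed

context flow_al begin

lemma NP_cont: "c > 0 \<Longrightarrow> continuous_on {c..b} NP"
  unfolding NP_def using pe_pos
  by (intro continuous_on_powr' SC_cont_int SC_powr SC_base continuous_intros) auto

lemma NP_nn [simp]: "0 \<le> NP t" by (simp add: NP_def)

lemma Er_cont: "c > 0 \<Longrightarrow> continuous_on {c..b} Er"
  unfolding Er_def using ex_pos m_pos a_bounds
  by (intro continuous_intros continuous_on_powr' NP_cont SC_cont_int SC_powr SC_base SC_intros) auto

lemma Er_ge: "chi powr mub \<le> Er t"
proof -
  have "chi powr mub * 1 \<le> chi powr mub * (1 + NP t powr (2 * ex))" by (intro mult_left_mono) auto
  moreover have "0 \<le> chi powr (3 - 2 * a) * (\<integral>x. Pa x t powr m \<partial>LU)" "0 \<le> chi powr (1 - a) * (\<integral>x. norm (gP x t) powr (m / 2) \<partial>LU)"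
    "0 \<le> chi powr (- ((3 - 2 * a) * (al - 1) / (5 - 4 * a))) * (\<integral>x. \<bar>tder Psi x t\<bar> powr (m / (5 - 4 * a)) \<partial>LU)" by auto
  ultimately show ?thesis unfolding Er_def by linarith
qed

lemma Er_nn: "0 \<le> Er t" using Er_ge[of t] by (meson order_trans powr_ge_zero)

lemma LpPsi_eq: "t > 0 \<Longrightarrow> LpPsi U Psi (2 * rs / (1 - rs)) t = ennreal (NP t)"
proof -
  assume t: "t > 0"
  have "nnI U (\<lambda>x. \<bar>Psi x t\<bar> powr pe) = ennreal (\<integral>x. Pa x t powr pe \<partial>LU)"
    unfolding Pa_def[symmetric] using pe_pos by (intro nnI_U SC_time[OF _ t] SC_powr SC_base) auto
  then show ?thesis by (simp add: LpPsi_def pe_def[symmetric] NP_def epow_ennreal)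
qed

lemma Efun_eq: assumes t: "t > 0" shows "Efun a rs chi U Psi al t = ennreal (Er t)"
proof -
  have 1: "nnI U (\<lambda>x. \<bar>Psi x t\<bar> powr m) = ennreal (\<integral>x. Pa x t powr m \<partial>LU)"
    unfolding Pa_def[symmetric] using m_pos by (intro nnI_U SC_time[OF _ t] SC_powr SC_base) auto
  have 2: "nnI U (\<lambda>x. norm (xgrad Psi x t) powr (m / 2)) = ennreal (\<integral>x. norm (gP x t) powr (m / 2) \<partial>LU)"
    unfolding gP_def[symmetric] using m_pos by (intro nnI_U SC_time[OF _ t] SC_powr SC_base SC_intros) auto
  have 3: "nnI U (\<lambda>x. \<bar>tder Psi x t\<bar> powr (m / (5 - 4 * a))) = ennreal (\<integral>x. \<bar>tder Psi x t\<bar> powr (m / (5 - 4 * a)) \<partial>LU)"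
    using m_pos a_bounds by (intro nnI_U SC_time[OF _ t] SC_powr SC_base SC_intros) auto
  have e: "2 * th / (1 - th) = 2 * ex" by (simp add: ex_def)
  show ?thesis
    unfolding Efun_def Let_def th_def[symmetric] mub_def[symmetric] m_def[symmetric] LpPsi_eq[OF t] 1 2 3 e Er_def epow_ennreal[OF NP_nn]
    by (simp add: ennreal_mult ennreal_plus Bochner_Integration.integral_nonneg flip: ennreal_1)
qed

lemma EInt_ge: assumes s: "0 < s" "s \<le> t" shows "ennreal (integral {s..t} Er) \<le> EInt a rs chi U Psi al t"
proof -
  have "(Er has_integral integral {s..t} Er) {s..t}" using s by (intro integrable_integral integrable_continuous_interval Er_cont)
  then have hi: "(Er has_integral integral {s..t} Er) {s<..<t}" by (simp add: has_integral_Icc_iff_Ioo)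
  have "ennreal (integral {s..t} Er) = (\<integral>\<^sup>+ r. indicator {s<..<t} r * ennreal (Er r) \<partial>lborel)"
    using nn_integral_has_integral_lebesgue[OF _ hi] Er_nn by (simp add: ennreal_mult' ennreal_indicator)
  also have "\<dots> = (\<integral>\<^sup>+ r. indicator {s<..<t} r * ennreal (Er r) \<partial>lebesgue)" by (rule nn_integral_completion[symmetric])
  also have "\<dots> \<le> EInt a rs chi U Psi al t"
    unfolding EInt_def
  proof (intro nn_integral_mono)
    fix r :: real
    show "indicator {s<..<t} r * ennreal (Er r) \<le> Efun a rs chi U Psi al r * indicator {0<..<t} r"
      using s Efun_eq[of r] by (auto simp: indicator_def)
  qed
  finally show ?thesis .
qed

lemma EInt_mono: "s \<le> t \<Longrightarrow> EInt a rs chi U Psi al s \<le> EInt a rs chi U Psi al t"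
  unfolding EInt_def by (intro nn_integral_mono) (auto simp: indicator_def)

text \<open>The constant summand of the data functional turns a bound on its integral into a bound
  on the length of the time interval.\<close>

lemma EInt_chi: assumes t: "t > 0" shows "ennreal (chi powr mub * t) \<le> EInt a rs chi U Psi al t"
proof -
  have "ennreal (chi powr mub * t) = (\<integral>\<^sup>+ r. ennreal (chi powr mub) * indicator {0<..<t} r \<partial>lebesgue)"
    using t by (simp add: nn_integral_cmult_indicator ennreal_mult)
  also have "\<dots> \<le> EInt a rs chi U Psi al t"
    unfolding EInt_def
  proof (intro nn_integral_mono)
    fix r :: real
    show "ennreal (chi powr mub) * indicator {0<..<t} r \<le> Efun a rs chi U Psi al r * indicator {0<..<t} r"
      using Efun_eq[of r] Er_ge[of r] by (auto simp: indicator_def intro!: ennreal_leI)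
  qed
  finally show ?thesis .
qed

text \<open>Retains the factor \<open>c15\<close> of \<open>Cstar\<close>, from which
  \<open>small_time\<close> recovers \<open>c12\<close>.\<close>

lemma Cst_ge: "c15 N ab ac * al * (al - 1) \<le> Cst"
proof -
  define C0 where "C0 = CC0 N ab ac rs al cbar U"
  have c15: "1 \<le> c15 N ab ac" by (simp add: c15_def)
  have "c15 N ab ac * al * (al - 1) \<le> max (CC2 N ab ac rs al cbar U) (c15 N ab ac) * al * (al - 1)" using al2 by (intro mult_right_mono) auto
  then have 1: "c15 N ab ac * al * (al - 1) \<le> C0" by (simp add: C0_def CC0_def)
  have C00: "0 \<le> C0" using 1 c15 al2 by (smt (verit) mult_nonneg_nonneg)
  define X where "X = 1 + 2 powr (2 * th / (1 - th)) + 2 powr (al + 4 * (1 - a) - 1) + 2 powr ((al + 4 * (1 - a)) / 2 - 1)"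
  define Y where "Y = (1 + measU U) powr (max 1 ((1 - rs) * th / (rs * (1 - th))))"
  have X: "1 \<le> X" by (simp add: X_def)
  have Y: "1 \<le> Y" unfolding Y_def by (intro powr_ge_one) auto
  have "C0 * (1 * 1) \<le> C0 * (X * Y)" using X Y C00 by (intro mult_left_mono mult_mono) auto
  moreover have "Cst = C0 * (X * Y)" by (simp add: Cst_def Cstar_def Let_def th_def[symmetric] C0_def X_def Y_def)
  ultimately show ?thesis using 1 by simp
qed

lemma Cst_pos: "0 < Cst"
proof -
  have "1 \<le> c15 N ab ac" by (simp add: c15_def)
  then have "0 < c15 N ab ac * al * (al - 1)" using al2 by simp
  then show ?thesis using Cst_ge by linarith
qed

lemma Cst_nn: "0 \<le> Cst" using Cst_pos by simp

definition "V0 = 1 + Phi al 0"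
definition "ET t = enn2real (EInt a rs chi U Psi al t)"
text \<open>The function \<open>\<V>\<close> of the informal statement.\<close>
definition "Vbd t = V0 * (1 - gam * Cst * V0 powr gam * ET t) powr (- 1 / gam)"

lemma V0_ge: "V0 \<ge> 1" using Phi_nn[of al 0] by (simp add: V0_def)

lemma Vbd_bound:
  assumes T: "T > 0" and fin: "EInt a rs chi U Psi al T < top" and small: "gam * Cst * V0 powr gam * ET T < 1"
    and t: "0 < t" "t \<le> T"
  shows "1 + Phi al t \<le> Vbd t" "\<And>s. 0 \<le> s \<Longrightarrow> s \<le> t \<Longrightarrow> Vbd s \<le> Vbd t" "chi powr mub * t \<le> ET t" "gam * Cst * V0 powr gam * ET t < 1"
proof -
  have fin': "EInt a rs chi U Psi al s < top" if "s \<le> T" for s using EInt_mono[OF that] fin by simp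
  have ETm: "ET s \<le> ET r" if "s \<le> r" "r \<le> T" for s r unfolding ET_def using EInt_mono[OF that(1)] fin'[OF that(2)] by (rule enn2real_mono)
  have K: "0 \<le> gam * Cst * V0 powr gam" using gam_pos Cst_nn by simp
  have sm: "gam * Cst * V0 powr gam * ET s < 1" if "s \<le> T" for s
    using mult_left_mono[OF ETm[OF that order_refl] K] small by linarith
  then show "gam * Cst * V0 powr gam * ET t < 1" using t by simp
  have Phc: "continuous_on {0..t} (\<lambda>s. 1 + Phi al s)" using al2 by (intro continuous_intros Phi_cont) auto
  have "1 + Phi al t \<le> (1 + Phi al 0) * (1 - gam * Cst * (1 + Phi al 0) powr gam * ET t) powr (- 1 / gam)"
  proof (rule bernoulli_ode_bound[OF t(1) Phc, where V' = "Phi' al" and E = Er])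
    show "\<And>s. 0 < 1 + Phi al s" using Phi_nn by (simp add: add_pos_nonneg)
    fix s assume s: "0 < s" "s < t"
    have "(Phi al has_real_derivative Phi' al s) (at s within {s / 2..t})" using s by (intro Phi_deriv al2) auto
    then have "(Phi al has_real_derivative Phi' al s) (at s)" using s at_within_Icc_at[of "s/2" s t] by simp
    then show "((\<lambda>s. 1 + Phi al s) has_real_derivative Phi' al s) (at s)" by (auto intro!: derivative_eq_intros)
    show "Phi' al s \<le> Cst * Er s * (1 + Phi al s) powr (1 + gam)" by (rule Phi'_Er[OF s(1)])
    show "integral {s..t} Er \<le> ET t"
    proof -
      have "enn2real (ennreal (integral {s..t} Er)) \<le> ET t" unfolding ET_def using EInt_ge[of s t] s fin'[OF t(2)] by (intro enn2real_mono) auto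
      moreover have "0 \<le> integral {s..t} Er" using Er_nn s by (intro integral_nonneg integrable_continuous_interval Er_cont) auto
      ultimately show ?thesis by simp
    qed
  next
    show "gam * Cst * (1 + Phi al 0) powr gam * ET t < 1" using sm[OF t(2)] by (simp add: V0_def)
  qed (use gam_pos Cst_nn Er_cont in auto)
  then show "1 + Phi al t \<le> Vbd t" by (simp add: Vbd_def V0_def)
  show "chi powr mub * t \<le> ET t"
  proof -
    have "enn2real (ennreal (chi powr mub * t)) \<le> ET t" unfolding ET_def by (rule enn2real_mono[OF EInt_chi[OF t(1)] fin'[OF t(2)]])
    then show ?thesis using t by simp
  qed
  fix s :: real assume s: "0 \<le> s" "s \<le> t"
  have "gam * Cst * V0 powr gam * ET s \<le> gam * Cst * V0 powr gam * ET t" by (rule mult_left_mono[OF ETm[OF s(2) t(2)] K])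
  then have "(1 - gam * Cst * V0 powr gam * ET s) powr (- 1 / gam) \<le> (1 - gam * Cst * V0 powr gam * ET t) powr (- 1 / gam)"
    using sm[OF t(2)] gam_pos by (intro powr_mono2') auto
  then show "Vbd s \<le> Vbd t" unfolding Vbd_def using V0_ge by (intro mult_left_mono) auto
qed

end

section \<open>Estimates on cylinders\<close>

context flow_sob begin

text \<open>The right side of \<open>Phi'_le\<close> without the dissipation; \<open>bb\<close>
  below is the coefficient of the latter.\<close>

definition "Rs' be t = be * (be - 1) * (\<integral>x. rho x t powr (be - 2) * Hr x t \<partial>LU) + be * (\<integral>x. rho x t powr (be - 1) * \<bar>tder Psi x t\<bar> \<partial>LU)"

lemma Hr_nn: "0 \<le> Hr x t"
  unfolding Hr_def using c11_pos c12_pos by (intro add_nonneg_nonneg mult_nonneg_nonneg) auto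

lemma Rs'_nn: "be > 2 \<Longrightarrow> 0 \<le> Rs' be t"
  unfolding Rs'_def using Hr_nn by (intro add_nonneg_nonneg mult_nonneg_nonneg Bochner_Integration.integral_nonneg) auto

lemma time_cont:
  assumes "be > 2" "c > 0"
  shows "continuous_on {c..b} (Phi be)" "continuous_on {c..b} (Ia be)" "continuous_on {c..b} (Rs' be)"
  unfolding Phi_def[abs_def] Ia_def[abs_def] Rs'_def[abs_def] using assms
  by (auto intro!: continuous_intros SC_cont_int SC_intros SC_powr SC_base SC_IwHr)

definition "bb be = be * (be - 1) * (c10 N ab ac / chi)"

lemma bb_pos: "be > 2 \<Longrightarrow> bb be > 0" unfolding bb_def using c10_pos chi_ge(1) by simp

lemma energy_between:
  assumes be: "be > 2" and s: "0 < s" "s \<le> r"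
  shows "Phi be r + bb be * integral {s..r} (Ia be) \<le> Phi be s + integral {s..r} (Rs' be)"
proof -
  have "(Phi' be has_integral Phi be r - Phi be s) {s..r}"
    using s by (intro fundamental_theorem_of_calculus) (auto intro!: Phi_deriv be simp flip: has_real_derivative_iff_has_vector_derivative)
  moreover have I: "(Ia be has_integral integral {s..r} (Ia be)) {s..r}" "(Rs' be has_integral integral {s..r} (Rs' be)) {s..r}"
    using time_cont[OF be s(1)] by (auto intro!: integrable_integral integrable_continuous_interval)
  have "((\<lambda>x. - (bb be * Ia be x) + Rs' be x) has_integral - (bb be * integral {s..r} (Ia be)) + integral {s..r} (Rs' be)) {s..r}"
    by (intro has_integral_add has_integral_neg has_integral_mult_right I)
  ultimately have "Phi be r - Phi be s \<le> - (bb be * integral {s..r} (Ia be)) + integral {s..r} (Rs' be)"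
  proof (rule has_integral_le)
    fix x assume "x \<in> {s..r}"
    then have "x > 0" using s by simp
    then show "Phi' be x \<le> - (bb be * Ia be x) + Rs' be x"
      using Phi'_le[OF be, of x] by (simp add: bb_def Ia_def Rs'_def)
  qed
  then show ?thesis by simp
qed

definition "Ebd be s0 s1 t = 1 / (s1 - s0) * integral {s0..t} (Phi be) + integral {s0..t} (Rs' be)"

text \<open>In place of a cutoff in time, the energy inequality is started at a time in the gap
  \<open>[s0, s1]\<close> where the energy is minimal; the minimum is at most the average over the
  gap.\<close>

lemma energy_cyl:
  assumes be: "be > 2" and s: "0 < s0" "s0 < s1" "s1 \<le> t"
  shows "\<And>r. s1 \<le> r \<Longrightarrow> r \<le> t \<Longrightarrow> Phi be r \<le> Ebd be s0 s1 t" "bb be * integral {s1..t} (Ia be) \<le> Ebd be s0 s1 t" "0 \<le> Ebd be s0 s1 t"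
proof -
  note tc = time_cont[OF be]
  obtain s where ss: "s \<in> {s0..s1}" "\<And>r. r \<in> {s0..s1} \<Longrightarrow> Phi be s \<le> Phi be r"
    using continuous_attains_inf[OF compact_Icc _ tc(1)[OF s(1), of s1]] s by auto
  have io: "Phi be integrable_on {x..y}" "Ia be integrable_on {x..y}" "Rs' be integrable_on {x..y}" if "x > 0" for x y
    using tc[OF that] by (auto intro!: integrable_continuous_interval)
  have "(s1 - s0) * Phi be s = integral {s0..s1} (\<lambda>_. Phi be s)" using s by simp
  also have "\<dots> \<le> integral {s0..s1} (Phi be)" using ss io(1)[OF s(1)] by (intro integral_le) auto
  also have "\<dots> \<le> integral {s0..t} (Phi be)" using s Phi_nn io by (intro integral_subset_le) auto
  finally have P: "Phi be s \<le> 1 / (s1 - s0) * integral {s0..t} (Phi be)" using s by (simp add: pos_le_divide_eq mult.commute)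
  have s': "s > 0" "s0 \<le> s" "s \<le> s1" using ss s by auto
  have main: "Phi be r + bb be * integral {s..r} (Ia be) \<le> Ebd be s0 s1 t" if r: "s1 \<le> r" "r \<le> t" for r
  proof -
    have "integral {s..r} (Rs' be) \<le> integral {s0..t} (Rs' be)"
      using s s' r Rs'_nn[OF be] io by (intro integral_subset_le) auto
    then show ?thesis using energy_between[OF be s'(1), of r] P s' r by (simp add: Ebd_def)
  qed
  have Inn: "0 \<le> integral {x..y} (Ia be)" if "x > 0" for x y using Ia_nn io(2)[OF that] by (intro integral_nonneg) auto
  show 1: "Phi be r \<le> Ebd be s0 s1 t" if r: "s1 \<le> r" "r \<le> t" for r
    using main[OF r] mult_nonneg_nonneg[OF less_imp_le[OF bb_pos[OF be]] Inn[OF s'(1), of r]] by linarith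
  show "0 \<le> Ebd be s0 s1 t" using 1[OF s(3) order_refl] Phi_nn[of be t] by linarith
  have "integral {s1..t} (Ia be) \<le> integral {s..t} (Ia be)" using s s' Ia_nn io by (intro integral_subset_le) auto
  then have "bb be * integral {s1..t} (Ia be) \<le> bb be * integral {s..t} (Ia be)" using bb_pos[OF be] by simp
  then show "bb be * integral {s1..t} (Ia be) \<le> Ebd be s0 s1 t" using main[OF s(3) order_refl] Phi_nn[of be t] by linarith
qed

text \<open>The case \<open>th = 1\<close> of \<open>interp_main\<close>: the supremum in time of
  the energy to the power \<open>lam\<close> times the time integral of the dissipation, both
  bounded by \<open>Ebd\<close>.\<close>

lemma parabolic_sobolev:
  assumes be: "be > 2" and s: "0 < s0" "s0 < s1" "s1 \<le> t" and J: "\<And>r. s1 \<le> r \<Longrightarrow> r \<le> t \<Longrightarrow> JJ r \<le> Jm"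
  shows "integral {s1..t} (Phi (be + be * lam - a)) \<le> Csob be / bb be * Jm\<^sup>2 * Ebd be s0 s1 t powr (1 + lam)"
proof -
  have s1: "s1 > 0" using s by simp
  note E = energy_cyl[OF be s]
  have J0: "0 \<le> JJ r" for r by (simp add: JJ_def)
  have C0: "0 \<le> Csob be" by (simp add: Csob_def)
  have r0: "be + be * lam - a > 0" using be lam_bounds a_bounds by (smt (verit) mult_pos_pos)
  have "integral {s1..t} (Phi (be + be * lam - a)) \<le> integral {s1..t} (\<lambda>r. Ebd be s0 s1 t powr lam * (Csob be * Jm\<^sup>2) * Ia be r)"
  proof (rule integral_le)
    show "Phi (be + be * lam - a) integrable_on {s1..t}"
      unfolding Phi_def[abs_def] using s1 r0 by (intro integrable_continuous_interval SC_cont_int SC_powr SC_base) auto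
    show "(\<lambda>r. Ebd be s0 s1 t powr lam * (Csob be * Jm\<^sup>2) * Ia be r) integrable_on {s1..t}"
      using time_cont[OF be s1] by (intro integrable_continuous_interval continuous_intros)
    fix r assume r: "r \<in> {s1..t}"
    then have rp: "r > 0" using s1 by simp
    have Jr: "(JJ r)\<^sup>2 \<le> Jm\<^sup>2" using J[of r] J0[of r] r by (intro power_mono) auto
    have "Phi (be + be * lam - a) r \<le> Phi be r powr lam * (Csob be * Ia be r * (JJ r)\<^sup>2)"
      using interp_main[OF rp be, of 1] C0 Ia_nn[of be r] by (simp add: Phi_def add_diff_eq)
    also have "\<dots> \<le> Ebd be s0 s1 t powr lam * (Csob be * Ia be r * Jm\<^sup>2)"
      using E(1)[of r] r Phi_nn lam_bounds Jr C0 Ia_nn[of be r] by (intro mult_mono powr_mono2 mult_left_mono) (auto intro!: mult_nonneg_nonneg)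
    finally show "Phi (be + be * lam - a) r \<le> Ebd be s0 s1 t powr lam * (Csob be * Jm\<^sup>2) * Ia be r" by (simp add: mult_ac)
  qed
  also have "\<dots> = Ebd be s0 s1 t powr lam * (Csob be * Jm\<^sup>2) * integral {s1..t} (Ia be)" by simp
  also have "\<dots> \<le> Ebd be s0 s1 t powr lam * (Csob be * Jm\<^sup>2) * (Ebd be s0 s1 t / bb be)"
    using E(2) bb_pos[OF be] C0 by (intro mult_left_mono) (auto simp: pos_le_divide_eq mult.commute)
  also have "\<dots> = Csob be / bb be * Jm\<^sup>2 * Ebd be s0 s1 t powr (1 + lam)"
    using E(3) by (simp add: powr_add)
  finally show ?thesis .
qed

section \<open>Integrals over space-time cylinders\<close>

definition QI :: "real \<Rightarrow> real \<Rightarrow> (real^3 \<Rightarrow> real \<Rightarrow> real) \<Rightarrow> real" where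
  "QI s t f = (\<integral>z. f (fst z) (snd z) \<partial>LQ s t)"
abbreviation "mQ s t \<equiv> measure (LQ s t) (space (LQ s t))"

lemma QI_int: "SC f \<Longrightarrow> s > 0 \<Longrightarrow> integrable (LQ s t) (\<lambda>z. f (fst z) (snd z) :: real)"
  by (intro intQ SC_cyl)

lemma QI_fubini: "SC f \<Longrightarrow> s > 0 \<Longrightarrow> QI s t f = integral {s..t} (\<lambda>r. \<integral>x. f x r \<partial>LU)"
  unfolding QI_def by (intro cylinder_fubini SC_cyl)

lemma QI_nn: "(\<And>x t. 0 \<le> f x t) \<Longrightarrow> 0 \<le> QI s t f" unfolding QI_def by (intro Bochner_Integration.integral_nonneg) auto

lemma QI_mono_set:
  assumes "SC f" "0 < s" "s \<le> r" "\<And>x t. 0 \<le> f x t"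
  shows "QI r t f \<le> QI s t f"
proof -
  have "QI r t f = integral {r..t} (\<lambda>r. \<integral>x. f x r \<partial>LU)" "QI s t f = integral {s..t} (\<lambda>r. \<integral>x. f x r \<partial>LU)"
    using assms by (auto intro!: QI_fubini)
  moreover have "integral {r..t} (\<lambda>r. \<integral>x. f x r \<partial>LU) \<le> integral {s..t} (\<lambda>r. \<integral>x. f x r \<partial>LU)"
    using assms by (intro integral_subset_le integrable_continuous_interval SC_cont_int) auto
  ultimately show ?thesis by simp
qed

lemma QI_mono: "SC f \<Longrightarrow> SC g \<Longrightarrow> s > 0 \<Longrightarrow> (\<And>x t. f x t \<le> g x t) \<Longrightarrow> QI s t f \<le> QI s t g"
  unfolding QI_def by (intro integral_mono QI_int) auto

lemma mQ_eq: assumes "s \<le> t" shows "mQ s t = measU U * (t - s)"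
proof -
  have "mQ s t = (\<integral>z. 1 \<partial>LQ s t)" by simp
  also have "\<dots> = integral {s..t} (\<lambda>r. \<integral>x. 1 \<partial>LU)" using cylinder_fubini[of s t "\<lambda>x r. 1"] by (auto intro: continuous_intros)
  also have "\<dots> = measU U * (t - s)" using assms measure_LU by (simp add: mult.commute)
  finally show ?thesis .
qed

lemma QI_holder_power:
  assumes s: "s > 0" and r: "0 < r" "r \<le> k"
  shows "QI s t (\<lambda>x t. rho x t powr r) \<le> QI s t (\<lambda>x t. rho x t powr k) powr (r / k) * mQ s t powr (1 - r / k)"
  unfolding QI_def
proof (rule holder_measure(2)[OF fin_LQ])
  have S: "SC (\<lambda>x t. rho x t powr k)" using r by (intro SC_powr SC_base) auto
  show "integrable (LQ s t) (\<lambda>z. rho (fst z) (snd z) powr k)" by (rule QI_int[OF S s])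
  show "(\<lambda>z. rho (fst z) (snd z)) \<in> borel_measurable (LQ s t)" by (rule borel_measurable_integrable[OF QI_int[OF SC_base(7) s]])
qed (use r in auto)

lemma QI_holder:
  assumes s: "s > 0" and pq: "p > 1" "1 / p + 1 / q' = 1" and r: "r > 0" and g: "SC g" "\<And>x t. 0 \<le> g x t"
  shows "QI s t (\<lambda>x t. rho x t powr r * g x t) \<le> QI s t (\<lambda>x t. rho x t powr (p * r)) powr (1 / p) * QI s t (\<lambda>x t. g x t powr q') powr (1 / q')"
proof -
  have "1 / p < 1" using pq by simp
  then have "1 / q' > 0" using pq(2) by linarith
  then have q0: "q' > 0" by simp
  have q1: "1 / q' = 1 - 1 / p" using pq(2) by simp
  have S: "SC (\<lambda>x t. rho x t powr (p * r))" "SC (\<lambda>x t. g x t powr q')" using pq r q0 g by (auto intro!: SC_powr SC_base)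
  have e: "rho x t powr r * g x t = (rho x t powr (p * r)) powr (1 / p) * (g x t powr q') powr (1 - 1 / p)" for x t
    using pq q0 g(2)[of x t] unfolding q1[symmetric] by (simp add: powr_powr)
  show ?thesis
    unfolding QI_def e q1 using pq by (intro holder_theta QI_int[OF S(1) s] QI_int[OF S(2) s]) auto
qed

end

context flow_sob begin

context
  fixes kt tau t Th :: real and p q' :: "nat \<Rightarrow> real"
  assumes kt: "kt > 1" and tau: "0 < tau" "tau \<le> t" and Th: "Th \<ge> 1" "measU U * t \<le> Th"
    and pq_ball: "\<forall>i\<in>{1..4}. 1 < p i \<and> p i < kt \<and> 1 / p i + 1 / q' i = 1"
begin

lemma pq: "i \<in> {1..4} \<Longrightarrow> 1 < p i \<and> p i < kt \<and> 1 / p i + 1 / q' i = 1"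
  using pq_ball by blast

definition "m1 = QI tau t (\<lambda>x t. (1 + norm (gP x t)) powr ((2 - a) * q' 1)) powr (1 / q' 1)"
definition "m2 = QI tau t (\<lambda>x t. (1 + Pa x t) powr (2 * (1 - a) * q' 2) * (1 + norm (gP x t)) powr ((2 - a) * q' 2)) powr (1 / q' 2)"
definition "m3 = QI tau t (\<lambda>x t. (1 + Pa x t) powr ((6 - 4 * a) * q' 3)) powr (1 / q' 3)"
definition "m4 = QI tau t (\<lambda>x t. \<bar>tder Psi x t\<bar> powr q' 4) powr (1 / q' 4)"
text \<open>The quantity \<open>\<M>\<close> of the informal statement, with the time interval reduced to \<open>(tau, t)\<close>.\<close>
definition "Mr = 1 + chi powr (1 - a) * m1 + chi powr (1 - a) * m2 + chi powr (3 - a) * m3 + m4"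

lemma m_nn: "0 \<le> m1" "0 \<le> m2" "0 \<le> m3" "0 \<le> m4" by (auto simp: m1_def m2_def m3_def m4_def)
lemma Mr_ge: "1 \<le> Mr" unfolding Mr_def using m_nn by (smt (verit) mult_nonneg_nonneg powr_ge_zero)

lemma mQ_le: "tau \<le> s \<Longrightarrow> s \<le> t \<Longrightarrow> mQ s t \<le> Th"
proof -
  assume s: "tau \<le> s" "s \<le> t"
  have "measU U * (t - s) \<le> measU U * t" using s tau by (intro mult_left_mono) auto
  then show ?thesis using mQ_eq[OF s(2)] Th by simp
qed

lemma q_gt: assumes "i \<in> {1..4}" shows "q' i > 1"
proof -
  have "1 / p i < 1" "1 / p i > 0" "1 / p i + 1 / q' i = 1" using pq[OF assms] by auto
  then have "0 < 1 / q' i" "1 / q' i < 1" by linarith+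
  then show ?thesis by (simp add: field_simps zero_less_divide_iff)
qed

text \<open>The maximum with 1 makes all logarithms in the iteration nonnegative.\<close>
definition "yy k s = max 1 (QI s t (\<lambda>x t. rho x t powr k) powr (1 / k))"

lemma yy_ge: "1 \<le> yy k s" by (simp add: yy_def)

text \<open>The first bound forgets the power of the measure in favour of \<open>Th\<close>. The
  second keeps it, because the term of highest order has no data norm and its coefficient must be
  controlled together with this power.\<close>

lemma QI_rho_le:
  assumes s: "tau \<le> s" "s \<le> t" and r: "0 < r" "r \<le> k" "r \<le> r'"
  shows "QI s t (\<lambda>x t. rho x t powr r) \<le> Th * yy k s powr r'"
    "QI s t (\<lambda>x t. rho x t powr r) \<le> yy k s powr r * mQ s t powr (1 - r / k)"
proof -
  define I where "I = QI s t (\<lambda>x t. rho x t powr k)"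
  have I0: "I \<ge> 0" unfolding I_def by (rule QI_nn) simp
  have "I powr (r / k) = (I powr (1 / k)) powr r" by (simp add: powr_powr)
  also have "\<dots> \<le> yy k s powr r" using r by (intro powr_mono2) (auto simp: yy_def I_def)
  finally have 1: "I powr (r / k) \<le> yy k s powr r" .
  have h: "QI s t (\<lambda>x t. rho x t powr r) \<le> I powr (r / k) * mQ s t powr (1 - r / k)"
    unfolding I_def using s tau r by (intro QI_holder_power) auto
  also have "\<dots> \<le> yy k s powr r * mQ s t powr (1 - r / k)" by (intro mult_right_mono 1) simp
  finally show 2: "QI s t (\<lambda>x t. rho x t powr r) \<le> yy k s powr r * mQ s t powr (1 - r / k)" .
  have "mQ s t powr (1 - r / k) \<le> Th powr (1 - r / k)" using mQ_le[OF s] r by (intro powr_mono2) auto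
  also have "\<dots> \<le> Th powr 1" using Th r by (intro powr_mono) auto
  finally have "mQ s t powr (1 - r / k) \<le> Th" using Th by simp
  moreover have "yy k s powr r \<le> yy k s powr r'" using r yy_ge by (intro powr_mono) auto
  ultimately have "yy k s powr r * mQ s t powr (1 - r / k) \<le> yy k s powr r' * Th" by (intro mult_mono) auto
  then show "QI s t (\<lambda>x t. rho x t powr r) \<le> Th * yy k s powr r'" using 2 by (simp add: mult.commute)
qed

lemma QI_rho_g_le:
  assumes s: "tau \<le> s" "s \<le> t" and i: "i \<in> {1..4}" and r: "0 < r" "p i * r \<le> k" "r \<le> r'"
    and g: "SC g" "\<And>x t. 0 \<le> g x t"
  shows "QI s t (\<lambda>x t. rho x t powr r * g x t) \<le> Th * yy k s powr r' * QI tau t (\<lambda>x t. g x t powr q' i) powr (1 / q' i)"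
proof -
  have P: "p i > 1" "1 / p i + 1 / q' i = 1" using pq[OF i] by auto
  have S: "SC (\<lambda>x t. g x t powr q' i)" using q_gt[OF i] g by (intro SC_powr) auto
  have "QI s t (\<lambda>x t. rho x t powr r * g x t) \<le> QI s t (\<lambda>x t. rho x t powr (p i * r)) powr (1 / p i) * QI s t (\<lambda>x t. g x t powr q' i) powr (1 / q' i)"
    using s tau r by (intro QI_holder P g) auto
  also have "\<dots> \<le> (Th * yy k s powr r') * QI tau t (\<lambda>x t. g x t powr q' i) powr (1 / q' i)"
  proof (rule mult_mono)
    have pr: "0 < p i * r" using P r by simp
    have "QI s t (\<lambda>x t. rho x t powr (p i * r)) powr (1 / p i) \<le> (Th * yy k s powr (p i * r)) powr (1 / p i)"
      using QI_rho_le(1)[OF s pr r(2) order_refl] P by (intro powr_mono2 QI_nn) auto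
    also have "\<dots> = Th powr (1 / p i) * yy k s powr r" using Th P yy_ge[of k s] by (simp add: powr_mult powr_powr)
    also have "\<dots> \<le> Th powr 1 * yy k s powr r'" using Th P yy_ge r by (intro mult_mono powr_mono) auto
    finally show "QI s t (\<lambda>x t. rho x t powr (p i * r)) powr (1 / p i) \<le> Th * yy k s powr r'" using Th by simp
    show "QI s t (\<lambda>x t. g x t powr q' i) powr (1 / q' i) \<le> QI tau t (\<lambda>x t. g x t powr q' i) powr (1 / q' i)"
      using S tau s q_gt[OF i] by (intro powr_mono2 QI_mono_set QI_nn) auto
  qed (use Th in auto)
  finally show ?thesis by simp
qed

lemma SC_gP1: "SC (\<lambda>x t. (1 + norm (gP x t)) powr r)" and SC_Pa1: "SC (\<lambda>x t. (1 + Pa x t) powr r)"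
proof -
  show "SC (\<lambda>x t. (1 + norm (gP x t)) powr r)" by (rule SC_powr_pos) (auto intro!: SC_intros SC_base add_pos_nonneg)
  show "SC (\<lambda>x t. (1 + Pa x t) powr r)" by (rule SC_powr_pos) (auto intro!: SC_intros SC_base add_pos_nonneg)
qed

text \<open>Each product of \<open>rho\<close> with data goes by Hoelder with its own pair
  \<open>p i\<close>, \<open>q' i\<close>; \<open>p i < kt\<close> keeps the resulting exponent of
  \<open>rho\<close> below \<open>k\<close>. The pure power of \<open>rho\<close> is handled by the
  assumption \<open>pure\<close>, which depends on the smallness hypothesis and is supplied
  later.\<close>

lemma QI_Hr_le:
  assumes be: "be > 2" and s: "tau \<le> s" "s \<le> t" and k: "k = kt * be" and big: "be + 4 * (1 - a) \<le> k"
    and pure: "3/2 * c12 N ab ac * chi powr (3 - 2*a) * mQ s t powr (1 - (be + 4 * (1 - a)) / k) \<le> Kp * Mr * Th"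
  shows "QI s t (\<lambda>x t. rho x t powr (be - 2) * Hr x t) \<le> (c11 N ab ac + 3/2 * c12 N ab ac + Kp) * Mr * Th * yy k s powr (be + 4 * (1 - a))"
    "QI s t (\<lambda>x t. rho x t powr (be - 1) * \<bar>tder Psi x t\<bar>) \<le> Th * yy k s powr (be + 4 * (1 - a)) * m4"
    "QI s t (\<lambda>x t. rho x t powr be) \<le> Th * yy k s powr (be + 4 * (1 - a))"
proof -
  note ab = a_bounds
  define mb where "mb = be + 4 * (1 - a)"
  define y where "y = yy k s powr mb"
  have y0: "0 \<le> y" by (simp add: y_def)
  have s0: "s > 0" using s tau by simp
  have pk: "p i * r \<le> k" if "i \<in> {1..4}" "0 < r" "r \<le> be" for i r
    unfolding k using pq[OF that(1)] that be by (intro mult_mono) auto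
  have bek: "be \<le> k" using big ab by simp
  show "QI s t (\<lambda>x t. rho x t powr be) \<le> Th * yy k s powr (be + 4 * (1 - a))"
    by (rule QI_rho_le(1)[OF s]) (use be bek ab in auto)
  show "QI s t (\<lambda>x t. rho x t powr (be - 1) * \<bar>tder Psi x t\<bar>) \<le> Th * yy k s powr (be + 4 * (1 - a)) * m4"
    unfolding m4_def by (rule QI_rho_g_le[OF s]) (use be pk[of 4 "be - 1"] ab in \<open>auto intro!: SC_intros SC_base\<close>)
  define G where "G x t = norm (gP x t)" for x t
  have SG: "SC G" unfolding G_def[abs_def] by (intro SC_intros SC_base)
  define f1 f2 f3 f4 f5 where "f1 = (\<lambda>x t. rho x t powr (be - 2))" and "f2 = (\<lambda>x t. rho x t powr (be - 2 * a) * G x t powr (2 - a))"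
    and "f3 = (\<lambda>x t. rho x t powr (be - 2) * ((1 + Pa x t) powr (2 - 2*a) * G x t powr (2 - a)))" and "f4 = (\<lambda>x t. rho x t powr mb)"
    and "f5 = (\<lambda>x t. rho x t powr (be - 2) * (1 + Pa x t) powr (6 - 4*a))"
  have S2: "SC (\<lambda>x t. G x t powr (2 - a))" by (rule SC_powr[OF SG]) (use ab in \<open>auto simp: G_def\<close>)
  have S3: "SC (\<lambda>x t. (1 + Pa x t) powr (2 - 2*a) * G x t powr (2 - a))" by (intro SC_intros SC_Pa1 S2)
  have S: "SC f1" "SC f2" "SC f3" "SC f4" "SC f5"
    unfolding f1_def f2_def f3_def f4_def f5_def using be ab
    by (auto intro!: SC_intros(4) SC_powr SC_base S2 S3 SC_Pa1 simp: mb_def)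
  have e: "rho x t powr (be - 2) * Hr x t = c11 N ab ac * f1 x t + 3/4 * c12 N ab ac * chi powr (1 - a) * f2 x t + 3/4 * c12 N ab ac * chi powr (1 - a) * f3 x t
     + 3/2 * c12 N ab ac * chi powr (3 - 2*a) * f4 x t + 3/2 * c12 N ab ac * chi powr (3 - 2*a) * f5 x t" for x t
  proof -
    have "be - 2 + (2 - 2*a) = be - 2 * a" "be - 2 + (6 - 4*a) = mb" by (auto simp: mb_def)
    then have "rho x t powr (be - 2) * rho x t powr (2 - 2*a) = rho x t powr (be - 2 * a)" "rho x t powr (be - 2) * rho x t powr (6 - 4*a) = rho x t powr mb"
      by (simp_all flip: powr_add)
    then have f: "f2 x t = rho x t powr (be - 2) * rho x t powr (2 - 2*a) * G x t powr (2 - a)" "f4 x t = rho x t powr (be - 2) * rho x t powr (6 - 4*a)"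
      by (simp_all add: f2_def f4_def)
    show ?thesis unfolding f Hr_def f1_def f3_def f5_def G_def by (simp add: algebra_simps add_divide_distrib)
  qed
  have "QI s t (\<lambda>x t. rho x t powr (be - 2) * Hr x t) = c11 N ab ac * QI s t f1 + 3/4 * c12 N ab ac * chi powr (1 - a) * QI s t f2 + 3/4 * c12 N ab ac * chi powr (1 - a) * QI s t f3
     + 3/2 * c12 N ab ac * chi powr (3 - 2*a) * QI s t f4 + 3/2 * c12 N ab ac * chi powr (3 - 2*a) * QI s t f5"
    unfolding QI_def e using QI_int[OF S(1) s0] QI_int[OF S(2) s0] QI_int[OF S(3) s0] QI_int[OF S(4) s0] QI_int[OF S(5) s0] by simp
  also have "\<dots> \<le> c11 N ab ac * (Th * y) + 3/4 * c12 N ab ac * chi powr (1 - a) * (Th * y * m1) + 3/4 * c12 N ab ac * chi powr (1 - a) * (Th * y * m2)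
     + Kp * Mr * Th * y + 3/2 * c12 N ab ac * chi powr (3 - 2*a) * (Th * y * m3)"
  proof (intro add_mono mult_left_mono)
    show "QI s t f1 \<le> Th * y" unfolding f1_def y_def using be bek ab by (intro QI_rho_le(1)[OF s]) (auto simp: mb_def)
    have "QI s t f2 \<le> Th * y * QI tau t (\<lambda>x t. (G x t powr (2 - a)) powr q' 1) powr (1 / q' 1)"
      unfolding f2_def y_def using be ab pk[of 1 "be - 2 * a"] by (intro QI_rho_g_le[OF s] S2) (auto simp: mb_def)
    also have "\<dots> \<le> Th * y * m1" unfolding m1_def
    proof (intro mult_left_mono powr_mono2 QI_mono QI_nn)
      show "(G x t powr (2 - a)) powr q' 1 \<le> (1 + norm (gP x t)) powr ((2 - a) * q' 1)" for x t
        using q_gt[of 1] ab by (auto simp: powr_powr G_def intro!: powr_mono2)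
    qed (use Th tau y0 q_gt[of 1] S2 in \<open>auto intro!: SC_gP1 SC_powr\<close>)
    finally show "QI s t f2 \<le> Th * y * m1" .
    have "QI s t f3 \<le> Th * y * QI tau t (\<lambda>x t. ((1 + Pa x t) powr (2 - 2*a) * G x t powr (2 - a)) powr q' 2) powr (1 / q' 2)"
      unfolding f3_def y_def using be ab pk[of 2 "be - 2"] by (intro QI_rho_g_le[OF s] S3) (auto simp: mb_def)
    also have "\<dots> \<le> Th * y * m2" unfolding m2_def
    proof (intro mult_left_mono powr_mono2 QI_mono QI_nn)
      show "((1 + Pa x t) powr (2 - 2*a) * G x t powr (2 - a)) powr q' 2 \<le> (1 + Pa x t) powr (2 * (1 - a) * q' 2) * (1 + norm (gP x t)) powr ((2 - a) * q' 2)" for x t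
      proof -
        have "((1 + Pa x t) powr (2 - 2*a) * G x t powr (2 - a)) powr q' 2 = (1 + Pa x t) powr (2 * (1 - a) * q' 2) * G x t powr ((2 - a) * q' 2)"
          by (simp add: powr_mult powr_powr right_diff_distrib)
        also have "\<dots> \<le> (1 + Pa x t) powr (2 * (1 - a) * q' 2) * (1 + norm (gP x t)) powr ((2 - a) * q' 2)"
          using q_gt[of 2] ab by (intro mult_left_mono powr_mono2) (auto simp: G_def)
        finally show ?thesis .
      qed
    qed (use Th tau y0 q_gt[of 2] S3 in \<open>auto intro!: SC_gP1 SC_Pa1 SC_powr SC_intros(4)\<close>)
    finally show "QI s t f3 \<le> Th * y * m2" .
    \<comment> \<open>Here the measure is kept as a power, so that \<open>pure\<close> applies to
      its product with the coefficient.\<close>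
    have "QI s t f4 \<le> yy k s powr mb * mQ s t powr (1 - mb / k)"
      unfolding f4_def using be ab big by (intro QI_rho_le(2)[OF s]) (auto simp: mb_def)
    then have "3/2 * c12 N ab ac * chi powr (3 - 2*a) * QI s t f4 \<le> 3/2 * c12 N ab ac * chi powr (3 - 2*a) * (yy k s powr mb * mQ s t powr (1 - mb / k))"
      using c12_pos by (intro mult_left_mono) auto
    also have "\<dots> = (3/2 * c12 N ab ac * chi powr (3 - 2*a) * mQ s t powr (1 - mb / k)) * y" by (simp add: y_def)
    also have "\<dots> \<le> Kp * Mr * Th * y" using pure y0 by (intro mult_right_mono) (auto simp: mb_def)
    finally show "3/2 * c12 N ab ac * chi powr (3 - 2*a) * QI s t f4 \<le> Kp * Mr * Th * y" .
    have "QI s t f5 \<le> Th * y * QI tau t (\<lambda>x t. ((1 + Pa x t) powr (6 - 4*a)) powr q' 3) powr (1 / q' 3)"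
      unfolding f5_def y_def using be ab pk[of 3 "be - 2"] by (intro QI_rho_g_le[OF s] SC_Pa1) (auto simp: mb_def)
    then show "QI s t f5 \<le> Th * y * m3" by (simp add: m3_def powr_powr)
  qed (use c11_pos c12_pos in auto)
  also have "\<dots> \<le> (c11 N ab ac + 3/2 * c12 N ab ac + Kp) * Mr * Th * y"
  proof -
    define z where "z = Th * y"
    have z0: "0 \<le> z" using Th y0 by (simp add: z_def)
    have c3: "chi powr (3 - 2*a) \<le> chi powr (3 - a)" using chi_ge(1) ab by (intro powr_mono) auto
    define n1 n2 n3 where "n1 = chi powr (1 - a) * m1" and "n2 = chi powr (1 - a) * m2" and "n3 = chi powr (3 - a) * m3"
    have nn: "0 \<le> n1" "0 \<le> n2" "0 \<le> n3" using m_nn by (auto simp: n1_def n2_def n3_def)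
    have Mrn: "Mr = 1 + n1 + n2 + n3 + m4" by (simp add: Mr_def n1_def n2_def n3_def)
    have k12: "0 < c12 N ab ac" by (rule c12_pos)
    have "3/4 * c12 N ab ac * n1 + 3/4 * c12 N ab ac * n2 + 3/2 * c12 N ab ac * (chi powr (3 - 2*a) * m3) \<le> 3/2 * c12 N ab ac * n1 + 3/2 * c12 N ab ac * n2 + 3/2 * c12 N ab ac * n3"
      using k12 nn c3 m_nn by (intro add_mono mult_right_mono mult_left_mono) (auto simp: n3_def intro!: mult_right_mono)
    also have "\<dots> = 3/2 * c12 N ab ac * (n1 + n2 + n3)" by (simp add: algebra_simps)
    also have "\<dots> \<le> 3/2 * c12 N ab ac * Mr" using k12 m_nn by (intro mult_left_mono) (auto simp: Mrn)
    finally have A: "3/4 * c12 N ab ac * n1 + 3/4 * c12 N ab ac * n2 + 3/2 * c12 N ab ac * (chi powr (3 - 2*a) * m3) \<le> 3/2 * c12 N ab ac * Mr" .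
    have B: "c11 N ab ac \<le> c11 N ab ac * Mr" using Mr_ge c11_pos by (simp add: mult_le_cancel_left1)
    have "(c11 N ab ac + (3/4 * c12 N ab ac * n1 + 3/4 * c12 N ab ac * n2 + 3/2 * c12 N ab ac * (chi powr (3 - 2*a) * m3)) + Kp * Mr) * z
       \<le> (c11 N ab ac * Mr + 3/2 * c12 N ab ac * Mr + Kp * Mr) * z"
      using add_mono[OF B A] by (intro mult_right_mono z0) linarith
    then show ?thesis by (simp add: z_def n1_def n2_def algebra_simps)
  qed
  finally show "QI s t (\<lambda>x t. rho x t powr (be - 2) * Hr x t) \<le> (c11 N ab ac + 3/2 * c12 N ab ac + Kp) * Mr * Th * yy k s powr (be + 4 * (1 - a))"
    by (simp add: y_def mb_def)
qed

lemma Ebd_le: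
  assumes be: "be \<ge> 3" and s: "tau \<le> s0" "s0 < s1" "s1 \<le> t" and k: "k = kt * be" and big: "be + 4 * (1 - a) \<le> k"
    and pure: "3/2 * c12 N ab ac * chi powr (3 - 2*a) * mQ s0 t powr (1 - (be + 4 * (1 - a)) / k) \<le> Kp * Mr * Th"
    and D: "1 / (s1 - s0) \<le> D" and Kp: "Kp \<ge> 0"
  shows "Ebd be s0 s1 t \<le> be\<^sup>2 * (D / 9 + c11 N ab ac + 3/2 * c12 N ab ac + Kp + 1) * Mr * Th * yy k s0 powr (be + 4 * (1 - a))"
proof -
  have s0: "s0 > 0" "s0 \<le> t" using s tau by auto
  have be2: "be > 2" using be by simp
  define y where "y = Th * yy k s0 powr (be + 4 * (1 - a))"
  have y0: "0 \<le> y" using Th by (simp add: y_def)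
  note H = QI_Hr_le[OF be2 s(1) s0(2) k big pure]
  have D0: "0 \<le> D" using D s by (smt (verit) zero_le_divide_1_iff)
  have S: "SC (\<lambda>x t. rho x t powr be)" "SC (\<lambda>x t. rho x t powr (be - 2) * Hr x t)" "SC (\<lambda>x t. rho x t powr (be - 1) * \<bar>tder Psi x t\<bar>)"
    using be by (auto intro!: SC_intros SC_powr SC_base SC_IwHr)
  have I: "integral {s0..t} (Phi be) = QI s0 t (\<lambda>x t. rho x t powr be)" using QI_fubini[OF S(1) s0(1), of t] by (simp add: Phi_def[abs_def])
  have "integral {s0..t} (Rs' be) = be * (be - 1) * QI s0 t (\<lambda>x t. rho x t powr (be - 2) * Hr x t) + be * QI s0 t (\<lambda>x t. rho x t powr (be - 1) * \<bar>tder Psi x t\<bar>)"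
    unfolding Rs'_def[abs_def] QI_fubini[OF S(2) s0(1), of t] QI_fubini[OF S(3) s0(1), of t]
    by (subst integral_add) (auto intro!: integrable_continuous_interval continuous_intros SC_cont_int S s0)
  also have "\<dots> \<le> be\<^sup>2 * ((c11 N ab ac + 3/2 * c12 N ab ac + Kp) * Mr * y) + be\<^sup>2 * (Mr * y)"
  proof (intro add_mono mult_mono)
    show "be * (be - 1) \<le> be\<^sup>2" "be \<le> be\<^sup>2" using be by (auto simp: power2_eq_square)
    show "QI s0 t (\<lambda>x t. rho x t powr (be - 2) * Hr x t) \<le> (c11 N ab ac + 3/2 * c12 N ab ac + Kp) * Mr * y" using H(1) by (simp add: y_def mult_ac)
    have "m4 \<le> Mr" unfolding Mr_def using m_nn by (smt (verit) mult_nonneg_nonneg powr_ge_zero)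
    then have "y * m4 \<le> y * Mr" using y0 by (rule mult_left_mono)
    then show "QI s0 t (\<lambda>x t. rho x t powr (be - 1) * \<bar>tder Psi x t\<bar>) \<le> Mr * y" using H(2) by (simp add: y_def mult_ac)
  qed (use be Hr_nn in \<open>auto intro!: QI_nn mult_nonneg_nonneg\<close>)
  finally have R: "integral {s0..t} (Rs' be) \<le> be\<^sup>2 * ((c11 N ab ac + 3/2 * c12 N ab ac + Kp) * Mr * y) + be\<^sup>2 * (Mr * y)" .
  have "1 / (s1 - s0) * integral {s0..t} (Phi be) \<le> D * y"
    unfolding I using D D0 H(3) s by (intro mult_mono) (auto simp: y_def intro!: QI_nn)
  also have "\<dots> \<le> be\<^sup>2 * (D / 9 * Mr * y)"
  proof -
    \<comment> \<open>From \<open>be >= 3\<close> the prefactor \<open>be^2\<close> is at least 9,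
      so the average over the gap can share it with the other terms; this is the origin of
      \<open>D / 9\<close>.\<close>
    have "3\<^sup>2 \<le> be\<^sup>2" using be by (intro power_mono) auto
    then have "9 * (D / 9 * 1 * y) \<le> be\<^sup>2 * (D / 9 * Mr * y)" using D0 y0 Mr_ge by (intro mult_mono mult_left_mono) auto
    then show ?thesis by simp
  qed
  finally show ?thesis using R by (simp add: Ebd_def y_def algebra_simps)
qed

end
end

section \<open>The iteration\<close>

text \<open>Unrolling multiplies the start value by all slopes, but an inhomogeneity only by the
  later ones. The slope \<open>r 0\<close> thus never acts on an inhomogeneity, whence the quotient
  \<open>nu / r 0\<close>.\<close>

lemma affine_recursion_bound:
  fixes x L b r :: "nat \<Rightarrow> real"
  assumes step: "\<And>j. x (Suc j) \<le> L j / b j + r j * x j" and r: "\<And>j. 1 \<le> r j" and L: "\<And>j. 0 \<le> L j" and b: "\<And>j. 0 < b j" and x0: "0 \<le> x 0"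
    and P: "\<And>n. (\<Prod>i<n. r i) \<le> nu" and S: "\<And>n. (\<Sum>j<n. L j / b j) \<le> S"
  shows "x n \<le> nu * x 0 + nu / r 0 * S"
proof -
  define P where "P n = (\<Prod>i<n. r i)" for n
  define T where "T n = (\<Sum>j<n. L j / b j)" for n
  have P1: "1 \<le> P n" for n unfolding P_def using r by (intro prod_ge_1) auto
  have Pr: "r 0 \<le> P (Suc n)" for n
  proof (induction n)
    case 0 then show ?case by (simp add: P_def)
  next
    case (Suc n)
    have "P (Suc n) * 1 \<le> P (Suc n) * r (Suc n)" using r[of "Suc n"] P1[of "Suc n"] by (intro mult_left_mono) auto
    then show ?case using Suc by (simp add: P_def)
  qed
  have r0: "r 0 > 0" using r[of 0] by linarith
  have T0: "0 \<le> T n" for n unfolding T_def using L b by (intro sum_nonneg divide_nonneg_pos) auto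
  have main: "x n \<le> P n * x 0 + P n / r 0 * T n" for n
  proof (induction n)
    case 0 then show ?case by (simp add: P_def T_def)
  next
    case (Suc n)
    have "x (Suc n) \<le> L n / b n + r n * (P n * x 0 + P n / r 0 * T n)"
      using step[of n] Suc r[of n] by (smt (verit) mult_left_mono)
    also have "L n / b n \<le> P (Suc n) / r 0 * (L n / b n)"
    proof -
      have "1 \<le> P (Suc n) / r 0" using Pr[of n] r0 by simp
      moreover have "0 \<le> L n / b n" using L[of n] b[of n] by simp
      ultimately show ?thesis using mult_right_mono by fastforce
    qed
    also have "P (Suc n) / r 0 * (L n / b n) + r n * (P n * x 0 + P n / r 0 * T n) = P (Suc n) * x 0 + P (Suc n) / r 0 * T (Suc n)"
      by (simp add: P_def T_def algebra_simps)
    finally show ?case by simp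
  qed
  have "P n * x 0 + P n / r 0 * T n \<le> nu * x 0 + nu / r 0 * S"
  proof (intro add_mono mult_mono divide_right_mono)
    show "P n \<le> nu" "P n \<le> nu" unfolding P_def by (rule P)+
    show "T n \<le> S" unfolding T_def by (rule S)
    show "0 \<le> nu / r 0" using P[of 0] r0 by simp
  qed (use x0 r0 T0 P[of 0] P1 in \<open>auto intro: order_trans[OF _ P]\<close>)
  then show ?thesis using main[of n] by linarith
qed

text \<open>The geometric series in \<open>1 / kt\<close> and its derivative; the second bound is
  the last factor of \<open>omega\<close>.\<close>

lemma sum_inverse_betaj:
  fixes kt a0 :: real
  assumes kt: "kt > 1" and a0: "a0 > 0"
  shows "(\<Sum>j<n. 1 / betaj kt a0 j) \<le> kt / (a0 * (kt - 1))" "(\<Sum>j<n. (real j + 1) / betaj kt a0 j) \<le> kt\<^sup>2 / (a0 * (kt - 1)\<^sup>2)"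
proof -
  define z where "z = 1 / kt"
  have z: "0 < z" "z < 1" "norm z < 1" using kt by (auto simp: z_def)
  have e: "1 / betaj kt a0 j = (1 / a0) * z ^ j" for j by (simp add: betaj_def z_def power_one_over mult.commute)
  have e2: "(real j + 1) / betaj kt a0 j = (1 / a0) * (of_nat (Suc j) * z ^ j)" for j
  proof -
    have "(real j + 1) / betaj kt a0 j = (real j + 1) * (1 / betaj kt a0 j)" by simp
    then show ?thesis unfolding e by (simp add: mult_ac add.commute)
  qed
  have "(\<Sum>j<n. z ^ j) \<le> 1 / (1 - z)"
    using sum_le_suminf[OF summable_geometric[OF z(3)], of "{..<n}"] suminf_geometric[OF z(3)] z by simp
  then have "(1 / a0) * (\<Sum>j<n. z ^ j) \<le> (1 / a0) * (1 / (1 - z))" using a0 by (intro mult_left_mono) auto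
  also have "\<dots> = kt / (a0 * (kt - 1))" using kt a0 by (simp add: z_def field_simps)
  finally show "(\<Sum>j<n. 1 / betaj kt a0 j) \<le> kt / (a0 * (kt - 1))" by (simp only: e sum_distrib_left)
  have gd: "(\<lambda>j. of_nat (Suc j) * z ^ j) sums (1 / (1 - z)\<^sup>2)" using geometric_deriv_sums[OF z(3)] by simp
  have "(\<Sum>j<n. of_nat (Suc j) * z ^ j) \<le> 1 / (1 - z)\<^sup>2"
    using sum_le_suminf[OF sums_summable[OF gd], of "{..<n}"] sums_unique[OF gd] z by simp
  then have "(1 / a0) * (\<Sum>j<n. of_nat (Suc j) * z ^ j) \<le> (1 / a0) * (1 / (1 - z)\<^sup>2)" using a0 by (intro mult_left_mono) auto
  also have "\<dots> = kt\<^sup>2 / (a0 * (kt - 1)\<^sup>2)"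
  proof -
    have "1 - z = (kt - 1) / kt" using kt by (simp add: z_def field_simps)
    then show ?thesis using kt a0 by (simp add: power_divide)
  qed
  finally show "(\<Sum>j<n. (real j + 1) / betaj kt a0 j) \<le> kt\<^sup>2 / (a0 * (kt - 1)\<^sup>2)" by (simp only: e2 sum_distrib_left)
qed

text \<open>The factors differ from 1 by a multiple of \<open>(1 / kt) ^ j\<close>, so the product
  converges; as they are at least 1, the partial products stay below the limit.\<close>

lemma nutilde_bound:
  fixes kt a0 a :: real
  assumes kt: "kt > 1" and a0: "a0 > 2" and a: "0 < a" "a < 1"
  shows "(\<Prod>j<n. stilde a kt a0 j / betaj kt a0 j) \<le> nutilde a kt a0" "1 \<le> stilde a kt a0 j / betaj kt a0 j" "1 \<le> nutilde a kt a0"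
proof -
  define r where "r j = stilde a kt a0 j / betaj kt a0 j" for j
  have be: "betaj kt a0 j > 2" for j
  proof -
    have "1 * a0 \<le> kt ^ j * a0" using kt a0 by (intro mult_right_mono one_le_power) auto
    then show ?thesis using a0 unfolding betaj_def by linarith
  qed
  have req: "r j = (1 + 4 * (1 - a) / betaj kt a0 j) * (1 + a / (betaj kt a0 j - a))" for j
    using be[of j] by (simp add: r_def stilde_def add_divide_distrib[symmetric] field_simps)
  have r1: "1 \<le> r j" for j
  proof -
    have "1 * 1 \<le> (1 + 4 * (1 - a) / betaj kt a0 j) * (1 + a / (betaj kt a0 j - a))"
      using be[of j] a by (intro mult_mono) auto
    then show ?thesis unfolding req by simp
  qed
  have rb: "norm (r j - 1) \<le> 14 / a0 * (1 / kt) ^ j" for j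
  proof -
    define B where "B = betaj kt a0 j"
    have B: "B > 2" using be by (simp add: B_def)
    define X Y where "X = 4 * (1 - a) / B" and "Y = a / (B - a)"
    have X: "0 \<le> X" "X \<le> 4 / B" "4 / B \<le> 2" using B a by (auto simp: X_def pos_divide_le_eq intro!: divide_right_mono)
    have Y: "0 \<le> Y" "Y \<le> 2 / B"
    proof -
      show "0 \<le> Y" using B a by (simp add: Y_def)
      have "a * B \<le> 2 * (B - a)"
      proof -
        have "a * B \<le> 1 * B" using a B by (intro mult_right_mono) auto
        moreover have "1 * B \<le> 2 * (B - a)" using a B by simp
        ultimately show ?thesis by (rule order_trans)
      qed
      then show "Y \<le> 2 / B" using B a by (simp add: Y_def divide_simps mult.commute)
    qed
    have "r j = (1 + X) * (1 + Y)" unfolding req X_def Y_def B_def ..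
    then have "r j - 1 = X + Y + X * Y" by (simp add: algebra_simps)
    moreover have "X * Y \<le> 2 * (2 / B)" using X Y by (intro mult_mono) auto
    moreover have "0 \<le> X * Y" using X Y by simp
    ultimately have "norm (r j - 1) \<le> 10 / B" using X Y by simp
    also have "\<dots> \<le> 14 / B" using B by (intro divide_right_mono) auto
    also have "\<dots> = 14 / a0 * (1 / kt) ^ j" by (simp add: B_def betaj_def power_one_over mult.commute)
    finally show ?thesis .
  qed
  have "summable (\<lambda>j. 14 / a0 * (1 / kt) ^ j)" using kt by (intro summable_mult summable_geometric) auto
  then have "summable (\<lambda>j. norm (r j - 1))"
    by (rule summable_comparison_test'[where N = 0]) (use rb in auto)
  then have "convergent_prod r" by (intro abs_convergent_prod_imp_convergent_prod) (simp add: abs_convergent_prod_conv_summable)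
  then have hp: "r has_prod prodinf r" by (rule convergent_prod_has_prod)
  have nu: "nutilde a kt a0 = prodinf r" by (simp add: nutilde_def r_def[abs_def])
  have le: "(\<Prod>j<n. r j) \<le> prodinf r" for n
    using prod_le_prodinf[OF hp, of n] r1 by (smt (verit))
  then show "(\<Prod>j<n. stilde a kt a0 j / betaj kt a0 j) \<le> nutilde a kt a0" by (simp add: nu r_def)
  show "1 \<le> stilde a kt a0 j / betaj kt a0 j" using r1[of j] by (simp add: r_def)
  show "1 \<le> nutilde a kt a0" using le[of 0] by (simp add: nu)
qed

text \<open>Lets \<open>sum_L_le\<close> trade \<open>2 * ln KK\<close> for
  \<open>KK\<close>.\<close>

lemma ln_le_half: "x > 0 \<Longrightarrow> 2 * ln x \<le> x" for x :: real
proof -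
  assume x: "x > 0"
  have "ln (x / 2) \<le> x / 2 - 1" using x by (intro ln_le_minus_one) auto
  moreover have "ln (2::real) \<le> 2 - 1" by (rule ln_le_minus_one) simp
  ultimately show ?thesis using x by (simp add: ln_div)
qed

lemma ln4_ge_1: "1 \<le> ln (4 :: real)"
proof -
  have "exp 1 < (4 :: real)" using exp_le by simp
  then show ?thesis by (simp add: ln_ge_iff)
qed

locale flow_it = flow_al N ab ac U kv Rs G Om e0 Psi u rs cbar al
  for N ab ac U kv Rs G Om e0 Psi u rs cbar al +
  fixes kt a0 sig t T :: real and p q' :: "nat \<Rightarrow> real"
  assumes al_eq: "al = kt * a0" and kt: "kt > 1" "kt\<^sup>2 < 1 + lam"
    and pq: "\<And>i. i \<in> {1..4} \<Longrightarrow> 1 < p i \<and> p i < kt \<and> 1 / p i + 1 / q' i = 1"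
    and a0_1: "a0 \<ge> 2 * p 3 * (1 - a) / (kt - p 3)" and a0_2: "a0 \<ge> 4 * (1 - a) / (kt - 1)"
    and a0_3: "a0 \<ge> a / (1 + lam - kt\<^sup>2)" and a0_4: "a0 > a / lam" and a0_5: "a0 > 2"
    and sig: "0 < sig" "sig < 1" and tT: "0 < t" "t \<le> T"
    and fin: "EInt a rs chi U Psi al T < top" and small: "gam * Cst * V0 powr gam * ET T < 1"
begin

definition "h = kt - 1"
definition "KK = 1 / h"
abbreviation "be j \<equiv> betaj kt a0 j"
definition "tj j = sig * t * (1 - 1 / 2 ^ Suc j)"
definition "w = 1 + measU U"
definition "Th = w * (1 + t)"
definition "tau = sig * t / 2"
abbreviation "Mq \<equiv> Mr tau t q'"

lemma h_pos: "h > 0" using kt by (simp add: h_def)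

text \<open>The conditions on \<open>a0\<close> reinforce one another: adding
  \<open>a <= a0 * (1 + lam - kt^2)\<close> to twice \<open>4 * (1 - a) <= a0 * (kt - 1)\<close>
  gives \<open>8 - 7 * a <= a0 * lam\<close>, and \<open>lam < (2 - a) / 3\<close> does the rest.
  \<open>Ebd_le\<close> needs exponents of at least 3.\<close>

lemma a0_gt3: "a0 > 3"
proof -
  have d: "0 < 1 + lam - kt\<^sup>2" using kt by simp
  have f1: "a \<le> a0 * (1 + lam - kt\<^sup>2)" using a0_3 d by (simp add: pos_divide_le_eq)
  have f2: "4 * (1 - a) \<le> a0 * (kt - 1)" using a0_2 kt by (simp add: pos_divide_le_eq)
  have "a0 * (kt - 1) * 2 \<le> a0 * (kt - 1) * (kt + 1)" using kt a0_5 by (intro mult_left_mono) auto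
  also have "\<dots> = a0 * kt\<^sup>2 - a0" by (simp add: power2_eq_square algebra_simps)
  finally have f3: "a0 * (kt - 1) * 2 \<le> a0 * kt\<^sup>2 - a0" .
  define P1 P2 P3 where "P1 = a0 * (kt - 1)" and "P2 = a0 * kt\<^sup>2" and "P3 = a0 * lam"
  have "a \<le> a0 + P3 - P2" using f1 by (simp add: P2_def P3_def algebra_simps)
  moreover have "4 - 4 * a \<le> P1" using f2 by (simp add: P1_def)
  moreover have "2 * P1 \<le> P2 - a0" using f3 by (simp add: P1_def P2_def)
  ultimately have "8 - 7 * a \<le> P3" by linarith
  then have 1: "8 - 7 * a \<le> a0 * lam" by (simp add: P3_def)
  have "a0 * lam < a0 * ((2 - a) / 3)" using lam_bounds a0_5 by (intro mult_strict_left_mono) auto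
  then have "3 * (8 - 7 * a) < a0 * (2 - a)" using 1 by simp
  moreover have "3 * (2 - a) \<le> 3 * (8 - 7 * a)" using a_bounds by simp
  ultimately have "3 * (2 - a) < a0 * (2 - a)" by linarith
  then show ?thesis by (rule mult_right_less_imp_less) (use a_bounds in simp)
qed

text \<open>For \<open>kt >= 4/3\<close> the bound \<open>kt^2 < 1 + lam\<close> would give
  \<open>lam > 7/9\<close>, against \<open>lam < 2/3\<close>.\<close>

lemma h_lt: "h < 1/3"
proof (rule ccontr)
  assume "\<not> h < 1/3"
  then have "4/3 \<le> kt" by (simp add: h_def)
  then have "(4/3)\<^sup>2 \<le> kt\<^sup>2" by (intro power_mono) auto
  then show False using kt lam_bounds a_bounds by (simp add: power2_eq_square)
qed

lemma KK_gt: "KK > 3"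
  using h_pos h_lt by (simp add: KK_def field_simps)

lemma be_ge: "be j \<ge> a0" "be j > 3" "be (Suc j) = kt * be j" "be 0 = a0" "be 1 = al"
proof -
  have "1 * a0 \<le> kt ^ j * a0" using kt a0_5 by (intro mult_right_mono one_le_power) auto
  then show "be j \<ge> a0" by (simp add: betaj_def)
  then show "be j > 3" using a0_gt3 by simp
qed (auto simp: betaj_def al_eq)

lemma tj_facts: "tj 0 = tau" "tau \<le> tj j" "tj j < tj (Suc j)" "tj j < sig * t" "tj (Suc j) - tj j = sig * t / 2 ^ (j + 2)" "tj j \<le> t"
proof -
  have st: "0 < sig * t" using sig tT by simp
  show "tj 0 = tau" by (simp add: tj_def tau_def)
  have "(1::real) / 2 ^ Suc j \<le> 1 / 2 ^ Suc 0" by (intro divide_left_mono power_increasing) auto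
  then have "sig * t * (1 / 2) \<le> sig * t * (1 - 1 / 2 ^ Suc j)" using st by (intro mult_left_mono) auto
  then show "tau \<le> tj j" by (simp add: tj_def tau_def)
  show d: "tj (Suc j) - tj j = sig * t / 2 ^ (j + 2)" by (simp add: tj_def algebra_simps)
  have "0 < sig * t / 2 ^ (j + 2)" using st by simp
  then show "tj j < tj (Suc j)" using d by linarith
  have "sig * t * (1 - 1 / 2 ^ Suc j) < sig * t * 1" using st by (intro mult_strict_left_mono) auto
  then show 1: "tj j < sig * t" by (simp add: tj_def)
  have "sig * t \<le> 1 * t" using sig tT by (intro mult_right_mono) auto
  then show "tj j \<le> t" using 1 by simp
qed

lemma tau_pos: "0 < tau" "tau \<le> t" using tj_facts(2)[of 0] tj_facts(6)[of 0] sig tT by (auto simp: tau_def)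

lemma w_ge: "w \<ge> 1" "measU U \<le> w" by (auto simp: w_def)
lemma Th_ge: "Th \<ge> 1" "measU U * t \<le> Th" "w \<le> Th"
proof -
  have "1 * 1 \<le> w * (1 + t)" using w_ge tT by (intro mult_mono) auto
  then show "Th \<ge> 1" by (simp add: Th_def)
  show "measU U * t \<le> Th" unfolding Th_def using w_ge tT by (intro mult_mono) auto
  have "w * 1 \<le> w * (1 + t)" using w_ge tT by (intro mult_left_mono) auto
  then show "w \<le> Th" by (simp add: Th_def)
qed

lemma pq_ball: "\<forall>i\<in>{1..4}. 1 < p i \<and> p i < kt \<and> 1 / p i + 1 / q' i = 1" using pq by blast

lemmas ctx = kt(1) tau_pos Th_ge(1,2) pq_ball

text \<open>The integrand in the smallness hypothesis is at least \<open>chi powr mub\<close>, so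
  the hypothesis limits time itself. The factor \<open>1 - a\<close> comes from
  \<open>gam_ge\<close>, \<open>c12\<close> from \<open>Cst_ge\<close>, and
  \<open>al - 1 >= 2\<close> supplies a factor 2 of the 32.\<close>

lemma small_time: "32 * (1 - a) * c12 N ab ac * chi powr (3 - 2*a) * t \<le> 1"
proof -
  have T: "T > 0" using tT by simp
  note vb = Vbd_bound[OF T fin small tT]
  have al3: "al > 3" using be_ge(2)[of 1] be_ge(5) by simp
  have k12: "0 < c12 N ab ac" by (rule c12_pos)
  have "4 * c12 N ab ac \<le> c15 N ab ac" using c11_pos by (simp add: c15_def c14_def le_max_iff_disj)
  then have "4 * c12 N ab ac * (al * (al - 1)) \<le> c15 N ab ac * (al * (al - 1))" using al3 by (intro mult_right_mono) auto
  also have "\<dots> \<le> Cst" using Cst_ge by (simp add: mult.assoc)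
  finally have C: "4 * c12 N ab ac * (al * (al - 1)) \<le> Cst" .
  have "32 * (1 - a) * c12 N ab ac = 4 * (1 - a) * (4 * c12 N ab ac * 2)" by simp
  also have "\<dots> \<le> 4 * (1 - a) * (4 * c12 N ab ac * (al - 1))" using a_bounds k12 al3 by (intro mult_left_mono) auto
  also have "\<dots> = (4 * (1 - a) / al) * (4 * c12 N ab ac * (al * (al - 1)))" using al3 by simp
  also have "\<dots> \<le> gam * Cst" using gam_ge C a_bounds al3 k12 gam_pos by (intro mult_mono) auto
  also have "\<dots> \<le> gam * Cst * V0 powr gam"
  proof -
    have "1 \<le> V0 powr gam" using V0_ge gam_pos by (intro powr_ge_one) auto
    then have "gam * Cst * 1 \<le> gam * Cst * V0 powr gam" using gam_pos Cst_nn by (intro mult_left_mono) auto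
    then show ?thesis by simp
  qed
  finally have g: "32 * (1 - a) * c12 N ab ac \<le> gam * Cst * V0 powr gam" .
  have "chi powr (3 - 2*a) \<le> chi powr mub" using mub_ge chi_ge(1) by (intro powr_mono) auto
  then have "chi powr (3 - 2*a) * t \<le> chi powr mub * t" using tT by (intro mult_right_mono) auto
  then have le: "chi powr (3 - 2*a) * t \<le> ET t" using vb(3) by linarith
  have "(32 * (1 - a) * c12 N ab ac) * (chi powr (3 - 2*a) * t) \<le> (gam * Cst * V0 powr gam) * ET t"
    by (rule mult_mono[OF g le]) (use gam_pos Cst_nn tT in auto)
  then show ?thesis using vb(4) by (simp add: mult.assoc)
qed

text \<open>One summand for each case of \<open>pure_bound\<close>: the first where a data norm
  dominates, the second where the smallness hypothesis does.\<close>

definition "Kp = 3/2 * c12 N ab ac + KK / (sig * t)"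

text \<open>The exponent of the measure in the term of highest order. It is smallest at
  \<open>j = 0\<close>, so a condition on \<open>a0\<close> alone covers all steps.\<close>

lemma expo: assumes "d = 4 * (1 - a)"
  shows "be j + d \<le> kt * be j" "0 \<le> 1 - (be j + d) / (kt * be j)" "1 - (be j + d) / (kt * be j) \<le> 1"
    "1 - (a0 + d) / (kt * a0) \<le> 1 - (be j + d) / (kt * be j)"
proof -
  have b: "be j > 0" "a0 > 0" using be_ge(2)[of j] a0_5 by auto
  have "d \<le> a0 * (kt - 1)" using a0_2 kt by (simp add: assms pos_divide_le_eq)
  also have "\<dots> \<le> be j * (kt - 1)" using be_ge(1)[of j] kt by (intro mult_right_mono) auto
  finally show 1: "be j + d \<le> kt * be j" by (simp add: algebra_simps)
  have kb: "0 < kt * be j" using kt b by simp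
  show "0 \<le> 1 - (be j + d) / (kt * be j)" using 1 kb by simp
  have d0: "0 \<le> d" using a_bounds by (simp add: assms)
  then show "1 - (be j + d) / (kt * be j) \<le> 1" using kb b by simp
  have "d / (kt * be j) \<le> d / (kt * a0)" using d0 kt b be_ge(1)[of j] by (intro divide_left_mono mult_left_mono) auto
  then show "1 - (a0 + d) / (kt * a0) \<le> 1 - (be j + d) / (kt * be j)" using b kt by (simp add: add_divide_distrib)
qed

text \<open>\<open>1 + Pa\<close> is at least 1, so the third data norm dominates a power of the
  measure even for vanishing data.\<close>

lemma m3_ge: assumes "tau \<le> s" "s \<le> t" shows "mQ s t powr (1 / q' 3) \<le> m3 tau t q'"
proof -
  have q1: "q' 3 > 1" by (rule q_gt[OF ctx]) simp
  have "mQ s t \<le> mQ tau t" using assms mult_left_mono[of "t - s" "t - tau" "measU U"] by (simp only: mQ_eq tau_pos) simp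
  also have "\<dots> = QI tau t (\<lambda>x t. 1)" by (simp add: QI_def)
  also have "\<dots> \<le> QI tau t (\<lambda>x t. (1 + Pa x t) powr ((6 - 4 * a) * q' 3))"
    using tau_pos q1 a_bounds by (intro QI_mono SC_intros SC_Pa1[OF ctx] powr_ge_one) auto
  finally show ?thesis unfolding m3_def[OF ctx] using q1 by (intro powr_mono2) auto
qed

lemma Mq_ge: "1 + chi powr (3 - a) * m3 tau t q' \<le> Mq" "1 \<le> Mq"
proof -
  note n = m_nn[OF ctx]
  have "0 \<le> chi powr (1 - a) * m1 tau t q'" "0 \<le> chi powr (1 - a) * m2 tau t q'" using n by auto
  then show "1 + chi powr (3 - a) * m3 tau t q' \<le> Mq" unfolding Mr_def[OF ctx] using n(4) by linarith
  show "1 \<le> Mq" by (rule Mr_ge[OF ctx])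
qed

text \<open>The term of highest order carries the factor \<open>\<chi>\<^sub>*\<close> to the power \<open>3 - 2a\<close> but no norm of the data.
  If \<open>a * h * a0 \<ge> 6 * (1 - a)\<close>, it is dominated by the third summand of \<open>\<M>\<close>;
  otherwise \<open>1 - a\<close> is at least a multiple of \<open>h\<close> and the smallness hypothesis bounds it by \<open>KK / t\<close>.\<close>
lemma pure_bound:
  assumes s: "tau \<le> s" "s \<le> t"
  shows "3/2 * c12 N ab ac * chi powr (3 - 2*a) * mQ s t powr (1 - (be j + 4 * (1 - a)) / (kt * be j)) \<le> Kp * Mq * Th"
proof -
  define e where "e = 1 - (be j + 4 * (1 - a)) / (kt * be j)"
  have e: "0 \<le> e" "e \<le> 1" using expo[OF refl, of j] by (auto simp: e_def)
  define mu where "mu = mQ s t"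
  have mu: "0 \<le> mu" "mu \<le> Th" using mQ_le[OF ctx s] by (auto simp: mu_def)
  have k12: "0 < c12 N ab ac" by (rule c12_pos)
  have mue: "mu powr e \<le> Th"
  proof -
    have "mu powr e \<le> Th powr e" using mu e by (intro powr_mono2) auto
    also have "\<dots> \<le> Th powr 1" using Th_ge e by (intro powr_mono) auto
    finally show ?thesis using Th_ge by simp
  qed
  have KP: "0 \<le> KK / (sig * t)" using KK_gt sig tT by simp
  show ?thesis
  proof (cases "6 * (1 - a) \<le> a * h * a0")
    case True
    define z where "z = chi powr (3 - a) * m3 tau t q'"
    have zM: "1 + z \<le> Mq" using Mq_ge(1) by (simp add: z_def)
    have m3: "mu powr (1 / q' 3) \<le> m3 tau t q'" using m3_ge[OF s] by (simp add: mu_def)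
    have z0: "0 \<le> z" using m_nn[OF ctx] by (simp add: z_def)
    have q3: "q' 3 > 1" by (rule q_gt[OF ctx]) simp
    have cle: "chi powr (3 - 2*a) \<le> chi powr (3 - a)" using chi_ge(1) a_bounds by (intro powr_mono) auto
    have "chi powr (3 - 2*a) * mu powr e \<le> Mq * Th"
    \<comment> \<open>For \<open>mu >= 1\<close> the quantity \<open>z\<close> alone exceeds the
      power of \<open>chi\<close>; for smaller \<open>mu\<close> the powers of \<open>chi\<close>
      and \<open>mu\<close> must be traded against each other.\<close>
    proof (cases "mu \<ge> 1")
      case True
      then have "1 \<le> mu powr (1 / q' 3)" using q3 by (intro powr_ge_one) auto
      then have "chi powr (3 - a) * 1 \<le> z" unfolding z_def using m3 by (intro mult_left_mono) auto
      then have "chi powr (3 - 2*a) \<le> Mq" using cle zM by simp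
      then show ?thesis using mue Mq_ge(2) by (intro mult_mono) auto
    next
      case False
      have "chi powr (3 - 2*a) * mu powr e \<le> 1 + z"
      proof (cases "mu = 0")
        case True then show ?thesis using z0 by simp
      next
        case mu0: False
        \<comment> \<open>The power of \<open>z\<close> to compare with.
          \<open>l <= e * q' 3\<close> gives the right direction for powers of
          \<open>mu < 1\<close>, \<open>l <= 1\<close> bounds \<open>z powr l\<close> by
          \<open>1 + z\<close>, and \<open>key\<close> says that enough of the power of
          \<open>chi\<close> is left.\<close>
        define l where "l = min 1 (e * q' 3)"
        have l: "0 \<le> l" "l \<le> 1" "l \<le> e * q' 3" using e q3 by (auto simp: l_def)
        have key: "3 - 2*a \<le> (3 - a) * l"
        proof (cases "1 \<le> e * q' 3")
          case True then show ?thesis using a_bounds by (simp add: l_def)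
        next
          case False
          define d where "d = 2 * (1 - a)"
          have p3: "1 < p 3" "p 3 < kt" "1 / p 3 + 1 / q' 3 = 1" using pq[of 3] by auto
          have a00: "a0 > 0" using a0_5 by simp
          have "2 * p 3 * (1 - a) \<le> a0 * (kt - p 3)" using a0_1 p3 by (simp add: pos_divide_le_eq)
          then have "p 3 * (a0 + d) \<le> kt * a0" by (simp add: d_def algebra_simps)
          then have "(a0 + d) / (kt * a0) \<le> 1 / p 3" using p3 kt a00 by (simp add: divide_simps mult.commute)
          then have "1 / q' 3 \<le> 1 - (a0 + d) / (kt * a0)" using p3 by linarith
          also have "1 - (a0 + d) / (kt * a0) = (h * a0 - d) / (kt * a0)" using kt a00 by (simp add: h_def field_simps)
          finally have Q: "1 / q' 3 \<le> (h * a0 - d) / (kt * a0)" .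
          have "1 - (a0 + 4 * (1 - a)) / (kt * a0) = (h * a0 - 2 * d) / (kt * a0)" using kt a00 by (simp add: h_def d_def field_simps)
          then have E: "(h * a0 - 2 * d) / (kt * a0) \<le> e" using expo(4)[OF refl, of j] by (simp add: e_def)
          \<comment> \<open>The difference of the two sides is
            \<open>a * h * a0 - 6 * (1 - a)\<close>, nonnegative by the case assumption.\<close>
          have "(3 - 2*a) * (h * a0 - d) \<le> (3 - a) * (h * a0 - 2 * d)"
            using \<open>6 * (1 - a) \<le> a * h * a0\<close> by (simp add: d_def algebra_simps)
          then have "(3 - 2*a) * ((h * a0 - d) / (kt * a0)) \<le> (3 - a) * ((h * a0 - 2 * d) / (kt * a0))"
            using kt a00 by (simp add: divide_right_mono)
          then have "(3 - 2*a) * (1 / q' 3) \<le> (3 - a) * e"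
            using mult_left_mono[OF Q, of "3 - 2*a"] mult_left_mono[OF E, of "3 - a"] a_bounds by linarith
          then have "3 - 2*a \<le> (3 - a) * e * q' 3" using q3 by (simp add: pos_divide_le_eq)
          then show ?thesis using False by (simp add: l_def mult.assoc)
        qed
        have lq: "l / q' 3 \<le> e" using l q3 by (simp add: pos_divide_le_eq)
        have "chi powr (3 - 2*a) * mu powr e \<le> chi powr ((3 - a) * l) * mu powr (l / q' 3)"
          using key lq chi_ge(1) False mu by (intro mult_mono powr_mono powr_mono') auto
        also have "\<dots> = (chi powr (3 - a) * mu powr (1 / q' 3)) powr l"
          by (simp add: powr_mult powr_powr)
        also have "\<dots> \<le> z powr l" unfolding z_def using m3 l by (intro powr_mono2 mult_left_mono) auto
        also have "\<dots> \<le> 1 + z powr 1" using l z0 by (intro powr_le_one_add) auto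
        finally show ?thesis using z0 by simp
      qed
      then have "chi powr (3 - 2*a) * mu powr e \<le> Mq * 1" using zM by simp
      also have "\<dots> \<le> Mq * Th" using Th_ge Mq_ge(2) by (intro mult_left_mono) auto
      finally show ?thesis .
    qed
    then have "3/2 * c12 N ab ac * (chi powr (3 - 2*a) * mu powr e) \<le> 3/2 * c12 N ab ac * (Mq * Th)" using k12 by (intro mult_left_mono) auto
    also have "\<dots> \<le> Kp * (Mq * Th)" unfolding Kp_def using KP Mq_ge(2) Th_ge by (intro mult_right_mono) auto
    finally show ?thesis by (simp add: mu_def e_def mult.assoc)
  next
    case False
    \<comment> \<open>For \<open>a <= 1/2\<close> this is \<open>KK > 3\<close>. For larger
      \<open>a\<close>, the failed case condition with \<open>a0 > 3\<close> forces
      \<open>h <= 4 * (1 - a)\<close>.\<close>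
    have ka: "1/4 \<le> KK * (1 - a)"
    proof (cases "a \<le> 1/2")
      case True
      have "3 * (1/2) \<le> KK * (1 - a)" using KK_gt True by (intro mult_mono) auto
      then show ?thesis by simp
    next
      case a2: False
      have "1/2 * h * 3 \<le> a * h * a0" using a2 h_pos a0_gt3 by (intro mult_mono) auto
      then have "h \<le> 4 * (1 - a)" using False by simp
      then show ?thesis using h_pos by (simp add: KK_def field_simps)
    qed
    have st: "0 < sig * t" "sig * t \<le> t" using sig tT by auto
    define C where "C = c12 N ab ac * chi powr (3 - 2*a) * t"
    have C: "0 \<le> C" "32 * (1 - a) * C \<le> 1" using k12 tT small_time by (auto simp: C_def mult_ac)
    have "C * (1/4) \<le> C * (KK * (1 - a))" using ka C by (intro mult_left_mono) auto
    also have "\<dots> = KK / 32 * (32 * (1 - a) * C)" by simp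
    also have "\<dots> \<le> KK / 32 * 1" using C KK_gt by (intro mult_left_mono) auto
    finally have "3/2 * C \<le> KK" using KK_gt by simp
    then have "3/2 * c12 N ab ac * chi powr (3 - 2*a) * t \<le> KK" by (simp add: C_def mult.assoc)
    then have "3/2 * c12 N ab ac * chi powr (3 - 2*a) \<le> KK / t" using tT by (simp add: pos_le_divide_eq)
    also have "\<dots> \<le> KK / (sig * t)" using st KK_gt by (intro divide_left_mono) auto
    also have "\<dots> \<le> Kp" using k12 by (simp add: Kp_def)
    finally have "3/2 * c12 N ab ac * chi powr (3 - 2*a) \<le> Kp" .
    moreover have Kp0: "0 \<le> Kp" using KP k12 by (simp add: Kp_def)
    then have "Kp * 1 \<le> Kp * Mq" using Mq_ge(2) by (intro mult_left_mono) auto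
    ultimately have A: "3/2 * c12 N ab ac * chi powr (3 - 2*a) \<le> Kp * Mq" by simp
    have "3/2 * c12 N ab ac * chi powr (3 - 2*a) * mu powr e \<le> (Kp * Mq) * Th"
      by (rule mult_mono[OF A mue]) (use Kp0 Mq_ge(2) in auto)
    then show ?thesis by (simp add: mu_def e_def)
  qed
qed

end

section \<open>The recursion for the norms and its solution\<close>

context flow_it begin

abbreviation "Vt \<equiv> Vbd t"

lemma T_pos: "T > 0" using tT by simp

lemma Phi_le_Vt: assumes "0 < r" "r \<le> t" shows "1 + Phi al r \<le> Vt"
  using Vbd_bound(1)[OF T_pos fin small assms(1)] Vbd_bound(2)[OF T_pos fin small tT, of r] assms tT by simp

lemma Vt_ge: "Vt \<ge> 1" using Phi_le_Vt[of t] Phi_nn[of al t] tT by simp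

text \<open>The Sobolev constant grows at most quadratically in the exponent and so does the
  coefficient of the dissipation, so the quotient is bounded uniformly along the iteration.\<close>

lemma Csob_le: assumes bt2: "bt > 2" shows "Csob bt / bb bt \<le> 2 * cbar1 N ab ac cbar * chi"
proof -
  define K where "K = (cbar / (2 - a)) powr (2 - a)"
  have K0: "0 \<le> K" by (simp add: K_def)
  have k: "0 < c10 N ab ac" "1 \<le> chi" using c10_pos chi_ge(1) by auto
  have Kc: "K / c10 N ab ac \<le> cbar1 N ab ac cbar" by (simp add: cbar1_def K_def)
  have "Csob bt = K * (bt - a) powr (2 - a)"
    using bt2 cbar0 a_bounds by (simp add: Csob_def K_def flip: powr_mult)
  also have "\<dots> \<le> K * (2 * (bt * (bt - 1)))"
  proof (rule mult_left_mono[OF _ K0])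
    have "(bt - a) powr (2 - a) \<le> bt powr (2 - a)" using bt2 a_bounds by (intro powr_mono2) auto
    also have "\<dots> \<le> bt powr 2" using bt2 a_bounds by (intro powr_mono) auto
    also have "\<dots> = bt * bt" using bt2 by (simp add: power2_eq_square)
    also have "\<dots> \<le> bt * (2 * (bt - 1))" using bt2 by (intro mult_left_mono) auto
    also have "\<dots> = 2 * (bt * (bt - 1))" by simp
    finally show "(bt - a) powr (2 - a) \<le> 2 * (bt * (bt - 1))" .
  qed
  finally have C: "Csob bt \<le> K * (2 * (bt * (bt - 1)))" .
  have p: "bt * (bt - 1) > 0" using bt2 by simp
  have "Csob bt / bb bt \<le> K * (2 * (bt * (bt - 1))) / bb bt" using C bb_pos[OF bt2] by (intro divide_right_mono) auto
  also have "\<dots> = 2 * (K / c10 N ab ac) * chi" using bt2 k p unfolding bb_def by (simp add: divide_simps)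
  also have "\<dots> \<le> 2 * cbar1 N ab ac cbar * chi" using Kc k by (intro mult_right_mono) auto
  finally show ?thesis .
qed

lemma Ebd_step:
  defines "Z \<equiv> 1 + 1 / (sig * t)"
  shows "Ebd (be j) (tj j) (tj (Suc j)) t
    \<le> (be j)\<^sup>2 * 2 ^ j * c16 N ab ac * KK * Z * Mq * Th * yy t (kt * be j) (tj j) powr (be j + 4 * (1 - a))"
proof -
  define s where "s = 1 / (sig * t)"
  have s: "0 < s" using sig tT by (simp add: s_def)
  define D where "D = 4 * 2 ^ j * s"
  have st: "0 < sig * t" using sig tT by simp
  have k: "0 < c11 N ab ac" "0 < c12 N ab ac" using c11_pos c12_pos by auto
  have D: "1 / (tj (Suc j) - tj j) \<le> D" unfolding tj_facts(5) D_def s_def by (simp add: power_add)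
  have Kp0: "Kp \<ge> 0" unfolding Kp_def using k KK_gt st by (intro add_nonneg_nonneg divide_nonneg_pos) auto
  define y where "y = yy t (kt * be j) (tj j) powr (be j + 4 * (1 - a))"
  have be3: "be j \<ge> 3" using be_ge(2)[of j] by simp
  have 1: "Ebd (be j) (tj j) (tj (Suc j)) t \<le> (be j)\<^sup>2 * (D / 9 + c11 N ab ac + 3/2 * c12 N ab ac + Kp + 1) * Mq * Th * y"
    unfolding y_def
    by (rule Ebd_le[OF ctx be3 tj_facts(2,3,6) refl expo(1)[OF refl] pure_bound[OF tj_facts(2,6)] D Kp0])
  define P where "P = (2::real) ^ j"
  have P: "1 \<le> P" by (simp add: P_def)
  have "D / 9 + c11 N ab ac + 3/2 * c12 N ab ac + Kp + 1 \<le> P * c16 N ab ac * KK * (1 + s)"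
  proof -
    have c9: "9 * 1 \<le> c16 N ab ac" "c11 N ab ac + 3 * c12 N ab ac + 1 \<le> c16 N ab ac" using k by (auto simp: c16_def)
    have PK: "1 * 3 \<le> P * KK" using P KK_gt by (intro mult_mono) auto
    have "P * 3 \<le> P * KK" "1 * KK \<le> P * KK" using P KK_gt by (auto intro!: mult_left_mono mult_right_mono)
    then have "4 * P / 9 + KK \<le> 9 * (P * KK)" using P by linarith
    also have "\<dots> \<le> c16 N ab ac * (P * KK)" using c9 PK by (intro mult_right_mono) auto
    finally have "(4 * P / 9 + KK) * s \<le> c16 N ab ac * (P * KK) * s" using s by (intro mult_right_mono) auto
    moreover have "c16 N ab ac * 1 \<le> c16 N ab ac * (P * KK)" using c9 PK by (intro mult_left_mono) auto
    moreover define A1 A2 A3 where "A1 = c16 N ab ac * (P * KK)" and "A2 = (4 * P / 9 + KK) * s" and "A3 = c16 N ab ac * (P * KK) * s"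
    ultimately have "A2 \<le> A3" "c16 N ab ac \<le> A1" by simp_all
    moreover have "D / 9 + Kp = A2 + 3/2 * c12 N ab ac" by (simp add: A2_def Kp_def s_def D_def P_def algebra_simps)
    ultimately have "D / 9 + c11 N ab ac + 3/2 * c12 N ab ac + Kp + 1 \<le> A1 + A3" using c9 k by linarith
    also have "\<dots> = P * c16 N ab ac * KK * (1 + s)" by (simp add: A1_def A3_def algebra_simps)
    finally show ?thesis .
  qed
  then have "(be j)\<^sup>2 * (D / 9 + c11 N ab ac + 3/2 * c12 N ab ac + Kp + 1) * Mq * Th * y \<le> (be j)\<^sup>2 * (P * c16 N ab ac * KK * (1 + s)) * Mq * Th * y"
    using Mq_ge(2) Th_ge(1) by (intro mult_right_mono mult_left_mono) (auto simp: y_def)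
  then show ?thesis using 1 by (simp add: y_def P_def Z_def s_def mult_ac)
qed

definition "rr j = be j * (1 + lam) - a"

text \<open>\<open>rr j\<close> is the exponent gained in one step, and here the conditions on
  \<open>a0\<close> and \<open>kt\<close> enter: \<open>kt * be (Suc j) = kt^2 * be j\<close> fits
  below it by the choice of \<open>a0\<close>, and \<open>a < a0 * lam\<close> keeps it above
  \<open>be j\<close>. \<open>kaphat\<close> arises from \<open>be j >= 2\<close>.\<close>

lemma rr_facts:
  "kt * be (Suc j) \<le> rr j" "be j \<le> rr j" "kaphat a rs * be j \<le> rr j" "0 < kaphat a rs" "2 * (1 + lam) \<le> rr j" "be j - a \<le> rr j"
proof -
  note b = be_ge(1,2)[of j] and l = lam_bounds(1) and ab = a_bounds
  have d: "0 < 1 + lam - kt\<^sup>2" using kt by simp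
  have "a \<le> a0 * (1 + lam - kt\<^sup>2)" using a0_3 d by (simp add: pos_divide_le_eq)
  also have "\<dots> \<le> be j * (1 + lam - kt\<^sup>2)" using b d by (intro mult_right_mono) auto
  finally show "kt * be (Suc j) \<le> rr j" by (simp add: be_ge(3) rr_def algebra_simps power2_eq_square)
  have "a < a0 * lam" using a0_4 l by (simp add: pos_divide_less_eq)
  also have "\<dots> \<le> be j * lam" using b l by (intro mult_right_mono) auto
  finally show "be j \<le> rr j" by (simp add: rr_def algebra_simps)
  then show "be j - a \<le> rr j" using ab by simp
  have "a * 2 \<le> a * be j" using b ab by (intro mult_left_mono) auto
  then show "kaphat a rs * be j \<le> rr j" by (simp add: rr_def kaphat_def lam_def algebra_simps)
  show "0 < kaphat a rs" using l ab by (simp add: kaphat_def lam_def)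
  have "1 * (1 + lam) \<le> (be j - 2) * (1 + lam)" using b l by (intro mult_right_mono) auto
  then show "2 * (1 + lam) \<le> rr j" using ab l by (simp add: rr_def algebra_simps)
qed

text \<open>The iteration starts at the exponent \<open>kt * be 0 = al\<close>, the one for which
  the growth estimate holds.\<close>

lemma yy0_le: "yy t (kt * be 0) (tj 0) \<le> ((1 + t) * Vt) powr (1 / al)"
proof -
  have S: "SC (\<lambda>x t. rho x t powr al)" using al2 by (intro SC_powr SC_base) auto
  have "QI tau t (\<lambda>x t. rho x t powr al) = integral {tau..t} (Phi al)"
    using QI_fubini[OF S tau_pos(1), of t] by (simp add: Phi_def[abs_def])
  also have "\<dots> \<le> integral {tau..t} (\<lambda>_. Vt)"
  proof (intro integral_le integrable_continuous_interval continuous_intros time_cont(1)[OF al2] tau_pos)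
    fix r assume "r \<in> {tau..t}"
    then show "Phi al r \<le> Vt" using Phi_le_Vt[of r] tau_pos by simp
  qed
  also have "\<dots> = (t - tau) * Vt" using tau_pos by simp
  also have "\<dots> \<le> (1 + t) * Vt" using tau_pos Vt_ge by (intro mult_right_mono) auto
  finally have "QI tau t (\<lambda>x t. rho x t powr al) powr (1 / al) \<le> ((1 + t) * Vt) powr (1 / al)"
    using al2 by (intro powr_mono2 QI_nn) auto
  moreover have "1 \<le> ((1 + t) * Vt) powr (1 / al)"
  proof -
    have "1 * 1 \<le> (1 + t) * Vt" using tT Vt_ge by (intro mult_mono) auto
    then show ?thesis using al2 by (intro powr_ge_one) auto
  qed
  ultimately show ?thesis by (simp add: yy_def[OF ctx] tj_facts(1) be_ge(4) flip: al_eq)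
qed

lemma Mq_Z_ge: "1 \<le> 1 + 1 / (sig * t)" "1 \<le> c16 N ab ac" "1 \<le> cbar1 N ab ac cbar"
  using sig tT c11_pos c12_pos by (auto simp: c16_def cbar1_def)

lemma ln_nn: "0 \<le> ln KK" "0 \<le> ln Mq" "0 \<le> ln Th" "0 \<le> ln a0" "0 \<le> ln (1 + 1 / (sig * t))" "0 \<le> ln (c16 N ab ac)"
  "0 \<le> ln (cbar1 N ab ac cbar)" "0 \<le> ln (2 * kt)" "0 \<le> mu3 a rs" "0 \<le> mu2 a rs"
  using KK_gt Mq_ge Th_ge a0_gt3 Mq_Z_ge kt lam_bounds a_bounds by (auto simp: mu3_def mu2_def lam_def[symmetric] intro!: ln_ge_zero)

context
  fixes Bs :: real
  assumes NP_Bs_ball: "\<forall>r\<in>{tau..t}. NP r + 1 \<le> Bs"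
begin

lemma NP_Bs: "tau \<le> r \<Longrightarrow> r \<le> t \<Longrightarrow> NP r + 1 \<le> Bs" using NP_Bs_ball by auto

lemma Bs_ge: "Bs \<ge> 1" using NP_Bs[of t] NP_nn[of t] tau_pos by linarith

text \<open>\<open>chi\<close> times the square of the bound in \<open>JJ_bound\<close>, without its
  numerical factor; it is the same in every step.\<close>

definition "XX = chi * w powr ((1 - rs) / rs) * Bs\<^sup>2 * Vt powr (2 / al)"

lemma XX_ge: "XX \<ge> 1"
proof -
  have "1 * 1 * 1 * 1 \<le> XX" unfolding XX_def
    using chi_ge(1) w_ge Bs_ge Vt_ge rs al2 rs_pos by (intro mult_mono powr_ge_one one_le_power) auto
  then show ?thesis by simp
qed

lemma JJ_bound: assumes r: "tau \<le> r" "r \<le> t" shows "JJ r \<le> 2 * w powr (1 / pe) * Bs * Vt powr (1 / al)"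
proof -
  define W y where "W = w powr (1 / pe)" and "y = Vt powr (1 / al)"
  have W: "W \<ge> 1" unfolding W_def using w_ge pe_pos by (intro powr_ge_one) auto
  have y: "y \<ge> 1" unfolding y_def using Vt_ge al2 by (intro powr_ge_one) auto
  have r0: "r > 0" using r tau_pos by simp
  have e: "0 \<le> 1 / pe - 1 / al" using al_pe pe_pos by (simp add: frac_le)
  have "Phi al r \<le> Vt" using Phi_le_Vt[OF r0 r(2)] by simp
  then have 1: "Phi al r powr (1 / al) \<le> y" unfolding y_def using Phi_nn al2 by (intro powr_mono2) auto
  have "measU U powr (1 / pe - 1 / al) \<le> w powr (1 / pe - 1 / al)" using e w_ge by (intro powr_mono2) auto
  also have "\<dots> \<le> W" unfolding W_def using w_ge al2 by (intro powr_mono) auto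
  finally have 2: "measU U powr (1 / pe - 1 / al) \<le> W" .
  have 3: "measU U powr (1 / pe) \<le> W" unfolding W_def using w_ge pe_pos by (intro powr_mono2) auto
  have "JJ r \<le> Phi al r powr (1 / al) * measU U powr (1 / pe - 1 / al) + measU U powr (1 / pe) + NP r"
    by (rule JJ_le[OF r0 al_pe])
  also have "\<dots> \<le> y * W + W + (Bs - 1)" using 1 2 3 NP_Bs[OF r] y W by (intro add_mono mult_mono) auto
  also have "\<dots> \<le> W * y + W * Bs"
  proof -
    have "0 \<le> (W - 1) * (Bs - 1)" using W Bs_ge by simp
    then show ?thesis by (simp add: algebra_simps)
  qed
  also have "\<dots> \<le> W * (Bs * y) + W * (Bs * y)"
    using mult_right_mono[of 1 Bs y] mult_left_mono[of 1 y Bs] W y Bs_ge by (intro add_mono mult_left_mono) auto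
  finally show ?thesis by (simp add: W_def y_def mult_ac)
qed

text \<open>The parabolic gain raises the exponent to \<open>rr j\<close>, and Hoelder on the
  cylinder lowers it to the exponent of the next step at the cost of a power of
  \<open>Th\<close>.\<close>

lemma yy_step_powr:
  defines "E \<equiv> \<lambda>j. (be j)\<^sup>2 * 2 ^ j * c16 N ab ac * KK * (1 + 1 / (sig * t)) * Mq * Th * yy t (kt * be j) (tj j) powr (be j + 4 * (1 - a))"
  shows "yy t (kt * be (Suc j)) (tj (Suc j)) \<le> (8 * cbar1 N ab ac cbar * XX * E j powr (1 + lam)) powr (1 / rr j) * Th powr (1 / be j)"
    "1 \<le> E j"
proof -
  note b = be_ge(2)[of j]
  have b2: "be j > 2" using b by simp
  define k where "k = kt * be (Suc j)"
  have bk: "be j \<le> k" unfolding k_def be_ge(3) using b kt mult_mono[of 1 kt 1 kt] mult_right_mono[of 1 "kt * kt" "be j"] by (simp add: mult.assoc)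
  have kr: "k \<le> rr j" using rr_facts(1)[of j] by (simp add: k_def)
  have k0: "0 < k" "0 < rr j" using bk kr b by linarith+
  define Y where "Y = yy t (kt * be j) (tj j)"
  have Y1: "1 \<le> Y" unfolding Y_def by (rule yy_ge[OF ctx])
  have mm: "0 \<le> be j + 4 * (1 - a)" using b a_bounds by simp
  show E1: "1 \<le> E j"
  proof -
    have "(1::real) * 1 * 1 * 1 * 1 * 1 * 1 * 1 \<le> E j" unfolding E_def Y_def[symmetric]
      using b KK_gt Mq_Z_ge Mq_ge(2) Th_ge(1) powr_ge_one[OF Y1 mm] by (intro mult_mono one_le_power) auto
    then show ?thesis by simp
  qed
  note sj = tj_facts(2)[of j] tj_facts(3)[of j]
  have s0: "0 < tj j" "0 < tj (Suc j)" using sj tau_pos by auto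
  have EE: "Ebd (be j) (tj j) (tj (Suc j)) t \<le> E j" unfolding E_def by (rule Ebd_step)
  have En: "0 \<le> Ebd (be j) (tj j) (tj (Suc j)) t" by (rule energy_cyl(3)[OF b2 s0(1) sj(2) tj_facts(6)])
  define Jm where "Jm = 2 * w powr (1 / pe) * Bs * Vt powr (1 / al)"
  have Jm2: "Jm\<^sup>2 = 4 * (w powr ((1 - rs) / rs) * Bs\<^sup>2 * Vt powr (2 / al))"
  proof -
    have "(w powr (1 / pe))\<^sup>2 = w powr (2 / pe)" "(Vt powr (1 / al))\<^sup>2 = Vt powr (2 / al)"
      by (simp_all add: power2_eq_square flip: powr_add)
    moreover have "2 / pe = (1 - rs) / rs" using rs rs_pos by (simp add: pe_def field_simps)
    ultimately show ?thesis by (simp add: Jm_def power_mult_distrib)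
  qed
  have "integral {tj (Suc j)..t} (Phi (rr j)) \<le> Csob (be j) / bb (be j) * Jm\<^sup>2 * Ebd (be j) (tj j) (tj (Suc j)) t powr (1 + lam)"
  proof -
    have "rr j = be j + be j * lam - a" by (simp add: rr_def algebra_simps)
    moreover have "JJ r \<le> Jm" if "tj (Suc j) \<le> r" "r \<le> t" for r
      unfolding Jm_def using JJ_bound[of r] that tj_facts(2)[of "Suc j"] by simp
    ultimately show ?thesis using parabolic_sobolev[OF b2 s0(1) sj(2) tj_facts(6)] by simp
  qed
  also have "\<dots> \<le> 2 * cbar1 N ab ac cbar * chi * Jm\<^sup>2 * E j powr (1 + lam)"
    using Csob_le[OF b2] EE En lam_bounds Mq_Z_ge chi_ge(1) by (intro mult_mono powr_mono2) auto
  also have "\<dots> = 8 * cbar1 N ab ac cbar * XX * E j powr (1 + lam)" by (simp add: Jm2 XX_def)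
  finally have I: "integral {tj (Suc j)..t} (Phi (rr j)) \<le> 8 * cbar1 N ab ac cbar * XX * E j powr (1 + lam)" (is "_ \<le> ?R") .
  have R1: "1 \<le> ?R"
  proof -
    have "1 * 1 * 1 * 1 \<le> ?R" using XX_ge Mq_Z_ge E1 lam_bounds by (intro mult_mono powr_ge_one) auto
    then show ?thesis by simp
  qed
  have S: "SC (\<lambda>x t. rho x t powr rr j)" using k0 by (intro SC_powr SC_base) auto
  have Qr: "QI (tj (Suc j)) t (\<lambda>x t. rho x t powr rr j) \<le> ?R"
    using I QI_fubini[OF S s0(2), of t] by (simp add: Phi_def[abs_def])
  have "QI (tj (Suc j)) t (\<lambda>x t. rho x t powr k) \<le> QI (tj (Suc j)) t (\<lambda>x t. rho x t powr rr j) powr (k / rr j) * mQ (tj (Suc j)) t powr (1 - k / rr j)"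
    using k0 kr s0 by (intro QI_holder_power) auto
  also have "\<dots> \<le> ?R powr (k / rr j) * Th powr (1 - k / rr j)"
    using Qr k0 kr mQ_le[OF ctx tj_facts(2,6)] by (intro mult_mono powr_mono2 QI_nn) auto
  also have "\<dots> \<le> ?R powr (k / rr j) * Th powr 1" using k0 Th_ge(1) by (intro mult_left_mono powr_mono) auto
  finally have "QI (tj (Suc j)) t (\<lambda>x t. rho x t powr k) powr (1 / k) \<le> (?R powr (k / rr j) * Th powr 1) powr (1 / k)"
    using k0 by (intro powr_mono2 QI_nn) auto
  also have "\<dots> = ?R powr (1 / rr j) * Th powr (1 / k)" using k0 R1 Th_ge(1) by (simp add: powr_mult powr_powr)
  \<comment> \<open>Weakening \<open>1 / k\<close> to \<open>1 / be j\<close> gives the logarithm of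
    \<open>Th\<close> the denominator of the recursion.\<close>
  also have "\<dots> \<le> ?R powr (1 / rr j) * Th powr (1 / be j)"
    using bk b Th_ge(1) by (intro mult_left_mono powr_mono divide_left_mono) auto
  finally have 1: "QI (tj (Suc j)) t (\<lambda>x t. rho x t powr k) powr (1 / k) \<le> ?R powr (1 / rr j) * Th powr (1 / be j)" .
  have "1 * 1 \<le> ?R powr (1 / rr j) * Th powr (1 / be j)" using R1 Th_ge(1) k0 b by (intro mult_mono powr_ge_one) auto
  then show "yy t (kt * be (Suc j)) (tj (Suc j)) \<le> ?R powr (1 / rr j) * Th powr (1 / be j)" using 1 by (simp add: yy_def[OF ctx] k_def)
qed

text \<open>The logarithms that do not depend on \<open>j\<close>. The term \<open>2 * ln KK\<close>
  is kept apart because it is to disappear from the final constant.\<close>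

definition "Alog = ln 8 + ln (cbar1 N ab ac cbar) + 2 * ln (c16 N ab ac) + mu3 a rs * ln a0 + ln (XX) / kaphat a rs
   + mu2 a rs * (ln (1 + 1 / (sig * t)) + ln Mq) + mu3 a rs * ln Th"

lemma Alog_nn: "0 \<le> Alog"
  unfolding Alog_def using ln_nn XX_ge rr_facts(4) by (intro add_nonneg_nonneg mult_nonneg_nonneg divide_nonneg_pos) auto

text \<open>The logarithm of \<open>yy_step_powr\<close>, arranged as an affine recursion. The part
  growing linearly in \<open>j\<close> comes from \<open>2 ^ j\<close> and from the power
  \<open>kt ^ j\<close> inside \<open>be j\<close>.\<close>

lemma yy_log_step:
  defines "x \<equiv> \<lambda>j. ln (yy t (kt * be j) (tj j))"
  shows "x (Suc j) \<le> (Alog + 2 * ln KK + real j * (mu3 a rs * ln (2 * kt))) / be j + stilde a kt a0 j / be j * x j"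
proof -
  define Z where "Z = 1 + 1 / (sig * t)"
  define b r where "b = be j" and "r = rr j"
  note rf = rr_facts(1,2,3,5,6)[of j, folded b_def r_def]
  have b: "b > 3" "b > 0" using be_ge(2)[of j] by (auto simp: b_def)
  have r: "r > 0" using rf b by linarith
  have l: "0 < lam" by (rule lam_bounds)
  define Y where "Y = yy t (kt * be j) (tj j)"
  have Y1: "1 \<le> Y" unfolding Y_def by (rule yy_ge[OF ctx])
  define mm where "mm = b + 4 * (1 - a)"
  define E where "E = b\<^sup>2 * 2 ^ j * c16 N ab ac * KK * Z * Mq * Th * Y powr mm"
  have Y': "yy t (kt * be (Suc j)) (tj (Suc j)) \<le> (8 * cbar1 N ab ac cbar * XX * E powr (1 + lam)) powr (1 / r) * Th powr (1 / b)"
    and E1: "1 \<le> E"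
    using yy_step_powr[of j] by (auto simp: E_def b_def r_def Y_def Z_def mm_def)
  have Z1: "1 \<le> Z" using Mq_Z_ge(1) by (simp only: Z_def)
  have pos: "c16 N ab ac > 0" "KK > 0" "Z > 0" "Mq > 0" "Th > 0" "cbar1 N ab ac cbar > 0" "XX > 0"
    using Mq_Z_ge KK_gt Mq_ge(2) Th_ge(1) XX_ge Z1 by auto
  define lb l2 l16 lK lZ lM lT l8 lc lX lY where "lb = ln b" and "l2 = ln (2::real)" and "l16 = ln (c16 N ab ac)" and "lK = ln KK" and "lZ = ln Z" and "lM = ln Mq"
    and "lT = ln Th" and "l8 = ln (8::real)" and "lc = ln (cbar1 N ab ac cbar)" and "lX = ln (XX)" and "lY = ln Y"
  note ldefs = this
  have lb: "lb = real j * ln kt + ln a0"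
    using kt a0_5 by (simp add: lb_def b_def betaj_def ln_mult ln_realpow)
  have lnn: "0 \<le> lb" "0 \<le> l2" "0 \<le> l16" "0 \<le> lK" "0 \<le> lZ" "0 \<le> lM" "0 \<le> lT" "0 \<le> l8" "0 \<le> lc" "0 \<le> lX" "0 \<le> lY"
    using ln_nn XX_ge Y1 b by (auto simp: ldefs Z_def)
  have lnE: "ln E = 2 * lb + real j * l2 + l16 + lK + lZ + lM + lT + mm * lY"
    unfolding E_def ldefs using pos b Y1 by (simp add: ln_mult ln_realpow ln_powr)
  \<comment> \<open>The coefficient of \<open>ln E\<close> after multiplication by \<open>b\<close>.
    It equals \<open>1 + a / r\<close>; since \<open>r >= 2 * (1 + lam)\<close>, it is below
    \<open>mu2\<close> and its double below \<open>mu3\<close>.\<close>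
  define xi where "xi = (1 + lam) * b / r"
  have xi_eq: "xi = 1 + a / r" using r by (simp add: xi_def r_def rr_def b_def field_simps)
  have mu2: "mu2 a rs = 1 + a / (1 + lam)" and mu3: "mu3 a rs = 2 + a / (1 + lam)" by (auto simp: mu2_def mu3_def lam_def)
  define u1 u2 where "u1 = a / r" and "u2 = a / (1 + lam)"
  have u: "0 \<le> u1" "2 * u1 \<le> u2" "u2 \<le> 1"
  proof -
    have "a / r \<le> a / (2 * (1 + lam))" using rf(4) l a_bounds by (intro divide_left_mono) auto
    then show "2 * u1 \<le> u2" using l by (simp add: u1_def u2_def field_simps)
  qed (use a_bounds r l in \<open>auto simp: u1_def u2_def\<close>)
  have xi: "0 \<le> xi" "xi \<le> mu2 a rs" "2 * xi \<le> mu3 a rs" "xi \<le> 2" "xi + 1 \<le> mu3 a rs" "xi \<le> mu3 a rs"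
    using u unfolding xi_eq mu2 mu3 u1_def[symmetric] u2_def[symmetric] by auto
  have br: "0 \<le> b / r" "b / r \<le> 1" "b / r \<le> 1 / kaphat a rs"
    using rf(2,3) rr_facts(4) b r by (auto simp: field_simps)
  \<comment> \<open>The slope \<open>stilde\<close> is obtained from \<open>xi * mm\<close> by
    replacing \<open>r\<close> with the smaller \<open>b - a\<close>.\<close>
  have st: "xi * mm \<le> stilde a kt a0 j"
  proof -
    have "a / r \<le> a / (b - a)" using rf(5) b a_bounds r by (intro divide_left_mono) auto
    then have "xi * mm \<le> (1 + a / (b - a)) * mm" unfolding xi_eq using b a_bounds by (intro mult_right_mono) (auto simp: mm_def)
    then show ?thesis by (simp add: stilde_def mm_def b_def mult.commute)
  qed
  have Yp: "yy t (kt * be (Suc j)) (tj (Suc j)) \<ge> 1" by (rule yy_ge[OF ctx])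
  have "x (Suc j) \<le> ln ((8 * cbar1 N ab ac cbar * XX * E powr (1 + lam)) powr (1 / r) * Th powr (1 / b))"
    unfolding x_def using Y' Yp pos E1 by (subst ln_le_cancel_iff) auto
  also have "\<dots> = (l8 + lc + lX + (1 + lam) * ln E) / r + lT / b"
    unfolding ldefs using pos E1 by (simp add: ln_mult ln_powr)
  finally have "b * x (Suc j) \<le> b * ((l8 + lc + lX + (1 + lam) * ln E) / r + lT / b)" using b by (intro mult_left_mono) auto
  also have "\<dots> = (b / r) * l8 + (b / r) * lc + (b / r) * lX + xi * ln E + lT"
    using b by (simp add: xi_def add_divide_distrib algebra_simps)
  also have "xi * ln E = (2 * xi) * lb + xi * (real j * l2) + xi * l16 + xi * lK + xi * lZ + xi * lM + xi * lT + (xi * mm) * lY"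
    by (simp add: lnE algebra_simps)
  finally have 1: "b * x (Suc j) \<le> (b / r) * l8 + (b / r) * lc + (b / r) * lX + ((2 * xi) * lb + xi * (real j * l2) + xi * l16 + xi * lK + xi * lZ + xi * lM + xi * lT + (xi * mm) * lY) + lT" .
  have "0 \<le> real j * l2" using lnn by simp
  have "(b / r) * l8 \<le> 1 * l8" "(b / r) * lc \<le> 1 * lc" "(b / r) * lX \<le> 1 / kaphat a rs * lX" "(2 * xi) * lb \<le> mu3 a rs * lb"
    "xi * (real j * l2) \<le> mu3 a rs * (real j * l2)" "xi * l16 \<le> 2 * l16" "xi * lK \<le> 2 * lK" "xi * lZ \<le> mu2 a rs * lZ" "xi * lM \<le> mu2 a rs * lM"
    "(xi + 1) * lT \<le> mu3 a rs * lT" "(xi * mm) * lY \<le> stilde a kt a0 j * lY"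
    by (rule mult_right_mono; fact)+
  note ineqs = this
  have x10: "(xi + 1) * lT = xi * lT + lT" by (simp add: algebra_simps)
  have "b * x (Suc j) \<le> l8 + lc + 1 / kaphat a rs * lX + mu3 a rs * lb + mu3 a rs * (real j * l2) + 2 * l16 + 2 * lK + mu2 a rs * lZ + mu2 a rs * lM + mu3 a rs * lT + stilde a kt a0 j * lY"
    using 1 ineqs unfolding x10 mult_1 by linarith
  also have "\<dots> = Alog + 2 * ln KK + real j * (mu3 a rs * ln (2 * kt)) + stilde a kt a0 j * lY"
    using kt unfolding Alog_def lb Z_def[symmetric] by (simp add: ldefs ln_mult algebra_simps)
  finally have "x (Suc j) \<le> (Alog + 2 * ln KK + real j * (mu3 a rs * ln (2 * kt)) + stilde a kt a0 j * lY) / b"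
    using b by (simp add: pos_le_divide_eq mult.commute)
  then show ?thesis by (simp add: x_def lY_def Y_def b_def add_divide_distrib)
qed

definition "om = omega a kt a0"

text \<open>The bound for the sum of the \<open>1 / be j\<close> lies below that for the sum of the
  \<open>(j + 1) / be j\<close> by at least the factor \<open>h\<close>, that is
  \<open>1 / KK\<close>. As \<open>2 * ln KK <= KK\<close>, the terms with \<open>KK\<close> cost no
  more than \<open>S\<close>, and \<open>ln 4 >= 1\<close> pays for it.\<close>

lemma sum_L_le:
  "(\<Sum>j<n. (Alog + 2 * ln KK + real j * (mu3 a rs * ln (2 * kt))) / be j) \<le> kt\<^sup>2 / (a0 * h\<^sup>2) * (Alog + ln 4 + mu3 a rs * ln (2 * kt))"
proof -
  define S where "S = kt\<^sup>2 / (a0 * h\<^sup>2)"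
  have a00: "a0 > 0" using a0_5 by simp
  note si = sum_inverse_betaj[OF kt(1) a00, of n, folded h_def]
  have S0: "0 \<le> S" using a00 by (simp add: S_def)
  have bp: "be j > 0" for j using be_ge(2)[of j] by linarith
  have kh: "kt / (a0 * h) \<le> S" "KK * (kt / (a0 * h)) \<le> S"
  proof -
    have "KK * (kt / (a0 * h)) = kt / (a0 * h\<^sup>2)" by (simp add: KK_def power2_eq_square)
    also have "\<dots> \<le> S" unfolding S_def using kt a00 h_pos by (intro divide_right_mono) (auto simp: power2_eq_square)
    finally show 2: "KK * (kt / (a0 * h)) \<le> S" .
    have "1 * (kt / (a0 * h)) \<le> KK * (kt / (a0 * h))" using KK_gt kt a00 h_pos by (intro mult_right_mono) auto
    then show "kt / (a0 * h) \<le> S" using 2 by simp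
  qed
  define B where "B = mu3 a rs * ln (2 * kt)"
  have B: "0 \<le> B" unfolding B_def using ln_nn by simp
  have "(\<Sum>j<n. (Alog + 2 * ln KK + real j * B) / be j) \<le> (\<Sum>j<n. Alog * (1 / be j) + 2 * ln KK * (1 / be j) + B * ((real j + 1) / be j))"
  proof (rule sum_mono)
    fix j
    have "B * (real j / be j) \<le> B * ((real j + 1) / be j)" using B bp[of j] by (intro mult_left_mono divide_right_mono) auto
    then show "(Alog + 2 * ln KK + real j * B) / be j \<le> Alog * (1 / be j) + 2 * ln KK * (1 / be j) + B * ((real j + 1) / be j)"
      by (simp add: add_divide_distrib mult.commute)
  qed
  also have "\<dots> = Alog * (\<Sum>j<n. 1 / be j) + 2 * ln KK * (\<Sum>j<n. 1 / be j) + B * (\<Sum>j<n. (real j + 1) / be j)"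
    by (simp only: sum.distrib sum_distrib_left)
  also have "\<dots> \<le> Alog * S + S * ln 4 + B * S"
  proof (intro add_mono mult_left_mono Alog_nn B)
    show "(\<Sum>j<n. 1 / be j) \<le> S" using si(1) kh(1) by linarith
    show "(\<Sum>j<n. (real j + 1) / be j) \<le> S" using si(2) by (simp add: S_def)
    have "2 * ln KK * (\<Sum>j<n. 1 / be j) \<le> KK * (kt / (a0 * h))"
      using si(1) ln_le_half[of KK] KK_gt bp by (intro mult_mono sum_nonneg) (auto simp: less_imp_le)
    also have "\<dots> \<le> S * 1" using kh by simp
    also have "\<dots> \<le> S * ln 4" using S0 ln4_ge_1 by (intro mult_left_mono) auto
    finally show "2 * ln KK * (\<Sum>j<n. 1 / be j) \<le> S * ln 4" .
  qed
  finally show ?thesis by (simp add: S_def B_def algebra_simps)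
qed

lemma yy_log_bound:
  "ln (yy t (kt * be n) (tj n)) \<le> nutilde a kt a0 * (ln ((1 + t) * Vt) / al) + om * (Alog + ln 4 + mu3 a rs * ln (2 * kt))"
proof -
  note nt = nutilde_bound[OF kt(1) a0_5 a_bounds]
  have bp: "be j > 0" for j using be_ge(2)[of j] by linarith
  have "ln (yy t (kt * be n) (tj n)) \<le> nutilde a kt a0 * ln (yy t (kt * be 0) (tj 0)) + nutilde a kt a0 / (stilde a kt a0 0 / be 0) * (kt\<^sup>2 / (a0 * h\<^sup>2) * (Alog + ln 4 + mu3 a rs * ln (2 * kt)))"
  proof (rule affine_recursion_bound[where L = "\<lambda>j. Alog + 2 * ln KK + real j * (mu3 a rs * ln (2 * kt))" and b = be])
    show "0 \<le> Alog + 2 * ln KK + real j * (mu3 a rs * ln (2 * kt))" for j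
      using ln_nn Alog_nn by (intro add_nonneg_nonneg mult_nonneg_nonneg) auto
    show "0 \<le> ln (yy t (kt * be 0) (tj 0))" using yy_ge[OF ctx] by simp
  qed (use yy_log_step nt sum_L_le bp in auto)
  also have "ln (yy t (kt * be 0) (tj 0)) \<le> ln ((1 + t) * Vt) / al"
  proof -
    have p: "0 < (1 + t) * Vt" using tT Vt_ge by simp
    have "ln (yy t (kt * be 0) (tj 0)) \<le> ln (((1 + t) * Vt) powr (1 / al))"
      using yy0_le yy_ge[OF ctx, of "kt * be 0" "tj 0"] p by (subst ln_le_cancel_iff) auto
    then show ?thesis using p by (simp add: ln_powr)
  qed
  finally show ?thesis using nt(3) by (simp add: om_def omega_def h_def mult_left_mono)
qed

definition "Cfin = Cbar1 N ab ac rs kt a0 cbar U * chi powr om1 a rs kt a0 * (1 + 1 / (sig * t)) powr om2 a rs kt a0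
   * (1 + t) powr om4 a rs kt a0 * Mq powr om2 a rs kt a0 * Bs powr (2 * om1 a rs kt a0)
   * Vt powr ((2 * om1 a rs kt a0 + nutilde a kt a0) / al)"

text \<open>Both sides are compared through logarithms, where every constant of the claim becomes a
  linear combination of the same few quantities.\<close>

lemma yy_bound: "yy t (kt * be n) (tj n) \<le> Cfin"
proof -
  define k1 where "k1 = kaphat a rs"
  have k1: "k1 > 0" using rr_facts(4) by (simp add: k1_def)
  define Z where "Z = 1 + 1 / (sig * t)"
  define nu where "nu = nutilde a kt a0"
  have nu1: "1 \<le> nu" unfolding nu_def by (rule nutilde_bound(3)[OF kt(1) a0_5 a_bounds])
  have om0: "0 \<le> om"
  proof -
    define r0 where "r0 = stilde a kt a0 0 / betaj kt a0 0"
    have "1 \<le> r0" unfolding r0_def by (rule nutilde_bound(2)[OF kt(1) a0_5 a_bounds])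
    moreover have "om = nu / r0 * (kt\<^sup>2 / (a0 * (kt - 1)\<^sup>2))" by (simp add: om_def omega_def nu_def r0_def)
    ultimately show ?thesis using nu1 a0_5 by simp
  qed
  have B1: "Bs \<ge> 1" by (rule Bs_ge)
  have Z1: "1 \<le> Z" using Mq_Z_ge(1) by (simp only: Z_def)
  have pos: "c16 N ab ac > 0" "Z > 0" "Mq > 0" "Th > 0" "cbar1 N ab ac cbar > 0" "chi > 0" "w > 0" "Bs > 0" "Vt > 0" "1 + t > 0" "a0 > 0" "kt > 0"
    using Mq_Z_ge Mq_ge(2) Th_ge(1) chi_ge(1) w_ge B1 Vt_ge tT a0_5 kt Z1 by auto
  define l2 l16 lZ lM lT lc lx lw lB lV lt la lk where "l2 = ln (2::real)" and "l16 = ln (c16 N ab ac)" and "lZ = ln Z" and "lM = ln Mq" and "lT = ln Th"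
    and "lc = ln (cbar1 N ab ac cbar)" and "lx = ln chi" and "lw = ln w" and "lB = ln Bs" and "lV = ln Vt" and "lt = ln (1 + t)" and "la = ln a0" and "lk = ln (2 * kt)"
  note ld = this
  have l2: "0 < l2" by (simp add: l2_def)
  have l4: "ln (4::real) = 2 * l2" "ln (8::real) = 3 * l2"
    using ln_realpow[of "2::real" 2] ln_realpow[of "2::real" 3] by (auto simp: l2_def)
  have lXX: "ln (XX) = lx + (1 - rs) / rs * lw + 2 * lB + 2 / al * lV"
    unfolding XX_def ld using pos by (simp add: ln_mult ln_powr ln_realpow)
  have lTh: "lT = lw + lt" unfolding ld Th_def using pos by (simp add: ln_mult)
  have lAb: "ln (Abar N ab ac rs cbar) = (4 + 1 / rs) * l2 + lc + 2 * l16"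
    unfolding Abar_def ld using pos by (simp add: ln_mult ln_powr ln_realpow)
  have Ab0: "Abar N ab ac rs cbar > 0" unfolding Abar_def using pos by simp
  have c20: "cbar2 N ab ac rs kt cbar > 0" unfolding cbar2_def using pos Ab0 by simp
  have lc2: "ln (cbar2 N ab ac rs kt cbar) = mu3 a rs * lk + ((4 + 1 / rs) * l2 + lc + 2 * l16)"
    unfolding cbar2_def lAb[symmetric] lk_def using pos Ab0 by (subst ln_mult) (auto simp: ln_powr)
  define A where "A = 3 * l2 + lc + 2 * l16 + mu3 a rs * la + (lx + (1 - rs) / rs * lw + 2 * lB + 2 / al * lV) / k1 + mu2 a rs * (lZ + lM) + mu3 a rs * lT"
  have "ln (yy t (kt * be n) (tj n)) \<le> nu * ((lt + lV) / al) + om * (A + 2 * l2 + mu3 a rs * lk)"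
    using yy_log_bound[of n] pos unfolding Alog_def lXX A_def l4 by (simp add: nu_def k1_def ld Z_def ln_mult)
  also have "\<dots> \<le> om / k1 * l2 + (om * (mu3 a rs * lk + ((4 + 1 / rs) * l2 + lc + 2 * l16)) + mu3 a rs * om * la + (mu3 a rs * om + om / k1 * (1 - rs) / rs) * lw)
      + om / k1 * lx + mu2 a rs * om * lZ + (mu3 a rs * om + nu / al) * lt + mu2 a rs * om * lM + 2 * (om / k1) * lB + (2 * (om / k1) + nu) / al * lV"
  proof -
    \<comment> \<open>The factors 8 from the step and 4 from \<open>sum_L_le\<close> make
      \<open>2 ^ 5\<close>; because \<open>rs < 1\<close>, they fit into the
      \<open>2 powr (4 + 1 / rs)\<close> of \<open>Abar\<close>.\<close>
    have "1 * l2 \<le> (1 / rs) * l2" using rs rs_pos l2 by (intro mult_right_mono) auto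
    then have "om * (5 * l2) \<le> om * ((4 + 1 / rs) * l2)" using om0 by (intro mult_left_mono) (auto simp: distrib_right)
    moreover have "0 \<le> om / k1 * l2" using om0 k1 l2 by simp
    moreover have "nu * ((lt + lV) / al) + om * (A + 2 * l2 + mu3 a rs * lk) = om * (5 * l2) + (om * (mu3 a rs * lk + (lc + 2 * l16)) + mu3 a rs * om * la + (mu3 a rs * om + om / k1 * (1 - rs) / rs) * lw)
      + om / k1 * lx + mu2 a rs * om * lZ + (mu3 a rs * om + nu / al) * lt + mu2 a rs * om * lM + 2 * (om / k1) * lB + (2 * (om / k1) + nu) / al * lV"
      unfolding A_def lTh by (simp add: algebra_simps add_divide_distrib)
    moreover have "om * (mu3 a rs * lk + ((4 + 1 / rs) * l2 + lc + 2 * l16)) = om * ((4 + 1 / rs) * l2) + om * (mu3 a rs * lk + (lc + 2 * l16))" by (simp add: algebra_simps)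
    ultimately show ?thesis by linarith
  qed
  also have "\<dots> = ln Cfin"
    unfolding Cfin_def Cbar1_def Let_def om1_def om2_def om3_def om4_def om5_def om_def[symmetric] k1_def[symmetric] nu_def[symmetric] al_eq[symmetric]
      w_def[symmetric] Z_def[symmetric]
    using pos c20 by (simp add: ln_mult ln_powr lc2 ld)
  finally have "ln (yy t (kt * be n) (tj n)) \<le> ln Cfin" .
  moreover have "0 < Cfin"
    unfolding Cfin_def Cbar1_def Let_def w_def[symmetric] Z_def[symmetric] using pos c20 by simp
  ultimately show ?thesis using yy_ge[OF ctx, of "kt * be n" "tj n"] by (subst (asm) ln_le_cancel_iff) auto
qed

text \<open>The passage from integral norms to the supremum: a value above \<open>Cfin\<close>
  persists on an open set of measure \<open>mu > 0\<close> contained in all cylinders, so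
  \<open>c * mu powr (1 / k) <= Cfin\<close> along exponents tending to infinity. Continuity makes
  the bound pointwise.\<close>

lemma rho_le_Cfin: assumes x: "x0 \<in> U" and s: "sig * t < s0" "s0 < t" shows "rho x0 s0 \<le> Cfin"
proof (rule ccontr)
  assume "\<not> rho x0 s0 \<le> Cfin"
  define c where "c = (Cfin + rho x0 s0) / 2"
  have c: "Cfin < c" "c < rho x0 s0" using \<open>\<not> rho x0 s0 \<le> Cfin\<close> by (auto simp: c_def)
  have C1: "1 \<le> Cfin" using yy_bound[of 0] yy_ge[OF ctx, of "kt * be 0" "tj 0"] by linarith
  have c0: "c > 0" using c C1 by simp
  have st: "0 < sig * t" using sig tT by simp
  define W where "W = U \<times> {sig * t<..<t}"
  have W: "open W" unfolding W_def using U_open by (intro open_Times) auto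
  have cont: "continuous_on W (\<lambda>z. rho (fst z) (snd z))"
    using SC_base(7) unfolding SC_def by (rule continuous_on_subset) (use CU st in \<open>auto simp: W_def\<close>)
  define O1 where "O1 = {z\<in>W. c < rho (fst z) (snd z)}"
  have "open ((\<lambda>z. rho (fst z) (snd z)) -` {c<..} \<inter> W)" using cont W by (simp add: continuous_on_open_vimage)
  moreover have "(\<lambda>z. rho (fst z) (snd z)) -` {c<..} \<inter> W = O1" by (auto simp: O1_def)
  ultimately have O1: "open O1" by simp
  have z: "(x0, s0) \<in> O1" using x s c by (auto simp: O1_def W_def)
  have sub: "O1 \<subseteq> U \<times> {tj n..t}" for n using tj_facts(4)[of n] by (auto simp: O1_def W_def)
  have lm: "O1 \<in> lmeasurable" using bounded_subset[OF Q_bounded sub[of 0]] O1 by (intro bounded_set_imp_lmeasurable) auto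
  define mu where "mu = measure lebesgue O1"
  have mu: "mu > 0"
  proof -
    have "mu \<noteq> 0" using open_not_negligible[OF O1] z lm by (auto simp: mu_def negligible_iff_measure)
    then show ?thesis by (simp add: mu_def zero_less_measure_iff)
  qed
  have le: "c * mu powr (1 / (kt * be n)) \<le> Cfin" for n
  proof -
    define k where "k = kt * be n"
    have k: "k > 0" using be_ge(2)[of n] kt by (simp add: k_def)
    have t0: "tj n > 0" using tj_facts(2)[of n] tau_pos by simp
    interpret finite_measure "LQ (tj n) t" by (rule fin_LQ)
    have O1s: "O1 \<in> sets (LQ (tj n) t)" using sub[of n] lm Q_lm[of "tj n" t] by (simp add: sets_restrict_space_iff)
    have "c powr k * mu = (\<integral>z. c powr k * indicator O1 z \<partial>LQ (tj n) t)"
      using sub[of n] Q_lm[of "tj n" t] lm O1s by (simp add: mu_def measure_restrict_space Int_absorb2)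
    also have "\<dots> \<le> QI (tj n) t (\<lambda>x t. rho x t powr k)"
      unfolding QI_def
    proof (rule integral_mono)
      show "integrable (LQ (tj n) t) (\<lambda>z. c powr k * indicator O1 z)" using O1s by (intro integrable_mult_right integrable_real_indicator) (auto simp: emeasure_finite less_top[symmetric])
      show "integrable (LQ (tj n) t) (\<lambda>z. rho (fst z) (snd z) powr k)" using k t0 by (intro QI_int SC_powr SC_base) auto
      show "c powr k * indicator O1 z \<le> rho (fst z) (snd z) powr k" for z
        using c0 k by (auto simp: indicator_def O1_def intro!: powr_mono2)
    qed
    finally have "(c powr k * mu) powr (1 / k) \<le> QI (tj n) t (\<lambda>x t. rho x t powr k) powr (1 / k)" using k mu by (intro powr_mono2) auto
    moreover have "(c powr k * mu) powr (1 / k) = c * mu powr (1 / k)" using k c0 mu by (simp add: powr_mult powr_powr)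
    ultimately show ?thesis using yy_bound[of n] unfolding yy_def[OF ctx] k_def by linarith
  qed
  have "(\<lambda>n. 1 / (kt * be n)) \<longlonglongrightarrow> 0"
  proof -
    have "(\<lambda>n. 1 / (kt * a0) * (1 / kt) ^ n) \<longlonglongrightarrow> 1 / (kt * a0) * 0" using kt by (intro tendsto_intros LIMSEQ_power_zero) auto
    moreover have "1 / (kt * be n) = 1 / (kt * a0) * (1 / kt) ^ n" for n by (simp add: betaj_def power_one_over mult_ac)
    ultimately show ?thesis by simp
  qed
  then have "(\<lambda>n. c * mu powr (1 / (kt * be n))) \<longlonglongrightarrow> c * mu powr 0" using mu by (intro tendsto_intros) auto
  then have "c * mu powr 0 \<le> Cfin" by (rule LIMSEQ_le_const2) (use le in auto)
  then show False using c mu by simp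
qed

end

section \<open>Transfer to the extended-valued norms of the statement\<close>

lemma tau_lt: "tau < t" 
proof -
  have "sig * t < 1 * t" using sig tT by (intro mult_strict_right_mono) auto
  then show ?thesis using tj_facts(4)[of 0] unfolding tj_facts(1) mult_1 by (rule less_trans[rotated])
qed

lemma nnI_ge_QI:
  assumes f: "SC f" "\<And>x t. 0 \<le> f x t"
  shows "ennreal (QI tau t f) \<le> nnI (U \<times> {0<..<t}) (\<lambda>p. f (fst p) (snd p))"
proof -
  \<comment> \<open>The cylinder of \<open>QI\<close> contains its final time, the one of
    \<open>nnI\<close> does not; the difference lies in this null hyperplane.\<close>
  define H where "H = {z :: (real^3) \<times> real. (0, 1) \<bullet> z = t}"
  have "negligible H" unfolding H_def by (rule negligible_hyperplane) (simp add: zero_prod_def)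
  then have ae: "AE z in lebesgue. z \<notin> H" by (intro AE_not_in) (simp add: negligible_iff_null_sets)
  have "ennreal (QI tau t f) = (\<integral>\<^sup>+ z. ennreal (f (fst z) (snd z)) \<partial>LQ tau t)"
    unfolding QI_def using QI_int[OF f(1) tau_pos(1)] f(2) by (intro nn_integral_eq_integral[symmetric]) auto
  also have "\<dots> = (\<integral>\<^sup>+ z. ennreal (f (fst z) (snd z)) * indicator (U \<times> {tau..t}) z \<partial>lebesgue)"
    using Q_borel[of tau t] by (subst nn_integral_restrict_space) auto
  also have "\<dots> \<le> nnI (U \<times> {0<..<t}) (\<lambda>p. f (fst p) (snd p))"
    unfolding nnI_def
  proof (intro nn_integral_mono_AE, use ae in eventually_elim)
    fix z :: "(real^3) \<times> real" assume "z \<notin> H"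
    then have "snd z \<noteq> t" by (cases z) (simp add: H_def)
    then show "ennreal (f (fst z) (snd z)) * indicator (U \<times> {tau..t}) z \<le> ennreal (f (fst z) (snd z)) * indicator (U \<times> {0<..<t}) z"
      using tau_pos by (cases z) (auto simp: indicator_def)
  qed
  finally show ?thesis .
qed

text \<open>An inequality of extended reals: \<open>Mfun\<close> integrates down to time 0 and may
  be infinite, while \<open>Mr\<close> lives on times where the data are regular.\<close>

lemma Mfun_ge: "ennreal Mq \<le> Mfun a chi U Psi q' 0 t"
proof -
  have qp: "q' i > 0" if "i \<in> {1..4}" for i using q_gt[OF ctx that] by simp
  have ge: "ennreal (QI tau t f powr (1 / q' i)) \<le> epow (nnI (U \<times> {0<..<t}) (\<lambda>p. f (fst p) (snd p))) (1 / q' i)"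
    if "SC f" "\<And>x t. 0 \<le> f x t" "i \<in> {1..4}" for f i
  proof -
    have "epow (ennreal (QI tau t f)) (1 / q' i) \<le> epow (nnI (U \<times> {0<..<t}) (\<lambda>p. f (fst p) (snd p))) (1 / q' i)"
      using qp[OF that(3)] by (intro epow_mono nnI_ge_QI that) auto
    then show ?thesis using QI_nn[of f tau t] that(2) by (simp add: epow_ennreal)
  qed
  have qt: "2 * max (2 - a) (3 - 2 * a) = 6 - 4 * a" using a_bounds by simp
  have g1: "ennreal (m1 tau t q') \<le> epow (nnI (U \<times> {0<..<t}) (\<lambda>p. (1 + norm (gP (fst p) (snd p))) powr ((2 - a) * q' 1))) (1 / q' 1)"
    unfolding m1_def[OF ctx] by (rule ge) (auto intro: SC_gP1[OF ctx])
  have g2: "ennreal (m2 tau t q') \<le> epow (nnI (U \<times> {0<..<t}) (\<lambda>p. (1 + Pa (fst p) (snd p)) powr (2 * (1 - a) * q' 2) * (1 + norm (gP (fst p) (snd p))) powr ((2 - a) * q' 2))) (1 / q' 2)"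
    unfolding m2_def[OF ctx] by (rule ge) (auto intro!: SC_intros(4) SC_gP1[OF ctx] SC_Pa1[OF ctx])
  have g3: "ennreal (m3 tau t q') \<le> epow (nnI (U \<times> {0<..<t}) (\<lambda>p. (1 + Pa (fst p) (snd p)) powr ((6 - 4 * a) * q' 3))) (1 / q' 3)"
    unfolding m3_def[OF ctx] by (rule ge) (auto intro: SC_Pa1[OF ctx])
  have g4: "ennreal (m4 tau t q') \<le> epow (nnI (U \<times> {0<..<t}) (\<lambda>p. \<bar>tder Psi (fst p) (snd p)\<bar> powr q' 4)) (1 / q' 4)"
    unfolding m4_def[OF ctx] by (rule ge[of "\<lambda>x t. \<bar>tder Psi x t\<bar> powr q' 4" 4]) (use qp[of 4] in \<open>auto intro!: SC_powr SC_intros SC_base\<close>)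
  have "ennreal Mq = 1 + ennreal (chi powr (1 - a)) * ennreal (m1 tau t q') + ennreal (chi powr (1 - a)) * ennreal (m2 tau t q')
     + ennreal (chi powr (3 - a)) * ennreal (m3 tau t q') + ennreal (m4 tau t q')"
    unfolding Mr_def[OF ctx] using m_nn[OF ctx] by (simp add: ennreal_mult ennreal_plus flip: ennreal_1)
  also have "\<dots> \<le> Mfun a chi U Psi q' 0 t"
    unfolding Mfun_def Let_def qt gP_def[symmetric] Pa_def[symmetric]
    by (intro add_mono mult_left_mono g1 g2 g3 g4 order_refl) auto
  finally show ?thesis .
qed

text \<open>The data norm is continuous in time, so its essential bound holds at every time of the
  closed interval, as the pointwise use in \<open>JJ_bound\<close> demands.\<close>

lemma NP_le_esssup:
  assumes B: "esssup (lebesgue_on {tau<..<t}) (\<lambda>r. LpPsi U Psi (2 * rs / (1 - rs)) r) = ennreal b" "b \<ge> 0" and r: "r \<in> {tau..t}"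
  shows "NP r \<le> b"
proof (rule AE_le_on_closure[where S = "{tau<..<t}" and f = NP and x = r and e = b])
  have cl: "closure {tau<..<t} = {tau..t}" using tau_lt by (rule closure_greaterThanLessThan)
  show "r \<in> closure {tau<..<t}" "continuous_on (closure {tau<..<t}) NP" unfolding cl using r NP_cont tau_pos by auto
  have "AE r in lebesgue_on {tau<..<t}. LpPsi U Psi (2 * rs / (1 - rs)) r \<le> ennreal b" unfolding B(1)[symmetric] by (rule esssup_AE)
  then show "AE r in lebesgue_on {tau<..<t}. NP r \<le> b"
  proof (rule AE_mp, intro AE_I2 impI)
    fix r assume "r \<in> space (lebesgue_on {tau<..<t})" and le: "LpPsi U Psi (2 * rs / (1 - rs)) r \<le> ennreal b"
    then have "r > 0" using tau_pos by simp
    then show "NP r \<le> b" using le B(2) by (simp add: LpPsi_eq)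
  qed
qed simp

lemma om_nn: "0 \<le> om1 a rs kt a0" "0 \<le> om2 a rs kt a0"
proof -
  define r0 where "r0 = stilde a kt a0 0 / betaj kt a0 0"
  have "1 \<le> r0" unfolding r0_def by (rule nutilde_bound(2)[OF kt(1) a0_5 a_bounds])
  moreover have "omega a kt a0 = nutilde a kt a0 / r0 * (kt\<^sup>2 / (a0 * (kt - 1)\<^sup>2))" by (simp add: omega_def r0_def)
  ultimately have "0 \<le> omega a kt a0" using nutilde_bound(3)[OF kt(1) a0_5 a_bounds] a0_5 by simp
  then show "0 \<le> om1 a rs kt a0" "0 \<le> om2 a rs kt a0" using rr_facts(4) ln_nn(10) by (auto simp: om1_def om2_def)
qed

lemma sup_bound:
  defines "Bs \<equiv> 1 + esssup (lebesgue_on {tau<..<t}) (\<lambda>r. LpPsi U Psi (2 * rs / (1 - rs)) r)"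
  shows "esssup (lebesgue_on (U \<times> {sig * t<..<t})) (\<lambda>z. ennreal \<bar>u (fst z) (snd z) - Psi (fst z) (snd z)\<bar>)
    \<le> ennreal (Cbar1 N ab ac rs kt a0 cbar U * chi powr om1 a rs kt a0 * (1 + 1 / (sig * t)) powr om2 a rs kt a0 * (1 + t) powr om4 a rs kt a0)
      * epow (Mfun a chi U Psi q' 0 t) (om2 a rs kt a0) * epow Bs (2 * om1 a rs kt a0)
      * ennreal (Vt powr ((2 * om1 a rs kt a0 + nutilde a kt a0) / al))" (is "?L \<le> ennreal ?C * ?M * ?B * ennreal ?V")
proof -
  have Mge: "ennreal (Mq powr om2 a rs kt a0) \<le> ?M"
    using epow_mono[OF Mfun_ge om_nn(2)] Mq_ge(2) by (simp add: epow_ennreal)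
  have Mpos: "0 < ennreal (Mq powr om2 a rs kt a0)" using Mq_ge(2) by simp
  have Cpos: "?C > 0"
  proof -
    have "Abar N ab ac rs cbar > 0" using Mq_Z_ge by (simp add: Abar_def)
    then have "cbar2 N ab ac rs kt cbar > 0" using kt by (simp add: cbar2_def)
    moreover have "0 < 1 + 1 / (sig * t)" using Mq_Z_ge(1) by linarith
    moreover have "0 < 1 + measU U" using measU_nn by (simp add: add_pos_nonneg)
    ultimately show ?thesis using a0_5 chi_ge(1) tT by (simp add: Cbar1_def Let_def)
  qed
  have Vpos: "?V > 0" using Vt_ge by simp
  show ?thesis
  \<comment> \<open>If the essential supremum is infinite, so is its \<open>epow\<close>; the other
    factors are nonzero, hence the right side is infinite.\<close>
  proof (cases "Bs = top")
    case True
    define X M1 V1 where "X = ennreal ?C" and "M1 = ?M" and "V1 = ennreal ?V"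
    have "X \<noteq> 0" "M1 \<noteq> 0" "V1 \<noteq> 0"
      using Cpos Vpos order_less_le_trans[OF Mpos Mge] unfolding X_def M1_def V1_def by (simp_all only: ennreal_eq_0_iff not_le less_irrefl)
    then have "X * M1 * top * V1 = top" by (simp add: ennreal_mult_eq_top_iff)
    moreover have "?B = top" using True by (simp add: epow_def)
    ultimately have "ennreal ?C * ?M * ?B * ennreal ?V = top" by (simp only: X_def M1_def V1_def)
    then show ?thesis by simp
  next
    case False
    define es where "es = esssup (lebesgue_on {tau<..<t}) (\<lambda>r. LpPsi U Psi (2 * rs / (1 - rs)) r)"
    define b where "b = enn2real es"
    have b: "b \<ge> 0" "es = ennreal b" using False by (auto simp: Bs_def es_def[symmetric] b_def less_top[symmetric])
    have NPb: "\<forall>r\<in>{tau..t}. NP r + 1 \<le> 1 + b" using NP_le_esssup[of b] b by (auto simp: es_def)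
    have BB: "?B = ennreal ((1 + b) powr (2 * om1 a rs kt a0))"
      using b by (simp add: Bs_def es_def[symmetric] epow_ennreal flip: ennreal_1 ennreal_plus)
    have "?L \<le> ennreal (Cfin (1 + b))"
    proof (rule esssup_I)
      have W: "U \<times> {sig * t<..<t} \<in> sets lebesgue" using borel_open[OF open_Times[OF U_open open_greaterThanLessThan[of "sig * t" t]]] by simp
      have "continuous_on (U \<times> {sig * t<..<t}) (\<lambda>z. rho (fst z) (snd z))"
        using SC_base(7) unfolding SC_def by (rule continuous_on_subset) (use CU sig tT in \<open>auto intro: less_trans[OF mult_pos_pos]\<close>)
      then have "(\<lambda>z. rho (fst z) (snd z)) \<in> borel_measurable (lebesgue_on (U \<times> {sig * t<..<t}))"
        using W by (rule continuous_imp_measurable_on_sets_lebesgue)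
      then show "(\<lambda>z. ennreal \<bar>u (fst z) (snd z) - Psi (fst z) (snd z)\<bar>) \<in> borel_measurable (lebesgue_on (U \<times> {sig * t<..<t}))"
        by (simp add: rho_def v_def)
      show "AE z in lebesgue_on (U \<times> {sig * t<..<t}). ennreal \<bar>u (fst z) (snd z) - Psi (fst z) (snd z)\<bar> \<le> ennreal (Cfin (1 + b))"
        using rho_le_Cfin[OF NPb] by (intro AE_I2 ennreal_leI) (auto simp: rho_def v_def)
    qed
    also have "\<dots> = ennreal ?C * ennreal (Mq powr om2 a rs kt a0) * ennreal ((1 + b) powr (2 * om1 a rs kt a0)) * ennreal ?V"
    proof -
      have "Cfin (1 + b) = ?C * Mq powr om2 a rs kt a0 * (1 + b) powr (2 * om1 a rs kt a0) * ?V"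
        unfolding Cfin_def[OF NPb] ..
      then show ?thesis using Cpos by (simp only: ennreal_mult' ennreal_mult'' less_imp_le powr_ge_zero mult_nonneg_nonneg)
    qed
    also have "\<dots> \<le> ennreal ?C * ?M * ?B * ennreal ?V" unfolding BB by (intro mult_right_mono mult_left_mono Mge) auto
    finally show ?thesis .
  qed
qed

end

section \<open>The supremum bound\<close>

context flow_al begin

lemma V0fun_eq: "V0fun U u Psi al = ennreal V0"
proof -
  have "continuous_on CU (\<lambda>x. v x 0)" by (rule slice_cont[OF v_cont0]) simp
  then have c: "continuous_on CU (\<lambda>x. rho x 0 powr al)" unfolding rho_def using al2 by (intro continuous_on_powr' continuous_intros) auto
  have "nnI U (\<lambda>x. \<bar>u x 0 - Psi x 0\<bar> powr al) = ennreal (Phi al 0)"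
    using nnI_U[OF c] by (simp add: Phi_def rho_def v_def)
  then show ?thesis using Phi_nn by (simp add: V0fun_def V0_def flip: ennreal_1 ennreal_plus)
qed

text \<open>The factor in front of the integral is positive, so the bound by \<open>B\<close> forces
  the integral to be finite; only then does \<open>ET\<close> carry its value.\<close>

lemma smallness_real:
  assumes "ennreal (gam * Cst) * epow (V0fun U u Psi al) gam * EInt a rs chi U Psi al T \<le> ennreal B" "0 < B" "B < 1"
  shows "EInt a rs chi U Psi al T < top" "gam * Cst * V0 powr gam * ET T < 1"
proof -
  define K where "K = gam * Cst * V0 powr gam"
  have K: "K > 0" using gam_pos Cst_pos V0_ge by (simp add: K_def)
  have "ennreal (gam * Cst) * epow (V0fun U u Psi al) gam = ennreal K"
    unfolding V0fun_eq K_def using V0_ge gam_pos Cst_pos by (simp add: epow_ennreal ennreal_mult)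
  then have le: "ennreal K * EInt a rs chi U Psi al T \<le> ennreal B" using assms(1) by simp
  show fin: "EInt a rs chi U Psi al T < top"
  proof (rule ccontr)
    assume "\<not> EInt a rs chi U Psi al T < top"
    then have "EInt a rs chi U Psi al T = top" by (metis less_top)
    then have "ennreal K * EInt a rs chi U Psi al T = top" using K by (simp add: ennreal_mult_eq_top_iff)
    then show False using le by (simp add: top_unique)
  qed
  then have "EInt a rs chi U Psi al T = ennreal (ET T)" by (simp add: ET_def)
  then have "ennreal (K * ET T) \<le> ennreal B" using le K by (simp add: ennreal_mult' ET_def)
  then have "K * ET T \<le> B" using assms(2) by simp
  then show "gam * Cst * V0 powr gam * ET T < 1" using assms(3) by (simp add: K_def)
qed

end

theorem theorem4p6:
  fixes N :: nat and ab ac :: "nat \<Rightarrow> real"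
    and kv :: "real^3" and Rs G Om :: real and e0 :: "real \<Rightarrow> real^3"
    and U :: "(real^3) set"
    and rs kt a0 cbar T B :: real and p q :: "nat \<Rightarrow> real"
    and Psi u :: "real^3 \<Rightarrow> real \<Rightarrow> real"
  assumes N: "N \<ge> 1"
    and ab0: "ab 0 = 0" and ab_mono: "\<And>i j. i < j \<Longrightarrow> j \<le> N \<Longrightarrow> ab i < ab j"
    and ac_pos: "\<And>i. i \<le> N \<Longrightarrow> ac i > 0"
    and kv: "norm kv = 1" and Rs: "Rs \<ge> 0" and G: "G > 0" and Om: "Om \<ge> 0"
    and e0: "smooth_curve e0" "\<And>t. norm (e0 t) = 1"
    and U: "open U" "bounded U" "C1_boundary U"
    and rs: "3 / (5 - aexp N ab) < rs" "rs < 1" "rs \<ge> 1 / (2 - aexp N ab)"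
    and kt: "1 < kt" "kt < sqrt (1 + lambda0 (aexp N ab) rs)"
    and pq: "\<And>i. i \<in> {1..4} \<Longrightarrow> 1 < p i \<and> p i < kt \<and> 1 / p i + 1 / q i = 1"
    and a0_ge: "a0 \<ge> max (max (2 * p 3 * (1 - aexp N ab) / (kt - p 3)) (4 * (1 - aexp N ab) / (kt - 1)))
                        (max (aexp N ab / (1 + lambda0 (aexp N ab) rs - kt\<^sup>2)) (2 * rs / (kt * (1 - rs))))"
    and a0_gt: "a0 > max 2 (max (aexp N ab / lambda0 (aexp N ab) rs)
                               ((4 - 3 * aexp N ab) / (lambda0 (aexp N ab) rs * kt)))"
    and cbar: "cbar > 0"
      "\<And>f :: real^3 \<Rightarrow> real. C1_on UNIV f \<Longrightarrow>
         (\<exists>K. compact K \<and> K \<subseteq> U \<and> (\<forall>x. x \<notin> K \<longrightarrow> f x = 0)) \<Longrightarrow>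
         (let qs = rs * (2 - aexp N ab) in
          epow (nnI UNIV (\<lambda>x. \<bar>f x\<bar> powr (3 * qs / (3 - qs)))) ((3 - qs) / (3 * qs))
            \<le> ennreal cbar * epow (nnI UNIV (\<lambda>x. norm (xgrad (\<lambda>y s. f y) x 0) powr qs)) (1 / qs))"
    and Psi: "regular_fn U Psi"
    and sol: "is_solution N ab ac kv Rs G Om e0 U Psi u"
    and u_nonneg: "\<And>x t. x \<in> closure U \<Longrightarrow> t \<ge> 0 \<Longrightarrow> u x t \<ge> 0"
    and T: "T > 0" and B: "0 < B" "B < 1"
    and smallness:
      "(let a = aexp N ab; al = kt * a0; gm = gammaA a rs al in
         ennreal (gm * Cstar N ab ac rs al cbar U) * epow (V0fun U u Psi al) gm
           * EInt a rs (chistar N ac Rs G Om U) U Psi al T \<le> ennreal B)"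
  shows
    "\<forall>t \<sigma>. 0 < t \<and> t \<le> T \<and> 0 < \<sigma> \<and> \<sigma> < 1 \<longrightarrow>
      (let a = aexp N ab; al = kt * a0; gm = gammaA a rs al; chis = chistar N ac Rs G Om U;
           V0 = enn2real (V0fun U u Psi al);
           Vt = V0 * (1 - gm * Cstar N ab ac rs al cbar U * V0 powr gm
                          * enn2real (EInt a rs chis U Psi al t)) powr (- 1 / gm);
           Bs = 1 + esssup (lebesgue_on {\<sigma> * t / 2<..<t}) (\<lambda>\<tau>. LpPsi U Psi (2 * rs / (1 - rs)) \<tau>);
           w1 = om1 a rs kt a0; w2 = om2 a rs kt a0; w4 = om4 a rs kt a0 in
       esssup (lebesgue_on (U \<times> {\<sigma> * t<..<t}))
              (\<lambda>z. ennreal \<bar>u (fst z) (snd z) - Psi (fst z) (snd z)\<bar>)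
         \<le> ennreal (Cbar1 N ab ac rs kt a0 cbar U * chis powr w1 * (1 + 1 / (\<sigma> * t)) powr w2
                     * (1 + t) powr w4)
           * epow (Mfun a chis U Psi q 0 t) w2 * epow Bs (2 * w1)
           * ennreal (Vt powr ((2 * w1 + nutilde a kt a0) / al)))"
proof -
  note pq_all = pq
  define lm where "lm = lambda0 (aexp N ab) rs"
  interpret flow_sob N ab ac U kv Rs G Om e0 Psi u rs cbar
    using N ab0 ab_mono ac_pos U kv Rs G e0(2) Psi sol u_nonneg rs cbar by unfold_locales
  have l: "lam = lm" by (simp add: lm_def lam_def)
  have lm: "0 < lm" "lm < 1" using lam_bounds unfolding l by auto
  have kt0: "kt > 0" and a00: "a0 > 2" using kt a0_gt by auto
  have kt2: "kt\<^sup>2 < 1 + lm"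
  proof -
    have "kt\<^sup>2 < (sqrt (1 + lm))\<^sup>2" using kt by (intro power_strict_mono) (auto simp: lm_def)
    then show ?thesis using lm by simp
  qed
  interpret flow_al N ab ac U kv Rs G Om e0 Psi u rs cbar "kt * a0"
  proof
    have "1 * a0 < kt * a0" using kt a00 by (intro mult_strict_right_mono) auto
    then show "2 < kt * a0" using a00 by linarith
    have "2 * rs / (kt * (1 - rs)) \<le> a0" using a0_ge by simp
    then show "pe \<le> kt * a0" using kt rs by (simp add: pe_def pos_divide_le_eq mult_ac)
    have "(4 - 3 * aexp N ab) / (lm * kt) < a0" using a0_gt by (simp add: lm_def)
    then show "4 - 3 * aexp N ab < kt * a0 * lam" unfolding l using kt0 lm by (simp add: pos_divide_less_eq mult_ac)
  qed
  have sm: "EInt (aexp N ab) rs chi U Psi (kt * a0) T < top" "gam * Cst * V0 powr gam * ET T < 1"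
    using smallness_real[of T B] smallness B by (auto simp: Let_def gam_def Cst_def chi_def)
  have V0e: "enn2real (V0fun U u Psi (kt * a0)) = V0" unfolding V0fun_eq using V0_ge by simp
  show ?thesis
  proof (intro allI impI, elim conjE, goal_cases)
    case (1 t \<sigma>)
    interpret flow_it N ab ac U kv Rs G Om e0 Psi u rs cbar "kt * a0" kt a0 \<sigma> t T p q
    proof unfold_locales
      show "i \<in> {1..4} \<Longrightarrow> 1 < p i \<and> p i < kt \<and> 1 / p i + 1 / q i = 1" for i by (rule pq_all)
    qed (use a0_ge a0_gt kt kt2 1 sm in \<open>auto simp: l lm_def\<close>)
    show ?case using sup_bound unfolding Let_def V0e Vbd_def ET_def gam_def Cst_def chi_def tau_def by simp
  qed
qed

end
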